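(* (i) $\mathcal{F}^{\rm d}_{\rm tv}$ is equal to $\mathcal{F}^{\rm d}_{\rm tor}+(1-\tau)\mathcal{F}^{\rm c}$ and is also the kernel of the endomorphism of $\mathcal{F}^{\rm d}$ given by multiplication by $1+\tau$ (i.e. $f\mapsto f^{1+\tau}$). (ii) There exist canonical isomorphisms of $R$-modules $$\mathcal{F}^{\rm d}_{\rm tv}/\mathcal{F}^{\rm d}_{\rm tor}\cong(1-\tau)\mathcal{F}^{\rm c}\cong\widehat{\mathbb{Z}}(1).$$ The first of these is induced by the equality $\mathcal{F}^{\rm d}_{\rm tv}=\mathcal{F}^{\rm d}_{\rm tor}+(1-\tau)\mathcal{F}^{\rm c}$ (that is, it is inverse to the map induced by the inclusion $(1-\tau)\mathcal{F}^{\rm c}\subseteq\mathcal{F}^{\rm d}_{\rm tv}$), and the second sends $\Phi^{1-\tau}$ to the topological generator $(\zeta_m)_m$ of $\widehat{\mathbb{Z}}(1)$. (iii) If $\mathcal{F}^{\star}$ denotes either $\mathcal{F}^{\rm d}$ or $\mathcal{F}^{\rm sd}$, then the $R$-module homomorphism $$\mathcal{F}^{\star}_{\rm tf}/\mathcal{F}^{\rm c}\to(1+\tau)\mathcal{F}^{\star}/(1+\tau)\mathcal{F}^{\rm c}$$ that is induced by multiplication by $1+\tau$ is bijective.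
   Context: Fix an algebraic closure $\mathbb{Q}^c$ of $\mathbb{Q}$. $\mu_n$ is the group of $n$-th roots of unity in $\mathbb{Q}^c$, $\mu_n^*=\mu_n\setminus\{1\}$, and $\mu_\infty^*$ is the set of all roots of unity different from $1$. $\mathbb{N}^*=\mathbb{N}\setminus\{1\}$. Put $\mathbb{Q}(n)=\mathbb{Q}(\mu_n)$, $G_n=\mathrm{Gal}(\mathbb{Q}(n)/\mathbb{Q})$, $R_n=\mathbb{Z}[G_n]$ and $R=\varprojlim_n R_n$ (along restriction maps). Fix generators $\zeta_n$ of $\mu_n$ with $\zeta_{mn}^m=\zeta_n$ for all $m,n$. $\tau$ denotes complex conjugation. $\mathcal{F}$ is the multiplicative group of $\mathrm{Gal}(\mathbb{Q}^c/\mathbb{Q})$-equivariant functions $f:\mu_\infty^*\to\mathbb{Q}^{c,\times}$; write $f(n):=f(\zeta_n)\in\mathbb{Q}(n)^\times$. It is an $R$-module via $(f^r)(\zeta)=f(\zeta)^r$, where on $\zeta$ of order $n$ the element $r$ acts through its image in $R_n$. $\mathcal{F}^{\rm d}$ (distributions) is the $R$-submodule of $f\in\mathcal{F}$ with $\prod_{\zeta^a=\varepsilon}f(\zeta)=f(\varepsilon)$ for all $a\in\mathbb{N}$, $\varepsilon\in\mu_\infty^*$. $\mathcal{F}^{\rm sd}$ (strict distributions) is the submodule of $f\in\mathcal{F}^{\rm d}$ with $f(\varepsilon\zeta)\equiv f(\zeta)$ modulo all primes above $\ell$, for all $n\in\mathbb{N}$, all primes $\ell\nmid n$, all $\varepsilon\in\mu_\ell$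 and $\zeta\in\mu_n^*$. $\Phi\in\mathcal{F}^{\rm sd}$ is $\Phi(\zeta)=1-\zeta$, and $\mathcal{F}^{\rm c}$ is the $R$-submodule generated by $\Phi$ (it is torsion-free). Sums of submodules refer to the (multiplicatively written) group law of $\mathcal{F}^{\rm d}$, and $(1\pm\tau)\mathcal{G}=\{f^{1\pm\tau}:f\in\mathcal{G}\}$. For an abelian group $A$, $A_{\rm tor}$ is its torsion subgroup and $A_{\rm tf}=A/A_{\rm tor}$. A distribution $f$ is torsion-valued if $f(n)$ has finite order for every $n\in\mathbb{N}^*$; $\mathcal{F}^{\rm d}_{\rm tv}$ is the $R$-submodule of $\mathcal{F}^{\rm d}$ of all torsion-valued distributions. $\widehat{\mathbb{Z}}(1)=\varprojlim_m\mu_m$ with transition maps $\mu_m\to\mu_{m'}$, $x\mapsto x^{m/m'}$ for $m'\mid m$, with its natural $R$-module structure. *)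

theory Defs
  imports
    "HOL-Analysis.Function_Topology"
    "HOL-Computational_Algebra.Computational_Algebra"
    "HOL-Algebra.Bij"
    "HOL-Algebra.Module"
    "HOL-Algebra.Ideal"
    "HOL-Algebra.Generated_Fields"
begin

section \<open>Modules\<close>

definition Rmodule_hom :: "('r, 'x) ring_scheme \<Rightarrow> ('r, 'a, 'y) module_scheme \<Rightarrow> ('r, 'b, 'z) module_scheme \<Rightarrow> ('a \<Rightarrow> 'b) set"
  where "Rmodule_hom R M N =
    {h \<in> carrier M \<rightarrow> carrier N.
       (\<forall>x\<in>carrier M. \<forall>y\<in>carrier M. h (x \<oplus>\<^bsub>M\<^esub> y) = h x \<oplus>\<^bsub>N\<^esub> h y) \<and>
       (\<forall>r\<in>carrier R. \<forall>x\<in>carrier M. h (r \<odot>\<^bsub>M\<^esub> x) = r \<odot>\<^bsub>N\<^esub> h x)}"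

text \<open>The module axioms for both sides are part of the notion, so that an isomorphism also
  witnesses that source and target are modules over the commutative ring \<open>R\<close>.\<close>

definition Rmodule_iso :: "('r, 'x) ring_scheme \<Rightarrow> ('r, 'a, 'y) module_scheme \<Rightarrow> ('r, 'b, 'z) module_scheme \<Rightarrow> ('a \<Rightarrow> 'b) set"
  where "Rmodule_iso R M N =
    {h \<in> Rmodule_hom R M N. module R M \<and> module R N \<and> bij_betw h (carrier M) (carrier N)}"

definition generated_submodule :: "('r, 'x) ring_scheme \<Rightarrow> ('r, 'a, 'y) module_scheme \<Rightarrow> 'a set \<Rightarrow> 'a set"
  where "generated_submodule R M S = \<Inter> {N. submodule N R M \<and> S \<subseteq> N}"

text \<open>The multiplicative fields of a module record carry no meaning.\<close>

definition quot_module :: "('r, 'a, 'y) module_scheme \<Rightarrow> 'a set \<Rightarrow> ('r, 'a set) module"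
  where "quot_module M N =
    \<lparr>carrier = a_rcosets\<^bsub>M\<^esub> N, mult = undefined, one = undefined,
     zero = N, add = set_add M,
     smult = (\<lambda>r C. \<Union>x\<in>C. N +>\<^bsub>M\<^esub> (r \<odot>\<^bsub>M\<^esub> x))\<rparr>"

definition torsion :: "('r, 'a, 'y) module_scheme \<Rightarrow> 'a set"
  where "torsion M = {x \<in> carrier M. \<exists>k::nat. k > 0 \<and> [k] \<cdot>\<^bsub>M\<^esub> x = \<zero>\<^bsub>M\<^esub>}"


section \<open>Cyclotomic fields inside the algebraic closure of \<open>\<rat>\<close> in \<open>\<complex>\<close>\<close>

definition complex_ring :: "complex ring"
  where "complex_ring = \<lparr>carrier = UNIV, mult = (*), one = 1, zero = 0, add = (+)\<rparr>"

definition Qc :: "complex set"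
  where "Qc = {z. algebraic z}"

definition mu :: "nat \<Rightarrow> complex set"
  where "mu n = {z. z ^ n = 1}"

definition mu_inf_star :: "complex set"
  where "mu_inf_star = (\<Union>n\<in>{0<..}. mu n) - {1}"

definition root_order :: "complex \<Rightarrow> nat"
  where "root_order z = (LEAST n. n > 0 \<and> z ^ n = 1)"

definition cyc_field :: "nat \<Rightarrow> complex set"
  where "cyc_field n = generate_field complex_ring (\<rat> \<union> mu n)"

text \<open>Automorphisms are represented as extensional functions, so that equality of automorphisms
  is equality of functions; the group law is composition.\<close>

definition Gal :: "complex set \<Rightarrow> complex set \<Rightarrow> (complex \<Rightarrow> complex) monoid"
  where "Gal L K = (BijGroup L)
    \<lparr>carrier := {\<sigma> \<in> Bij L.
       \<sigma> \<in> ring_hom (complex_ring\<lparr>carrier := L\<rparr>) (complex_ring\<lparr>carrier := L\<rparr>) \<and>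
       (\<forall>x\<in>K. \<sigma> x = x)}\<rparr>"

abbreviation G :: "nat \<Rightarrow> (complex \<Rightarrow> complex) monoid"
  where "G n \<equiv> Gal (cyc_field n) \<rat>"


section \<open>The ring \<open>R\<close>\<close>

definition int_group_ring :: "('g, 'x) monoid_scheme \<Rightarrow> ('g \<Rightarrow> int) ring"
  where "int_group_ring H =
    \<lparr>carrier = {a. finite {g. a g \<noteq> 0} \<and> {g. a g \<noteq> 0} \<subseteq> carrier H},
     mult = (\<lambda>a b x. \<Sum>(g, h) \<in> {(g, h). a g \<noteq> 0 \<and> b h \<noteq> 0 \<and> g \<otimes>\<^bsub>H\<^esub> h = x}. a g * b h),
     one = (\<lambda>x. if x = \<one>\<^bsub>H\<^esub> then 1 else 0),
     zero = (\<lambda>x. 0),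
     add = (\<lambda>a b x. a x + b x)\<rparr>"

abbreviation Rn :: "nat \<Rightarrow> ((complex \<Rightarrow> complex) \<Rightarrow> int) ring"
  where "Rn n \<equiv> int_group_ring (G n)"

text \<open>For \<open>m\<close> dividing \<open>n\<close>, the map from \<open>Rn n\<close> to \<open>Rn m\<close> induced by restricting automorphisms.\<close>

definition Rn_restrict :: "nat \<Rightarrow> nat \<Rightarrow> ((complex \<Rightarrow> complex) \<Rightarrow> int) \<Rightarrow> ((complex \<Rightarrow> complex) \<Rightarrow> int)"
  where "Rn_restrict n m a =
    (\<lambda>\<rho>. \<Sum>\<sigma> \<in> {\<sigma> \<in> carrier (G n). restrict \<sigma> (cyc_field m) = \<rho>}. a \<sigma>)"

definition R :: "(nat \<Rightarrow> (complex \<Rightarrow> complex) \<Rightarrow> int) ring"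
  where "R =
    \<lparr>carrier = {r \<in> (\<Pi>\<^sub>E n\<in>{0<..}. carrier (Rn n)).
       \<forall>n>0. \<forall>m. m dvd n \<longrightarrow> Rn_restrict n m (r n) = r m},
     mult = (\<lambda>r s. \<lambda>n\<in>{0<..}. r n \<otimes>\<^bsub>Rn n\<^esub> s n),
     one = (\<lambda>n\<in>{0<..}. \<one>\<^bsub>Rn n\<^esub>),
     zero = (\<lambda>n\<in>{0<..}. \<zero>\<^bsub>Rn n\<^esub>),
     add = (\<lambda>r s. \<lambda>n\<in>{0<..}. r n \<oplus>\<^bsub>Rn n\<^esub> s n)\<rparr>"

definition tau :: "nat \<Rightarrow> (complex \<Rightarrow> complex) \<Rightarrow> int"
  where "tau = (\<lambda>n\<in>{0<..}. \<lambda>\<sigma>. if \<sigma> = restrict cnj (cyc_field n) then 1 else 0)"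

text \<open>The exponential action \<open>x\<^sup>a\<close> of \<open>a \<in> Rn n\<close> on nonzero \<open>x\<close> in \<open>cyc_field n\<close>.\<close>

definition act :: "nat \<Rightarrow> ((complex \<Rightarrow> complex) \<Rightarrow> int) \<Rightarrow> complex \<Rightarrow> complex"
  where "act n a x = (\<Prod>\<sigma>\<in>carrier (G n). \<sigma> x powi a \<sigma>)"


section \<open>Distributions\<close>

text \<open>The multiplicative groups below are written additively, as library modules are:
  \<open>add\<close> is the pointwise product and \<open>smult r f\<close> is \<open>f\<^sup>r\<close>.\<close>

definition FF :: "(nat \<Rightarrow> (complex \<Rightarrow> complex) \<Rightarrow> int, complex \<Rightarrow> complex) module"
  where "FF =
    \<lparr>carrier = {f \<in> mu_inf_star \<rightarrow>\<^sub>E Qc - {0}.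
       \<forall>\<sigma>\<in>carrier (Gal Qc \<rat>). \<forall>\<zeta>\<in>mu_inf_star. f (\<sigma> \<zeta>) = \<sigma> (f \<zeta>)},
     mult = undefined, one = undefined,
     zero = (\<lambda>\<zeta>\<in>mu_inf_star. 1),
     add = (\<lambda>f g. \<lambda>\<zeta>\<in>mu_inf_star. f \<zeta> * g \<zeta>),
     smult = (\<lambda>r f. \<lambda>\<zeta>\<in>mu_inf_star. act (root_order \<zeta>) (r (root_order \<zeta>)) (f \<zeta>))\<rparr>"

definition Fd :: "(complex \<Rightarrow> complex) set"
  where "Fd = {f \<in> carrier FF.
    \<forall>a::nat. \<forall>\<epsilon>\<in>mu_inf_star. a > 0 \<longrightarrow> (\<Prod>\<zeta> \<in> {\<zeta>. \<zeta> ^ a = \<epsilon>}. f \<zeta>) = f \<epsilon>}"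

definition alg_integers :: "complex ring"
  where "alg_integers = complex_ring\<lparr>carrier := {z. algebraic_int z}\<rparr>"

text \<open>Congruence of algebraic numbers (not assumed integral) modulo all primes above \<open>l\<close>:
  for each prime ideal \<open>P\<close> above \<open>l\<close> of the ring of all algebraic integers, the difference lies
  in the maximal ideal of the localization at \<open>P\<close>.\<close>

definition cong_above :: "nat \<Rightarrow> complex \<Rightarrow> complex \<Rightarrow> bool"
  where "cong_above l x y \<longleftrightarrow>
    (\<forall>P. primeideal P alg_integers \<and> of_nat l \<in> P \<longrightarrow>
      (\<exists>a\<in>P. \<exists>b\<in>carrier alg_integers - P. x - y = a / b))"

definition Fsd :: "(complex \<Rightarrow> complex) set"
  where "Fsd = {f \<in> Fd.
    \<forall>n l::nat. n > 0 \<longrightarrow> prime l \<longrightarrow> \<not> l dvd n \<longrightarrow>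
      (\<forall>\<epsilon>\<in>mu l. \<forall>\<zeta>\<in>mu n - {1}. cong_above l (f (\<epsilon> * \<zeta>)) (f \<zeta>))}"

definition Phi :: "complex \<Rightarrow> complex"
  where "Phi = (\<lambda>\<zeta>\<in>mu_inf_star. 1 - \<zeta>)"

definition Fc :: "(complex \<Rightarrow> complex) set"
  where "Fc = generated_submodule R FF {Phi}"

text \<open>A subset of \<open>FF\<close>, viewed as a module with the operations inherited from \<open>FF\<close>.\<close>

abbreviation sub :: "(complex \<Rightarrow> complex) set \<Rightarrow> (nat \<Rightarrow> (complex \<Rightarrow> complex) \<Rightarrow> int, complex \<Rightarrow> complex) module"
  where "sub A \<equiv> FF\<lparr>carrier := A\<rparr>"

abbreviation one_plus_tau :: "nat \<Rightarrow> (complex \<Rightarrow> complex) \<Rightarrow> int"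
  where "one_plus_tau \<equiv> \<one>\<^bsub>R\<^esub> \<oplus>\<^bsub>R\<^esub> tau"

abbreviation one_minus_tau :: "nat \<Rightarrow> (complex \<Rightarrow> complex) \<Rightarrow> int"
  where "one_minus_tau \<equiv> \<one>\<^bsub>R\<^esub> \<ominus>\<^bsub>R\<^esub> tau"

abbreviation mult_by :: "(nat \<Rightarrow> (complex \<Rightarrow> complex) \<Rightarrow> int) \<Rightarrow> (complex \<Rightarrow> complex) set \<Rightarrow> (complex \<Rightarrow> complex) set"
  where "mult_by r A \<equiv> (\<lambda>f. r \<odot>\<^bsub>FF\<^esub> f) ` A"

text \<open>Fixed compatible generators of the groups \<open>mu n\<close>.\<close>

definition compatible_generators :: "(nat \<Rightarrow> complex) \<Rightarrow> bool"
  where "compatible_generators z \<longleftrightarrow>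
    (\<forall>n>0. mu n = range (\<lambda>k::nat. z n ^ k)) \<and>
    (\<forall>m>0. \<forall>n>0. z (m * n) ^ m = z n)"

definition Ftv :: "(nat \<Rightarrow> complex) \<Rightarrow> (complex \<Rightarrow> complex) set"
  where "Ftv z = {f \<in> Fd. \<forall>n>1. \<exists>k::nat. k > 0 \<and> f (z n) ^ k = 1}"


section \<open>The module of compatible systems of roots of unity\<close>

definition Zhat1 :: "(nat \<Rightarrow> (complex \<Rightarrow> complex) \<Rightarrow> int, nat \<Rightarrow> complex) module"
  where "Zhat1 =
    \<lparr>carrier = {x \<in> (\<Pi>\<^sub>E m\<in>{0<..}. mu m).
       \<forall>m>0. \<forall>m'. m' dvd m \<longrightarrow> x m ^ (m div m') = x m'},
     mult = undefined, one = undefined,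
     zero = (\<lambda>m\<in>{0<..}. 1),
     add = (\<lambda>x y. \<lambda>m\<in>{0<..}. x m * y m),
     smult = (\<lambda>r x. \<lambda>m\<in>{0<..}. act m (r m) (x m))\<rparr>"

definition Zhat1_topology :: "(nat \<Rightarrow> complex) topology"
  where "Zhat1_topology =
    subtopology (product_topology (\<lambda>m. discrete_topology (mu m)) {0<..}) (carrier Zhat1)"

definition topological_generator :: "(nat \<Rightarrow> complex) \<Rightarrow> bool"
  where "topological_generator x \<longleftrightarrow> x \<in> carrier Zhat1 \<and>
    Zhat1_topology closure_of (range (\<lambda>k::int. [k] \<cdot>\<^bsub>Zhat1\<^esub> x)) = carrier Zhat1"

end

(*
If p divides n, the value of a distribution at order n is a norm from arbitrarily high levels of
the cyclotomic Z_p-tower. In that tower the primes above l <> p have unbounded residue degrees, so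
the value is a unit above l. When n is a power of p, the prime above p is stable under complex
conjugation, so f^(1+tau) = 1 makes f(n) a unit there too. As complex conjugation is central in the
Galois groups, f^(1+tau) = 1 also says that all conjugates of all values of f have absolute value 1,
and f is torsion-valued by Kronecker's theorem.

For torsion-valued f the distribution relations make (f(zeta_(2m))^2)_m a compatible system of
roots of unity. This defines an R-linear map from torsion-valued distributions to Zhat(1) whose
kernel consists of torsion elements. Since (1 - x) / (1 - x^-1) = -x, it sends Phi^(1-tau) to
(zeta_m)_m, and it is injective on the R-multiples of Phi^(1-tau). As R maps onto Zhat through
the cyclotomic character, (zeta_m)_m generates Zhat(1) over R; this gives the decomposition of
the torsion-valued distributions in (i) and the isomorphisms in (ii). For (iii), if f^(1+tau) = c^(1+tau)
with c in F^c, then f/c is torsion-valued, hence lies in F^d_tor + (1-tau)F^c.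
*)
theory Submission
  imports
    Defs
    "Jordan_Normal_Form.Char_Poly"
    "HOL-Number_Theory.Residues"
    "HOL-Number_Theory.Pocklington"
begin

hide_const (open) up_ring.coeff up_ring.monom module.smult


section \<open>Algebraic integers\<close>

text \<open>The valuation above l is built by hand. \<open>P\<close> is a prime ideal of the ring of
  all algebraic integers, and 1 - zeta_(l^j), or l for j = 0, serves as uniformiser on Q(l^j n) for
  l not dividing n. What replaces ramification theory is the congruence s^q = s modulo this
  uniformiser on Z[zeta_(l^j n)], for a power q of l with q = 1 modulo n. The tower argument needs a
  prime p different from l in the order, so powers of l are exactly the orders left to complex
  conjugation. Both 2s in f(zeta_(2m))^2 come from signs: Q(m) contains -1 also for odd m, so that
  the level bounds the roots of unity only when it is even, and the product of the a-th roots of e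
  is e only up to sign. That R maps onto Zhat needs an argument, because a Galois element acts on
  roots of unity through a unit of Zhat, and non-units arise only as combinations of such elements.
  Two units and a constant suffice for even elements; the prime 2 is the obstacle, since a sum of
  two units is even.\<close>

definition int_span :: "complex set \<Rightarrow> complex set"
  where "int_span V = {z. \<exists>c. z = (\<Sum>v\<in>V. of_int (c v) * v)}"

lemma int_spanI: "z = (\<Sum>v\<in>V. of_int (c v) * v) \<Longrightarrow> z \<in> int_span V"
  unfolding int_span_def by auto

lemma int_span_base:
  assumes "finite V" "v \<in> V" shows "v \<in> int_span V"
proof -
  have "(\<Sum>w\<in>V. of_int (if w = v then 1 else 0) * w) = (\<Sum>w\<in>V. if w = v then w else 0)"
    by (intro sum.cong) auto
  also have "\<dots> = v" using assms by simp
  finally show ?thesis unfolding int_span_def by (intro CollectI exI) (rule sym)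
qed

lemma int_span_0: "0 \<in> int_span V"
  unfolding int_span_def by (intro CollectI exI[of _ "\<lambda>_. 0"]) simp

lemma int_span_add:
  assumes "x \<in> int_span V" "y \<in> int_span V" shows "x + y \<in> int_span V"
proof -
  obtain c d where "x = (\<Sum>v\<in>V. of_int (c v) * v)" "y = (\<Sum>v\<in>V. of_int (d v) * v)"
    using assms unfolding int_span_def by auto
  then have "x + y = (\<Sum>v\<in>V. of_int (c v + d v) * v)"
    by (simp add: sum.distrib algebra_simps)
  then show ?thesis by (rule int_spanI)
qed

lemma int_span_scale:
  assumes "x \<in> int_span V" shows "of_int k * x \<in> int_span V"
proof -
  obtain c where "x = (\<Sum>v\<in>V. of_int (c v) * v)"
    using assms unfolding int_span_def by auto
  then have "of_int k * x = (\<Sum>v\<in>V. of_int (k * c v) * v)"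
    by (simp add: sum_distrib_left algebra_simps)
  then show ?thesis by (rule int_spanI)
qed

lemma int_span_sum:
  assumes "\<And>i. i \<in> I \<Longrightarrow> f i \<in> int_span V" shows "(\<Sum>i\<in>I. f i) \<in> int_span V"
  using assms by (induction I rule: infinite_finite_induct) (auto intro: int_span_0 int_span_add)

lemma int_span_mult_stable:
  assumes "\<And>v. v \<in> V \<Longrightarrow> x * v \<in> int_span V" "y \<in> int_span V"
  shows "x * y \<in> int_span V"
proof -
  obtain c where "y = (\<Sum>v\<in>V. of_int (c v) * v)"
    using assms unfolding int_span_def by auto
  then have "x * y = (\<Sum>v\<in>V. of_int (c v) * (x * v))"
    by (simp add: sum_distrib_left algebra_simps)
  then show ?thesis using assms by (auto intro!: int_span_sum int_span_scale)
qed

text \<open>Multiplication by \<open>x\<close> on the span is given by an integer matrix, the tuple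
  of the elements of \<open>V\<close> is an eigenvector with eigenvalue \<open>x\<close>, and the
  characteristic polynomial is monic over the integers. The nonzero element \<open>v0\<close> keeps
  that tuple from being the zero vector.\<close>

lemma algebraic_int_if_stable_span:
  assumes V: "finite V" "v0 \<in> V" "v0 \<noteq> 0" and st: "\<And>v. v \<in> V \<Longrightarrow> x * v \<in> int_span V"
  shows "algebraic_int x"
proof -
  define n where "n = card V"
  obtain f :: "nat \<Rightarrow> complex" where f: "bij_betw f {..<n} V"
    using ex_bij_betw_nat_finite[OF V(1)] unfolding n_def atLeast0LessThan by blast
  have "\<forall>v\<in>V. \<exists>c. x * v = (\<Sum>w\<in>V. of_int (c w) * w)" using st unfolding int_span_def by blast
  then obtain c where c: "\<And>v. v \<in> V \<Longrightarrow> x * v = (\<Sum>w\<in>V. of_int (c v w) * w)" by metis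
  define A :: "int mat" where "A = mat n n (\<lambda>(i, j). c (f i) (f j))"
  define B :: "complex mat" where "B = map_mat of_int A"
  have A: "A \<in> carrier_mat n n" unfolding A_def by simp
  have B: "B \<in> carrier_mat n n" unfolding B_def A_def by simp
  define w where "w = Matrix.vec n f"
  have w: "w \<in> carrier_vec n" unfolding w_def by simp
  have fV: "\<And>i. i < n \<Longrightarrow> f i \<in> V" using f by (auto simp: bij_betw_def)
  obtain i0 where i0: "i0 < n" "f i0 = v0" using f V(2) by (auto simp: bij_betw_def)
  have "w \<noteq> 0\<^sub>v n"
  proof
    assume "w = 0\<^sub>v n"
    then have "w $ i0 = 0" using i0 by simp
    then show False using i0 V(3) by (simp add: w_def)
  qed
  moreover have "B *\<^sub>v w = x \<cdot>\<^sub>v w"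
  proof (rule eq_vecI)
    fix i assume "i < dim_vec (x \<cdot>\<^sub>v w)"
    then have i: "i < n" by (simp add: w_def)
    have "(B *\<^sub>v w) $ i = (\<Sum>j<n. of_int (c (f i) (f j)) * f j)"
      using i by (simp add: B_def A_def w_def mult_mat_vec_def scalar_prod_def atLeast0LessThan)
    also have "\<dots> = (\<Sum>u\<in>V. of_int (c (f i) u) * u)"
      by (rule sum.reindex_bij_betw[OF f])
    also have "\<dots> = x * f i" using c[OF fV[OF i]] by simp
    finally show "(B *\<^sub>v w) $ i = (x \<cdot>\<^sub>v w) $ i" using i by (simp add: w_def)
  qed (simp add: B_def A_def w_def)
  ultimately have "eigenvalue B x"
    unfolding eigenvalue_def eigenvector_def using w B by auto
  then have "poly (char_poly B) x = 0" using eigenvalue_root_char_poly[OF B] by simp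
  moreover have "char_poly B = map_poly of_int (char_poly A)"
    unfolding B_def using of_int_hom.char_poly_hom[OF A] by simp
  moreover have "lead_coeff (char_poly A) = 1" using degree_monic_char_poly[OF A] by simp
  ultimately show ?thesis by (auto simp: algebraic_int_altdef_ipoly)
qed

lemma algebraic_int_power_span:
  assumes "algebraic_int (x :: complex)"
  obtains m :: nat and c :: "nat \<Rightarrow> int" where "m > 0" "x ^ m = (\<Sum>i<m. of_int (c i) * x ^ i)"
proof -
  obtain p where p: "poly (map_poly of_int p) x = 0" "lead_coeff p = (1 :: int)"
    using assms by (auto simp: algebraic_int_altdef_ipoly)
  define m where "m = degree p"
  have d: "degree (map_poly of_int p :: complex poly) = m" unfolding m_def by (simp add: degree_map_poly)
  have "poly (map_poly of_int p) x = (\<Sum>i\<le>m. of_int (coeff p i) * x ^ i)"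
    unfolding poly_altdef d by (simp add: coeff_map_poly)
  also have "\<dots> = (\<Sum>i<m. of_int (coeff p i) * x ^ i) + x ^ m"
    using p(2) by (simp add: m_def lessThan_Suc_atMost[symmetric])
  finally have e: "x ^ m = (\<Sum>i<m. of_int (- coeff p i) * x ^ i)"
    using p(1) by (simp add: sum_negf eq_neg_iff_add_eq_0 add.commute)
  have "m > 0"
  proof (rule ccontr)
    assume "\<not> m > 0"
    then show False using e by simp
  qed
  then show ?thesis using e by (rule that)
qed

text \<open>The finitely many monomials x^i y^j below the degrees of the two integral equations span
  a lattice stable under both \<open>x\<close> and \<open>y\<close>, hence under their sum and
  product. The equations are needed only at the top exponents.\<close>

lemma algebraic_int_binary:
  assumes "algebraic_int (x :: complex)" "algebraic_int y"
  shows algebraic_int_add: "algebraic_int (x + y)" and algebraic_int_mult: "algebraic_int (x * y)"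
proof -
  obtain m c where m: "m > 0" "x ^ m = (\<Sum>i<m. of_int (c i) * x ^ i)"
    using algebraic_int_power_span[OF assms(1)] by metis
  obtain n d where n: "n > 0" "y ^ n = (\<Sum>i<n. of_int (d i) * y ^ i)"
    using algebraic_int_power_span[OF assms(2)] by metis
  define V where "V = (\<lambda>(i, j). x ^ i * y ^ j) ` ({..<m} \<times> {..<n})"
  have fin: "finite V" unfolding V_def by simp
  have V: "x ^ i * y ^ j \<in> int_span V" if "i < m" "j < n" for i j
    using that by (intro int_span_base fin) (auto simp: V_def)
  have one: "1 \<in> V" unfolding V_def using m n by (auto intro!: image_eqI[of _ _ "(0, 0)"])
  have X: "x * v \<in> int_span V" if "v \<in> V" for v
  proof -
    obtain i j where ij: "i < m" "j < n" "v = x ^ i * y ^ j" using \<open>v \<in> V\<close> by (auto simp: V_def)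
    show ?thesis
    proof (cases "Suc i = m")
      case True
      then have "x * v = x ^ m * y ^ j" using ij by (auto simp: power_Suc[symmetric] simp del: power_Suc)
      also have "\<dots> = (\<Sum>k<m. of_int (c k) * (x ^ k * y ^ j))"
        unfolding m(2) by (simp add: sum_distrib_right mult.assoc)
      finally show ?thesis using ij by (auto intro!: int_span_sum int_span_scale V)
    next
      case False
      then show ?thesis using V[of "Suc i" j] ij by (simp add: mult.assoc)
    qed
  qed
  have Y: "y * v \<in> int_span V" if "v \<in> V" for v
  proof -
    obtain i j where ij: "i < m" "j < n" "v = x ^ i * y ^ j" using \<open>v \<in> V\<close> by (auto simp: V_def)
    show ?thesis
    proof (cases "Suc j = n")
      case True
      then have "y * v = x ^ i * y ^ n" using ij by (auto simp: power_Suc[symmetric] simp del: power_Suc)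
      also have "\<dots> = (\<Sum>k<n. of_int (d k) * (x ^ i * y ^ k))"
        unfolding n(2) by (simp add: sum_distrib_left mult_ac)
      finally show ?thesis using ij by (auto intro!: int_span_sum int_span_scale V)
    next
      case False
      then show ?thesis using V[of i "Suc j"] ij by (simp add: mult_ac)
    qed
  qed
  show "algebraic_int (x + y)"
    by (rule algebraic_int_if_stable_span[OF fin one]) (auto simp: distrib_right intro: int_span_add X Y)
  show "algebraic_int (x * y)"
    by (rule algebraic_int_if_stable_span[OF fin one]) (auto simp: mult.assoc intro!: int_span_mult_stable[OF X] Y)
qed

lemma algebraic_int_diff:
  "algebraic_int x \<Longrightarrow> algebraic_int y \<Longrightarrow> algebraic_int (x - y :: complex)"
  using algebraic_int_add[of x "- y"] by simp

lemma algebraic_int_power: "algebraic_int (x :: complex) \<Longrightarrow> algebraic_int (x ^ k)"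
  by (induction k) (auto intro: algebraic_int_mult)

lemma algebraic_int_root_of_unity:
  assumes "n > 0" "x ^ n = 1" shows "algebraic_int (x :: complex)"
proof -
  have "poly (monom 1 n - 1) x = 0" using assms by (simp add: poly_monom)
  moreover have "degree (monom 1 n - 1 :: complex poly) = n"
  proof -
    have "degree (monom (1::complex) n + (- 1)) = degree (monom (1::complex) n)"
      using assms by (intro degree_add_eq_left) (auto simp: degree_monom_eq)
    then show ?thesis by (simp add: degree_monom_eq)
  qed
  then have "lead_coeff (monom 1 n - 1 :: complex poly) = 1" using assms by simp
  ultimately show ?thesis
    by (intro algebraic_int.intros[of "monom 1 n - 1"]) auto
qed

section \<open>Denominators of algebraic numbers\<close>

text \<open>Multiplying an integer equation for \<open>x\<close> of degree n by the (n-1)-st power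
  of its leading coefficient a turns it into a monic one for a x; the powers of a x below n then
  span a stable lattice.\<close>

lemma algebraic_imp_scaled_algebraic_int:
  assumes "algebraic (x :: complex)"
  obtains a :: int where "a \<noteq> 0" "algebraic_int (of_int a * x)"
proof -
  obtain p where p: "\<And>i. coeff p i \<in> \<int>" "p \<noteq> 0" "poly p x = 0"
    using assms by (auto elim!: algebraicE)
  have "\<forall>i. \<exists>a. coeff p i = of_int a" using p(1) by (auto elim!: Ints_cases)
  then obtain a where a: "\<And>i. coeff p i = of_int (a i)" by metis
  define n where "n = degree p"
  define V where "V = (\<lambda>i. (of_int (a n) * x) ^ i) ` {..<n}"
  have n: "n > 0"
  proof (rule ccontr)
    assume "\<not> n > 0"
    then obtain c where "p = [:c:]" by (auto simp: n_def elim: degree_eq_zeroE)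
    then show False using p by auto
  qed
  have an: "a n \<noteq> 0" using p(2) a[of n] by (auto simp: n_def)
  have fin: "finite V" unfolding V_def by simp
  have one: "1 \<in> V" unfolding V_def using n by (auto intro!: image_eqI[of _ _ 0])
  let ?y = "of_int (a n) * x"
  have "(\<Sum>i\<le>n. of_int (a i) * x ^ i) = 0"
    using p(3) unfolding poly_altdef n_def a .
  then have "of_int (a n) * x ^ n = - (\<Sum>i<n. of_int (a i) * x ^ i)"
    by (simp add: lessThan_Suc_atMost[symmetric] eq_neg_iff_add_eq_0 add.commute)
  then have "?y ^ n = - (\<Sum>i<n. of_int (a n) ^ (n - 1) * (of_int (a i) * x ^ i))"
    (is "_ = ?r")
  proof -
    have "?y ^ n = of_int (a n) ^ (n - 1) * (of_int (a n) * x ^ n)"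
      using n by (cases n) (simp_all add: power_mult_distrib mult_ac)
    also have "\<dots> = of_int (a n) ^ (n - 1) * - (\<Sum>i<n. of_int (a i) * x ^ i)"
      using \<open>of_int (a n) * x ^ n = _\<close> by simp
    also have "\<dots> = ?r" by (simp only: sum_distrib_left mult_minus_right)
    finally show ?thesis .
  qed
  also have "\<dots> = (\<Sum>i<n. of_int (- (a n ^ (n - 1 - i) * a i)) * ?y ^ i)"
    unfolding sum_negf[symmetric]
  proof (intro sum.cong refl)
    fix i assume "i \<in> {..<n}"
    then have "n - 1 = (n - 1 - i) + i" by auto
    then have "of_int (a n) ^ (n - 1) = (of_int (a n) ^ (n - 1 - i) * of_int (a n) ^ i :: complex)"
      by (metis power_add)
    then show "- (of_int (a n) ^ (n - 1) * (of_int (a i) * x ^ i)) = of_int (- (a n ^ (n - 1 - i) * a i)) * ?y ^ i"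
      by (simp add: power_mult_distrib)
  qed
  finally have y: "?y ^ n = \<dots>" .
  have "?y ^ i \<in> int_span V" if "i \<in> {..<n}" for i
    using that by (intro int_span_base[OF fin]) (auto simp: V_def)
  then have yn: "?y ^ n \<in> int_span V"
    unfolding y by (intro int_span_sum int_span_scale)
  have "algebraic_int ?y"
  proof (rule algebraic_int_if_stable_span[OF fin one])
    fix v assume "v \<in> V"
    then obtain i where i: "i < n" "v = ?y ^ i" by (auto simp: V_def)
    show "?y * v \<in> int_span V"
    proof (cases "Suc i = n")
      case True
      then show ?thesis using yn i by (auto simp: power_Suc[symmetric] simp del: power_Suc)
    next
      case False
      then have "?y ^ Suc i \<in> int_span V"
        using i unfolding V_def by (intro int_span_base imageI) auto
      then show ?thesis using i by simp
    qed
  qed simp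
  then show ?thesis using an that by blast
qed

text \<open>Substituting a X for X in the monic equation of a x gives an integer equation for
  \<open>x\<close>.\<close>

lemma algebraic_if_scaled_algebraic_int:
  assumes "a \<noteq> (0 :: int)" "algebraic_int (of_int a * (x :: complex))"
  shows "algebraic x"
proof -
  obtain p where p: "poly (map_poly of_int p) (of_int a * x) = 0" "lead_coeff p = (1 :: int)"
    using assms(2) by (auto simp: algebraic_int_altdef_ipoly)
  have m: "map_poly of_int p \<noteq> (0 :: complex poly)" using p(2) by auto
  show ?thesis
  proof (rule algebraicI[of "pcompose (map_poly of_int p) [:0, of_int a:]"])
    fix i show "coeff (pcompose (map_poly of_int p) [:0, of_int a:]) i \<in> (\<int> :: complex set)"
      by (intro coeff_pcompose_semiring_closed) (auto simp: coeff_map_poly coeff_pCons split: nat.splits)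
  next
    show "pcompose (map_poly of_int p) [:0, of_int a:] \<noteq> (0 :: complex poly)"
      using m assms(1) by (auto simp: pcompose_eq_0_iff)
    show "poly (pcompose (map_poly of_int p) [:0, of_int a:]) x = 0"
      using p(1) by (simp add: poly_pcompose mult.commute)
  qed
qed

lemma algebraic_binary:
  assumes "algebraic (x :: complex)" "algebraic y"
  shows algebraic_add: "algebraic (x + y)" and algebraic_mult: "algebraic (x * y)"
proof -
  obtain a where a: "a \<noteq> 0" "algebraic_int (of_int a * x)"
    using algebraic_imp_scaled_algebraic_int[OF assms(1)] by metis
  obtain b where b: "b \<noteq> 0" "algebraic_int (of_int b * y)"
    using algebraic_imp_scaled_algebraic_int[OF assms(2)] by metis
  have "algebraic_int (of_int b * (of_int a * x) + of_int a * (of_int b * y))"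
    by (rule algebraic_int_add[OF algebraic_int_mult[OF _ a(2)] algebraic_int_mult[OF _ b(2)]]) auto
  then have "algebraic_int (of_int (a * b) * (x + y))" by (simp add: algebra_simps)
  then show "algebraic (x + y)" using a b by (intro algebraic_if_scaled_algebraic_int[of "a * b"]) auto
  have "algebraic_int ((of_int a * x) * (of_int b * y))"
    by (rule algebraic_int_mult[OF a(2) b(2)])
  then have "algebraic_int (of_int (a * b) * (x * y))" by (simp add: algebra_simps)
  then show "algebraic (x * y)" using a b by (intro algebraic_if_scaled_algebraic_int[of "a * b"]) auto
qed

lemma algebraic_inverse:
  assumes "algebraic (x :: complex)" shows "algebraic (inverse x)"
proof (cases "x = 0")
  case False
  obtain p where p: "\<And>i. coeff p i \<in> \<int>" "p \<noteq> 0" "poly p x = 0"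
    using assms by (auto elim!: algebraicE)
  show ?thesis
  proof (rule algebraicI[of "reflect_poly p"])
    fix i show "coeff (reflect_poly p) i \<in> \<int>" using p(1) by (simp add: coeff_reflect_poly)
  next
    show "reflect_poly p \<noteq> 0" using p by simp
    show "poly (reflect_poly p) (inverse x) = 0"
      using p False poly_reflect_poly_nz[of "inverse x" p] by simp
  qed
qed (use assms in simp)


section \<open>Extending embeddings\<close>

text \<open>The graph of an embedding of a ring of algebraic numbers containing the rationals. As a
  relation it can be enlarged and united along chains without mentioning a domain. The clause on (0,
  y) gives single-valuedness, because differences of pairs are available; injectivity and closure
  under inverses follow from algebraicity.\<close>

definition emb_rel :: "(complex \<times> complex) set \<Rightarrow> bool"
  where "emb_rel S \<longleftrightarrow> (\<forall>q\<in>\<rat>. (q, q) \<in> S) \<and>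
    (\<forall>x y x' y'. (x, y) \<in> S \<longrightarrow> (x', y') \<in> S \<longrightarrow> (x + x', y + y') \<in> S \<and> (x * x', y * y') \<in> S) \<and>
    (\<forall>y. (0, y) \<in> S \<longrightarrow> y = 0) \<and> (\<forall>x y. (x, y) \<in> S \<longrightarrow> algebraic x)"

lemma emb_relD:
  assumes "emb_rel S"
  shows "q \<in> \<rat> \<Longrightarrow> (q, q) \<in> S"
    and "(x, y) \<in> S \<Longrightarrow> (x', y') \<in> S \<Longrightarrow> (x + x', y + y') \<in> S"
    and "(x, y) \<in> S \<Longrightarrow> (x', y') \<in> S \<Longrightarrow> (x * x', y * y') \<in> S"
    and "(0, y) \<in> S \<Longrightarrow> y = 0"
    and "(x, y) \<in> S \<Longrightarrow> algebraic x"
  using assms unfolding emb_rel_def by blast+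

lemma emb_rel_0_1:
  assumes "emb_rel S" shows "(0, 0) \<in> S" "(1, 1) \<in> S" "(-1, -1) \<in> S" "(of_nat k, of_nat k) \<in> S"
  by (rule emb_relD(1)[OF assms]; simp)+

lemma emb_rel_uminus:
  assumes "emb_rel S" "(x, y) \<in> S" shows "(- x, - y) \<in> S"
  using emb_relD(3)[OF assms(1) emb_rel_0_1(3)[OF assms(1)] assms(2)] by simp

lemma emb_rel_diff:
  assumes "emb_rel S" "(x, y) \<in> S" "(x', y') \<in> S" shows "(x - x', y - y') \<in> S"
  using emb_relD(2)[OF assms(1,2) emb_rel_uminus[OF assms(1,3)]] by simp

lemma emb_rel_unique:
  assumes "emb_rel S" "(x, y) \<in> S" "(x, y') \<in> S" shows "y = y'"
  using emb_relD(4)[OF assms(1)] emb_rel_diff[OF assms] by fastforce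

lemma emb_rel_sum:
  assumes "emb_rel S" "\<And>i. i \<in> I \<Longrightarrow> (f i, g i) \<in> S"
  shows "(\<Sum>i\<in>I. f i, \<Sum>i\<in>I. g i) \<in> S"
  using assms(2)
  by (induction I rule: infinite_finite_induct) (auto intro: emb_rel_0_1[OF assms(1)] emb_relD(2)[OF assms(1)])

text \<open>For an embedding \<open>S\<close> the polynomial \<open>q\<close> is determined by
  \<open>p\<close>: it is the image of \<open>p\<close>. Carrying both along avoids mapping
  coefficients by a function that is defined on a subfield only.\<close>

definition polyrel :: "(complex \<times> complex) set \<Rightarrow> complex poly \<Rightarrow> complex poly \<Rightarrow> bool"
  where "polyrel S p q \<longleftrightarrow> (\<forall>i. (coeff p i, coeff q i) \<in> S)"

lemma polyrel_const: "emb_rel S \<Longrightarrow> (x, y) \<in> S \<Longrightarrow> polyrel S [:x:] [:y:]"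
  unfolding polyrel_def by (auto simp: coeff_pCons emb_rel_0_1 split: nat.splits)

lemma polyrel_add:
  "emb_rel S \<Longrightarrow> polyrel S p q \<Longrightarrow> polyrel S p' q' \<Longrightarrow> polyrel S (p + p') (q + q')"
  unfolding polyrel_def by (auto intro: emb_relD(2))

lemma polyrel_diff:
  "emb_rel S \<Longrightarrow> polyrel S p q \<Longrightarrow> polyrel S p' q' \<Longrightarrow> polyrel S (p - p') (q - q')"
  unfolding polyrel_def by (auto intro: emb_rel_diff)

lemma polyrel_mult:
  "emb_rel S \<Longrightarrow> polyrel S p q \<Longrightarrow> polyrel S p' q' \<Longrightarrow> polyrel S (p * p') (q * q')"
  unfolding polyrel_def coeff_mult by (auto intro!: emb_rel_sum emb_relD(3))

lemma polyrel_monom: "emb_rel S \<Longrightarrow> (x, y) \<in> S \<Longrightarrow> polyrel S (monom x k) (monom y k)"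
  unfolding polyrel_def by (auto simp: emb_rel_0_1)

lemma polyrel_pderiv: "emb_rel S \<Longrightarrow> polyrel S p q \<Longrightarrow> polyrel S (pderiv p) (pderiv q)"
  unfolding polyrel_def coeff_pderiv by (auto intro!: emb_relD(3) emb_rel_0_1(4) simp del: of_nat_Suc)

lemma polyrel_0: "emb_rel S \<Longrightarrow> polyrel S 0 q \<Longrightarrow> q = 0"
  unfolding polyrel_def by (auto intro!: poly_eqI emb_relD(4))

lemma polyrel_rat: "emb_rel S \<Longrightarrow> (\<And>i. coeff p i \<in> \<rat>) \<Longrightarrow> polyrel S p p"
  unfolding polyrel_def by (auto intro: emb_relD(1))

lemma emb_rel_power:
  assumes "emb_rel S" "(x, y) \<in> S" shows "(x ^ k, y ^ k) \<in> S"
  by (induction k) (auto intro: emb_rel_0_1[OF assms(1)] emb_relD(3)[OF assms(1)] assms(2))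

lemma polyrel_poly:
  assumes S: "emb_rel S" and xy: "(x, y) \<in> S" and pq: "polyrel S p q"
  shows "(poly p x, poly q y) \<in> S"
proof -
  have "poly p x = (\<Sum>i\<le>max (degree p) (degree q). coeff p i * x ^ i)"
    unfolding poly_altdef by (rule sum.mono_neutral_left) (auto simp: coeff_eq_0)
  moreover have "poly q y = (\<Sum>i\<le>max (degree p) (degree q). coeff q i * y ^ i)"
    unfolding poly_altdef by (rule sum.mono_neutral_left) (auto simp: coeff_eq_0)
  ultimately show ?thesis
    using pq unfolding polyrel_def
    by (auto intro!: emb_rel_sum[OF S] emb_relD(3)[OF S] emb_rel_power[OF S xy])
qed

text \<open>Dividing out powers of X leaves an equation a + x p(x) = 0 with a nonzero, which
  exhibits the inverse. Thus a ring of algebraic numbers over the rationals is already a field,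
  which is why \<open>emb_rel\<close> does not ask for inverses.\<close>

lemma inverse_eq_rat_poly:
  fixes x :: complex
  assumes "algebraic x" "x \<noteq> 0"
  obtains q where "\<And>i. coeff q i \<in> \<rat>" "inverse x = poly q x"
proof -
  have "\<exists>q. (\<forall>i. coeff q i \<in> \<rat>) \<and> inverse x = poly q x"
    if "\<forall>i. coeff p i \<in> \<rat>" "p \<noteq> 0" "poly p x = 0" for p
    using that
  proof (induction p rule: pCons_induct)
    case (pCons a p)
    have c: "coeff p i \<in> \<rat>" for i using pCons.prems(1)[rule_format, of "Suc i"] by simp
    have a: "a \<in> \<rat>" using pCons.prems(1)[rule_format, of 0] by simp
    show ?case
    proof (cases "a = 0")
      case True
      then show ?thesis using pCons c assms by auto
    next
      case False
      have "inverse x = poly ([:- inverse a:] * p) x"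
        using pCons.prems(3) False assms(2) by (simp add: field_simps eq_neg_iff_add_eq_0)
      then show ?thesis using c a by (intro exI[of _ "[:- inverse a:] * p"]) auto
    qed
  qed simp
  moreover obtain p where "\<And>i. coeff p i \<in> \<int>" "p \<noteq> 0" "poly p x = 0"
    using assms by (auto elim!: algebraicE)
  ultimately have "\<exists>q. (\<forall>i. coeff q i \<in> \<rat>) \<and> inverse x = poly q x"
    using Ints_subset_Rats by blast
  then show ?thesis using that by blast
qed

text \<open>The inverse of \<open>x\<close> is a rational polynomial in \<open>x\<close>, and
  rational polynomials commute with the embedding. The second claim amounts to injectivity.\<close>

lemma emb_rel_inverse:
  assumes S: "emb_rel S" and xy: "(x, y) \<in> S" "x \<noteq> 0"
  shows "(inverse x, inverse y) \<in> S" "y \<noteq> 0"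
proof -
  obtain q where q: "\<And>i. coeff q i \<in> \<rat>" "inverse x = poly q x"
    using inverse_eq_rat_poly[OF emb_relD(5)[OF S xy(1)] xy(2)] by metis
  have *: "(inverse x, poly q y) \<in> S"
    unfolding q(2) by (rule polyrel_poly[OF S xy(1) polyrel_rat[OF S q(1)]])
  have "(1, y * poly q y) \<in> S" using emb_relD(3)[OF S xy(1) *] xy(2) by simp
  then have "y * poly q y = 1" using emb_rel_unique[OF S _ emb_rel_0_1(2)[OF S]] by auto
  then have "y \<noteq> 0" "poly q y = inverse y" by (auto simp: inverse_unique)
  then show "(inverse x, inverse y) \<in> S" "y \<noteq> 0" using * by auto
qed

text \<open>Long division by a monic polynomial uses only ring operations on coefficients, so it
  runs in parallel on both sides. The image side reads off the coefficient of \<open>p'\<close> at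
  the degree of \<open>p\<close>, so the degrees of image polynomials never enter.\<close>

lemma polyrel_division:
  assumes S: "emb_rel S" and m: "polyrel S m m'" "lead_coeff m = 1"
  shows "polyrel S p p' \<Longrightarrow> \<exists>q q' r r'. polyrel S q q' \<and> polyrel S r r' \<and>
    p = q * m + r \<and> p' = q' * m' + r' \<and> (r = 0 \<or> degree r < degree m)"
proof (induction "degree p" arbitrary: p p' rule: less_induct)
  case less
  show ?case
  proof (cases "p = 0 \<or> degree p < degree m")
    case True
    then show ?thesis using less.prems polyrel_const[OF S emb_rel_0_1(1)[OF S]]
      by (intro exI[of _ 0] exI[of _ p] exI[of _ p']) auto
  next
    case False
    define k where "k = degree p - degree m"
    define a where "a = monom (lead_coeff p) k"
    define a' where "a' = monom (coeff p' (degree p)) k"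
    have rel: "polyrel S a a'"
      unfolding a_def a'_def using less.prems by (intro polyrel_monom S) (auto simp: polyrel_def)
    define p1 where "p1 = p - a * m"
    have rel1: "polyrel S p1 (p' - a' * m')"
      unfolding p1_def using less.prems rel m by (intro polyrel_diff polyrel_mult S)
    have ka: "k + degree m = degree p" using False by (simp add: k_def)
    have "degree (a * m) \<le> degree p"
      using degree_mult_le[of a m] degree_monom_le[of "lead_coeff p" k] ka by (simp add: a_def)
    then have dle: "degree p1 \<le> degree p" unfolding p1_def by (intro degree_diff_le) auto
    have c0: "coeff p1 (degree p) = 0"
      unfolding p1_def a_def using m(2) by (simp add: coeff_monom_mult flip: ka)
    have "p1 = 0 \<or> degree p1 < degree p"
      using dle c0 by (metis le_neq_implies_less leading_coeff_0_iff)
    then have "\<exists>q q' r r'. polyrel S q q' \<and> polyrel S r r' \<and>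
      p1 = q * m + r \<and> p' - a' * m' = q' * m' + r' \<and> (r = 0 \<or> degree r < degree m)"
    proof
      assume "p1 = 0"
      then show ?thesis using rel1 polyrel_0[OF S, of "p' - a' * m'"] polyrel_const[OF S emb_rel_0_1(1)[OF S]]
        by (intro exI[of _ 0]) auto
    qed (use less.hyps rel1 in blast)
    then obtain q q' r r' where h: "polyrel S q q'" "polyrel S r r'" "p1 = q * m + r"
      "p' - a' * m' = q' * m' + r'" "r = 0 \<or> degree r < degree m" by blast
    show ?thesis
    proof (intro exI conjI)
      show "polyrel S (q + a) (q' + a')" using h rel by (intro polyrel_add S)
      show "p = (q + a) * m + r" using h(3) unfolding p1_def by (simp add: algebra_simps)
      show "p' = (q' + a') * m' + r'" using h(4) by (simp add: algebra_simps)
    qed (use h in auto)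
  qed
qed

text \<open>\<open>minpolyrel S x m m'\<close>: \<open>m\<close> is the minimal polynomial of \<open>x\<close> over the field \<open>Domain S\<close> and
  \<open>m'\<close> is its image under the embedding \<open>S\<close>.\<close>

definition minpolyrel :: "(complex \<times> complex) set \<Rightarrow> complex \<Rightarrow> complex poly \<Rightarrow> complex poly \<Rightarrow> bool"
  where "minpolyrel S x m m' \<longleftrightarrow> polyrel S m m' \<and> lead_coeff m = 1 \<and> poly m x = 0 \<and>
    (\<forall>p q. polyrel S p q \<longrightarrow> poly p x = 0 \<longrightarrow> p = 0 \<or> degree m \<le> degree p)"

lemma minpolyrel_exists:
  assumes S: "emb_rel S" and x: "algebraic x"
  obtains m m' where "minpolyrel S x m m'"
proof -
  let ?P = "\<lambda>p. p \<noteq> 0 \<and> poly p x = 0 \<and> (\<exists>q. polyrel S p q)"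
  obtain p where "\<And>i. coeff p i \<in> \<int>" "p \<noteq> 0" "poly p x = 0"
    using x by (auto elim!: algebraicE)
  then have "?P p" using polyrel_rat[OF S, of p] by (meson Ints_subset_Rats subsetD)
  then obtain m where m: "?P m" "\<And>p. ?P p \<Longrightarrow> degree m \<le> degree p"
    using ex_has_least_nat[of ?P p degree] by blast
  then obtain m' where m': "polyrel S m m'" by blast
  let ?c = "inverse (lead_coeff m)" and ?c' = "inverse (coeff m' (degree m))"
  have nz: "m \<noteq> 0" "poly m x = 0" using m(1) by auto
  have "(?c, ?c') \<in> S"
    using m' nz unfolding polyrel_def by (intro emb_rel_inverse(1)[OF S]) auto
  then have "polyrel S ([:?c:] * m) ([:?c':] * m')" using m' by (intro polyrel_mult polyrel_const S)
  then have "minpolyrel S x ([:?c:] * m) ([:?c':] * m')"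
    unfolding minpolyrel_def using m(2) nz by (auto simp: degree_mult_eq)
  then show ?thesis by (rule that)
qed

text \<open>Minimality kills the remainder, and its image with it. The simultaneous factorisation of
  \<open>p'\<close> is what makes the extension by a root of \<open>m'\<close> well defined.\<close>

lemma minpolyrel_dvd:
  assumes S: "emb_rel S" and m: "minpolyrel S x m m'" and p: "polyrel S p p'" "poly p x = 0"
  obtains q q' where "polyrel S q q'" "p = q * m" "p' = q' * m'"
proof -
  obtain q q' r r' where h: "polyrel S q q'" "polyrel S r r'"
    "p = q * m + r" "p' = q' * m' + r'" "r = 0 \<or> degree r < degree m"
    using polyrel_division[OF S _ _ p(1)] m unfolding minpolyrel_def by metis
  have "poly r x = 0" using h(3) p(2) m by (auto simp: minpolyrel_def)
  then have "r = 0" using m h(2,5) unfolding minpolyrel_def by fastforce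
  then have "r' = 0" using h(2) polyrel_0[OF S] by auto
  show ?thesis using that[OF h(1)] h(3,4) \<open>r = 0\<close> \<open>r' = 0\<close> by simp
qed

lemma minpolyrel_degree_pos: "minpolyrel S x m m' \<Longrightarrow> 0 < degree m"
proof (rule ccontr)
  assume m: "minpolyrel S x m m'" and "\<not> 0 < degree m"
  then obtain c where "m = [:c:]" by (auto elim: degree_eq_zeroE)
  then show False using m by (auto simp: minpolyrel_def)
qed

section \<open>Adjoining a root and extending to all algebraic numbers\<close>

definition adjoin :: "(complex \<times> complex) set \<Rightarrow> complex \<Rightarrow> complex \<Rightarrow> (complex \<times> complex) set"
  where "adjoin S x y = {(poly p x, poly q y) | p q. polyrel S p q}"

lemma adjoin_incl:
  assumes S: "emb_rel S"
  shows "S \<subseteq> adjoin S x y" "(x, y) \<in> adjoin S x y"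
proof -
  show "S \<subseteq> adjoin S x y"
  proof
    fix ab assume "ab \<in> S"
    then show "ab \<in> adjoin S x y"
      unfolding adjoin_def using polyrel_const[OF S, of "fst ab" "snd ab"]
      by (intro CollectI exI[of _ "[:fst ab:]"] exI[of _ "[:snd ab:]"]) auto
  qed
  show "(x, y) \<in> adjoin S x y"
    unfolding adjoin_def using polyrel_monom[OF S emb_rel_0_1(2)[OF S], of 1]
    by (intro CollectI exI[of _ "monom 1 1"]) (auto simp: poly_monom)
qed

lemma algebraic_poly:
  assumes "\<And>i. algebraic (coeff p i)" "algebraic (x :: complex)" shows "algebraic (poly p x)"
  using assms(1)
proof (induction p)
  case (pCons a p)
  have "algebraic a" "\<And>i. algebraic (coeff p i)"
    using pCons.prems[of 0] pCons.prems[of "Suc _"] by auto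
  then show ?case using pCons.IH assms(2) by (auto intro: algebraic_add algebraic_mult)
qed simp

text \<open>Well-definedness is the point: if \<open>p\<close> vanishes at \<open>x\<close>, the
  minimal polynomial divides \<open>p\<close>, hence \<open>m'\<close> divides the image of
  \<open>p\<close>, which then vanishes at the root \<open>y\<close> of \<open>m'\<close>.\<close>

lemma emb_rel_adjoin:
  assumes S: "emb_rel S" and x: "algebraic x" and m: "minpolyrel S x m m'" "poly m' y = 0"
  shows "emb_rel (adjoin S x y)"
  unfolding emb_rel_def
proof (intro conjI allI impI ballI)
  fix q :: complex assume "q \<in> \<rat>"
  then show "(q, q) \<in> adjoin S x y" using adjoin_incl(1)[OF S, of x y] emb_relD(1)[OF S] by blast
next
  fix a b a' b' assume "(a, b) \<in> adjoin S x y" "(a', b') \<in> adjoin S x y"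
  then obtain p q p' q' where h: "a = poly p x" "b = poly q y" "polyrel S p q"
    "a' = poly p' x" "b' = poly q' y" "polyrel S p' q'" by (auto simp: adjoin_def)
  show "(a + a', b + b') \<in> adjoin S x y"
    unfolding adjoin_def using h polyrel_add[OF S h(3,6)]
    by (intro CollectI exI[of _ "p + p'"] exI[of _ "q + q'"]) auto
  show "(a * a', b * b') \<in> adjoin S x y"
    unfolding adjoin_def using h polyrel_mult[OF S h(3,6)]
    by (intro CollectI exI[of _ "p * p'"] exI[of _ "q * q'"]) auto
next
  fix b assume "(0, b) \<in> adjoin S x y"
  then obtain p q where h: "0 = poly p x" "b = poly q y" "polyrel S p q"
    by (auto simp: adjoin_def)
  obtain r r' where "p = r * m" "q = r' * m'"
    using minpolyrel_dvd[OF S m(1) h(3)] h(1) by metis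
  then show "b = 0" using h m(2) by simp
next
  fix a b assume "(a, b) \<in> adjoin S x y"
  then show "algebraic a"
    unfolding adjoin_def polyrel_def using x emb_relD(5)[OF S] by (auto intro!: algebraic_poly)
qed

text \<open>The leading coefficient 1 of \<open>m\<close> has a nonzero image, so \<open>m'\<close>
  is not constant.\<close>

lemma emb_rel_extend_root:
  assumes S: "emb_rel S" and x: "algebraic x" and m: "minpolyrel S x m m'"
  obtains y where "poly m' y = 0"
proof -
  have "(1, coeff m' (degree m)) \<in> S" using m unfolding minpolyrel_def polyrel_def by metis
  then have "coeff m' (degree m) \<noteq> 0" using emb_rel_inverse(2)[OF S] by simp
  then have "0 < degree m'" using le_degree minpolyrel_degree_pos[OF m] by (metis less_le_trans)
  then have "\<not> constant (poly m')" by (simp add: constant_degree)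
  then show ?thesis using fundamental_theorem_of_algebra that by blast
qed

lemma emb_rel_Union:
  assumes "C \<noteq> {}" "\<And>S. S \<in> C \<Longrightarrow> emb_rel S" "subset.chain A C"
  shows "emb_rel (\<Union>C)"
proof -
  have common: "\<exists>S\<in>C. a \<in> S \<and> b \<in> S" if "a \<in> \<Union>C" "b \<in> \<Union>C" for a b
  proof -
    from that(1) obtain S where S: "a \<in> S" "S \<in> C" by (rule UnionE)
    from that(2) obtain T where T: "b \<in> T" "T \<in> C" by (rule UnionE)
    have "S \<subseteq> T \<or> T \<subseteq> S" using assms(3) S(2) T(2) unfolding subset_chain_def by simp
    then show ?thesis
    proof
      assume "S \<subseteq> T"
      then show ?thesis using S T by (intro bexI[of _ T]) auto
    next
      assume "T \<subseteq> S"
      then show ?thesis using S T by (intro bexI[of _ S]) auto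
    qed
  qed
  show ?thesis
    unfolding emb_rel_def
  proof (intro conjI allI impI ballI)
    fix q :: complex assume "q \<in> \<rat>"
    moreover obtain S where "S \<in> C" using assms(1) by auto
    ultimately show "(q, q) \<in> \<Union>C" using emb_relD(1)[OF assms(2)] by (auto intro: UnionI)
  next
    fix x y x' y' assume "(x, y) \<in> \<Union>C" "(x', y') \<in> \<Union>C"
    then obtain S where S: "S \<in> C" "(x, y) \<in> S" "(x', y') \<in> S" using common by (meson bexE)
    show "(x + x', y + y') \<in> \<Union>C" "(x * x', y * y') \<in> \<Union>C"
      using emb_relD(2,3)[OF assms(2)[OF S(1)] S(2,3)] S(1) by (auto intro: UnionI)
  next
    fix y assume "(0, y) \<in> \<Union>C"
    then show "y = 0" using emb_relD(4)[OF assms(2)] by blast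
  next
    fix x y assume "(x, y) \<in> \<Union>C"
    then show "algebraic x" using emb_relD(5)[OF assms(2)] by blast
  qed
qed

lemma Gal_iff:
  "\<sigma> \<in> carrier (Gal L K) \<longleftrightarrow> \<sigma> \<in> extensional L \<and> bij_betw \<sigma> L L \<and>
    (\<forall>x\<in>L. \<forall>y\<in>L. \<sigma> (x + y) = \<sigma> x + \<sigma> y \<and> \<sigma> (x * y) = \<sigma> x * \<sigma> y) \<and> \<sigma> 1 = 1 \<and> (\<forall>x\<in>K. \<sigma> x = x)"
  unfolding Gal_def Bij_def BijGroup_def Ring.ring_hom_def complex_ring_def
  by (auto simp: bij_betw_def)

abbreviation Aut :: "(complex \<Rightarrow> complex) set"
  where "Aut \<equiv> carrier (Gal Qc \<rat>)"

text \<open>Surjectivity comes from finiteness: the injective map sends the finite set of roots of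
  any integer polynomial into itself, hence onto itself.\<close>

lemma emb_rel_total_imp_Aut:
  assumes M: "emb_rel M" and tot: "\<And>x. algebraic x \<Longrightarrow> \<exists>y. (x, y) \<in> M"
  shows "\<exists>\<sigma>\<in>Aut. \<forall>x y. (x, y) \<in> M \<longrightarrow> \<sigma> x = y"
proof -
  define \<sigma> where "\<sigma> = (\<lambda>x\<in>Qc. THE y. (x, y) \<in> M)"
  have eq: "\<sigma> x = y" if "(x, y) \<in> M" for x y
    using emb_rel_unique[OF M] that emb_relD(5)[OF M that] unfolding \<sigma>_def Qc_def by (auto intro!: the_equality)
  have mem: "(x, \<sigma> x) \<in> M" if "algebraic x" for x using tot[OF that] eq by metis
  have inj: "inj_on \<sigma> Qc"
  proof (rule inj_onI)
    fix x y assume "x \<in> Qc" "y \<in> Qc" "\<sigma> x = \<sigma> y"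
    then have "(x - y, 0) \<in> M" using emb_rel_diff[OF M mem mem, of x y] by (simp add: Qc_def)
    then show "x = y" using emb_rel_inverse(2)[OF M, of "x - y" 0] by auto
  qed
  have roots: "poly p (\<sigma> x) = 0" if p: "\<And>i. coeff p i \<in> \<rat>" "poly p x = 0" "algebraic x" for p x
    using polyrel_poly[OF M mem[OF p(3)] polyrel_rat[OF M p(1)]] p(2) emb_relD(4)[OF M] by auto
  have alg: "algebraic (\<sigma> x)" if x: "algebraic x" for x
  proof -
    obtain p where p: "\<And>i. coeff p i \<in> \<int>" "p \<noteq> 0" "poly p x = 0" using x by (auto elim!: algebraicE)
    then have "\<And>i. coeff p i \<in> \<rat>" using Ints_subset_Rats by blast
    then have "poly p (\<sigma> x) = 0" using roots p x by blast
    then show ?thesis using p by (auto intro: algebraicI)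
  qed
  have surj: "\<exists>x\<in>Qc. \<sigma> x = y" if y: "y \<in> Qc" for y
  proof -
    obtain p where p: "\<And>i. coeff p i \<in> \<int>" "p \<noteq> 0" "poly p y = 0" 
      using y by (auto elim!: algebraicE simp: Qc_def)
    then have rat: "\<And>i. coeff p i \<in> \<rat>" using Ints_subset_Rats by blast
    let ?Z = "{x. poly p x = 0}"
    have Z: "algebraic x" if "x \<in> ?Z" for x using p that by (auto intro: algebraicI)
    have "\<sigma> ` ?Z \<subseteq> ?Z" using roots[OF rat] Z by auto
    moreover have "inj_on \<sigma> ?Z" by (rule inj_on_subset[OF inj]) (use Z in \<open>auto simp: Qc_def\<close>)
    ultimately have "\<sigma> ` ?Z = ?Z" using endo_inj_surj[of ?Z \<sigma>] poly_roots_finite[OF p(2)] by auto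
    then have "y \<in> \<sigma> ` ?Z" using p(3) by auto
    then show ?thesis using Z by (auto simp: Qc_def)
  qed
  have "\<sigma> \<in> Aut"
    unfolding Gal_iff
  proof (intro conjI ballI)
    show "\<sigma> \<in> extensional Qc" by (simp add: \<sigma>_def)
    show "bij_betw \<sigma> Qc Qc" unfolding bij_betw_def using inj surj alg by (auto simp: Qc_def)
  next
    fix x y assume "x \<in> Qc" "y \<in> Qc"
    then show "\<sigma> (x + y) = \<sigma> x + \<sigma> y" "\<sigma> (x * y) = \<sigma> x * \<sigma> y"
      by (auto intro!: eq emb_relD(2,3)[OF M] mem simp: Qc_def)
  qed (auto intro!: eq emb_relD(1)[OF M])
  then show ?thesis using eq by blast
qed

text \<open>Zorn's lemma: a maximal extension is total, since any missing algebraic number could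
  still be adjoined.\<close>

theorem emb_rel_extend:
  assumes S: "emb_rel S"
  shows "\<exists>\<sigma>\<in>Aut. \<forall>x y. (x, y) \<in> S \<longrightarrow> \<sigma> x = y"
proof -
  let ?A = "{T. emb_rel T \<and> S \<subseteq> T}"
  have "\<exists>M\<in>?A. \<forall>X\<in>?A. M \<subseteq> X \<longrightarrow> X = M"
  proof (rule subset_Zorn_nonempty)
    show "?A \<noteq> {}" using S by blast
    fix C assume C: "C \<noteq> {}" "subset.chain ?A C"
    then have "\<And>T. T \<in> C \<Longrightarrow> emb_rel T \<and> S \<subseteq> T" by (auto simp: subset_chain_def)
    then show "\<Union>C \<in> ?A" using emb_rel_Union[OF C(1) _ C(2)] C(1) by blast
  qed
  then obtain M where "M \<in> ?A" and max0: "\<forall>X\<in>?A. M \<subseteq> X \<longrightarrow> X = M" by (rule bexE)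
  then have M: "emb_rel M" "S \<subseteq> M" by simp_all
  have max: "X = M" if "emb_rel X" "M \<subseteq> X" for X using max0 that M(2) by simp
  have "\<exists>y. (x, y) \<in> M" if x: "algebraic x" for x
  proof -
    obtain m m' where m: "minpolyrel M x m m'" by (rule minpolyrel_exists[OF M(1) x])
    obtain y where y: "poly m' y = 0" by (rule emb_rel_extend_root[OF M(1) x m])
    show ?thesis
      using max[OF emb_rel_adjoin[OF M(1) x m y] adjoin_incl(1)[OF M(1)]] adjoin_incl(2)[OF M(1), of x y] by blast
  qed
  then show ?thesis using emb_rel_total_imp_Aut[OF M(1)] M(2) by blast
qed

lemma emb_rel_Id_on:
  assumes "\<rat> \<subseteq> K" "\<And>x y. x \<in> K \<Longrightarrow> y \<in> K \<Longrightarrow> x + y \<in> K \<and> x * y \<in> K" "K \<subseteq> Qc"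
  shows "emb_rel {(x, x) | x. x \<in> K}"
  using assms unfolding emb_rel_def by (auto simp: Qc_def)

text \<open>Half of the Galois correspondence. \<open>K\<close> is a field because its elements are
  algebraic. An element outside \<open>K\<close> has a minimal polynomial with a second root, and
  sending the element to that root extends to an automorphism over \<open>K\<close>.\<close>

theorem Aut_fixed:
  assumes K: "\<rat> \<subseteq> K" "\<And>x y. x \<in> K \<Longrightarrow> y \<in> K \<Longrightarrow> x + y \<in> K \<and> x * y \<in> K" "K \<subseteq> Qc"
    and x: "x \<in> Qc" and fixed: "\<And>\<sigma>. \<sigma> \<in> Aut \<Longrightarrow> (\<And>y. y \<in> K \<Longrightarrow> \<sigma> y = y) \<Longrightarrow> \<sigma> x = x"
  shows "x \<in> K"
proof (rule ccontr)
  assume nx: "x \<notin> K"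
  define S where "S = {(x, x) | x. x \<in> K}"
  have S: "emb_rel S" unfolding S_def by (rule emb_rel_Id_on[OF K])
  have alg: "algebraic x" using x by (simp add: Qc_def)
  obtain m m' where m: "minpolyrel S x m m'" by (rule minpolyrel_exists[OF S alg])
  then have mm: "m' = m" "polyrel S m m" "lead_coeff m = 1" "poly m x = 0"
    unfolding minpolyrel_def polyrel_def S_def by (auto intro: poly_eqI)
  have "[:- x, 1:] dvd m" using mm by (simp add: poly_eq_0_iff_dvd)
  then obtain r where r: "m = [:- x, 1:] * r" by (elim dvdE)
  have r0: "r \<noteq> 0" using r mm by auto
  have dr: "degree m = Suc (degree r)" unfolding r using r0 by (subst degree_mult_eq) auto
  have "degree r \<noteq> 0"
  proof
    assume "degree r = 0"
    then obtain c where c: "r = [:c:]" by (auto elim: degree_eq_zeroE)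
    have "coeff m 1 = 1" using dr mm(3) \<open>degree r = 0\<close> by simp
    then have "c = 1" unfolding r c by simp
    have "coeff m 0 = - x" unfolding r c \<open>c = 1\<close> by simp
    then have "- x \<in> K"
      using mm(2)[unfolded polyrel_def S_def, rule_format, of 0] by auto
    moreover have "- 1 \<in> K" using K(1) by (meson Rats_1 Rats_minus_iff subsetD)
    ultimately have "- 1 * (- x) \<in> K" using K(2) by blast
    then show False using nx by simp
  qed
  \<comment> \<open>Separability: a double root at \<open>x\<close> would also be a root of the
    derivative, which is nonzero of smaller degree.\<close>
  have "poly r x \<noteq> 0"
  proof
    assume "poly r x = 0"
    have "pderiv m = r + [:- x, 1:] * pderiv r" unfolding r pderiv_mult by (simp add: pderiv_pCons)
    then have "poly (pderiv m) x = 0" using \<open>poly r x = 0\<close> by simp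
    moreover have "polyrel S (pderiv m) (pderiv m)" by (rule polyrel_pderiv[OF S mm(2)])
    ultimately have "pderiv m = 0 \<or> degree m \<le> degree (pderiv m)"
      using m unfolding minpolyrel_def by blast
    then show False using dr by (auto simp: degree_pderiv pderiv_eq_0_iff)
  qed
  moreover obtain y where y: "poly r y = 0"
    using \<open>degree r \<noteq> 0\<close> fundamental_theorem_of_algebra[of r] by (auto simp: constant_degree)
  ultimately have "y \<noteq> x" by auto
  have "poly m' y = 0" unfolding mm(1) r using y by simp
  then have "emb_rel (adjoin S x y)" by (rule emb_rel_adjoin[OF S alg m])
  from emb_rel_extend[OF this] obtain \<sigma> where \<sigma>: "\<sigma> \<in> Aut" "\<forall>a b. (a, b) \<in> adjoin S x y \<longrightarrow> \<sigma> a = b"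
    by (rule bexE)
  have "\<sigma> x = y" using \<sigma>(2) adjoin_incl(2)[OF S, of x y] by blast
  moreover have "\<sigma> a = a" if "a \<in> K" for a
    using \<sigma>(2) adjoin_incl(1)[OF S, of x y] that unfolding S_def by blast
  ultimately show False using fixed[OF \<sigma>(1)] \<open>y \<noteq> x\<close> by auto
qed


section \<open>Automorphisms raising roots of unity to a power\<close>

text \<open>Congruences are needed over two kinds of rings, that of all algebraic integers and the
  rings Z[zeta_n]; a closure predicate on sets of complex numbers covers both.\<close>

definition csubring :: "complex set \<Rightarrow> bool"
  where "csubring A \<longleftrightarrow> 1 \<in> A \<and> (\<forall>x\<in>A. \<forall>y\<in>A. x + y \<in> A \<and> x - y \<in> A \<and> x * y \<in> A)"

lemma csubringD:
  assumes "csubring A"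
  shows "1 \<in> A" "x \<in> A \<Longrightarrow> y \<in> A \<Longrightarrow> x + y \<in> A" "x \<in> A \<Longrightarrow> y \<in> A \<Longrightarrow> x - y \<in> A"
    "x \<in> A \<Longrightarrow> y \<in> A \<Longrightarrow> x * y \<in> A"
  using assms unfolding csubring_def by blast+

lemma csubring_closed:
  assumes A: "csubring A"
  shows "0 \<in> A" "x \<in> A \<Longrightarrow> - x \<in> A" "x \<in> A \<Longrightarrow> x ^ k \<in> A"
    "of_nat k \<in> A" "of_int i \<in> A"
    "(\<And>i. i \<in> I \<Longrightarrow> f i \<in> A) \<Longrightarrow> (\<Sum>i\<in>I. f i) \<in> A"
    "(\<And>i. i \<in> I \<Longrightarrow> f i \<in> A) \<Longrightarrow> (\<Prod>i\<in>I. f i) \<in> A"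
proof -
  show 0: "0 \<in> A" using csubringD(3)[OF A csubringD(1)[OF A] csubringD(1)[OF A]] by simp
  show m: "- x \<in> A" if "x \<in> A" for x using csubringD(3)[OF A 0 that] by simp
  show "x \<in> A \<Longrightarrow> x ^ k \<in> A" by (induction k) (auto intro: csubringD[OF A])
  show n: "of_nat k \<in> A" for k by (induction k) (auto intro: 0 csubringD[OF A])
  show "of_int i \<in> A" by (cases i rule: int_cases2) (auto intro: n m)
  show "(\<And>i. i \<in> I \<Longrightarrow> f i \<in> A) \<Longrightarrow> (\<Sum>i\<in>I. f i) \<in> A"
    by (induction I rule: infinite_finite_induct) (auto intro: 0 csubringD[OF A])
  show "(\<And>i. i \<in> I \<Longrightarrow> f i \<in> A) \<Longrightarrow> (\<Prod>i\<in>I. f i) \<in> A"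
    by (induction I rule: infinite_finite_induct) (auto intro: csubringD[OF A])
qed

lemma csubring_ipoly:
  assumes A: "csubring A" and "x \<in> A" shows "poly (of_int_poly f) x \<in> A"
  by (induction f) (auto intro!: csubringD[OF A] csubring_closed[OF A] assms(2))

lemma csubring_algebraic_int: "csubring {x. algebraic_int x}"
  unfolding csubring_def by (auto intro: algebraic_int_add algebraic_int_diff algebraic_int_mult)

section \<open>Frobenius congruences modulo a prime\<close>

lemma frobenius_add:
  assumes A: "csubring A" and p: "prime p" and ab: "a \<in> A" "b \<in> A"
  shows "\<exists>c\<in>A. (a + b) ^ p = a ^ p + b ^ p + of_nat p * c"
proof -
  let ?f = "\<lambda>k. of_nat (p choose k) * a ^ k * b ^ (p - k)"
  let ?c = "\<Sum>k\<in>{0<..<p}. of_nat ((p choose k) div p) * a ^ k * b ^ (p - k)"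
  have p0: "p > 0" using p by (simp add: prime_gt_0_nat)
  have "(a + b) ^ p = (\<Sum>k\<le>p. ?f k)" by (rule binomial_ring)
  also have "{..p} = insert 0 (insert p {0<..<p})" using p0 by auto
  also have "(\<Sum>k\<in>\<dots>. ?f k) = b ^ p + (a ^ p + (\<Sum>k\<in>{0<..<p}. ?f k))"
    using p0 by simp
  also have "(\<Sum>k\<in>{0<..<p}. ?f k) = of_nat p * ?c"
    unfolding sum_distrib_left
  proof (intro sum.cong refl)
    fix k assume "k \<in> {0<..<p}"
    then have "p dvd (p choose k)" using p by (intro dvd_choose_prime) auto
    then have "of_nat (p choose k) = (of_nat p * of_nat ((p choose k) div p) :: complex)"
      by (metis dvd_mult_div_cancel of_nat_mult)
    then show "?f k = of_nat p * (of_nat ((p choose k) div p) * a ^ k * b ^ (p - k))" by simp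
  qed
  finally have "(a + b) ^ p = a ^ p + b ^ p + of_nat p * ?c" by simp
  moreover have "?c \<in> A"
    by (intro csubring_closed(6)[OF A] csubringD(4)[OF A] csubring_closed[OF A] ab)
  ultimately show ?thesis by blast
qed

lemma fermat_int_complex:
  assumes p: "prime p"
  shows "\<exists>c. of_int a ^ p = (of_int a + of_nat p * of_int c :: complex)"
proof -
  have "int p dvd a ^ p - a"
  proof (cases "int p dvd a")
    case True
    then show ?thesis using p by (intro dvd_diff dvd_power) (auto simp: prime_gt_0_nat dest: dvd_power_le intro: dvd_trans)
  next
    case False
    then have "coprime a (int p)" using p prime_imp_coprime[of "int p" a] by (simp add: coprime_commute)
    then have "[a ^ totient p = 1] (mod int p)"
      using p residues.euler_theorem[of "int p" a] prime_gt_1_nat[OF p] by (simp add: residues_def)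
    then have "int p dvd a * (a ^ (p - 1) - 1)"
      using p by (auto simp: totient_prime cong_iff_dvd_diff)
    also have "a * (a ^ (p - 1) - 1) = a ^ p - a"
      using p by (simp add: algebra_simps power_eq_if prime_gt_0_nat)
    finally show ?thesis .
  qed
  then obtain c where "a ^ p - a = int p * c" by blast
  then have "of_int (a ^ p) = (of_int (a + int p * c) :: complex)" by (simp add: algebra_simps)
  then show ?thesis by (intro exI[of _ c]) simp
qed

text \<open>Modulo p the p-th power is additive and fixes the integer coefficients, so it commutes
  with evaluating an integer polynomial.\<close>

lemma frobenius_ipoly:
  assumes A: "csubring A" and p: "prime p" and x: "x \<in> A"
  shows "\<exists>c\<in>A. poly (of_int_poly f) (x ^ p) = poly (of_int_poly f) x ^ p + of_nat p * c"
proof (induction f)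
  case 0
  show ?case using p by (intro bexI[of _ 0]) (auto simp: csubring_closed[OF A] prime_gt_0_nat)
next
  case (pCons a f)
  let ?F = "\<lambda>y. poly (of_int_poly f) y"
  obtain c where c: "c \<in> A" "?F (x ^ p) = ?F x ^ p + of_nat p * c" using pCons.IH by blast
  obtain d where d: "of_int a ^ p = (of_int a + of_nat p * of_int d :: complex)"
    using fermat_int_complex[OF p] by blast
  have pc: "poly (of_int_poly (pCons a f)) y = of_int a + y * ?F y" for y :: complex
    by (simp add: of_int_hom.map_poly_pCons_hom)
  have "?F x \<in> A" by (rule csubring_ipoly[OF A x])
  then obtain e where e: "e \<in> A" "(of_int a + x * ?F x) ^ p = of_int a ^ p + (x * ?F x) ^ p + of_nat p * e"
    using frobenius_add[OF A p, of "of_int a" "x * ?F x"] x by (blast intro: csubring_closed[OF A] csubringD[OF A])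
  show ?case
  proof (intro bexI)
    show "poly (of_int_poly (pCons a f)) (x ^ p) =
      poly (of_int_poly (pCons a f)) x ^ p + of_nat p * (x ^ p * c - of_int d - e)"
      unfolding pc using c(2) d e(2) by (simp add: algebra_simps power_mult_distrib)
    show "x ^ p * c - of_int d - e \<in> A"
      by (intro csubringD[OF A] csubring_closed[OF A] c e x)
  qed
qed

lemma frobenius_ipoly_iterated:
  assumes A: "csubring A" and p: "prime p" and x: "x \<in> A"
  shows "\<exists>c\<in>A. poly (of_int_poly f) (x ^ (p ^ g)) = poly (of_int_poly f) x ^ (p ^ g) + of_nat p * c"
proof (induction g)
  case 0
  show ?case by (intro bexI[of _ 0]) (auto simp: csubring_closed[OF A])
next
  case (Suc g)
  let ?F = "\<lambda>y. poly (of_int_poly f) y"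
  obtain c where c: "c \<in> A" "?F (x ^ p ^ g) = ?F x ^ p ^ g + of_nat p * c" using Suc by blast
  have xg: "x ^ p ^ g \<in> A" "?F x ^ p ^ g \<in> A" using x by (auto intro!: csubring_closed[OF A] csubring_ipoly[OF A])
  obtain d where d: "d \<in> A" "?F ((x ^ p ^ g) ^ p) = ?F (x ^ p ^ g) ^ p + of_nat p * d"
    using frobenius_ipoly[OF A p xg(1)] by blast
  obtain e where e: "e \<in> A" "(?F x ^ p ^ g + of_nat p * c) ^ p = (?F x ^ p ^ g) ^ p + (of_nat p * c) ^ p + of_nat p * e"
    using frobenius_add[OF A p xg(2), of "of_nat p * c"] c by (blast intro: csubring_closed[OF A] csubringD[OF A])
  have pp: "(of_nat p * c) ^ p = of_nat p * (c * (of_nat p * c) ^ (p - 1))"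
    using p by (simp add: power_eq_if prime_gt_0_nat)
  show ?case
  proof (intro bexI)
    have "?F (x ^ p ^ Suc g) = ?F ((x ^ p ^ g) ^ p)" by (simp add: power_mult[symmetric] mult.commute)
    also have "\<dots> = (?F x ^ p ^ g) ^ p + of_nat p * (c * (of_nat p * c) ^ (p - 1) + e + d)"
      unfolding d(2) c(2) e(2) pp by (simp add: algebra_simps)
    also have "(?F x ^ p ^ g) ^ p = ?F x ^ p ^ Suc g" by (simp add: power_mult[symmetric] mult.commute)
    finally show "?F (x ^ p ^ Suc g) = ?F x ^ p ^ Suc g + of_nat p * (c * (of_nat p * c) ^ (p - 1) + e + d)" .
    show "c * (of_nat p * c) ^ (p - 1) + e + d \<in> A"
      by (intro csubringD[OF A] csubring_closed[OF A] c e d)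
  qed
qed

text \<open>The coefficients are polynomials in the roots up to sign; the induction splits off one
  linear factor at a time.\<close>

lemma algebraic_int_coeff_if_roots:
  fixes p :: "complex poly"
  assumes "lead_coeff p = 1" "\<And>x. poly p x = 0 \<Longrightarrow> algebraic_int x"
  shows "algebraic_int (coeff p i)"
  using assms
proof (induction "degree p" arbitrary: p i)
  case 0
  then obtain c where "p = [:c:]" by (auto elim: degree_eq_zeroE)
  then show ?case using 0 by (auto simp: coeff_pCons split: nat.splits)
next
  case (Suc n)
  then obtain a where a: "poly p a = 0"
    using fundamental_theorem_of_algebra[of p] by (auto simp: constant_degree)
  then obtain q where q: "p = [:- a, 1:] * q" by (auto simp: poly_eq_0_iff_dvd elim: dvdE)
  have "q \<noteq> 0" using Suc q by auto
  then have dq: "degree p = Suc (degree q)" unfolding q by (subst degree_mult_eq) auto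
  have lq: "lead_coeff q = 1" using Suc.prems(1) unfolding q lead_coeff_mult by simp
  have IH: "algebraic_int (coeff q j)" for j
    using Suc.hyps dq lq Suc.prems(2) q by auto
  have p': "p = pCons 0 q + [:- a:] * q" unfolding q by simp
  have "coeff p i = (case i of 0 \<Rightarrow> 0 | Suc j \<Rightarrow> coeff q j) + - a * coeff q i"
    unfolding p' by (simp add: coeff_pCons)
  then show ?case using IH Suc.prems(2)[OF a]
    by (auto split: nat.splits intro!: algebraic_int_diff algebraic_int_mult)
qed

lemma algebraic_int_poly:
  assumes "\<And>i. algebraic_int (coeff p i)" "algebraic_int (x :: complex)" shows "algebraic_int (poly p x)"
  using assms(1)
proof (induction p)
  case (pCons a p)
  have "algebraic_int a" "\<And>i. algebraic_int (coeff p i)"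
    using pCons.prems[of 0] pCons.prems[of "Suc _"] by auto
  then show ?case using pCons.IH assms(2) by (auto intro: algebraic_int_add algebraic_int_mult)
qed simp

text \<open>Irreducibility of the cyclotomic polynomials: if \<open>m\<close> is the minimal polynomial of \<open>\<omega>\<close> and
  \<open>m(\<omega>\<^sup>p) \<noteq> 0\<close>, then differentiating \<open>X\<^sup>n - 1 = h m\<close> at \<open>\<omega>\<^sup>p\<close> shows that \<open>m(\<omega>\<^sup>p)\<close> divides \<open>n\<close>,
  whereas \<open>m(\<omega>\<^sup>p)\<close> is congruent to \<open>m(\<omega>)\<^sup>p = 0\<close> modulo \<open>p\<close>.\<close>

lemma Aut_prime_power:
  assumes p: "prime p" and n: "n > 0" and pn: "\<not> p dvd n" and w: "w ^ n = 1"
  shows "\<exists>\<sigma>\<in>Aut. \<sigma> w = w ^ p"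
proof -
  define S :: "(complex \<times> complex) set" where "S = {(x, x) | x. x \<in> \<rat>}"
  have S: "emb_rel S" unfolding S_def
    by (rule emb_rel_Id_on) (auto simp: Qc_def rat_imp_algebraic intro: Rats_add Rats_mult)
  have wi: "algebraic_int w" by (rule algebraic_int_root_of_unity[OF n w])
  then have alg: "algebraic w" by (rule algebraic_int_imp_algebraic)
  obtain m m' where m: "minpolyrel S w m m'" by (rule minpolyrel_exists[OF S alg])
  then have mm: "m' = m" "polyrel S m m" "lead_coeff m = 1" "poly m w = 0"
    unfolding minpolyrel_def polyrel_def S_def by (auto intro: poly_eqI)
  define g :: "complex poly" where "g = monom 1 n - 1"
  have dg: "degree g = n" "lead_coeff g = 1"
  proof -
    have "degree (monom (1::complex) n + (- 1)) = degree (monom (1::complex) n)"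
      using n by (intro degree_add_eq_left) (auto simp: degree_monom_eq)
    then show "degree g = n" by (simp add: g_def degree_monom_eq)
    then show "lead_coeff g = 1" using n by (simp add: g_def)
  qed
  have pg: "poly g x = x ^ n - 1" for x by (simp add: g_def poly_monom)
  have "polyrel S g g" unfolding g_def S_def polyrel_def by (auto simp: coeff_1)
  from minpolyrel_dvd[OF S m this] obtain h where h: "g = h * m" using w pg by auto
  have lh: "lead_coeff h = 1" using dg mm(3) unfolding h lead_coeff_mult by simp
  have roots: "algebraic_int x" if "poly g x = 0" for x
    using that pg by (intro algebraic_int_root_of_unity[OF n]) auto
  have mi: "algebraic_int (coeff m i)" for i
    by (rule algebraic_int_coeff_if_roots[OF mm(3)]) (use roots h in auto)
  have hi: "algebraic_int (coeff h i)" for i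
    by (rule algebraic_int_coeff_if_roots[OF lh]) (use roots h in auto)
  have "coeff m i \<in> \<rat>" for i using mm(2) unfolding polyrel_def S_def by auto
  \<comment> \<open>The coefficients are rational because \<open>S\<close> is the identity on the
    rationals, and integral because all roots of \<open>m\<close> are roots of unity.\<close>
  then have mint: "\<forall>i. \<exists>a. coeff m i = of_int a"
    using mi rational_algebraic_int_is_int by (blast elim: Ints_cases)
  then obtain m0 where m0: "m = of_int_poly m0"
  proof -
    from mint obtain a where a: "\<And>i. coeff m i = of_int (a i)" by metis
    have "m = of_int_poly (Abs_poly a)"
    proof (rule poly_eqI)
      have "eventually (\<lambda>i. coeff m i = 0) cofinite" by (rule MOST_coeff_eq_0)
      then have "coeff (Abs_poly a) = a" by (intro Abs_poly_inverse) (simp add: a)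
      then show "coeff m i = coeff (of_int_poly (Abs_poly a)) i" for i by (simp add: coeff_map_poly a)
    qed
    then show ?thesis by (rule that)
  qed
  define b where "b = w ^ p"
  have bi: "algebraic_int b" unfolding b_def using wi by (rule algebraic_int_power)
  have bn: "b ^ n = 1" unfolding b_def using w by (metis power_commutes power_mult power_one mult.commute)
  have "poly m b = 0"
  proof (rule ccontr)
    assume "poly m b \<noteq> 0"
    moreover have "poly h b * poly m b = 0" using pg[of b] bn unfolding h by simp
    ultimately have hb: "poly h b = 0" by simp
    have "pderiv g = monom (of_nat n) (n - 1)" unfolding g_def by (simp add: pderiv_diff pderiv_monom)
    then have "of_nat n * b ^ (n - 1) = poly (pderiv (h * m)) b" unfolding h[symmetric] by (simp add: poly_monom)
    also have "\<dots> = poly (pderiv h) b * poly m b" using hb by (simp add: pderiv_mult mult.commute)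
    finally have "of_nat n * (b ^ (n - 1) * b) = b * (poly (pderiv h) b * poly m b)" by (simp add: mult_ac)
    also have "b ^ (n - 1) * b = 1" using bn n by (metis power_minus_mult)
    finally have e: "of_nat n = b * poly (pderiv h) b * poly m b" by simp
    obtain c where c: "algebraic_int c" "poly m b = of_nat p * c"
      using frobenius_ipoly[OF csubring_algebraic_int p, of w m0] wi mm(4) p unfolding m0[symmetric] b_def
      by (auto simp: prime_gt_0_nat zero_power)
    define d where "d = b * poly (pderiv h) b * c"
    have "algebraic_int d" unfolding d_def
      by (intro algebraic_int_mult algebraic_int_poly bi c(1)) (auto simp: coeff_pderiv intro!: algebraic_int_mult hi simp del: of_nat_Suc)
    \<comment> \<open>The quotient n / p is a rational algebraic integer, hence an integer, against
      the assumption that p does not divide n.\<close>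
    moreover have nd: "of_nat n = of_nat p * d" unfolding e c(2) d_def by simp
    then have "d = of_nat n / of_nat p" using p by (auto simp: field_simps)
    then have "d \<in> \<rat>" by simp
    ultimately obtain k where k: "d = of_int k" using rational_algebraic_int_is_int by (blast elim: Ints_cases)
    have "(of_int (int n) :: complex) = of_int (int p * k)" using nd k by simp
    then have "int n = int p * k" by (simp only: of_int_eq_iff)
    then have "int p dvd int n" by simp
    then show False using pn by simp
  qed
  then have y: "poly m' b = 0" using mm by simp
  show ?thesis
    using emb_rel_extend[OF emb_rel_adjoin[OF S alg m y]] adjoin_incl(2)[OF S, of w b] unfolding b_def by blast
qed


section \<open>Cyclotomic fields\<close>

lemma Qc_0 [simp]: "0 \<in> Qc" and Qc_1 [simp]: "1 \<in> Qc"
  by (simp_all add: Qc_def)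

lemma Qc_closed:
  shows Qc_add: "x \<in> Qc \<Longrightarrow> y \<in> Qc \<Longrightarrow> x + y \<in> Qc"
    and Qc_mult: "x \<in> Qc \<Longrightarrow> y \<in> Qc \<Longrightarrow> x * y \<in> Qc"
    and Qc_uminus: "x \<in> Qc \<Longrightarrow> - x \<in> Qc"
    and Qc_inverse: "x \<in> Qc \<Longrightarrow> inverse x \<in> Qc"
    and Qc_Rats: "x \<in> \<rat> \<Longrightarrow> x \<in> Qc"
  by (auto simp: Qc_def algebraic_add algebraic_mult algebraic_inverse rat_imp_algebraic)

lemma Qc_power: "x \<in> Qc \<Longrightarrow> x ^ k \<in> Qc"
  by (induction k) (auto intro: Qc_mult)

lemma Qc_sum: "(\<And>i. i \<in> I \<Longrightarrow> f i \<in> Qc) \<Longrightarrow> (\<Sum>i\<in>I. f i) \<in> Qc"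
  by (induction I rule: infinite_finite_induct) (auto intro: Qc_add)

lemma Qc_prod: "(\<And>i. i \<in> I \<Longrightarrow> f i \<in> Qc) \<Longrightarrow> (\<Prod>i\<in>I. f i) \<in> Qc"
  by (induction I rule: infinite_finite_induct) (auto intro: Qc_mult)

lemma Qc_powi: "x \<in> Qc \<Longrightarrow> x powi k \<in> Qc"
  by (auto simp: power_int_def intro: Qc_power Qc_inverse)

lemma Qc_mu: "n > 0 \<Longrightarrow> w \<in> mu n \<Longrightarrow> w \<in> Qc"
  by (auto simp: Qc_def mu_def intro: algebraic_int_imp_algebraic algebraic_int_root_of_unity)

lemma Qc_mu_inf: "w \<in> mu_inf_star \<Longrightarrow> w \<in> Qc"
  by (auto simp: mu_inf_star_def intro: Qc_mu)

lemma Aut_simps: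
  assumes "\<sigma> \<in> Aut"
  shows Aut_add: "x \<in> Qc \<Longrightarrow> y \<in> Qc \<Longrightarrow> \<sigma> (x + y) = \<sigma> x + \<sigma> y"
    and Aut_mult: "x \<in> Qc \<Longrightarrow> y \<in> Qc \<Longrightarrow> \<sigma> (x * y) = \<sigma> x * \<sigma> y"
    and Aut_rat: "q \<in> \<rat> \<Longrightarrow> \<sigma> q = q"
    and Aut_1: "\<sigma> 1 = 1"
    and Aut_0: "\<sigma> 0 = 0"
    and Aut_closed: "x \<in> Qc \<Longrightarrow> \<sigma> x \<in> Qc"
    and Aut_inj: "x \<in> Qc \<Longrightarrow> y \<in> Qc \<Longrightarrow> \<sigma> x = \<sigma> y \<longleftrightarrow> x = y"
    and Aut_ext: "\<sigma> \<in> extensional Qc"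
    and Aut_bij: "bij_betw \<sigma> Qc Qc"
  using assms unfolding Gal_iff by (auto simp: bij_betw_def inj_on_def)

lemma Aut_eq_0: "\<sigma> \<in> Aut \<Longrightarrow> x \<in> Qc \<Longrightarrow> \<sigma> x = 0 \<longleftrightarrow> x = 0"
  using Aut_inj[of \<sigma> x 0] by (simp add: Aut_0)

lemma Aut_power: "\<sigma> \<in> Aut \<Longrightarrow> x \<in> Qc \<Longrightarrow> \<sigma> (x ^ k) = \<sigma> x ^ k"
  by (induction k) (auto simp: Aut_1 Aut_mult Qc_power)

lemma Aut_uminus: "\<sigma> \<in> Aut \<Longrightarrow> x \<in> Qc \<Longrightarrow> \<sigma> (- x) = - \<sigma> x"
  using Aut_mult[of \<sigma> "- 1" x] by (simp add: Aut_rat Qc_Rats)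

lemma Aut_diff: "\<sigma> \<in> Aut \<Longrightarrow> x \<in> Qc \<Longrightarrow> y \<in> Qc \<Longrightarrow> \<sigma> (x - y) = \<sigma> x - \<sigma> y"
  using Aut_add[of \<sigma> x "- y"] by (simp add: Aut_uminus Qc_uminus)

lemma Aut_inverse:
  assumes "\<sigma> \<in> Aut" "x \<in> Qc" shows "\<sigma> (inverse x) = inverse (\<sigma> x)"
proof (cases "x = 0")
  case False
  then have "\<sigma> x * \<sigma> (inverse x) = 1"
    using Aut_mult[OF assms Qc_inverse[OF assms(2)]] assms by (simp add: Aut_1)
  then show ?thesis by (metis inverse_unique)
qed (simp add: Aut_0[OF assms(1)])

lemma Aut_powi: "\<sigma> \<in> Aut \<Longrightarrow> x \<in> Qc \<Longrightarrow> \<sigma> (x powi k) = \<sigma> x powi k"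
  by (auto simp: power_int_def Aut_power Aut_inverse Qc_inverse)

lemma Aut_sum:
  "\<sigma> \<in> Aut \<Longrightarrow> (\<And>i. i \<in> I \<Longrightarrow> f i \<in> Qc) \<Longrightarrow> \<sigma> (\<Sum>i\<in>I. f i) = (\<Sum>i\<in>I. \<sigma> (f i))"
  by (induction I rule: infinite_finite_induct) (auto simp: Aut_0 Aut_add Qc_sum)

lemma Aut_prod:
  "\<sigma> \<in> Aut \<Longrightarrow> (\<And>i. i \<in> I \<Longrightarrow> f i \<in> Qc) \<Longrightarrow> \<sigma> (\<Prod>i\<in>I. f i) = (\<Prod>i\<in>I. \<sigma> (f i))"
  by (induction I rule: infinite_finite_induct) (auto simp: Aut_1 Aut_mult Qc_prod)

lemma Aut_poly:
  assumes "\<sigma> \<in> Aut" "\<And>i. coeff p i \<in> \<rat>" "x \<in> Qc"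
  shows "\<sigma> (poly p x) = poly p (\<sigma> x)"
proof -
  have "\<sigma> (poly p x) = (\<Sum>i\<le>degree p. \<sigma> (coeff p i * x ^ i))"
    unfolding poly_altdef using assms by (intro Aut_sum) (auto intro: Qc_mult Qc_Rats Qc_power)
  also have "\<dots> = poly p (\<sigma> x)"
    unfolding poly_altdef
    using assms by (intro sum.cong refl) (auto simp: Aut_mult Aut_power Aut_rat Qc_Rats Qc_power)
  finally show ?thesis .
qed

lemma Aut_compose:
  assumes "\<sigma> \<in> Aut" "\<tau> \<in> Aut" shows "compose Qc \<sigma> \<tau> \<in> Aut"
  unfolding Gal_iff
  using assms bij_betw_trans[OF Aut_bij[OF assms(2)] Aut_bij[OF assms(1)]]
  by (auto simp: compose_def comp_def Qc_closed Aut_closed Aut_add Aut_mult Aut_rat Aut_1)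

lemma Aut_id: "(\<lambda>x\<in>Qc. x) \<in> Aut"
  unfolding Gal_iff by (auto simp: Qc_closed bij_betw_def inj_on_def)

lemma Aut_cnj: "(\<lambda>x\<in>Qc. cnj x) \<in> Aut"
proof -
  have alg: "algebraic (cnj x)" if ax: "algebraic x" for x
  proof -
    obtain a where a: "a \<noteq> 0" "algebraic_int (of_int a * x)"
      by (rule algebraic_imp_scaled_algebraic_int[OF ax])
    then have "algebraic_int (cnj (of_int a * x))" by (subst algebraic_int_cnj_iff)
    then show ?thesis using a(1) by (intro algebraic_if_scaled_algebraic_int[of a]) auto
  qed
  have "x \<in> cnj ` Qc" if "x \<in> Qc" for x
    using that alg[of x] by (intro image_eqI[of _ _ "cnj x"]) (auto simp: Qc_def)
  then have "bij_betw cnj Qc Qc"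
    unfolding bij_betw_def using alg by (auto simp: inj_on_def Qc_def)
  moreover have "cnj x = x" if "x \<in> \<rat>" for x :: complex
    using that by (auto elim!: Rats_cases')
  ultimately show ?thesis
    unfolding Gal_iff by (auto simp: Qc_closed cong: bij_betw_cong)
qed

lemma mu_closed:
  shows "1 \<in> mu n" "x \<in> mu n \<Longrightarrow> y \<in> mu n \<Longrightarrow> x * y \<in> mu n"
    "x \<in> mu n \<Longrightarrow> x ^ k \<in> mu n" "x \<in> mu n \<Longrightarrow> inverse x \<in> mu n"
    "m dvd n \<Longrightarrow> x \<in> mu m \<Longrightarrow> x \<in> mu n"
  by (auto simp: mu_def power_mult_distrib power_inverse power_mult dest: arg_cong[of _ _ "\<lambda>x. x ^ _"])
     (metis mult.commute power_mult power_one)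

lemma mu_nonzero: "n > 0 \<Longrightarrow> x \<in> mu n \<Longrightarrow> x \<noteq> 0"
  by (auto simp: mu_def zero_power)

lemma finite_mu: "n > 0 \<Longrightarrow> finite (mu n)" and card_mu: "n > 0 \<Longrightarrow> card (mu n) = n"
  unfolding mu_def by (auto simp: finite_roots_unity card_roots_unity_eq)

lemma Aut_in_mu: "\<sigma> \<in> Aut \<Longrightarrow> n > 0 \<Longrightarrow> w \<in> mu n \<Longrightarrow> \<sigma> w \<in> mu n"
  using Aut_power[of \<sigma> w n] Qc_mu[of n w] by (auto simp: mu_def Aut_1)

lemma mu_mem_iff_root_order:
  assumes "w \<in> mu n" "n > 0"
  shows "root_order w > 0" "w ^ k = 1 \<longleftrightarrow> root_order w dvd k"
proof -
  let ?r = "root_order w"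
  have *: "?r > 0 \<and> w ^ ?r = 1"
    unfolding root_order_def by (rule LeastI[of _ n]) (use assms in \<open>simp add: mu_def\<close>)
  then show "?r > 0" by blast
  show "w ^ k = 1 \<longleftrightarrow> ?r dvd k"
  proof
    assume k: "w ^ k = 1"
    have "w ^ k = w ^ (?r * (k div ?r) + k mod ?r)" by simp
    also have "\<dots> = w ^ (k mod ?r)" using * by (simp only: power_add power_mult power_one mult_1)
    finally have "w ^ (k mod ?r) = 1" using k by simp
    then have "k mod ?r = 0"
      using * not_less_Least[of "k mod ?r" "\<lambda>n. n > 0 \<and> w ^ n = 1"] unfolding root_order_def[symmetric]
      by (metis mod_less_divisor neq0_conv)
    then show "?r dvd k" by auto
  qed (use * in \<open>auto simp: power_mult\<close>)
qed

lemma mu_inf_star_iff: "w \<in> mu_inf_star \<longleftrightarrow> w \<noteq> 1 \<and> (\<exists>n>0. w \<in> mu n)"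
  by (auto simp: mu_inf_star_def)

lemma mu_inf_starI: "w \<in> mu n \<Longrightarrow> n > 0 \<Longrightarrow> w \<noteq> 1 \<Longrightarrow> w \<in> mu_inf_star"
  by (auto simp: mu_inf_star_def)

lemma mu_inf_star_order:
  assumes "w \<in> mu_inf_star"
  shows "root_order w > 1" "w \<in> mu (root_order w)" "w ^ k = 1 \<longleftrightarrow> root_order w dvd k"
proof -
  obtain n where n: "w \<in> mu n" "n > 0" "w \<noteq> 1" using assms by (auto simp: mu_inf_star_iff)
  note o = mu_mem_iff_root_order[OF n(1,2)]
  show "w \<in> mu (root_order w)" using o(2)[of "root_order w"] by (simp add: mu_def)
  then show "root_order w > 1" using o(1) n(3) by (cases "root_order w = 1") (auto simp: mu_def)
  show "w ^ k = 1 \<longleftrightarrow> root_order w dvd k" by (rule o(2))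
qed

lemma root_order_dvd: "w \<in> mu n \<Longrightarrow> n > 0 \<Longrightarrow> root_order w dvd n"
  using mu_mem_iff_root_order(2)[of w n n] by (simp add: mu_def)

lemma Aut_mu_inf: "\<sigma> \<in> Aut \<Longrightarrow> w \<in> mu_inf_star \<Longrightarrow> \<sigma> w \<in> mu_inf_star"
  using Aut_inj[of \<sigma> w 1] by (auto simp: mu_inf_star_iff Aut_in_mu Aut_1 Qc_mu)

lemma Aut_root_order:
  assumes "\<sigma> \<in> Aut" "w \<in> mu_inf_star" shows "root_order (\<sigma> w) = root_order w"
proof -
  have w: "w \<in> Qc" using assms Qc_mu_inf by blast
  have "\<sigma> w ^ n = 1 \<longleftrightarrow> w ^ n = 1" for n
    using Aut_inj[OF assms(1), of "w ^ n" 1] w by (simp add: Aut_power[OF assms(1)] Aut_1[OF assms(1)] Qc_power)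
  then show ?thesis unfolding root_order_def by simp
qed

lemma complex_ring_field: "field complex_ring"
proof (rule cring.cring_fieldI)
  have "\<exists>y. y + x = 0" for x :: complex by (rule exI[of _ "- x"]) simp
  then show "cring complex_ring"
    unfolding complex_ring_def
    by (intro cringI abelian_groupI comm_monoidI) (auto simp: algebra_simps)
  have "\<exists>y. y * x = 1 \<and> x * y = 1" if "x \<noteq> 0" for x :: complex
    using that by (intro exI[of _ "inverse x"]) simp
  then show "Units complex_ring = carrier complex_ring - {\<zero>\<^bsub>complex_ring\<^esub>}"
    by (auto simp: complex_ring_def Units_def)
qed

lemma complex_ring_simps [simp]:
  "carrier complex_ring = UNIV" "\<zero>\<^bsub>complex_ring\<^esub> = 0" "\<one>\<^bsub>complex_ring\<^esub> = 1"
  "x \<oplus>\<^bsub>complex_ring\<^esub> y = x + y" "x \<otimes>\<^bsub>complex_ring\<^esub> y = x * y"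
  by (simp_all add: complex_ring_def)

lemma complex_ring_inv [simp]:
  "\<ominus>\<^bsub>complex_ring\<^esub> x = - x" "x \<noteq> 0 \<Longrightarrow> inv\<^bsub>complex_ring\<^esub> x = inverse x"
proof -
  interpret field complex_ring by (rule complex_ring_field)
  show "\<ominus>\<^bsub>complex_ring\<^esub> x = - x" by (rule minus_equality) auto
  show "inv\<^bsub>complex_ring\<^esub> x = inverse x" if "x \<noteq> 0"
    using that by (intro comm_inv_char) auto
qed

lemma cyc_field_closed:
  shows cyc_field_1: "1 \<in> cyc_field n"
    and cyc_field_Rats: "q \<in> \<rat> \<Longrightarrow> q \<in> cyc_field n"
    and cyc_field_mu: "w \<in> mu n \<Longrightarrow> w \<in> cyc_field n"
    and cyc_field_add: "x \<in> cyc_field n \<Longrightarrow> y \<in> cyc_field n \<Longrightarrow> x + y \<in> cyc_field n"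
    and cyc_field_mult: "x \<in> cyc_field n \<Longrightarrow> y \<in> cyc_field n \<Longrightarrow> x * y \<in> cyc_field n"
    and cyc_field_uminus: "x \<in> cyc_field n \<Longrightarrow> - x \<in> cyc_field n"
    and cyc_field_inverse: "x \<in> cyc_field n \<Longrightarrow> inverse x \<in> cyc_field n"
proof -
  note g = generate_field.intros[where R = complex_ring and H = "\<rat> \<union> mu n", folded cyc_field_def]
  show "1 \<in> cyc_field n" using g(1) by simp
  show q: "q \<in> \<rat> \<Longrightarrow> q \<in> cyc_field n" for q using g(2) by simp
  show "w \<in> mu n \<Longrightarrow> w \<in> cyc_field n" using g(2) by simp
  show "x \<in> cyc_field n \<Longrightarrow> y \<in> cyc_field n \<Longrightarrow> x + y \<in> cyc_field n" using g(5) by simp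
  show "x \<in> cyc_field n \<Longrightarrow> y \<in> cyc_field n \<Longrightarrow> x * y \<in> cyc_field n" using g(6) by simp
  show "x \<in> cyc_field n \<Longrightarrow> - x \<in> cyc_field n" using g(3) by simp
  show "inverse x \<in> cyc_field n" if "x \<in> cyc_field n"
    using g(4)[OF that] that by (cases "x = 0") auto
qed

lemma cyc_field_power: "x \<in> cyc_field n \<Longrightarrow> x ^ k \<in> cyc_field n"
  by (induction k) (auto intro: cyc_field_1 cyc_field_mult)

lemma cyc_field_poly:
  assumes "\<And>i. coeff p i \<in> \<rat>" "x \<in> cyc_field n" shows "poly p x \<in> cyc_field n"
  using assms(1)
proof (induction p)
  case (pCons a p)
  have "a \<in> \<rat>" "\<And>i. coeff p i \<in> \<rat>"
    using pCons.prems[of 0] pCons.prems[of "Suc _"] by auto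
  then show ?case using pCons.IH assms(2) by (auto intro: cyc_field_add cyc_field_mult cyc_field_Rats)
qed (auto intro: cyc_field_Rats)

lemma cyc_field_powi: "x \<in> cyc_field n \<Longrightarrow> x powi k \<in> cyc_field n"
  by (auto simp: power_int_def intro: cyc_field_power cyc_field_inverse)

lemma cyc_field_prod: "(\<And>i. i \<in> I \<Longrightarrow> f i \<in> cyc_field n) \<Longrightarrow> (\<Prod>i\<in>I. f i) \<in> cyc_field n"
  by (induction I rule: infinite_finite_induct) (auto intro: cyc_field_1 cyc_field_mult)

text \<open>Q(zeta) equals Q[zeta]: the inverse of an algebraic number is a rational polynomial in
  it, and polynomials compose.\<close>

lemma cyc_field_cases [consumes 1]:
  assumes n: "n > 0" and gen: "mu n = range (\<lambda>k::nat. w ^ k)" and x: "x \<in> cyc_field n"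
  obtains p where "\<And>i. coeff p i \<in> \<rat>" "x = poly p w"
proof -
  let ?P = "\<lambda>x. \<exists>p. (\<forall>i. coeff p i \<in> \<rat>) \<and> x = poly p w"
  have w: "w \<in> mu n" unfolding gen by (metis power_one_right rangeI)
  have "?P x"
    using x unfolding cyc_field_def
  proof (induction rule: generate_field.induct)
    case one
    show ?case by (intro exI[of _ 1]) (auto simp: coeff_1)
  next
    case (incl h)
    then show ?case
    proof
      assume "h \<in> \<rat>"
      then show ?case by (intro exI[of _ "[:h:]"]) (auto simp: coeff_pCons split: nat.splits)
    next
      assume "h \<in> mu n"
      then obtain k where "h = w ^ k" using gen by auto
      then show ?case by (intro exI[of _ "monom 1 k"]) (auto simp: poly_monom)
    qed
  next
    case (a_inv h)
    then obtain p where "\<forall>i. coeff p i \<in> \<rat>" "h = poly p w" by blast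
    then show ?case by (intro exI[of _ "- p"]) auto
  next
    case (eng_add h1 h2)
    then obtain p q where "\<forall>i. coeff p i \<in> \<rat>" "h1 = poly p w" "\<forall>i. coeff q i \<in> \<rat>" "h2 = poly q w" by blast
    then show ?case by (intro exI[of _ "p + q"]) auto
  next
    case (eng_mult h1 h2)
    then obtain p q where "\<forall>i. coeff p i \<in> \<rat>" "h1 = poly p w" "\<forall>i. coeff q i \<in> \<rat>" "h2 = poly q w" by blast
    then show ?case by (intro exI[of _ "p * q"]) (auto simp: coeff_mult intro!: Rats_sum)
  next
    case (m_inv h)
    then obtain p where p: "\<forall>i. coeff p i \<in> \<rat>" "h = poly p w" by blast
    have "algebraic h"
      unfolding p(2) using p(1) Qc_mu[OF n w] by (intro algebraic_poly) (auto intro: rat_imp_algebraic simp: Qc_def)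
    then obtain q where q: "\<And>i. coeff q i \<in> \<rat>" "inverse h = poly q h"
      using inverse_eq_rat_poly m_inv.hyps by (metis complex_ring_simps(2))
    show ?case
    proof (intro exI conjI)
      show "\<forall>i. coeff (pcompose q p) i \<in> \<rat>"
        using p(1) q(1) by (intro allI coeff_pcompose_semiring_closed) auto
      show "inv\<^bsub>complex_ring\<^esub> h = poly (pcompose q p) w"
        using m_inv.hyps q(2) p(2) by (simp add: poly_pcompose)
    qed
  qed
  then show ?thesis using that by blast
qed

lemma cyc_field_Qc: 
  assumes "n > 0" "x \<in> cyc_field n" shows "x \<in> Qc"
  using assms(2) unfolding cyc_field_def
  by (induction rule: generate_field.induct) (auto intro: Qc_closed Qc_mu[OF assms(1)])

lemma cyc_field_mono:
  assumes "m dvd n" "x \<in> cyc_field m" shows "x \<in> cyc_field n"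
  using assms(2) unfolding cyc_field_def[of m]
  by (induction rule: generate_field.induct)
     (auto intro: cyc_field_closed cyc_field_mu[OF mu_closed(5)[OF assms(1)]])

lemma Aut_cyc_field:
  assumes "\<sigma> \<in> Aut" "n > 0" "x \<in> cyc_field n" shows "\<sigma> x \<in> cyc_field n"
  using assms(3) unfolding cyc_field_def
proof (induction rule: generate_field.induct)
  case (m_inv h)
  then show ?case using cyc_field_Qc[OF assms(2), of h] cyc_field_inverse[of "\<sigma> h" n] unfolding cyc_field_def[symmetric]
    by (simp add: Aut_inverse[OF assms(1)])
qed (use assms(1,2) cyc_field_Qc[OF assms(2)] in
     \<open>auto simp: Aut_1 Aut_rat Aut_add Aut_mult Aut_uminus cyc_field_def[symmetric] intro: cyc_field_closed Aut_in_mu\<close>)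

lemma Aut_eq_on_cyc_field:
  assumes "\<sigma> \<in> Aut" "\<tau> \<in> Aut" "n > 0" "x \<in> cyc_field n" and eq: "\<And>w. w \<in> mu n \<Longrightarrow> \<sigma> w = \<tau> w"
  shows "\<sigma> x = \<tau> x"
  using assms(4) unfolding cyc_field_def
proof (induction rule: generate_field.induct)
  case (m_inv h)
  then show ?case using cyc_field_Qc[OF assms(3), of h] unfolding cyc_field_def[symmetric]
    by (simp add: Aut_inverse[OF assms(1)] Aut_inverse[OF assms(2)])
qed (use assms(1-3) cyc_field_Qc[OF assms(3)] eq in
     \<open>auto simp: Aut_1 Aut_rat Aut_add Aut_mult Aut_uminus cyc_field_def[symmetric]\<close>)

text \<open>The form of the Galois correspondence by which values of equivariant functions are
  located in their cyclotomic fields: only the action on \<open>mu n\<close> has to be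
  inspected.\<close>

lemma cyc_field_fixed:
  assumes "n > 0" "x \<in> Qc" "\<And>\<sigma>. \<sigma> \<in> Aut \<Longrightarrow> (\<And>w. w \<in> mu n \<Longrightarrow> \<sigma> w = w) \<Longrightarrow> \<sigma> x = x"
  shows "x \<in> cyc_field n"
proof (rule Aut_fixed)
  fix \<sigma> assume s: "\<sigma> \<in> Aut" "\<And>y. y \<in> cyc_field n \<Longrightarrow> \<sigma> y = y"
  show "\<sigma> x = x" by (rule assms(3)[OF s(1)]) (rule s(2)[OF cyc_field_mu])
qed (use assms(2) cyc_field_Qc[OF assms(1)] in \<open>auto intro: cyc_field_closed\<close>)

section \<open>The Galois action on roots of unity\<close>

locale generators =
  fixes z :: "nat \<Rightarrow> complex"
  assumes compat: "compatible_generators z"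
begin

lemma mu_eq_range: "n > 0 \<Longrightarrow> mu n = range (\<lambda>k::nat. z n ^ k)"
  using compat by (simp add: compatible_generators_def)

lemma z_mult_power: "m > 0 \<Longrightarrow> n > 0 \<Longrightarrow> z (m * n) ^ m = z n"
  using compat by (simp add: compatible_generators_def)

lemma z_mu: "n > 0 \<Longrightarrow> z n \<in> mu n"
  unfolding mu_eq_range by (metis power_one_right rangeI)

lemma mu_cases:
  assumes "n > 0" "w \<in> mu n" obtains k :: nat where "w = z n ^ k"
  using assms mu_eq_range by auto

text \<open>\<open>mu n\<close> has n elements, all of them powers of \<open>z n\<close>, so the
  order of \<open>z n\<close> cannot be smaller than n.\<close>

lemma root_order_z: assumes n: "n > 0" shows "root_order (z n) = n"
proof -
  let ?r = "root_order (z n)"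
  note o = mu_mem_iff_root_order[OF z_mu[OF n] n]
  have "mu n \<subseteq> (\<lambda>k. z n ^ k) ` {..<?r}"
  proof
    fix w assume "w \<in> mu n"
    then obtain k where k: "w = z n ^ k" by (rule mu_cases[OF n])
    have "w = z n ^ (?r * (k div ?r) + k mod ?r)" unfolding k by simp
    also have "\<dots> = z n ^ (k mod ?r)" using o(2)[of ?r] by (simp only: power_add power_mult dvd_refl) simp
    finally show "w \<in> (\<lambda>k. z n ^ k) ` {..<?r}" using o(1) by (intro image_eqI[of _ _ "k mod ?r"]) auto
  qed
  then have "card (mu n) \<le> ?r"
    by (metis card_lessThan finite_imageI finite_lessThan card_image_le card_mono le_trans)
  moreover have "?r dvd n" using o(2)[of n] z_mu[OF n] by (simp add: mu_def)
  ultimately show ?thesis using n by (simp add: card_mu[OF n] dvd_imp_le le_antisym)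
qed

lemma z_power_eq_1: "n > 0 \<Longrightarrow> z n ^ k = 1 \<longleftrightarrow> n dvd k"
  using mu_mem_iff_root_order(2)[OF z_mu, of n k] by (simp add: root_order_z)

lemma z_power_eq_iff:
  assumes n: "n > 0" shows "z n ^ i = z n ^ j \<longleftrightarrow> [i = j] (mod n)"
proof -
  have nz: "z n \<noteq> 0" using mu_nonzero[OF n z_mu[OF n]] .
  have *: "z n ^ i = z n ^ j \<longleftrightarrow> [i = j] (mod n)" if "i \<le> j" for i j
  proof -
    have "z n ^ j = z n ^ i * z n ^ (j - i)" using that by (simp add: power_add[symmetric])
    then have "z n ^ i = z n ^ j \<longleftrightarrow> z n ^ (j - i) = 1" using nz by auto
    also have "\<dots> \<longleftrightarrow> [i = j] (mod n)"
      unfolding z_power_eq_1[OF n] using that by (simp add: cong_sym_eq[of i] cong_altdef_nat)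
    finally show ?thesis .
  qed
  show ?thesis using *[of i j] *[of j i] by (cases "i \<le> j") (auto simp: cong_sym_eq)
qed

lemma z_mu_inf: "n > 1 \<Longrightarrow> z n \<in> mu_inf_star"
  using z_mu[of n] z_power_eq_1[of n 1] by (intro mu_inf_starI[of _ n]) auto

lemma mu_power_cong:
  assumes "n > 0" "w \<in> mu n" "[i = j] (mod n)" shows "w ^ i = w ^ j"
proof -
  obtain k where k: "w = z n ^ k" by (rule mu_cases[OF assms(1,2)])
  show ?thesis unfolding k power_mult[symmetric] z_power_eq_iff[OF assms(1)]
    using assms(3) by (rule cong_scalar_left)
qed

lemma coprime_if_order:
  assumes n: "n > 0" and k: "root_order (z n ^ k) = n" shows "coprime k n"
proof -
  have w: "z n ^ k \<in> mu n" using z_mu[OF n] by (rule mu_closed(3))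
  define g where "g = gcd k n"
  have g: "g dvd k" "g dvd n" "g > 0" using n by (auto simp: g_def)
  have "(z n ^ k) ^ (n div g) = 1"
    unfolding power_mult[symmetric] z_power_eq_1[OF n] using g
    by (metis div_mult_swap dvd_div_mult dvd_triv_right mult.commute)
  then have "n dvd n div g" using mu_mem_iff_root_order(2)[OF w n] k by simp
  then have "n \<le> n div g" using g n by (intro dvd_imp_le) (auto simp: div_greater_zero_iff dvd_imp_le)
  then have "g = 1" using g n by (metis One_nat_def Suc_lessI div_less_dividend leD)
  then show ?thesis by (simp add: g_def coprime_iff_gcd_eq_1)
qed

text \<open>Surjectivity of the cyclotomic character modulo n: prime factors are peeled off
  \<open>u\<close>, each of them prime to n and realised by \<open>Aut_prime_power\<close>.\<close>

lemma Aut_unit: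
  assumes n: "n > 0" and u: "coprime u n"
  shows "\<exists>\<sigma>\<in>Aut. \<forall>w\<in>mu n. \<sigma> w = w ^ u"
  using u
proof (induction u rule: less_induct)
  case (less u)
  have zQ: "w \<in> Qc" if "w \<in> mu n" for w using Qc_mu[OF n that] .
  consider "u = 0" | "u = 1" | "u > 1" by linarith
  then show ?case
  proof cases
    case 1
    then have "n = 1" using less.prems by simp
    then show ?thesis using 1 Aut_id by (intro bexI[of _ "\<lambda>x\<in>Qc. x"]) (auto simp: mu_def)
  next
    case 2
    then show ?thesis using Aut_id zQ by (intro bexI[of _ "\<lambda>x\<in>Qc. x"]) auto
  next
    case 3
    then obtain p where p: "prime p" "p dvd u" using prime_factor_nat[of u] by auto
    then obtain v where v: "u = p * v" by auto
    have pn: "\<not> p dvd n"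
      using p less.prems by (metis coprime_common_divisor_nat not_prime_1 One_nat_def)
    have "v > 0" using v 3 by (cases v) auto
    then have "v < u" unfolding v using prime_gt_1_nat[OF p(1)] by simp
    moreover have "coprime v n" using less.prems v by simp
    ultimately obtain \<tau> where \<tau>: "\<tau> \<in> Aut" "\<And>w. w \<in> mu n \<Longrightarrow> \<tau> w = w ^ v" using less.IH by blast
    obtain \<sigma> where \<sigma>: "\<sigma> \<in> Aut" "\<sigma> (z n) = z n ^ p"
      using Aut_prime_power[OF p(1) n pn, of "z n"] z_mu[OF n] by (auto simp: mu_def)
    have \<sigma>': "\<sigma> w = w ^ p" if "w \<in> mu n" for w
    proof -
      obtain k where k: "w = z n ^ k" by (rule mu_cases[OF n \<open>w \<in> mu n\<close>])
      show ?thesis unfolding k using \<sigma> zQ[OF z_mu[OF n]]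
        by (simp add: Aut_power power_mult[symmetric] mult.commute)
    qed
    show ?thesis
    proof (intro bexI ballI)
      show "compose Qc \<sigma> \<tau> \<in> Aut" by (rule Aut_compose[OF \<sigma>(1) \<tau>(1)])
      fix w assume w: "w \<in> mu n"
      have "compose Qc \<sigma> \<tau> w = \<sigma> (w ^ v)" using zQ[OF w] \<tau>(2)[OF w] by (simp add: compose_def)
      also have "\<dots> = (w ^ v) ^ p" using mu_closed(3)[OF w] by (rule \<sigma>')
      finally show "compose Qc \<sigma> \<tau> w = w ^ u" unfolding v by (simp add: power_mult[symmetric] mult.commute)
    qed
  qed
qed

lemma Aut_exponent:
  assumes s: "\<sigma> \<in> Aut" and n: "n > 0"
  obtains u where "coprime u n" "\<And>w. w \<in> mu n \<Longrightarrow> \<sigma> w = w ^ u"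
proof -
  obtain u where u: "\<sigma> (z n) = z n ^ u" by (rule mu_cases[OF n Aut_in_mu[OF s n z_mu[OF n]]])
  have Q: "z n \<in> Qc" using Qc_mu[OF n z_mu[OF n]] .
  have "coprime u n"
  proof (cases "n = 1")
    case False
    then have "root_order (\<sigma> (z n)) = n"
      using n Aut_root_order[OF s z_mu_inf[of n]] root_order_z by simp
    then show ?thesis using coprime_if_order[OF n] u by simp
  qed simp
  moreover have "\<sigma> w = w ^ u" if w: "w \<in> mu n" for w
  proof -
    obtain k where k: "w = z n ^ k" by (rule mu_cases[OF n w])
    show ?thesis unfolding k using s Q u by (simp add: Aut_power power_mult[symmetric] mult.commute)
  qed
  ultimately show ?thesis by (rule that)
qed

text \<open>Inverting the exponent modulo n produces an inverse on Q(n) only, which is what the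
  group structure of \<open>G n\<close> asks for.\<close>

lemma Aut_inverse_on:
  assumes s: "\<sigma> \<in> Aut" and n: "n > 0"
  obtains \<tau> where "\<tau> \<in> Aut" "\<And>x. x \<in> cyc_field n \<Longrightarrow> \<sigma> (\<tau> x) = x" "\<And>x. x \<in> cyc_field n \<Longrightarrow> \<tau> (\<sigma> x) = x"
proof -
  obtain u where u: "coprime u n" "\<And>w. w \<in> mu n \<Longrightarrow> \<sigma> w = w ^ u" by (rule Aut_exponent[OF s n]) auto
  obtain v where v: "[u * v = 1] (mod n)" using u(1) cong_solve_coprime_nat by auto
  have "coprime v n" using v by (metis cong_imp_coprime cong_sym coprime_1_left coprime_mult_left_iff)
  then obtain \<tau> where t: "\<tau> \<in> Aut" "\<And>w. w \<in> mu n \<Longrightarrow> \<tau> w = w ^ v" using Aut_unit[OF n] by blast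
  have w: "w ^ (u * v) = w" if "w \<in> mu n" for w using mu_power_cong[OF n that v] by simp
  show ?thesis
  proof (rule that[OF t(1)])
    fix x assume x: "x \<in> cyc_field n"
    have xQ: "x \<in> Qc" by (rule cyc_field_Qc[OF n x])
    have "compose Qc \<sigma> \<tau> x = (\<lambda>x\<in>Qc. x) x"
      by (rule Aut_eq_on_cyc_field[OF Aut_compose[OF s t(1)] Aut_id n x])
         (use u t w Qc_mu[OF n] in \<open>auto simp: compose_def mu_closed power_mult[symmetric] mult.commute\<close>)
    then show "\<sigma> (\<tau> x) = x" using xQ by (simp add: compose_def)
    have "compose Qc \<tau> \<sigma> x = (\<lambda>x\<in>Qc. x) x"
      by (rule Aut_eq_on_cyc_field[OF Aut_compose[OF t(1) s] Aut_id n x])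
         (use u t w Qc_mu[OF n] in \<open>auto simp: compose_def mu_closed power_mult[symmetric]\<close>)
    then show "\<tau> (\<sigma> x) = x" using xQ by (simp add: compose_def)
  qed
qed

text \<open>Both roots are powers of one generator with exponents prime to the order; the required
  exponent is the inverse of the first times the second.\<close>

lemma Aut_transitive:
  assumes "w \<in> mu_inf_star" "w' \<in> mu_inf_star" "root_order w = root_order w'"
  shows "\<exists>\<sigma>\<in>Aut. \<sigma> w = w'"
proof -
  let ?n = "root_order w"
  have n: "?n > 0" using mu_inf_star_order(1)[OF assms(1)] by simp
  obtain j where j: "w = z ?n ^ j" by (rule mu_cases[OF n mu_inf_star_order(2)[OF assms(1)]])
  obtain k where k: "w' = z ?n ^ k" using mu_cases[OF n] mu_inf_star_order(2)[OF assms(2)] assms(3) by metis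
  have cop: "coprime j ?n" "coprime k ?n" using coprime_if_order[OF n] j k assms(3) by metis+
  obtain i where i: "[j * i = 1] (mod ?n)" using cop(1) cong_solve_coprime_nat by auto
  have "coprime i ?n" using i by (metis cong_imp_coprime cong_sym coprime_1_left coprime_mult_left_iff)
  then have "coprime (i * k) ?n" using cop by simp
  then obtain \<sigma> where s: "\<sigma> \<in> Aut" "\<And>w. w \<in> mu ?n \<Longrightarrow> \<sigma> w = w ^ (i * k)" using Aut_unit[OF n] by blast
  have "\<sigma> w = (z ?n ^ (j * i)) ^ k"
    using s(2)[OF mu_inf_star_order(2)[OF assms(1)]] j by (metis power_mult)
  also have "z ?n ^ (j * i) = z ?n ^ 1" unfolding z_power_eq_iff[OF n] by (rule i)
  finally show ?thesis using s(1) k by auto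
qed

text \<open>The intrinsic automorphisms of Q(n) are the restrictions from Q^c. For the harder
  inclusion, an automorphism sends \<open>z n\<close> to a power of itself with exponent prime to n;
  an automorphism of Q^c with that exponent agrees with it on all rational polynomials in
  \<open>z n\<close>.\<close>

lemma G_carrier:
  assumes n: "n > 0"
  shows "carrier (G n) = (\<lambda>\<sigma>. restrict \<sigma> (cyc_field n)) ` Aut"
proof (intro equalityI subsetI)
  fix \<rho> assume "\<rho> \<in> (\<lambda>\<sigma>. restrict \<sigma> (cyc_field n)) ` Aut"
  then obtain \<sigma> where s: "\<sigma> \<in> Aut" "\<rho> = restrict \<sigma> (cyc_field n)" by auto
  obtain \<tau> where t: "\<tau> \<in> Aut" "\<And>x. x \<in> cyc_field n \<Longrightarrow> \<sigma> (\<tau> x) = x" "\<And>x. x \<in> cyc_field n \<Longrightarrow> \<tau> (\<sigma> x) = x"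
    by (rule Aut_inverse_on[OF s(1) n]) auto
  have "bij_betw \<sigma> (cyc_field n) (cyc_field n)"
    by (rule bij_betw_byWitness[of _ \<tau>]) (use t s Aut_cyc_field[OF _ n] in auto)
  then show "\<rho> \<in> carrier (G n)"
    unfolding Gal_iff s(2) using s(1) cyc_field_Qc[OF n]
    by (auto simp: cyc_field_closed Aut_simps cong: bij_betw_cong)
next
  fix \<rho> assume "\<rho> \<in> carrier (G n)"
  then have r: "\<rho> \<in> extensional (cyc_field n)" "bij_betw \<rho> (cyc_field n) (cyc_field n)" "\<rho> 1 = 1"
    "\<And>x y. x \<in> cyc_field n \<Longrightarrow> y \<in> cyc_field n \<Longrightarrow> \<rho> (x + y) = \<rho> x + \<rho> y"
    "\<And>x y. x \<in> cyc_field n \<Longrightarrow> y \<in> cyc_field n \<Longrightarrow> \<rho> (x * y) = \<rho> x * \<rho> y"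
    "\<And>x. x \<in> \<rat> \<Longrightarrow> \<rho> x = x"
    unfolding Gal_iff by auto
  have inj: "\<rho> x = \<rho> y \<longleftrightarrow> x = y" if "x \<in> cyc_field n" "y \<in> cyc_field n" for x y
    using r(2) that by (auto simp: bij_betw_def inj_on_def)
  have zc: "z n \<in> cyc_field n" using cyc_field_mu[OF z_mu[OF n]] .
  have pow: "\<rho> (x ^ k) = \<rho> x ^ k" if "x \<in> cyc_field n" for x k
    by (induction k) (use r that in \<open>auto simp: cyc_field_power\<close>)
  have ord: "\<rho> (z n) ^ k = 1 \<longleftrightarrow> n dvd k" for k
    using inj[OF cyc_field_power[OF zc] cyc_field_1, of k] unfolding pow[OF zc] r(3) z_power_eq_1[OF n] .
  have mu: "\<rho> (z n) \<in> mu n" using ord[of n] by (simp add: mu_def)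
  have "root_order (\<rho> (z n)) = n"
    using mu_mem_iff_root_order(2)[OF mu n] ord by (metis dvd_antisym dvd_refl)
  moreover obtain u where u: "\<rho> (z n) = z n ^ u" by (rule mu_cases[OF n mu])
  ultimately have "coprime u n" using coprime_if_order[OF n] by metis
  then obtain \<sigma> where s: "\<sigma> \<in> Aut" "\<And>w. w \<in> mu n \<Longrightarrow> \<sigma> w = w ^ u" using Aut_unit[OF n] by blast
  have "\<rho> x = \<sigma> x" if x: "x \<in> cyc_field n" for x
  proof -
    obtain p where p: "\<And>i. coeff p i \<in> \<rat>" "x = poly p (z n)"
      using cyc_field_cases[OF n mu_eq_range[OF n] x] by blast
    have "\<rho> (poly p (z n)) = poly p (\<rho> (z n))"
      using p(1)
    proof (induction p)
      case 0
      show ?case using r(6)[of 0] by simp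
    next
      case (pCons a p)
      have "a \<in> \<rat>" "\<And>i. coeff p i \<in> \<rat>"
        using pCons.prems[of 0] pCons.prems[of "Suc _"] by auto
      then show ?case using pCons.IH r zc by (auto simp: cyc_field_closed cyc_field_poly)
    qed
    then show ?thesis
      unfolding p(2) using Aut_poly[OF s(1) p(1) Qc_mu[OF n z_mu[OF n]]] s(2)[OF z_mu[OF n]] u by simp
  qed
  then have "\<rho> = restrict \<sigma> (cyc_field n)" using r(1) by (auto simp: extensional_def restrict_def)
  then show "\<rho> \<in> (\<lambda>\<sigma>. restrict \<sigma> (cyc_field n)) ` Aut" using s(1) by auto
qed

lemma G_cases:
  assumes "n > 0" "\<rho> \<in> carrier (G n)"
  obtains \<sigma> where "\<sigma> \<in> Aut" "\<rho> = restrict \<sigma> (cyc_field n)"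
  using assms G_carrier by auto

lemma G_restrict: "n > 0 \<Longrightarrow> \<sigma> \<in> Aut \<Longrightarrow> restrict \<sigma> (cyc_field n) \<in> carrier (G n)"
  using G_carrier by auto

lemma G_eqI:
  assumes n: "n > 0" and "\<rho> \<in> carrier (G n)" "\<rho>' \<in> carrier (G n)" "\<rho> (z n) = \<rho>' (z n)"
  shows "\<rho> = \<rho>'"
proof -
  obtain \<sigma> where s: "\<sigma> \<in> Aut" "\<rho> = restrict \<sigma> (cyc_field n)" by (rule G_cases[OF n assms(2)])
  obtain \<sigma>' where s': "\<sigma>' \<in> Aut" "\<rho>' = restrict \<sigma>' (cyc_field n)" by (rule G_cases[OF n assms(3)])
  have zc: "z n \<in> cyc_field n" "z n \<in> Qc"
    using cyc_field_mu[OF z_mu[OF n]] Qc_mu[OF n z_mu[OF n]] by auto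
  have "\<sigma> w = \<sigma>' w" if w: "w \<in> mu n" for w
  proof -
    obtain k where k: "w = z n ^ k" by (rule mu_cases[OF n w])
    show ?thesis unfolding k using assms(4) s s' zc by (simp add: Aut_power)
  qed
  then have "\<sigma> x = \<sigma>' x" if "x \<in> cyc_field n" for x
    using Aut_eq_on_cyc_field[OF s(1) s'(1) n that] by blast
  then show ?thesis unfolding s(2) s'(2) by (auto simp: restrict_def)
qed

lemma finite_G: assumes n: "n > 0" shows "finite (carrier (G n))"
proof (rule inj_on_finite)
  show "inj_on (\<lambda>\<rho>. \<rho> (z n)) (carrier (G n))" by (rule inj_onI) (rule G_eqI[OF n])
  show "(\<lambda>\<rho>. \<rho> (z n)) ` carrier (G n) \<subseteq> mu n"
    using n cyc_field_mu[OF z_mu[OF n]] by (auto simp: Aut_in_mu z_mu elim!: G_cases[OF n])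
  show "finite (mu n)" by (rule finite_mu[OF n])
qed

lemma G_mult:
  assumes "g \<in> carrier (G n)" "h \<in> carrier (G n)"
  shows "g \<otimes>\<^bsub>G n\<^esub> h = compose (cyc_field n) g h"
  using assms unfolding Gal_def BijGroup_def by auto

lemma G_one: "\<one>\<^bsub>G n\<^esub> = (\<lambda>x\<in>cyc_field n. x)"
  unfolding Gal_def BijGroup_def by simp

lemma G_mult_restrict:
  assumes n: "n > 0" and s: "\<sigma> \<in> Aut" "\<tau> \<in> Aut"
  shows "restrict \<sigma> (cyc_field n) \<otimes>\<^bsub>G n\<^esub> restrict \<tau> (cyc_field n) = restrict (compose Qc \<sigma> \<tau>) (cyc_field n)"
  unfolding G_mult[OF G_restrict[OF n s(1)] G_restrict[OF n s(2)]]
  using Aut_cyc_field[OF s(2) n] cyc_field_Qc[OF n] by (auto simp: compose_def restrict_def)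

lemma G_closed:
  assumes "n > 0" "g \<in> carrier (G n)" "x \<in> cyc_field n" shows "g x \<in> cyc_field n"
proof -
  obtain \<sigma> where "\<sigma> \<in> Aut" "g = restrict \<sigma> (cyc_field n)" by (rule G_cases[OF assms(1,2)])
  then show ?thesis using assms by (simp add: Aut_cyc_field)
qed

text \<open>Commutativity is that of exponents: the two composites are compared at
  \<open>z n\<close>, whose image determines an element of \<open>G n\<close>.\<close>

lemma comm_group_G: assumes n: "n > 0" shows "comm_group (G n)"
proof (rule comm_groupI)
  show "\<one>\<^bsub>G n\<^esub> \<in> carrier (G n)"
    using G_restrict[OF n Aut_id] cyc_field_Qc[OF n]
    by (auto simp: G_one restrict_def fun_eq_iff intro: back_subst[of "\<lambda>f. f \<in> carrier (G n)"])
next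
  fix g h assume g: "g \<in> carrier (G n)" and h: "h \<in> carrier (G n)"
  obtain \<sigma> where s: "\<sigma> \<in> Aut" "g = restrict \<sigma> (cyc_field n)" by (rule G_cases[OF n g])
  obtain \<tau> where t: "\<tau> \<in> Aut" "h = restrict \<tau> (cyc_field n)" by (rule G_cases[OF n h])
  show c: "g \<otimes>\<^bsub>G n\<^esub> h \<in> carrier (G n)"
    unfolding s t G_mult_restrict[OF n s(1) t(1)] by (rule G_restrict[OF n Aut_compose[OF s(1) t(1)]])
  have c': "h \<otimes>\<^bsub>G n\<^esub> g \<in> carrier (G n)"
    unfolding s t G_mult_restrict[OF n t(1) s(1)] by (rule G_restrict[OF n Aut_compose[OF t(1) s(1)]])
  obtain u where u: "\<And>w. w \<in> mu n \<Longrightarrow> \<sigma> w = w ^ u" by (rule Aut_exponent[OF s(1) n]) auto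
  obtain v where v: "\<And>w. w \<in> mu n \<Longrightarrow> \<tau> w = w ^ v" by (rule Aut_exponent[OF t(1) n]) auto
  have zc: "z n \<in> cyc_field n" "z n \<in> Qc"
    using cyc_field_mu[OF z_mu[OF n]] Qc_mu[OF n z_mu[OF n]] by auto
  have "compose Qc \<sigma> \<tau> (z n) = compose Qc \<tau> \<sigma> (z n)"
    using zc u v z_mu[OF n] mu_closed(3)[OF z_mu[OF n]]
    by (simp add: compose_def power_mult[symmetric] mult.commute)
  then have "(g \<otimes>\<^bsub>G n\<^esub> h) (z n) = (h \<otimes>\<^bsub>G n\<^esub> g) (z n)"
    unfolding s t G_mult_restrict[OF n s(1) t(1)] G_mult_restrict[OF n t(1) s(1)] using zc by simp
  then show "g \<otimes>\<^bsub>G n\<^esub> h = h \<otimes>\<^bsub>G n\<^esub> g" by (rule G_eqI[OF n c c'])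
next
  fix g assume g: "g \<in> carrier (G n)"
  obtain \<sigma> where s: "\<sigma> \<in> Aut" "g = restrict \<sigma> (cyc_field n)" by (rule G_cases[OF n g])
  obtain \<tau> where t: "\<tau> \<in> Aut" "\<And>x. x \<in> cyc_field n \<Longrightarrow> \<tau> (\<sigma> x) = x"
    by (rule Aut_inverse_on[OF s(1) n]) auto
  show "\<exists>h\<in>carrier (G n). h \<otimes>\<^bsub>G n\<^esub> g = \<one>\<^bsub>G n\<^esub>"
    using G_restrict[OF n t(1)] G_mult_restrict[OF n t(1) s(1)] t(2) cyc_field_Qc[OF n]
    by (intro bexI[of _ "restrict \<tau> (cyc_field n)"]) (auto simp: s(2) G_one compose_def restrict_def)
  show "\<one>\<^bsub>G n\<^esub> \<otimes>\<^bsub>G n\<^esub> g = g"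
  proof -
    have one: "\<one>\<^bsub>G n\<^esub> = restrict (\<lambda>x\<in>Qc. x) (cyc_field n)"
      using cyc_field_Qc[OF n] by (auto simp: G_one restrict_def)
    show ?thesis
      unfolding one s(2) G_mult_restrict[OF n Aut_id s(1)]
      using cyc_field_Qc[OF n] Aut_cyc_field[OF s(1) n] by (auto simp: compose_def restrict_def)
  qed
next
  fix f g h assume "f \<in> carrier (G n)" "g \<in> carrier (G n)" "h \<in> carrier (G n)"
  then obtain \<rho> \<sigma> \<tau> where s: "\<rho> \<in> Aut" "\<sigma> \<in> Aut" "\<tau> \<in> Aut" "f = restrict \<rho> (cyc_field n)"
    "g = restrict \<sigma> (cyc_field n)" "h = restrict \<tau> (cyc_field n)" by (metis G_cases[OF n])
  have "compose Qc (compose Qc \<rho> \<sigma>) \<tau> = compose Qc \<rho> (compose Qc \<sigma> \<tau>)"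
    using Aut_closed[OF s(3)] Aut_ext[OF s(1)] by (auto simp: compose_def restrict_def)
  then show "f \<otimes>\<^bsub>G n\<^esub> g \<otimes>\<^bsub>G n\<^esub> h = f \<otimes>\<^bsub>G n\<^esub> (g \<otimes>\<^bsub>G n\<^esub> h)"
    using s by (simp add: G_mult_restrict[OF n] Aut_compose)
qed

end


section \<open>The ring R\<close>

lemma int_group_ring_simps [simp]:
  "\<zero>\<^bsub>int_group_ring H\<^esub> = (\<lambda>x. 0)"
  "\<one>\<^bsub>int_group_ring H\<^esub> = (\<lambda>x. if x = \<one>\<^bsub>H\<^esub> then 1 else 0)"
  "a \<oplus>\<^bsub>int_group_ring H\<^esub> b = (\<lambda>x. a x + b x)"
  by (simp_all add: int_group_ring_def)

lemma int_group_ring_carrier: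
  "finite (carrier H) \<Longrightarrow> a \<in> carrier (int_group_ring H) \<longleftrightarrow> (\<forall>g. g \<notin> carrier H \<longrightarrow> a g = 0)"
  by (auto simp: int_group_ring_def intro: finite_subset)

lemma int_group_ring_mult:
  assumes H: "finite (carrier H)" and ab: "a \<in> carrier (int_group_ring H)" "b \<in> carrier (int_group_ring H)"
  shows "(a \<otimes>\<^bsub>int_group_ring H\<^esub> b) x =
    (\<Sum>g\<in>carrier H. \<Sum>h\<in>carrier H. if g \<otimes>\<^bsub>H\<^esub> h = x then a g * b h else 0)"
proof -
  have z: "a g = 0" "b g = 0" if "g \<notin> carrier H" for g
    using ab that by (auto simp: int_group_ring_carrier[OF H])
  have "(a \<otimes>\<^bsub>int_group_ring H\<^esub> b) x =
    (\<Sum>(g, h)\<in>{(g, h). a g \<noteq> 0 \<and> b h \<noteq> 0 \<and> g \<otimes>\<^bsub>H\<^esub> h = x}. a g * b h)"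
    by (simp add: int_group_ring_def)
  also have "\<dots> = (\<Sum>(g, h)\<in>carrier H \<times> carrier H. if g \<otimes>\<^bsub>H\<^esub> h = x then a g * b h else 0)"
  proof (rule sum.mono_neutral_cong_left)
    show "finite (carrier H \<times> carrier H)" using H by simp
    show "{(g, h). a g \<noteq> 0 \<and> b h \<noteq> 0 \<and> g \<otimes>\<^bsub>H\<^esub> h = x} \<subseteq> carrier H \<times> carrier H"
      using z by blast
  qed (auto split: if_splits)
  finally show ?thesis by (simp add: sum.cartesian_product)
qed

lemma int_group_ring_mult_closed:
  assumes "comm_group H" and H: "finite (carrier H)"
    and ab: "a \<in> carrier (int_group_ring H)" "b \<in> carrier (int_group_ring H)"
  shows "a \<otimes>\<^bsub>int_group_ring H\<^esub> b \<in> carrier (int_group_ring H)"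
proof -
  interpret comm_group H by fact
  show ?thesis
    using ab by (auto simp: int_group_ring_carrier[OF H] int_group_ring_mult[OF H ab] intro!: sum.neutral)
qed

text \<open>Summing a convolution against a test function linearises it; all the ring axioms follow from this.\<close>

lemma int_group_ring_mult_sum:
  fixes F :: "'a \<Rightarrow> int"
  assumes "comm_group H" and H: "finite (carrier H)"
    and ab: "a \<in> carrier (int_group_ring H)" "b \<in> carrier (int_group_ring H)"
  shows "(\<Sum>x\<in>carrier H. (a \<otimes>\<^bsub>int_group_ring H\<^esub> b) x * F x) =
    (\<Sum>g\<in>carrier H. \<Sum>h\<in>carrier H. a g * b h * F (g \<otimes>\<^bsub>H\<^esub> h))"
proof -
  interpret comm_group H by fact
  have "(\<Sum>x\<in>carrier H. (a \<otimes>\<^bsub>int_group_ring H\<^esub> b) x * F x) =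
    (\<Sum>x\<in>carrier H. \<Sum>g\<in>carrier H. \<Sum>h\<in>carrier H. if g \<otimes>\<^bsub>H\<^esub> h = x then a g * b h * F x else 0)"
    unfolding int_group_ring_mult[OF H ab] sum_distrib_right by (intro sum.cong refl) auto
  also have "\<dots> = (\<Sum>g\<in>carrier H. \<Sum>x\<in>carrier H. \<Sum>h\<in>carrier H. if g \<otimes>\<^bsub>H\<^esub> h = x then a g * b h * F x else 0)"
    by (rule sum.swap)
  also have "\<dots> = (\<Sum>g\<in>carrier H. \<Sum>h\<in>carrier H. \<Sum>x\<in>carrier H. if g \<otimes>\<^bsub>H\<^esub> h = x then a g * b h * F x else 0)"
    by (intro sum.cong refl sum.swap)
  also have "\<dots> = (\<Sum>g\<in>carrier H. \<Sum>h\<in>carrier H. a g * b h * F (g \<otimes>\<^bsub>H\<^esub> h))"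
    using H by (intro sum.cong refl) (simp add: sum.delta')
  finally show ?thesis .
qed

text \<open>Testing against the indicator function of a point recovers each coefficient.\<close>

lemma int_group_ring_eqI:
  assumes "finite (carrier H)" "a \<in> carrier (int_group_ring H)" "b \<in> carrier (int_group_ring H)"
    and "\<And>F :: _ \<Rightarrow> int. (\<Sum>x\<in>carrier H. a x * F x) = (\<Sum>x\<in>carrier H. b x * F x)"
  shows "a = b"
proof
  fix x
  show "a x = b x"
  proof (cases "x \<in> carrier H")
    case True
    then show ?thesis
      using assms(1) assms(4)[of "\<lambda>y. if y = x then 1 else 0"] by (simp add: if_distrib cong: if_cong)
  next
    case False
    then show ?thesis using assms(1-3) by (simp add: int_group_ring_carrier)
  qed
qed

lemma int_group_ring_cring:
  assumes Hg: "comm_group H" and H: "finite (carrier H)"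
  shows "cring (int_group_ring H)"
proof -
  interpret comm_group H by fact
  let ?A = "int_group_ring H"
  note carr = int_group_ring_carrier[OF H]
  note cl = int_group_ring_mult_closed[OF Hg H]
  note ms = int_group_ring_mult_sum[OF Hg H]
  note eqI = int_group_ring_eqI[OF H]
  have one: "\<one>\<^bsub>?A\<^esub> \<in> carrier ?A" by (auto simp: carr)
  show ?thesis
  proof (rule cringI)
    show "abelian_group ?A"
    proof (rule abelian_groupI)
      fix a assume "a \<in> carrier ?A"
      then show "\<exists>b\<in>carrier ?A. b \<oplus>\<^bsub>?A\<^esub> a = \<zero>\<^bsub>?A\<^esub>"
        by (intro bexI[of _ "\<lambda>x. - a x"]) (auto simp: carr)
    qed (auto simp: carr)
    show "comm_monoid ?A"
    proof (rule comm_monoidI)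
      fix a b c assume abc: "a \<in> carrier ?A" "b \<in> carrier ?A" "c \<in> carrier ?A"
      show "a \<otimes>\<^bsub>?A\<^esub> b \<otimes>\<^bsub>?A\<^esub> c = a \<otimes>\<^bsub>?A\<^esub> (b \<otimes>\<^bsub>?A\<^esub> c)"
      proof (rule eqI)
        fix F :: "_ \<Rightarrow> int"
        have "(\<Sum>x\<in>carrier H. (a \<otimes>\<^bsub>?A\<^esub> b \<otimes>\<^bsub>?A\<^esub> c) x * F x) =
          (\<Sum>g\<in>carrier H. (a \<otimes>\<^bsub>?A\<^esub> b) g * (\<Sum>k\<in>carrier H. c k * F (g \<otimes>\<^bsub>H\<^esub> k)))"
          unfolding ms[OF cl[OF abc(1,2)] abc(3)] by (simp add: sum_distrib_left mult.assoc)
        also have "\<dots> = (\<Sum>g\<in>carrier H. a g * (\<Sum>h\<in>carrier H. b h * (\<Sum>k\<in>carrier H. c k * F (g \<otimes>\<^bsub>H\<^esub> (h \<otimes>\<^bsub>H\<^esub> k)))))"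
          unfolding ms[OF abc(1,2)]
          by (simp only: sum_distrib_left mult.assoc, intro sum.cong refl) (simp add: m_assoc)
        also have "\<dots> = (\<Sum>g\<in>carrier H. a g * (\<Sum>x\<in>carrier H. (b \<otimes>\<^bsub>?A\<^esub> c) x * F (g \<otimes>\<^bsub>H\<^esub> x)))"
          unfolding ms[OF abc(2,3)] by (simp add: sum_distrib_left mult.assoc)
        also have "\<dots> = (\<Sum>x\<in>carrier H. (a \<otimes>\<^bsub>?A\<^esub> (b \<otimes>\<^bsub>?A\<^esub> c)) x * F x)"
          unfolding ms[OF abc(1) cl[OF abc(2,3)]] by (simp add: sum_distrib_left mult.assoc)
        finally show "(\<Sum>x\<in>carrier H. (a \<otimes>\<^bsub>?A\<^esub> b \<otimes>\<^bsub>?A\<^esub> c) x * F x) =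
          (\<Sum>x\<in>carrier H. (a \<otimes>\<^bsub>?A\<^esub> (b \<otimes>\<^bsub>?A\<^esub> c)) x * F x)" .
      qed (intro cl abc)+
      show "a \<otimes>\<^bsub>?A\<^esub> b = b \<otimes>\<^bsub>?A\<^esub> a"
      proof (rule eqI)
        fix F :: "_ \<Rightarrow> int"
        show "(\<Sum>x\<in>carrier H. (a \<otimes>\<^bsub>?A\<^esub> b) x * F x) = (\<Sum>x\<in>carrier H. (b \<otimes>\<^bsub>?A\<^esub> a) x * F x)"
          unfolding ms[OF abc(1,2)] ms[OF abc(2,1)]
          by (subst sum.swap, intro sum.cong refl) (simp add: m_comm mult.commute)
      qed (intro cl abc)+
    next
      fix a assume a: "a \<in> carrier ?A"
      show "\<one>\<^bsub>?A\<^esub> \<otimes>\<^bsub>?A\<^esub> a = a"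
      proof (rule eqI)
        fix F :: "_ \<Rightarrow> int"
        have "(\<Sum>x\<in>carrier H. (\<one>\<^bsub>?A\<^esub> \<otimes>\<^bsub>?A\<^esub> a) x * F x) =
          (\<Sum>g\<in>carrier H. if g = \<one>\<^bsub>H\<^esub> then (\<Sum>h\<in>carrier H. a h * F h) else 0)"
          unfolding ms[OF one a] by (intro sum.cong refl) auto
        then show "(\<Sum>x\<in>carrier H. (\<one>\<^bsub>?A\<^esub> \<otimes>\<^bsub>?A\<^esub> a) x * F x) = (\<Sum>x\<in>carrier H. a x * F x)"
          using H by simp
      qed (intro cl a one)+
    qed (use one cl in auto)
    fix a b c assume abc: "a \<in> carrier ?A" "b \<in> carrier ?A" "c \<in> carrier ?A"
    have ab: "(\<lambda>x. a x + b x) \<in> carrier ?A" using abc by (auto simp: carr)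
    show "(a \<oplus>\<^bsub>?A\<^esub> b) \<otimes>\<^bsub>?A\<^esub> c = a \<otimes>\<^bsub>?A\<^esub> c \<oplus>\<^bsub>?A\<^esub> b \<otimes>\<^bsub>?A\<^esub> c"
      unfolding fun_eq_iff int_group_ring_simps(3) int_group_ring_mult[OF H ab abc(3)]
        int_group_ring_mult[OF H abc(1,3)] int_group_ring_mult[OF H abc(2,3)] sum.distrib[symmetric]
      by (intro allI sum.cong refl) (simp add: distrib_right)
  qed
qed

lemma powi_sum: "x \<noteq> 0 \<Longrightarrow> x powi (\<Sum>i\<in>I. f i) = (\<Prod>i\<in>I. x powi f i)" for x :: complex
  by (induction I rule: infinite_finite_induct) (auto simp: power_int_add)

lemma prod_powi: "(\<Prod>i\<in>I. f i) powi k = (\<Prod>i\<in>I. f i powi k)" for f :: "_ \<Rightarrow> complex"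
  by (induction I rule: infinite_finite_induct) (auto simp: power_int_mult_distrib)

section \<open>The group rings of the cyclotomic fields and their inverse limit\<close>

context generators
begin

lemma Rn_cring: "n > 0 \<Longrightarrow> cring (Rn n)"
  by (intro int_group_ring_cring comm_group_G finite_G)

lemma Rn_carrier: "n > 0 \<Longrightarrow> a \<in> carrier (Rn n) \<longleftrightarrow> (\<forall>g. g \<notin> carrier (G n) \<longrightarrow> a g = 0)"
  by (intro int_group_ring_carrier finite_G)

lemma G_restrict_level:
  assumes "n > 0" "m dvd n" "g \<in> carrier (G n)"
  shows "restrict g (cyc_field m) \<in> carrier (G m)"
proof -
  have m: "m > 0" using assms by (auto intro: Nat.gr0I)
  obtain \<sigma> where s: "\<sigma> \<in> Aut" "g = restrict \<sigma> (cyc_field n)" by (rule G_cases[OF assms(1,3)])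
  have "restrict g (cyc_field m) = restrict \<sigma> (cyc_field m)"
    using s(2) cyc_field_mono[OF assms(2)] by (auto simp: restrict_def)
  then show ?thesis using G_restrict[OF m s(1)] by simp
qed

lemma G_restrict_mult:
  assumes "n > 0" "m dvd n" "g \<in> carrier (G n)" "h \<in> carrier (G n)"
  shows "restrict (g \<otimes>\<^bsub>G n\<^esub> h) (cyc_field m) = restrict g (cyc_field m) \<otimes>\<^bsub>G m\<^esub> restrict h (cyc_field m)"
proof -
  have m: "m > 0" using assms by (auto intro: Nat.gr0I)
  have "restrict h (cyc_field m) x \<in> cyc_field m" if "x \<in> cyc_field m" for x
    by (rule G_closed[OF m G_restrict_level[OF assms(1,2,4)] that])
  then show ?thesis
    unfolding G_mult[OF assms(3,4)] G_mult[OF G_restrict_level[OF assms(1-3)] G_restrict_level[OF assms(1,2,4)]]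
    using cyc_field_mono[OF assms(2)] by (auto simp: compose_def restrict_def)
qed

lemma Rn_restrict_altdef:
  assumes "n > 0"
  shows "Rn_restrict n m a = (\<lambda>\<rho>. \<Sum>\<sigma>\<in>carrier (G n). if restrict \<sigma> (cyc_field m) = \<rho> then a \<sigma> else 0)"
  unfolding Rn_restrict_def using finite_G[OF assms] by (auto simp: sum.inter_filter)

lemma Rn_restrict_closed:
  assumes "n > 0" "m dvd n" shows "Rn_restrict n m a \<in> carrier (Rn m)"
proof -
  have m: "m > 0" using assms by (auto intro: Nat.gr0I)
  show ?thesis
    unfolding Rn_carrier[OF m] Rn_restrict_altdef[OF assms(1)]
    using G_restrict_level[OF assms] by (auto intro!: sum.neutral)
qed

text \<open>Change of variables: \<open>Rn_restrict\<close> is push-forward along restriction, so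
  test functions pull back. This reduces multiplicativity of the transition maps to that of
  restricting automorphisms.\<close>

lemma Rn_restrict_sum:
  fixes F :: "_ \<Rightarrow> int"
  assumes "n > 0" "m dvd n"
  shows "(\<Sum>\<rho>\<in>carrier (G m). Rn_restrict n m a \<rho> * F \<rho>) =
    (\<Sum>\<sigma>\<in>carrier (G n). a \<sigma> * F (restrict \<sigma> (cyc_field m)))"
proof -
  have m: "m > 0" using assms by (auto intro: Nat.gr0I)
  have "(\<Sum>\<rho>\<in>carrier (G m). Rn_restrict n m a \<rho> * F \<rho>) =
    (\<Sum>\<rho>\<in>carrier (G m). \<Sum>\<sigma>\<in>carrier (G n). if restrict \<sigma> (cyc_field m) = \<rho> then a \<sigma> * F \<rho> else 0)"
    unfolding Rn_restrict_altdef[OF assms(1)] sum_distrib_right by (intro sum.cong refl) auto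
  also have "\<dots> = (\<Sum>\<sigma>\<in>carrier (G n). \<Sum>\<rho>\<in>carrier (G m). if restrict \<sigma> (cyc_field m) = \<rho> then a \<sigma> * F \<rho> else 0)"
    by (rule sum.swap)
  also have "\<dots> = (\<Sum>\<sigma>\<in>carrier (G n). a \<sigma> * F (restrict \<sigma> (cyc_field m)))"
    using G_restrict_level[OF assms] finite_G[OF m] by (intro sum.cong refl) simp
  finally show ?thesis .
qed

lemma Rn_restrict_mult:
  assumes n: "n > 0" and d: "m dvd n" and ab: "a \<in> carrier (Rn n)" "b \<in> carrier (Rn n)"
  shows "Rn_restrict n m (a \<otimes>\<^bsub>Rn n\<^esub> b) = Rn_restrict n m a \<otimes>\<^bsub>Rn m\<^esub> Rn_restrict n m b"
proof -
  have m: "m > 0" using n d by (auto intro: Nat.gr0I)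
  note cl = Rn_restrict_closed[OF n d]
  note ms = int_group_ring_mult_sum[OF comm_group_G finite_G]
  show ?thesis
  proof (rule int_group_ring_eqI[OF finite_G[OF m]])
    fix F :: "_ \<Rightarrow> int"
    let ?r = "\<lambda>g. restrict g (cyc_field m)"
    have "(\<Sum>x\<in>carrier (G m). Rn_restrict n m (a \<otimes>\<^bsub>Rn n\<^esub> b) x * F x) =
      (\<Sum>g\<in>carrier (G n). \<Sum>h\<in>carrier (G n). a g * b h * F (?r g \<otimes>\<^bsub>G m\<^esub> ?r h))"
      unfolding Rn_restrict_sum[OF n d] ms[OF n n ab]
      by (intro sum.cong refl) (simp add: G_restrict_mult[OF n d])
    also have "\<dots> = (\<Sum>g\<in>carrier (G n). a g * (\<Sum>h\<in>carrier (G n). b h * F (?r g \<otimes>\<^bsub>G m\<^esub> ?r h)))"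
      by (simp add: sum_distrib_left mult.assoc)
    also have "\<dots> = (\<Sum>g\<in>carrier (G m). Rn_restrict n m a g * (\<Sum>h\<in>carrier (G m). Rn_restrict n m b h * F (g \<otimes>\<^bsub>G m\<^esub> h)))"
      unfolding Rn_restrict_sum[OF n d] ..
    also have "\<dots> = (\<Sum>x\<in>carrier (G m). (Rn_restrict n m a \<otimes>\<^bsub>Rn m\<^esub> Rn_restrict n m b) x * F x)"
      unfolding ms[OF m m cl cl] by (simp add: sum_distrib_left mult.assoc)
    finally show "(\<Sum>x\<in>carrier (G m). Rn_restrict n m (a \<otimes>\<^bsub>Rn n\<^esub> b) x * F x) = \<dots>" .
  qed (intro cl int_group_ring_mult_closed[OF comm_group_G finite_G] m)+
qed

lemma Rn_restrict_one:
  assumes n: "n > 0" and d: "m dvd n"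
  shows "Rn_restrict n m \<one>\<^bsub>Rn n\<^esub> = \<one>\<^bsub>Rn m\<^esub>"
proof -
  interpret comm_group "G n" by (rule comm_group_G[OF n])
  have "restrict \<one>\<^bsub>G n\<^esub> (cyc_field m) = \<one>\<^bsub>G m\<^esub>"
    unfolding G_one using cyc_field_mono[OF d] by (auto simp: restrict_def)
  moreover have "(\<Sum>\<sigma>\<in>carrier (G n). if restrict \<sigma> (cyc_field m) = \<rho> then \<one>\<^bsub>Rn n\<^esub> \<sigma> else 0) =
    (\<Sum>\<sigma>\<in>carrier (G n). if \<sigma> = \<one>\<^bsub>G n\<^esub> then (if restrict \<one>\<^bsub>G n\<^esub> (cyc_field m) = \<rho> then 1 else 0) else 0)" for \<rho>
    by (intro sum.cong refl) auto
  then have "(\<Sum>\<sigma>\<in>carrier (G n). if restrict \<sigma> (cyc_field m) = \<rho> then \<one>\<^bsub>Rn n\<^esub> \<sigma> else 0) =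
    (if restrict \<one>\<^bsub>G n\<^esub> (cyc_field m) = \<rho> then 1 else 0)" for \<rho>
    using finite_G[OF n] by simp
  ultimately show ?thesis
    unfolding Rn_restrict_altdef[OF n] int_group_ring_simps(2) by (intro ext) auto
qed

lemma R_simps:
  "r \<in> carrier R \<longleftrightarrow> r \<in> (\<Pi>\<^sub>E n\<in>{0<..}. carrier (Rn n)) \<and> (\<forall>n>0. \<forall>m. m dvd n \<longrightarrow> Rn_restrict n m (r n) = r m)"
  "r \<otimes>\<^bsub>R\<^esub> s = (\<lambda>n\<in>{0<..}. r n \<otimes>\<^bsub>Rn n\<^esub> s n)" "\<one>\<^bsub>R\<^esub> = (\<lambda>n\<in>{0<..}. \<one>\<^bsub>Rn n\<^esub>)"
  "\<zero>\<^bsub>R\<^esub> = (\<lambda>n\<in>{0<..}. \<zero>\<^bsub>Rn n\<^esub>)" "r \<oplus>\<^bsub>R\<^esub> s = (\<lambda>n\<in>{0<..}. r n \<oplus>\<^bsub>Rn n\<^esub> s n)"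
  by (simp_all add: R_def)

lemma R_component: "r \<in> carrier R \<Longrightarrow> n > 0 \<Longrightarrow> r n \<in> carrier (Rn n)"
  by (auto simp: R_simps)

lemma R_restrict: "r \<in> carrier R \<Longrightarrow> n > 0 \<Longrightarrow> m dvd n \<Longrightarrow> Rn_restrict n m (r n) = r m"
  by (auto simp: R_simps)

lemma R_cring: "cring R"
proof -
  have cg: "\<And>n. n > 0 \<Longrightarrow> cring (Rn n)" by (rule Rn_cring)
  have dvdpos: "m > 0" if "n > 0" "m dvd n" for m n :: nat using that by (auto intro: Nat.gr0I)
  have Rn_abel: "\<And>n. n > 0 \<Longrightarrow> abelian_group (Rn n)" using cg by (simp add: cring_def ring_def)
  have Rn_mon: "\<And>n. n > 0 \<Longrightarrow> comm_monoid (Rn n)" using cg by (simp add: cring_def)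
  note mc = monoid.m_closed[OF comm_monoid.axioms(1)[OF Rn_mon]]
  have oc: "\<one>\<^bsub>Rn n\<^esub> \<in> carrier (Rn n)" if "n > 0" for n
    by (rule monoid.one_closed[OF comm_monoid.axioms(1)[OF Rn_mon[OF that]]])
  have ext: "r = s" if "r \<in> extensional {0<..}" "s \<in> extensional {0<..}" "\<And>n. n > 0 \<Longrightarrow> r n = s n"
    for r s :: "nat \<Rightarrow> (complex \<Rightarrow> complex) \<Rightarrow> int" by (rule extensionalityI[of _ "{0<..}"]) (use that in auto)
  have rext: "r \<in> extensional {0<..}" if "r \<in> carrier R" for r using that by (auto simp: R_simps PiE_def)
  show ?thesis
  proof (rule cringI)
    show "abelian_group R"
    proof (rule abelian_groupI)
      fix r s assume "r \<in> carrier R" "s \<in> carrier R"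
      moreover have "Rn_restrict n m (\<lambda>x. r n x + s n x) = (\<lambda>x. Rn_restrict n m (r n) x + Rn_restrict n m (s n) x)" for n m
        unfolding Rn_restrict_def sum.distrib ..
      ultimately show "r \<oplus>\<^bsub>R\<^esub> s \<in> carrier R"
        by (auto simp: R_simps Rn_carrier dvdpos PiE_iff)
    next
      show "\<zero>\<^bsub>R\<^esub> \<in> carrier R" by (auto simp: R_simps Rn_carrier Rn_restrict_altdef dvdpos)
    next
      fix r assume r: "r \<in> carrier R"
      show "\<exists>s\<in>carrier R. s \<oplus>\<^bsub>R\<^esub> r = \<zero>\<^bsub>R\<^esub>"
      proof (intro bexI)
        show "(\<lambda>n\<in>{0<..}. \<lambda>x. - r n x) \<oplus>\<^bsub>R\<^esub> r = \<zero>\<^bsub>R\<^esub>" by (auto simp: R_simps restrict_def)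
        have "Rn_restrict n m (\<lambda>x. - r n x) = (\<lambda>x. - r m x)" if "n > 0" "m dvd n" for n m
          unfolding R_restrict[OF r that, symmetric] Rn_restrict_def sum_negf ..
        then show "(\<lambda>n\<in>{0<..}. \<lambda>x. - r n x) \<in> carrier R"
          using r by (auto simp: R_simps Rn_carrier dvdpos PiE_iff)
      qed
    qed (auto simp: R_simps restrict_def PiE_def extensional_def fun_eq_iff)
    show "comm_monoid R"
    proof (rule comm_monoidI)
      fix r s t assume r: "r \<in> carrier R" and s: "s \<in> carrier R" and t: "t \<in> carrier R"
      show "r \<otimes>\<^bsub>R\<^esub> s \<in> carrier R"
        using R_component[OF r] R_component[OF s] R_restrict[OF r] R_restrict[OF s]
        by (auto simp: R_simps mc Rn_restrict_mult dvdpos)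
      show "r \<otimes>\<^bsub>R\<^esub> s \<otimes>\<^bsub>R\<^esub> t = r \<otimes>\<^bsub>R\<^esub> (s \<otimes>\<^bsub>R\<^esub> t)"
        using R_component[OF r] R_component[OF s] R_component[OF t]
        by (auto simp: R_simps restrict_def monoid.m_assoc[OF comm_monoid.axioms(1)[OF Rn_mon]])
      show "r \<otimes>\<^bsub>R\<^esub> s = s \<otimes>\<^bsub>R\<^esub> r"
        using R_component[OF r] R_component[OF s]
        by (auto simp: R_simps restrict_def comm_monoid.m_comm[OF Rn_mon])
    next
      show "\<one>\<^bsub>R\<^esub> \<in> carrier R"
        using oc Rn_restrict_one dvdpos by (auto simp: R_simps)
    next
      fix r assume r: "r \<in> carrier R"
      show "\<one>\<^bsub>R\<^esub> \<otimes>\<^bsub>R\<^esub> r = r"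
        by (rule ext) (use R_component[OF r] rext[OF r] in \<open>auto simp: R_simps monoid.l_one[OF comm_monoid.axioms(1)[OF Rn_mon]] simp del: int_group_ring_simps\<close>)
    qed
    fix r s t assume r: "r \<in> carrier R" and s: "s \<in> carrier R" and t: "t \<in> carrier R"
    show "(r \<oplus>\<^bsub>R\<^esub> s) \<otimes>\<^bsub>R\<^esub> t = r \<otimes>\<^bsub>R\<^esub> t \<oplus>\<^bsub>R\<^esub> s \<otimes>\<^bsub>R\<^esub> t"
      using R_component[OF r] R_component[OF s] R_component[OF t]
      by (auto simp: R_simps restrict_def cring.cring_simprules(13)[OF Rn_cring] simp del: int_group_ring_simps)
  qed
qed

end


section \<open>Equivariant functions\<close>

context generators
begin

lemma G_hom:
  assumes n: "n > 0" and g: "g \<in> carrier (G n)"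
  shows "x \<in> cyc_field n \<Longrightarrow> y \<in> cyc_field n \<Longrightarrow> g (x * y) = g x * g y"
    and "g 1 = 1"
    and "x \<in> cyc_field n \<Longrightarrow> g (x powi k) = g x powi k"
    and "x \<in> cyc_field n \<Longrightarrow> g x = 0 \<longleftrightarrow> x = 0"
    and "(\<And>i. i \<in> I \<Longrightarrow> f i \<in> cyc_field n) \<Longrightarrow> g (\<Prod>i\<in>I. f i) = (\<Prod>i\<in>I. g (f i))"
proof -
  obtain \<sigma> where s: "\<sigma> \<in> Aut" "g = restrict \<sigma> (cyc_field n)" by (rule G_cases[OF n g])
  note Q = cyc_field_Qc[OF n]
  show "x \<in> cyc_field n \<Longrightarrow> y \<in> cyc_field n \<Longrightarrow> g (x * y) = g x * g y"
    using s Q by (simp add: Aut_mult cyc_field_mult)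
  show "g 1 = 1" using s by (simp add: Aut_1 cyc_field_1)
  show "x \<in> cyc_field n \<Longrightarrow> g (x powi k) = g x powi k"
    using s Q by (simp add: Aut_powi cyc_field_powi)
  show "x \<in> cyc_field n \<Longrightarrow> g x = 0 \<longleftrightarrow> x = 0"
    using s Q by (simp add: Aut_eq_0)
  show "(\<And>i. i \<in> I \<Longrightarrow> f i \<in> cyc_field n) \<Longrightarrow> g (\<Prod>i\<in>I. f i) = (\<Prod>i\<in>I. g (f i))"
    using s Q by (simp add: Aut_prod cyc_field_prod)
qed

section \<open>The exponential action on cyclotomic fields\<close>

lemma act_closed:
  assumes "n > 0" "x \<in> cyc_field n" shows "act n a x \<in> cyc_field n"
  unfolding act_def by (rule cyc_field_prod, rule cyc_field_powi, rule G_closed[OF assms(1) _ assms(2)])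

lemma act_nonzero:
  assumes "n > 0" "x \<in> cyc_field n" "x \<noteq> 0" shows "act n a x \<noteq> 0"
  unfolding act_def using assms finite_G[OF assms(1)] by (simp add: G_hom(4))

lemma act_1: "n > 0 \<Longrightarrow> act n a 1 = 1"
  unfolding act_def by (simp add: G_hom(2))

lemma act_mult_arg:
  assumes "n > 0" "x \<in> cyc_field n" "y \<in> cyc_field n"
  shows "act n a (x * y) = act n a x * act n a y"
  unfolding act_def prod.distrib[symmetric]
  using assms by (intro prod.cong refl) (simp add: G_hom power_int_mult_distrib)

lemma act_powi_arg:
  assumes "n > 0" "x \<in> cyc_field n" shows "act n a (x powi k) = act n a x powi k"
  unfolding act_def prod_powi
  using assms by (intro prod.cong refl) (simp add: G_hom power_int_mult[symmetric] mult.commute)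

lemma act_power_arg:
  assumes "n > 0" "x \<in> cyc_field n" shows "act n a (x ^ k) = act n a x ^ k"
  using act_powi_arg[OF assms, of a "int k"] by simp

lemma act_prod_arg:
  assumes "n > 0" "\<And>i. i \<in> I \<Longrightarrow> f i \<in> cyc_field n"
  shows "act n a (\<Prod>i\<in>I. f i) = (\<Prod>i\<in>I. act n a (f i))"
  using assms(2)
  by (induction I rule: infinite_finite_induct) (simp_all add: assms(1) act_1 act_mult_arg cyc_field_prod)

lemma act_add:
  assumes "n > 0" "x \<in> cyc_field n" "x \<noteq> 0"
  shows "act n (\<lambda>g. a g + b g) x = act n a x * act n b x"
  unfolding act_def prod.distrib[symmetric]
  using assms by (intro prod.cong refl) (simp add: G_hom power_int_add)

text \<open>The coefficients of a convolution are sums over factorisations g h. Powers turn these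
  sums into products, and exchanging the products collects the factors by g.\<close>

lemma act_mult:
  assumes n: "n > 0" and ab: "a \<in> carrier (Rn n)" "b \<in> carrier (Rn n)" and x: "x \<in> cyc_field n" "x \<noteq> 0"
  shows "act n (a \<otimes>\<^bsub>Rn n\<^esub> b) x = act n a (act n b x)"
proof -
  interpret comm_group "G n" by (rule comm_group_G[OF n])
  note fin = finite_G[OF n]
  have gx: "g x \<noteq> 0" "g x \<in> cyc_field n" if "g \<in> carrier (G n)" for g
    using G_hom(4)[OF n that x(1)] x(2) G_closed[OF n that x(1)] by auto
  have if_powi: "y powi (if P then k else 0) = (if P then y powi k else 1)" for y :: complex and P k by simp
  have "act n (a \<otimes>\<^bsub>Rn n\<^esub> b) x = (\<Prod>\<rho>\<in>carrier (G n). \<Prod>g\<in>carrier (G n). \<Prod>h\<in>carrier (G n).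
      if g \<otimes>\<^bsub>G n\<^esub> h = \<rho> then \<rho> x powi (a g * b h) else 1)"
    unfolding act_def int_group_ring_mult[OF fin ab]
    using gx by (intro prod.cong refl) (simp add: powi_sum if_powi)
  also have "\<dots> = (\<Prod>g\<in>carrier (G n). \<Prod>\<rho>\<in>carrier (G n). \<Prod>h\<in>carrier (G n).
      if g \<otimes>\<^bsub>G n\<^esub> h = \<rho> then \<rho> x powi (a g * b h) else 1)"
    by (rule prod.swap)
  also have "\<dots> = (\<Prod>g\<in>carrier (G n). \<Prod>h\<in>carrier (G n). \<Prod>\<rho>\<in>carrier (G n).
      if g \<otimes>\<^bsub>G n\<^esub> h = \<rho> then \<rho> x powi (a g * b h) else 1)"
    by (intro prod.cong refl prod.swap)
  also have "\<dots> = (\<Prod>g\<in>carrier (G n). \<Prod>h\<in>carrier (G n). (g \<otimes>\<^bsub>G n\<^esub> h) x powi (a g * b h))"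
    using fin by (intro prod.cong refl) simp
  also have "\<dots> = (\<Prod>g\<in>carrier (G n). g (act n b x) powi a g)"
  proof (intro prod.cong refl)
    fix g assume g: "g \<in> carrier (G n)"
    have "g (act n b x) = (\<Prod>h\<in>carrier (G n). g (h x powi b h))"
      unfolding act_def by (rule G_hom(5)[OF n g]) (auto intro: cyc_field_powi gx)
    also have "\<dots> = (\<Prod>h\<in>carrier (G n). (g \<otimes>\<^bsub>G n\<^esub> h) x powi b h)"
      using g gx x by (intro prod.cong refl) (simp add: G_hom(3)[OF n] G_mult compose_def)
    finally show "(\<Prod>h\<in>carrier (G n). (g \<otimes>\<^bsub>G n\<^esub> h) x powi (a g * b h)) = g (act n b x) powi a g"
      by (simp add: prod_powi power_int_mult[symmetric] mult.commute)
  qed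
  finally show ?thesis by (simp add: act_def)
qed

lemma act_point:
  assumes "n > 0" "\<rho> \<in> carrier (G n)"
  shows "act n (\<lambda>g. if g = \<rho> then 1 else 0) x = \<rho> x"
proof -
  have "act n (\<lambda>g. if g = \<rho> then 1 else 0) x = (\<Prod>g\<in>carrier (G n). if g = \<rho> then \<rho> x else 1)"
    unfolding act_def by (intro prod.cong refl) auto
  then show ?thesis using finite_G[OF assms(1)] assms(2) by simp
qed

lemma act_one:
  assumes "n > 0" "x \<in> cyc_field n" shows "act n \<one>\<^bsub>Rn n\<^esub> x = x"
proof -
  interpret comm_group "G n" by (rule comm_group_G[OF assms(1)])
  show ?thesis using act_point[OF assms(1) one_closed] assms(2) by (simp add: G_one)
qed

text \<open>Automorphisms of Q(n) with the same restriction to Q(m) take the same value at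
  \<open>x\<close>, and \<open>Rn_restrict\<close> adds up their exponents.\<close>

lemma act_level:
  assumes n: "n > 0" and d: "m dvd n" and x: "x \<in> cyc_field m" "x \<noteq> 0"
  shows "act m (Rn_restrict n m a) x = act n a x"
proof -
  have m: "m > 0" using n d by (auto intro: Nat.gr0I)
  have if_powi: "y powi (if P then k else 0) = (if P then y powi k else 1)" for y :: complex and P k by simp
  have "act m (Rn_restrict n m a) x = (\<Prod>\<rho>\<in>carrier (G m). \<Prod>\<sigma>\<in>carrier (G n).
      if restrict \<sigma> (cyc_field m) = \<rho> then \<rho> x powi a \<sigma> else 1)"
    unfolding act_def Rn_restrict_altdef[OF n]
    using x by (intro prod.cong refl) (simp add: powi_sum G_hom(4)[OF m] if_powi)
  also have "\<dots> = (\<Prod>\<sigma>\<in>carrier (G n). \<Prod>\<rho>\<in>carrier (G m).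
      if restrict \<sigma> (cyc_field m) = \<rho> then \<rho> x powi a \<sigma> else 1)"
    by (rule prod.swap)
  also have "\<dots> = act n a x"
    unfolding act_def using x finite_G[OF m] G_restrict_level[OF n d] by (intro prod.cong refl) simp
  finally show ?thesis .
qed

lemma act_R_level:
  assumes "r \<in> carrier R" "n > 0" "m dvd n" "x \<in> cyc_field m" "x \<noteq> 0"
  shows "act n (r n) x = act m (r m) x"
  using act_level[OF assms(2-5), of "r n"] R_restrict[OF assms(1-3)] by simp

text \<open>Here the commutativity of \<open>G n\<close> enters: the action of \<open>a\<close>
  commutes with every automorphism, so f^r is again equivariant.\<close>

lemma Aut_act:
  assumes s: "\<sigma> \<in> Aut" and n: "n > 0" and x: "x \<in> cyc_field n"
  shows "\<sigma> (act n a x) = act n a (\<sigma> x)"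
proof -
  interpret comm_group "G n" by (rule comm_group_G[OF n])
  define s where "s = restrict \<sigma> (cyc_field n)"
  have sG: "s \<in> carrier (G n)" unfolding s_def by (rule G_restrict[OF n s])
  have "s (act n a x) = (\<Prod>g\<in>carrier (G n). s (g x powi a g))"
    unfolding act_def by (rule G_hom(5)[OF n sG]) (auto intro: cyc_field_powi G_closed[OF n] x)
  also have "\<dots> = (\<Prod>g\<in>carrier (G n). g (s x) powi a g)"
  proof (intro prod.cong refl)
    fix g assume g: "g \<in> carrier (G n)"
    have "s (g x) = (s \<otimes>\<^bsub>G n\<^esub> g) x" using sG g x by (simp add: G_mult compose_def)
    also have "\<dots> = (g \<otimes>\<^bsub>G n\<^esub> s) x" using m_comm[OF sG g] by simp
    also have "\<dots> = g (s x)" using sG g x by (simp add: G_mult compose_def)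
    finally show "s (g x powi a g) = g (s x) powi a g"
      using G_closed[OF n g x] by (simp add: G_hom(3)[OF n sG])
  qed
  finally show ?thesis using act_closed[OF n x] x by (simp add: s_def act_def)
qed

section \<open>The module of equivariant functions\<close>

lemma FF_carrier:
  "f \<in> carrier FF \<longleftrightarrow> f \<in> mu_inf_star \<rightarrow>\<^sub>E Qc - {0} \<and> (\<forall>\<sigma>\<in>Aut. \<forall>w\<in>mu_inf_star. f (\<sigma> w) = \<sigma> (f w))"
  by (simp add: FF_def)

lemma FF_nonzero: "f \<in> carrier FF \<Longrightarrow> w \<in> mu_inf_star \<Longrightarrow> f w \<noteq> 0"
  and FF_Qc: "f \<in> carrier FF \<Longrightarrow> w \<in> mu_inf_star \<Longrightarrow> f w \<in> Qc"
  and FF_Aut: "f \<in> carrier FF \<Longrightarrow> w \<in> mu_inf_star \<Longrightarrow> \<sigma> \<in> Aut \<Longrightarrow> f (\<sigma> w) = \<sigma> (f w)"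
  unfolding FF_carrier by auto

lemma FF_ext: "f \<in> carrier FF \<Longrightarrow> f \<in> extensional mu_inf_star"
  unfolding FF_carrier by (auto simp: PiE_def)

lemma FF_eqI:
  assumes "f \<in> carrier FF" "g \<in> carrier FF" "\<And>w. w \<in> mu_inf_star \<Longrightarrow> f w = g w" shows "f = g"
  by (rule extensionalityI[OF FF_ext[OF assms(1)] FF_ext[OF assms(2)] assms(3)])

text \<open>An automorphism fixing \<open>mu n\<close> fixes \<open>w\<close>, hence
  \<open>f w\<close> by equivariance, so Galois theory puts \<open>f w\<close> into Q(n).\<close>

lemma FF_cyc_field:
  assumes f: "f \<in> carrier FF" and w: "w \<in> mu n" "n > 0" "w \<noteq> 1" shows "f w \<in> cyc_field n"
proof (rule cyc_field_fixed[OF w(2)])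
  have wi: "w \<in> mu_inf_star" using w by (intro mu_inf_starI)
  show "f w \<in> Qc" by (rule FF_Qc[OF f wi])
  fix \<sigma> assume s: "\<sigma> \<in> Aut" "\<And>w. w \<in> mu n \<Longrightarrow> \<sigma> w = w"
  show "\<sigma> (f w) = f w" using FF_Aut[OF f wi s(1)] s(2)[OF w(1)] by simp
qed

lemma FF_cyc_field_order:
  assumes "f \<in> carrier FF" "w \<in> mu_inf_star" shows "f w \<in> cyc_field (root_order w)"
  using FF_cyc_field[OF assms(1) mu_inf_star_order(2)[OF assms(2)]] mu_inf_star_order(1)[OF assms(2)] assms(2)
  by (auto simp: mu_inf_star_iff)

lemma FF_ops:
  "\<zero>\<^bsub>FF\<^esub> = (\<lambda>w\<in>mu_inf_star. 1)" "f \<oplus>\<^bsub>FF\<^esub> g = (\<lambda>w\<in>mu_inf_star. f w * g w)"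
  "r \<odot>\<^bsub>FF\<^esub> f = (\<lambda>w\<in>mu_inf_star. act (root_order w) (r (root_order w)) (f w))"
  by (simp_all add: FF_def)

text \<open>The definition acts at the exact order of the argument. Any multiple of the order may
  serve as level instead, so that roots of unity of different orders can be treated in one
  field.\<close>

lemma FF_smult_apply:
  assumes r: "r \<in> carrier R" and f: "f \<in> carrier FF" and w: "w \<in> mu n" "n > 0" "w \<noteq> 1"
  shows "(r \<odot>\<^bsub>FF\<^esub> f) w = act n (r n) (f w)"
proof -
  have wi: "w \<in> mu_inf_star" using w by (intro mu_inf_starI)
  show ?thesis
    unfolding FF_ops using wi
    by (simp add: act_R_level[OF r w(2) root_order_dvd[OF w(1,2)] FF_cyc_field_order[OF f wi] FF_nonzero[OF f wi]])
qed

lemma mu_inf_star_common: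
  assumes "w \<in> mu_inf_star" obtains n where "n > 0" "w \<in> mu n" "w \<noteq> 1" "root_order w = n"
  using mu_inf_star_order[OF assms] assms by (auto simp: mu_inf_star_iff)

lemma FF_closed:
  shows FF_zero_closed: "\<zero>\<^bsub>FF\<^esub> \<in> carrier FF"
    and FF_add_closed: "f \<in> carrier FF \<Longrightarrow> g \<in> carrier FF \<Longrightarrow> f \<oplus>\<^bsub>FF\<^esub> g \<in> carrier FF"
    and FF_inverse_closed: "f \<in> carrier FF \<Longrightarrow> (\<lambda>w\<in>mu_inf_star. inverse (f w)) \<in> carrier FF"
    and FF_smult_closed: "r \<in> carrier R \<Longrightarrow> f \<in> carrier FF \<Longrightarrow> r \<odot>\<^bsub>FF\<^esub> f \<in> carrier FF"
proof -
  show "\<zero>\<^bsub>FF\<^esub> \<in> carrier FF"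
    unfolding FF_carrier FF_ops by (auto simp: Aut_1 Aut_mu_inf)
  show "f \<oplus>\<^bsub>FF\<^esub> g \<in> carrier FF" if "f \<in> carrier FF" "g \<in> carrier FF"
    using that unfolding FF_ops FF_carrier[of "restrict _ _"]
    by (auto simp: FF_nonzero FF_Qc Qc_mult Aut_mult FF_Aut Aut_mu_inf)
  show "(\<lambda>w\<in>mu_inf_star. inverse (f w)) \<in> carrier FF" if "f \<in> carrier FF"
    using that unfolding FF_carrier[of "restrict _ _"]
    by (auto simp: FF_nonzero FF_Qc Qc_inverse Aut_inverse FF_Aut Aut_mu_inf)
  show "r \<odot>\<^bsub>FF\<^esub> f \<in> carrier FF" if r: "r \<in> carrier R" and f: "f \<in> carrier FF"
  proof -
    have c: "f w \<in> cyc_field (root_order w)" "root_order w > 0" "f w \<noteq> 0" if "w \<in> mu_inf_star" for w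
      using FF_cyc_field_order[OF f that] mu_inf_star_order(1)[OF that] FF_nonzero[OF f that] by auto
    have "act (root_order w) a (f w) \<in> Qc" "act (root_order w) a (f w) \<noteq> 0" if "w \<in> mu_inf_star" for w a
      using c[OF that] act_nonzero cyc_field_Qc[OF _ act_closed] by auto
    then show ?thesis
      unfolding FF_ops FF_carrier
      using c by (auto simp: Aut_mu_inf Aut_root_order FF_Aut[OF f] Aut_act)
  qed
qed

lemma FF_module: "module R FF"
proof (rule moduleI[OF R_cring])
  note ops = FF_ops
  show "abelian_group FF"
  proof (rule abelian_groupI)
    fix f assume f: "f \<in> carrier FF"
    show "\<exists>g\<in>carrier FF. g \<oplus>\<^bsub>FF\<^esub> f = \<zero>\<^bsub>FF\<^esub>"
      using FF_nonzero[OF f] by (intro bexI[OF _ FF_inverse_closed[OF f]]) (auto simp: ops restrict_def)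
    show "\<zero>\<^bsub>FF\<^esub> \<oplus>\<^bsub>FF\<^esub> f = f"
      by (rule FF_eqI[OF FF_add_closed[OF FF_zero_closed f] f]) (simp add: ops)
  qed (simp_all add: FF_add_closed FF_zero_closed, auto simp: ops restrict_def mult_ac)
  fix r s f g assume r: "r \<in> carrier R" and s: "s \<in> carrier R" and f: "f \<in> carrier FF" and g: "g \<in> carrier FF"
  have c: "f w \<in> cyc_field (root_order w)" "g w \<in> cyc_field (root_order w)" "f w \<noteq> 0" "root_order w > 0"
    if "w \<in> mu_inf_star" for w
    using FF_cyc_field_order[OF f that] FF_cyc_field_order[OF g that] FF_nonzero[OF f that]
      mu_inf_star_order(1)[OF that] by auto
  show "r \<odot>\<^bsub>FF\<^esub> f \<in> carrier FF" by (rule FF_smult_closed[OF r f])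
  show "(r \<oplus>\<^bsub>R\<^esub> s) \<odot>\<^bsub>FF\<^esub> f = r \<odot>\<^bsub>FF\<^esub> f \<oplus>\<^bsub>FF\<^esub> s \<odot>\<^bsub>FF\<^esub> f"
    using c by (auto simp: ops R_simps act_add restrict_def)
  show "r \<odot>\<^bsub>FF\<^esub> (f \<oplus>\<^bsub>FF\<^esub> g) = r \<odot>\<^bsub>FF\<^esub> f \<oplus>\<^bsub>FF\<^esub> r \<odot>\<^bsub>FF\<^esub> g"
    using c by (auto simp: ops act_mult_arg restrict_def)
  show "(r \<otimes>\<^bsub>R\<^esub> s) \<odot>\<^bsub>FF\<^esub> f = r \<odot>\<^bsub>FF\<^esub> (s \<odot>\<^bsub>FF\<^esub> f)"
    using c R_component[OF r] R_component[OF s] by (auto simp: ops R_simps act_mult restrict_def)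
next
  fix f assume f: "f \<in> carrier FF"
  have "\<one>\<^bsub>R\<^esub> \<in> carrier R" using R_cring by (simp add: cring_def ring_def monoid.one_closed)
  moreover have "root_order w > 0" if "w \<in> mu_inf_star" for w
    using mu_inf_star_order(1)[OF that] by simp
  ultimately show "\<one>\<^bsub>R\<^esub> \<odot>\<^bsub>FF\<^esub> f = f"
    using FF_cyc_field_order[OF f]
    by (intro FF_eqI[OF FF_smult_closed[OF _ f] f]) (auto simp: FF_ops R_simps act_one simp del: int_group_ring_simps)
qed

lemma FF_abelian_group: "abelian_group FF" and R_abelian_group: "abelian_group R"
  using FF_module by (simp_all add: module_def cring_def ring_def)

lemma FF_a_inv: "f \<in> carrier FF \<Longrightarrow> \<ominus>\<^bsub>FF\<^esub> f = (\<lambda>w\<in>mu_inf_star. inverse (f w))"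
  using FF_nonzero[of f]
  by (intro abelian_group.minus_equality[OF FF_abelian_group] FF_inverse_closed) (auto simp: FF_ops restrict_def)

lemma roots_finite: "a > 0 \<Longrightarrow> finite {w::complex. w ^ a = e}"
  by (rule finite_nth_roots)

lemma roots_mu:
  assumes "e \<in> mu n" "w ^ a = e" shows "w \<in> mu (a * n)"
  using assms by (auto simp: mu_def power_mult)

lemma roots_mu_inf:
  assumes "e \<in> mu_inf_star" "w ^ a = e" "a > 0" shows "w \<in> mu_inf_star"
proof -
  obtain n where n: "n > 0" "e \<in> mu n" "e \<noteq> 1" by (rule mu_inf_star_common[OF assms(1)])
  show ?thesis using roots_mu[OF n(2) assms(2)] n(1,3) assms by (intro mu_inf_starI[of _ "a * n"]) auto
qed

lemma Fd_iff:
  "f \<in> Fd \<longleftrightarrow> f \<in> carrier FF \<and> (\<forall>a e. a > 0 \<longrightarrow> e \<in> mu_inf_star \<longrightarrow> (\<Prod>w\<in>{w. w ^ a = e}. f w) = f e)"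
  unfolding Fd_def by blast

lemma Fd_FF: "f \<in> Fd \<Longrightarrow> f \<in> carrier FF" by (simp add: Fd_iff)

text \<open>The point is stability under \<open>R\<close>: the a-th roots of \<open>e\<close> and
  \<open>e\<close> itself are all handled at the single level a n, where the action is
  multiplicative in its argument.\<close>

lemma Fd_submodule: "submodule Fd R FF"
proof (rule module.submoduleI[OF FF_module])
  show "Fd \<subseteq> carrier FF" by (auto simp: Fd_iff)
  show "\<zero>\<^bsub>FF\<^esub> \<in> Fd"
    unfolding Fd_iff using FF_zero_closed roots_mu_inf
    by (auto simp: FF_ops intro!: prod.neutral)
next
  fix f assume f: "f \<in> Fd"
  show "\<ominus>\<^bsub>FF\<^esub> f \<in> Fd"
    unfolding Fd_iff FF_a_inv[OF Fd_FF[OF f]]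
  proof (intro conjI FF_inverse_closed[OF Fd_FF[OF f]] allI impI)
    fix a :: nat and e assume a: "a > 0" "e \<in> mu_inf_star"
    have "(\<Prod>w\<in>{w. w ^ a = e}. (\<lambda>w\<in>mu_inf_star. inverse (f w)) w) = (\<Prod>w\<in>{w. w ^ a = e}. inverse (f w))"
      using roots_mu_inf[OF a(2) _ a(1)] by (intro prod.cong refl) auto
    also have "\<dots> = inverse (\<Prod>w\<in>{w. w ^ a = e}. f w)" by (simp add: prod_inversef[symmetric] comp_def)
    also have "(\<Prod>w\<in>{w. w ^ a = e}. f w) = f e" using f a by (simp add: Fd_iff)
    finally show "(\<Prod>w\<in>{w. w ^ a = e}. (\<lambda>w\<in>mu_inf_star. inverse (f w)) w) = (\<lambda>w\<in>mu_inf_star. inverse (f w)) e"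
      using a by simp
  qed
next
  fix f g assume fg: "f \<in> Fd" "g \<in> Fd"
  show "f \<oplus>\<^bsub>FF\<^esub> g \<in> Fd"
    unfolding Fd_iff
  proof (intro conjI FF_add_closed Fd_FF fg allI impI)
    fix a :: nat and e assume a: "a > 0" "e \<in> mu_inf_star"
    have "(\<Prod>w\<in>{w. w ^ a = e}. (f \<oplus>\<^bsub>FF\<^esub> g) w) = (\<Prod>w\<in>{w. w ^ a = e}. f w * g w)"
      using roots_mu_inf[OF a(2) _ a(1)] by (intro prod.cong refl) (auto simp: FF_ops)
    also have "\<dots> = f e * g e" using fg a by (simp add: Fd_iff prod.distrib)
    finally show "(\<Prod>w\<in>{w. w ^ a = e}. (f \<oplus>\<^bsub>FF\<^esub> g) w) = (f \<oplus>\<^bsub>FF\<^esub> g) e"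
      using a by (simp add: FF_ops)
  qed
next
  fix r f assume r: "r \<in> carrier R" and f: "f \<in> Fd"
  show "r \<odot>\<^bsub>FF\<^esub> f \<in> Fd"
    unfolding Fd_iff
  proof (intro conjI FF_smult_closed r Fd_FF f allI impI)
    fix a :: nat and e assume a: "a > 0" "e \<in> mu_inf_star"
    obtain n where n: "n > 0" "e \<in> mu n" "e \<noteq> 1" by (rule mu_inf_star_common[OF a(2)])
    have w: "w \<in> mu (a * n)" "w \<noteq> 1" if "w ^ a = e" for w using roots_mu[OF n(2) that] n(3) that by auto
    have an: "a * n > 0" using a n by simp
    have "(\<Prod>w\<in>{w. w ^ a = e}. (r \<odot>\<^bsub>FF\<^esub> f) w) = (\<Prod>w\<in>{w. w ^ a = e}. act (a * n) (r (a * n)) (f w))"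
      using w FF_smult_apply[OF r Fd_FF[OF f] _ an] by (intro prod.cong refl) auto
    also have "\<dots> = act (a * n) (r (a * n)) (\<Prod>w\<in>{w. w ^ a = e}. f w)"
      using w FF_cyc_field[OF Fd_FF[OF f] _ an] by (intro act_prod_arg[OF an, symmetric]) auto
    also have "(\<Prod>w\<in>{w. w ^ a = e}. f w) = f e" using f a by (simp add: Fd_iff)
    also have "act (a * n) (r (a * n)) (f e) = (r \<odot>\<^bsub>FF\<^esub> f) e"
      by (rule FF_smult_apply[OF r Fd_FF[OF f] mu_closed(5)[OF _ n(2)] an n(3), symmetric]) simp
    finally show "(\<Prod>w\<in>{w. w ^ a = e}. (r \<odot>\<^bsub>FF\<^esub> f) w) = (r \<odot>\<^bsub>FF\<^esub> f) e" .
  qed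
qed

text \<open>For a compatible family of automorphisms of the fields Q(n) this is the corresponding
  Galois element inside \<open>R\<close>, with a basis element of the group ring at each
  level.\<close>

definition point :: "(nat \<Rightarrow> complex \<Rightarrow> complex) \<Rightarrow> nat \<Rightarrow> (complex \<Rightarrow> complex) \<Rightarrow> int"
  where "point \<rho> = (\<lambda>n\<in>{0<..}. \<lambda>g. if g = \<rho> n then 1 else 0)"

lemma point_closed:
  assumes "\<And>n. n > 0 \<Longrightarrow> \<rho> n \<in> carrier (G n)"
    and "\<And>n m. n > 0 \<Longrightarrow> m dvd n \<Longrightarrow> restrict (\<rho> n) (cyc_field m) = \<rho> m"
  shows "point \<rho> \<in> carrier R"
proof -
  have "Rn_restrict n m (\<lambda>g. if g = \<rho> n then 1 else 0) = (\<lambda>g. if g = \<rho> m then 1 else 0)"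
    if n: "n > 0" and d: "m dvd n" for n m
  proof
    fix g
    have "Rn_restrict n m (\<lambda>g. if g = \<rho> n then 1 else 0) g =
      (\<Sum>\<sigma>\<in>carrier (G n). if \<sigma> = \<rho> n then (if \<rho> m = g then 1 else 0) else 0)"
      unfolding Rn_restrict_altdef[OF n] using assms(2)[OF n d] by (intro sum.cong refl) auto
    then show "Rn_restrict n m (\<lambda>g. if g = \<rho> n then 1 else 0) g = (if g = \<rho> m then 1 else 0)"
      using finite_G[OF n] assms(1)[OF n] by auto
  qed
  moreover have "m > 0" if "n > 0" "m dvd n" for m n :: nat using that by (auto intro: Nat.gr0I)
  ultimately show ?thesis
    unfolding R_simps point_def using assms(1) by (auto simp: Rn_carrier)
qed

lemma tau_closed: "tau \<in> carrier R"
  and act_tau: "n > 0 \<Longrightarrow> x \<in> cyc_field n \<Longrightarrow> act n (tau n) x = cnj x"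
proof -
  let ?\<rho> = "\<lambda>n. restrict cnj (cyc_field n)"
  have eq: "?\<rho> n = restrict (\<lambda>x\<in>Qc. cnj x) (cyc_field n)" if "n > 0" for n
    using cyc_field_Qc[OF that] by (auto simp: restrict_def)
  have r: "?\<rho> n \<in> carrier (G n)" if "n > 0" for n
    unfolding eq[OF that] by (rule G_restrict[OF that Aut_cnj])
  have t: "tau = point ?\<rho>" unfolding tau_def point_def ..
  show "tau \<in> carrier R"
    unfolding t
  proof (rule point_closed)
    fix n m :: nat assume "n > 0" "m dvd n"
    then show "restrict (?\<rho> n) (cyc_field m) = ?\<rho> m" using cyc_field_mono[of m n] by (auto simp: restrict_def)
  qed (rule r)
  show "act n (tau n) x = cnj x" if "n > 0" "x \<in> cyc_field n"
    using act_point[OF that(1) r[OF that(1)], of x] that by (simp add: tau_def)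
qed

lemma R_one_closed: "\<one>\<^bsub>R\<^esub> \<in> carrier R"
  using R_cring by (simp add: cring_def ring_def monoid.one_closed)

lemma one_tau_closed: "one_plus_tau \<in> carrier R" "one_minus_tau \<in> carrier R"
proof -
  interpret cring R by (rule R_cring)
  show "one_plus_tau \<in> carrier R" "one_minus_tau \<in> carrier R" using tau_closed by simp_all
qed

lemma smult_tau:
  assumes f: "f \<in> carrier FF" and w: "w \<in> mu_inf_star" shows "(tau \<odot>\<^bsub>FF\<^esub> f) w = cnj (f w)"
  using FF_cyc_field_order[OF f w] mu_inf_star_order(1)[OF w] w by (simp add: FF_ops act_tau)

lemma smult_one_plus_tau:
  assumes f: "f \<in> carrier FF"
  shows "one_plus_tau \<odot>\<^bsub>FF\<^esub> f = (\<lambda>w\<in>mu_inf_star. f w * cnj (f w))"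
proof -
  have "one_plus_tau \<odot>\<^bsub>FF\<^esub> f = f \<oplus>\<^bsub>FF\<^esub> tau \<odot>\<^bsub>FF\<^esub> f"
    using module.smult_l_distr[OF FF_module R_one_closed tau_closed f] module.smult_one[OF FF_module f] by simp
  also have "\<dots> = (\<lambda>w\<in>mu_inf_star. f w * cnj (f w))"
    unfolding FF_ops(2) by (intro restrict_ext) (simp add: smult_tau[OF f])
  finally show ?thesis .
qed

lemma smult_one_minus_tau:
  assumes f: "f \<in> carrier FF"
  shows "one_minus_tau \<odot>\<^bsub>FF\<^esub> f = (\<lambda>w\<in>mu_inf_star. f w / cnj (f w))"
proof -
  have "one_minus_tau \<odot>\<^bsub>FF\<^esub> f = f \<oplus>\<^bsub>FF\<^esub> \<ominus>\<^bsub>FF\<^esub> (tau \<odot>\<^bsub>FF\<^esub> f)"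
    using module.smult_l_distr[OF FF_module R_one_closed abelian_group.a_inv_closed[OF R_abelian_group tau_closed] f]
      module.smult_one[OF FF_module f] module.smult_l_minus[OF FF_module tau_closed f]
    by (simp add: a_minus_def)
  also have "\<dots> = (\<lambda>w\<in>mu_inf_star. f w / cnj (f w))"
    unfolding FF_a_inv[OF FF_smult_closed[OF tau_closed f]] FF_ops(2)
    by (intro restrict_ext) (simp add: smult_tau[OF f] divide_inverse)
  finally show ?thesis .
qed

end


section \<open>Valuations above a rational prime\<close>

lemma alg_integers_simps [simp]:
  "x \<in> carrier alg_integers \<longleftrightarrow> algebraic_int x" "\<zero>\<^bsub>alg_integers\<^esub> = 0" "\<one>\<^bsub>alg_integers\<^esub> = 1"
  "x \<oplus>\<^bsub>alg_integers\<^esub> y = x + y" "x \<otimes>\<^bsub>alg_integers\<^esub> y = x * y"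
  by (simp_all add: alg_integers_def complex_ring_def)

lemma alg_integers_cring: "cring alg_integers"
proof (rule cringI)
  show "abelian_group alg_integers"
  proof (rule abelian_groupI)
    fix x assume "x \<in> carrier alg_integers"
    then show "\<exists>y\<in>carrier alg_integers. y \<oplus>\<^bsub>alg_integers\<^esub> x = \<zero>\<^bsub>alg_integers\<^esub>"
      by (intro bexI[of _ "- x"]) auto
  qed (auto intro: algebraic_int_add simp: add_ac)
  show "comm_monoid alg_integers"
    by (rule comm_monoidI) (auto intro: algebraic_int_mult simp: mult_ac)
qed (simp add: distrib_right)

lemma alg_integers_minus [simp]: "algebraic_int x \<Longrightarrow> \<ominus>\<^bsub>alg_integers\<^esub> x = - x"
proof -
  interpret cring alg_integers by (rule alg_integers_cring)
  show "algebraic_int x \<Longrightarrow> \<ominus>\<^bsub>alg_integers\<^esub> x = - x" by (intro minus_equality) auto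
qed

text \<open>Once powers of X are divided out of an integer equation for \<open>x\<close>, its
  constant term is a nonzero integer divisible by \<open>x\<close>.\<close>

lemma algebraic_int_divides_int:
  assumes "algebraic_int x" "x \<noteq> (0 :: complex)"
  shows "\<exists>y k. algebraic_int y \<and> k \<noteq> 0 \<and> x * y = of_int k"
proof -
  have "\<exists>y k. algebraic_int y \<and> k \<noteq> 0 \<and> x * y = of_int k"
    if "poly (of_int_poly p) x = 0" "p \<noteq> 0" for p
    using that
  proof (induction p)
    case (pCons a p)
    have pc: "poly (of_int_poly (pCons a p)) x = of_int a + x * poly (of_int_poly p) x"
      by (simp add: of_int_hom.map_poly_pCons_hom)
    show ?case
    proof (cases "a = 0")
      case True
      then show ?thesis using pCons pc assms(2) by auto
    next
      case False
      have "algebraic_int (poly (of_int_poly p) x)"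
        using csubring_ipoly[OF csubring_algebraic_int, of x p] assms(1) by simp
      moreover have "x * poly (of_int_poly p) x = of_int (- a)"
        using pCons.prems(1) unfolding pc by (simp add: eq_neg_iff_add_eq_0 add.commute)
      ultimately show ?thesis using False by (intro exI[of _ "poly (of_int_poly p) x"] exI[of _ "- a"]) auto
    qed
  qed simp
  moreover obtain p where "poly (of_int_poly p) x = 0" "lead_coeff p = 1"
    using assms(1) by (auto simp: algebraic_int_altdef_ipoly)
  ultimately show ?thesis by (metis leading_coeff_0_iff zero_neq_one)
qed

lemma ipoly_diff:
  assumes A: "csubring A" and xy: "x \<in> A" "y \<in> A"
  shows "\<exists>c\<in>A. poly (of_int_poly p) x - poly (of_int_poly p) y = (x - y) * c"
proof (induction p)
  case 0
  show ?case by (intro bexI[of _ 0]) (auto simp: csubring_closed[OF A])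
next
  case (pCons a p)
  then obtain c where c: "c \<in> A" "poly (of_int_poly p) x - poly (of_int_poly p) y = (x - y) * c" by blast
  have pc: "poly (of_int_poly (pCons a p)) x = of_int a + x * poly (of_int_poly p) x" for x :: complex
    by (simp add: of_int_hom.map_poly_pCons_hom)
  show ?case
  proof (intro bexI)
    have "poly (of_int_poly (pCons a p)) x - poly (of_int_poly (pCons a p)) y =
      x * (poly (of_int_poly p) x - poly (of_int_poly p) y) + (x - y) * poly (of_int_poly p) y"
      unfolding pc by (simp add: algebra_simps)
    then show "poly (of_int_poly (pCons a p)) x - poly (of_int_poly (pCons a p)) y = (x - y) * (x * c + poly (of_int_poly p) y)"
      unfolding c(2) by (simp add: algebra_simps)
    show "x * c + poly (of_int_poly p) y \<in> A"
      using c xy by (intro csubringD[OF A] csubring_ipoly[OF A])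
  qed
qed

definition congm :: "complex set \<Rightarrow> complex \<Rightarrow> complex \<Rightarrow> complex \<Rightarrow> bool"
  where "congm A m x y \<longleftrightarrow> (\<exists>c\<in>A. x - y = m * c)"

lemma congm_refl: "csubring A \<Longrightarrow> congm A m x x"
  unfolding congm_def by (intro bexI[of _ 0]) (auto simp: csubring_closed)

lemma congm_sym: "csubring A \<Longrightarrow> congm A m x y \<Longrightarrow> congm A m y x"
  unfolding congm_def by (metis csubring_closed(2) minus_diff_eq mult_minus_right)

lemma congm_trans: "csubring A \<Longrightarrow> congm A m x y \<Longrightarrow> congm A m y w \<Longrightarrow> congm A m x w"
  unfolding congm_def
proof (elim bexE)
  fix c d assume A: "csubring A" and cd: "c \<in> A" "x - y = m * c" "d \<in> A" "y - w = m * d"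
  have "x - w = m * (c + d)" using cd by (simp add: algebra_simps)
  then show "\<exists>c\<in>A. x - w = m * c" using csubringD(2)[OF A cd(1,3)] by blast
qed

lemma congm_mult_left: "csubring A \<Longrightarrow> b \<in> A \<Longrightarrow> congm A m x y \<Longrightarrow> congm A m (b * x) (b * y)"
  unfolding congm_def
proof (elim bexE)
  fix c assume A: "csubring A" and c: "b \<in> A" "c \<in> A" "x - y = m * c"
  have "b * x - b * y = m * (b * c)" using c by (simp add: right_diff_distrib[symmetric])
  then show "\<exists>c\<in>A. b * x - b * y = m * c" using csubringD(4)[OF A c(1,2)] by blast
qed

lemma congm_ipoly:
  assumes A: "csubring A" and "x \<in> A" "y \<in> A" "congm A m x y"
  shows "congm A m (poly (of_int_poly p) x) (poly (of_int_poly p) y)"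
proof -
  obtain c d where "c \<in> A" "poly (of_int_poly p) x - poly (of_int_poly p) y = (x - y) * c"
    "d \<in> A" "x - y = m * d"
    using ipoly_diff[OF assms(1-3), of p] assms(4) unfolding congm_def by blast
  then show ?thesis unfolding congm_def using csubringD(4)[OF A] by (metis mult.assoc)
qed

lemma congm_power:
  assumes A: "csubring A" and "x \<in> A" "y \<in> A" "congm A m x y" shows "congm A m (x ^ k) (y ^ k)"
  using congm_ipoly[OF assms, of "monom 1 k"] by (simp add: map_poly_monom poly_monom)

section \<open>Cyclotomic integers\<close>

context generators
begin

definition zring :: "nat \<Rightarrow> complex set"
  where "zring n = {poly (of_int_poly p) (z n) | p. True}"

lemma zring_csubring: "csubring (zring n)"
  unfolding csubring_def
proof (intro conjI ballI)
  show "1 \<in> zring n" unfolding zring_def by (intro CollectI exI[of _ 1]) simp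
  fix x y assume "x \<in> zring n" "y \<in> zring n"
  then obtain p q where "x = poly (of_int_poly p) (z n)" "y = poly (of_int_poly q) (z n)" by (auto simp: zring_def)
  then show "x + y \<in> zring n" "x - y \<in> zring n" "x * y \<in> zring n"
    unfolding zring_def
    by (auto intro: exI[of _ "p + q"] exI[of _ "p - q"] exI[of _ "p * q"] simp: of_int_poly_hom.hom_add of_int_poly_hom.hom_mult of_int_poly_hom.hom_minus)
qed

lemma z_zring: "z n \<in> zring n"
  unfolding zring_def by (intro CollectI exI[of _ "[:0, 1:]"]) simp

lemma mu_zring: "n > 0 \<Longrightarrow> w \<in> mu n \<Longrightarrow> w \<in> zring n"
  by (auto intro: csubring_closed(3)[OF zring_csubring z_zring] elim!: mu_cases)

lemma zring_algebraic_int: "n > 0 \<Longrightarrow> x \<in> zring n \<Longrightarrow> algebraic_int x"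
  unfolding zring_def
  using csubring_ipoly[OF csubring_algebraic_int, of "z n"] algebraic_int_root_of_unity[of n "z n"] z_mu[of n]
  by (auto simp: mu_def)

lemma cyc_field_fraction:
  assumes n: "n > 0" and x: "x \<in> cyc_field n"
  obtains a k where "a \<in> zring n" "k \<noteq> (0 :: int)" "x = a / of_int k"
proof -
  obtain p where p: "\<And>i. coeff p i \<in> \<rat>" "x = poly p (z n)"
    using cyc_field_cases[OF n mu_eq_range[OF n] x] by blast
  note A = zring_csubring[of n]
  have "\<exists>a k. a \<in> zring n \<and> k \<noteq> 0 \<and> poly p (z n) = a / of_int k"
    using p(1)
  proof (induction p)
    case 0
    show ?case by (intro exI[of _ 0] exI[of _ 1]) (auto simp: csubring_closed[OF A])
  next
    case (pCons b p)
    have b: "b \<in> \<rat>" "\<And>i. coeff p i \<in> \<rat>"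
      using pCons.prems[of 0] pCons.prems[of "Suc _"] by auto
    obtain a k where ak: "a \<in> zring n" "k \<noteq> 0" "poly p (z n) = a / of_int k" using pCons.IH b by blast
    obtain c d where cd: "d > 0" "b = of_int c / of_int d" using b(1) by (auto elim: Rats_cases')
    show ?case
    proof (intro exI conjI)
      show "of_int (c * k) + of_int d * (z n * a) \<in> zring n"
        by (intro csubringD[OF A] csubring_closed[OF A] z_zring ak)
      show "d * k \<noteq> 0" using cd ak by simp
      show "poly (pCons b p) (z n) = (of_int (c * k) + of_int d * (z n * a)) / of_int (d * k)"
      proof -
        have "a = of_int k * poly p (z n)" "of_int c = b * of_int d" using cd ak by auto
        then show ?thesis using cd ak(2) by (simp add: field_simps)
      qed
    qed
  qed
  then show ?thesis using p(2) that by metis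
qed

end

section \<open>Localisation at a prime ideal of the algebraic integers\<close>

locale prime_over = generators +
  fixes P :: "complex set" and l :: nat
  assumes prime_ideal: "primeideal P alg_integers" and l_mem: "of_nat l \<in> P" and l_prime: "prime l"
begin

lemma P_int: "x \<in> P \<Longrightarrow> algebraic_int x"
  using ideal.Icarr[OF primeideal.axioms(1)[OF prime_ideal], of x] by simp

lemma P_add: "x \<in> P \<Longrightarrow> y \<in> P \<Longrightarrow> x + y \<in> P"
  using additive_subgroup.a_closed[OF ideal.axioms(1)[OF primeideal.axioms(1)[OF prime_ideal]]] by simp

lemma P_mult: "x \<in> P \<Longrightarrow> algebraic_int y \<Longrightarrow> x * y \<in> P" "x \<in> P \<Longrightarrow> algebraic_int y \<Longrightarrow> y * x \<in> P"
  using ideal.I_r_closed[OF primeideal.axioms(1)[OF prime_ideal], of x y]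
    ideal.I_l_closed[OF primeideal.axioms(1)[OF prime_ideal], of x y] by auto

lemma P_uminus: "x \<in> P \<Longrightarrow> - x \<in> P"
  using P_mult(1)[of x "- 1"] by simp

lemma P_diff: "x \<in> P \<Longrightarrow> y \<in> P \<Longrightarrow> x - y \<in> P"
  using P_add[of x "- y"] P_uminus[of y] by simp

lemma P_0: "0 \<in> P"
  using P_mult(1)[OF l_mem, of 0] by simp

lemma P_1: "1 \<notin> P"
proof
  assume "1 \<in> P"
  then have "carrier alg_integers = P" using P_mult(1)[of 1] P_int by auto
  then show False using primeideal.I_notcarr[OF prime_ideal] by simp
qed

lemma P_prime: "algebraic_int x \<Longrightarrow> algebraic_int y \<Longrightarrow> x * y \<in> P \<Longrightarrow> x \<in> P \<or> y \<in> P"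
  using primeideal.I_prime[OF prime_ideal, of x y] by simp

lemma P_power: "algebraic_int x \<Longrightarrow> x ^ k \<in> P \<Longrightarrow> x \<in> P"
  by (induction k) (use P_1 P_prime algebraic_int_power in auto)

lemma P_power_iff: "algebraic_int x \<Longrightarrow> k > 0 \<Longrightarrow> x ^ k \<in> P \<longleftrightarrow> x \<in> P"
  using P_power[of x k] P_mult(1)[of x "x ^ (k - 1)"] algebraic_int_power[of x "k - 1"]
  by (cases k) auto

text \<open>A Bezout relation between l and an integer of \<open>P\<close> prime to l would put 1
  into \<open>P\<close>.\<close>

lemma P_int_iff: "of_int k \<in> P \<longleftrightarrow> int l dvd k"
proof
  assume "int l dvd k"
  then obtain c where "k = int l * c" by blast
  then show "of_int k \<in> P" using P_mult(1)[OF l_mem, of "of_int c"] by simp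
next
  assume k: "of_int k \<in> P"
  show "int l dvd k"
  proof (rule ccontr)
    assume "\<not> int l dvd k"
    then have "coprime (int l) k" using l_prime by (intro prime_imp_coprime) auto
    then obtain x y where "int l * x + k * y = 1" by (metis coprime_iff_gcd_eq_1 bezout_int mult.commute)
    then have "of_nat l * of_int x + of_int k * of_int y = (1 :: complex)"
      by (metis of_int_1 of_int_add of_int_mult of_int_of_nat_eq)
    moreover have "of_nat l * of_int x + of_int k * of_int y \<in> P" by (intro P_add P_mult l_mem k) auto
    ultimately show False using P_1 by simp
  qed
qed

text \<open>The unit group of the local ring at \<open>P\<close>. The fractions range over all
  algebraic integers, so \<open>U\<close> is independent of any number field.\<close>

definition U :: "complex set"
  where "U = {s / t | s t. algebraic_int s \<and> algebraic_int t \<and> s \<notin> P \<and> t \<notin> P}"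

lemma U_I: "algebraic_int s \<Longrightarrow> algebraic_int t \<Longrightarrow> s \<notin> P \<Longrightarrow> t \<notin> P \<Longrightarrow> s / t \<in> U"
  unfolding U_def by blast

lemma U_int: "algebraic_int s \<Longrightarrow> s \<notin> P \<Longrightarrow> s \<in> U"
  using U_I[of s 1] P_1 by simp

lemma U_nonzero: "x \<in> U \<Longrightarrow> x \<noteq> 0"
  unfolding U_def using P_0 by auto

lemma U_1: "1 \<in> U" by (intro U_int P_1) simp

lemma U_mult:
  assumes "x \<in> U" "y \<in> U" shows "x * y \<in> U"
proof -
  obtain s t s' t' where "algebraic_int s" "algebraic_int t" "s \<notin> P" "t \<notin> P" "x = s / t"
    "algebraic_int s'" "algebraic_int t'" "s' \<notin> P" "t' \<notin> P" "y = s' / t'" using assms unfolding U_def by blast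
  then show ?thesis using U_I[of "s * s'" "t * t'"] P_prime algebraic_int_mult by auto
qed

lemma U_inverse: "x \<in> U \<Longrightarrow> inverse x \<in> U"
  unfolding U_def by (force simp: field_simps)

lemma U_divide: "x \<in> U \<Longrightarrow> y \<in> U \<Longrightarrow> x / y \<in> U"
  by (simp add: divide_inverse U_mult U_inverse)

lemma U_power: "x \<in> U \<Longrightarrow> x ^ k \<in> U"
  by (induction k) (auto intro: U_1 U_mult)

lemma U_powi: "x \<in> U \<Longrightarrow> x powi k \<in> U"
  by (auto simp: power_int_def intro: U_power U_inverse)

lemma U_root_of_unity: "n > 0 \<Longrightarrow> w ^ n = 1 \<Longrightarrow> w \<in> U"
  using algebraic_int_root_of_unity[of n w] P_power_iff[of w n] P_1 by (intro U_int) auto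

lemma U_not_P: "x \<in> U \<Longrightarrow> x \<notin> P"
proof
  assume "x \<in> U" "x \<in> P"
  then obtain s t where st: "algebraic_int s" "algebraic_int t" "s \<notin> P" "t \<notin> P" "x = s / t" unfolding U_def by blast
  then have "t \<noteq> 0" using P_0 by auto
  then have "s = x * t" using st by simp
  then show False using P_mult(1)[OF \<open>x \<in> P\<close> st(2)] st(3) by simp
qed

text \<open>A uniformiser at \<open>P\<close> for the fields Q(l^j n) with n prime to l. It can be
  taken from Q(l^j) because the remaining extension is unramified above l. For j = 0 the formula 1 -
  zeta would give 0, and l itself takes its place.\<close>

definition unif :: "nat \<Rightarrow> complex"
  where "unif j = (if j = 0 then of_nat l else 1 - z (l ^ j))"

lemma l_pos: "l > 0" and l_gt_1: "l > 1"
  using prime_gt_1_nat[OF l_prime] by simp_all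

lemma lj_pos: "l ^ j > 0" using l_pos by simp

lemma unif_zring: "unif j \<in> zring (l ^ j)"
  unfolding unif_def by (auto intro: csubringD[OF zring_csubring] csubring_closed[OF zring_csubring] z_zring)

text \<open>The Frobenius congruence for the polynomial 1 - X at y = zeta_(l^j): modulo l, (1 -
  y)^(l^j) agrees with 1 - y^(l^j) = 0.\<close>

lemma unif_power: "\<exists>c. algebraic_int c \<and> unif j ^ (l ^ j) = of_nat l * c"
proof (cases "j = 0")
  case False
  have zi: "algebraic_int (z (l ^ j))" using zring_algebraic_int[OF lj_pos z_zring] .
  obtain c where c: "algebraic_int c"
    "poly (of_int_poly [:1, - 1:]) (z (l ^ j) ^ (l ^ j)) = poly (of_int_poly [:1, - 1:]) (z (l ^ j)) ^ (l ^ j) + of_nat l * c"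
    using frobenius_ipoly_iterated[OF csubring_algebraic_int l_prime, of "z (l ^ j)" "[:1, - 1:]" j] zi by auto
  have e: "poly (of_int_poly [:1, - 1:]) x = 1 - x" for x :: complex
    by (simp add: of_int_hom.map_poly_pCons_hom)
  have "z (l ^ j) ^ (l ^ j) = 1" using z_mu[OF lj_pos, of j] by (simp add: mu_def)
  then have "unif j ^ (l ^ j) = of_nat l * (- c)"
    using c(2) False unfolding e unif_def by (simp add: eq_neg_iff_add_eq_0)
  then show ?thesis using c(1) by (intro exI[of _ "- c"]) auto
qed (auto simp: unif_def intro: exI[of _ 1])

lemma unif_P: "unif j \<in> P"
  using unif_power[of j] P_mult(1)[OF l_mem] P_power_iff[OF zring_algebraic_int[OF lj_pos unif_zring] lj_pos] by metis

lemma unif_int: "algebraic_int (unif j)" by (rule P_int[OF unif_P])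

lemma unif_nonzero: "unif j \<noteq> 0"
proof (cases "j = 0")
  case False
  have "\<not> l ^ j dvd 1" using l_gt_1 False by (simp add: power_0_left)
  then show ?thesis using z_power_eq_1[OF lj_pos, of j 1] False by (simp add: unif_def)
qed (use l_pos in \<open>simp add: unif_def\<close>)

lemma zring_mono: 
  assumes "m dvd n" "n > 0" "x \<in> zring m" shows "x \<in> zring n"
proof -
  have m: "m > 0" using assms by (auto intro: Nat.gr0I)
  have "z m \<in> zring n" by (rule mu_zring[OF assms(2) mu_closed(5)[OF assms(1) z_mu[OF m]]])
  then show ?thesis using assms(3) csubring_ipoly[OF zring_csubring] unfolding zring_def[of m] by auto
qed

text \<open>For a primitive l-th root of unity t the relation 1 + t + ... + t^(l-1) = 0 writes l as
  the sum of the 1 - t^i. Each of these is a multiple of 1 - zeta_(l^j), because t is a power of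
  zeta_(l^j).\<close>

lemma unif_dvd_l: "\<exists>c\<in>zring (l ^ j). of_nat l = unif j * c"
proof (cases "j = 0")
  case True
  then show ?thesis using csubringD(1)[OF zring_csubring] by (intro bexI[of _ 1]) (auto simp: unif_def)
next
  case False
  let ?y = "z (l ^ j)"
  note A = zring_csubring[of "l ^ j"]
  define t where "t = z l"
  have "l ^ j = l ^ (j - 1) * l" using False by (cases j) simp_all
  then have t: "t = ?y ^ (l ^ (j - 1))"
    using z_mult_power[of "l ^ (j - 1)" l] l_pos by (simp add: t_def)
  have "t ^ l = 1" "t \<noteq> 1"
    using z_mu[OF l_pos] z_power_eq_1[OF l_pos, of 1] l_gt_1 by (auto simp: t_def mu_def)
  then have "(\<Sum>i<l. t ^ i) = 0"
    using power_diff_1_eq[of t l] by simp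
  then have "of_nat l = (\<Sum>i<l. 1 - t ^ i)" by (simp add: sum_subtractf)
  also have "\<dots> = (\<Sum>i<l. (1 - ?y) * (\<Sum>k<l ^ (j - 1) * i. ?y ^ k))"
    unfolding t power_mult[symmetric] by (intro sum.cong refl one_diff_power_eq)
  also have "\<dots> = unif j * (\<Sum>i<l. \<Sum>k<l ^ (j - 1) * i. ?y ^ k)"
    using False by (simp add: sum_distrib_left unif_def)
  finally show ?thesis
    by (rule bexI) (intro csubring_closed[OF A] z_zring)
qed

end

text \<open>All orbits of \<open>h\<close> have exactly d elements and \<open>v\<close> is constant
  on each of them; the induction removes one orbit at a time.\<close>

lemma orbit_sum_dvd:
  fixes v :: "'a \<Rightarrow> int"
  assumes "finite S" "d > 0" "\<And>s. s \<in> S \<Longrightarrow> h s \<in> S" "\<And>s. s \<in> S \<Longrightarrow> v (h s) = v s"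
    and per: "\<And>s i. s \<in> S \<Longrightarrow> (h ^^ i) s = s \<longleftrightarrow> d dvd i"
  shows "int d dvd (\<Sum>s\<in>S. v s)"
  using assms(1,3,4) per
proof (induction "card S" arbitrary: S rule: less_induct)
  case less
  show ?case
  proof (cases "S = {}")
    case False
    then obtain s where s: "s \<in> S" by blast
    have it: "(h ^^ i) t \<in> S" "v ((h ^^ i) t) = v t" if "t \<in> S" for i t
      by (induction i) (use that less.prems in auto)
    define B where "B = (\<lambda>i. (h ^^ i) s) ` {..<d}"
    have inj: "inj_on (\<lambda>i. (h ^^ i) s) {..<d}"
    proof (rule linorder_inj_onI)
      fix i j assume ij: "i < j" "i \<in> {..<d}" "j \<in> {..<d}"
      show "(h ^^ i) s \<noteq> (h ^^ j) s"
      proof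
        assume "(h ^^ i) s = (h ^^ j) s"
        also have "\<dots> = (h ^^ (j - i)) ((h ^^ i) s)" using ij by (metis funpow_add comp_apply le_add_diff_inverse2 less_imp_le)
        finally have "d dvd j - i" using less.prems(4)[OF it(1)[OF s]] by metis
        then show False using ij by (auto dest: dvd_imp_le)
      qed
    qed (use nat_le_linear in auto)
    have B: "B \<subseteq> S" "finite B" "s \<in> B"
      using it s assms(2) by (auto simp: B_def intro: image_eqI[of _ _ 0])
    have hB: "h t \<in> B \<longleftrightarrow> t \<in> B" if t: "t \<in> S" for t
    proof
      assume "t \<in> B"
      then obtain i where i: "i < d" "t = (h ^^ i) s" by (auto simp: B_def)
      show "h t \<in> B"
      proof (cases "Suc i = d")
        case True
        then have "h t = s" using i less.prems(4)[OF s, of d] by auto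
        then show ?thesis using B by simp
      next
        case False
        then show ?thesis using i by (auto simp: B_def intro!: image_eqI[of _ _ "Suc i"])
      qed
    next
      assume "h t \<in> B"
      then obtain i where i: "i < d" "h t = (h ^^ i) s" by (auto simp: B_def)
      \<comment> \<open>\<open>h\<close> is inverted by its (d-1)-st iterate, so the complement of
        the orbit is stable as well.\<close>
      have "t = (h ^^ d) t" using less.prems(4)[OF t, of d] by simp
      also have "\<dots> = (h ^^ (d - 1)) (h t)"
        using assms(2) by (cases d) (simp_all add: funpow_swap1)
      also have "\<dots> = (h ^^ (d - 1 + i)) s" unfolding i by (simp add: funpow_add)
      also have "\<dots> = (h ^^ ((d - 1 + i) mod d + d * ((d - 1 + i) div d))) s" by simp
      also have "\<dots> = (h ^^ ((d - 1 + i) mod d)) s"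
      proof -
        have "(h ^^ (d * ((d - 1 + i) div d))) s = s" using less.prems(4)[OF s] dvd_triv_left by blast
        then show ?thesis unfolding funpow_add comp_def by (rule arg_cong)
      qed
      finally show "t \<in> B" using assms(2) by (auto simp: B_def)
    qed
    have "int d dvd (\<Sum>s\<in>S - B. v s)"
    proof (rule less.hyps)
      show "card (S - B) < card S"
        using B s less.prems(1) by (intro psubset_card_mono) auto
    qed (use less.prems hB in auto)
    moreover have "(\<Sum>t\<in>B. v t) = int d * v s"
      unfolding B_def using it(2)[OF s] by (simp add: sum.reindex[OF inj] del: of_nat_mult)
    moreover have "(\<Sum>s\<in>S. v s) = (\<Sum>s\<in>S - B. v s) + (\<Sum>s\<in>B. v s)"
      using B less.prems(1) by (simp add: sum.subset_diff)
    ultimately show ?thesis by simp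
  qed simp
qed

context prime_over
begin

text \<open>Modulo \<open>unif j\<close>, roots of unity of order a power of \<open>l\<close> become trivial, so an automorphism raising
  the roots of unity of order prime to \<open>l\<close> to the power \<open>q = l\<^sup>g\<close> is the \<open>q\<close>-power map.\<close>

lemma zring_frobenius:
  assumes N: "N = l ^ j * n" "n > 0" "\<not> l dvd n" and s: "\<sigma> \<in> Aut"
    and sw: "\<And>w. w \<in> mu n \<Longrightarrow> \<sigma> w = w ^ (l ^ g)" and a: "a \<in> zring N"
  shows "congm (zring N) (unif j) (\<sigma> a) (a ^ (l ^ g))"
    and "[l ^ g = 1] (mod n) \<Longrightarrow> congm (zring N) (unif j) (a ^ (l ^ g)) a"
proof -
  let ?q = "l ^ g"
  let ?c = "congm (zring N) (unif j)"
  have N0: "N > 0" using N lj_pos by simp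
  note A = zring_csubring[of N]
  note cr = congm_refl[OF A] and ct = congm_trans[OF A] and cs = congm_sym[OF A]
  have cop: "coprime n (l ^ j)" using l_prime N(3)
    by (metis coprime_commute coprime_power_right_iff prime_imp_coprime)
  \<comment> \<open>Chinese remaindering of exponents: n x + l^j y = 1 modulo N splits
    \<open>z N\<close> into a root of unity of l-power order and one of order dividing n.\<close>
  obtain x where x: "[n * x = 1] (mod (l ^ j))" using cong_solve_coprime_nat[OF cop] by auto
  obtain y where y: "[l ^ j * y = 1] (mod n)" using cong_solve_coprime_nat[of "l ^ j" n] cop by (auto simp: coprime_commute)
  have "[n * x + l ^ j * y = 1] (mod (l ^ j))"
    using cong_add[OF x cong_mult_self_left[of "l ^ j" y]] by simp
  moreover have "[n * x + l ^ j * y = 1] (mod n)"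
    using cong_add[OF cong_mult_self_left[of n x] y] by simp
  ultimately have "[n * x + l ^ j * y = 1] (mod N)"
    unfolding N(1) using cop by (intro coprime_cong_mult_nat) (auto simp: coprime_commute)
  then have "z N ^ (n * x + l ^ j * y) = z N" using z_power_eq_iff[OF N0, of _ 1] by simp
  moreover have "z N ^ n = z (l ^ j)" "z N ^ (l ^ j) = z n"
    using z_mult_power[of n "l ^ j"] z_mult_power[of "l ^ j" n] N lj_pos by (auto simp: mult.commute)
  ultimately have zN: "z N = z (l ^ j) ^ x * z n ^ y"
    by (simp add: power_add power_mult)
  define e where "e = z n ^ y"
  have e: "e \<in> mu n" unfolding e_def by (rule mu_closed(3)[OF z_mu[OF N(2)]])
  have dv: "n dvd N" "l ^ j dvd N" using N(1) by auto
  have eA: "e \<in> zring N" by (rule zring_mono[OF dv(1) N0 mu_zring[OF N(2) e]])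
  \<comment> \<open>Roots of unity of l-power order are 1 modulo 1 - zeta_(l^j), by the geometric
    sum.\<close>
  have triv: "?c (b * w) b" if b: "b \<in> zring N" and w: "w \<in> mu (l ^ j)" for b w
  proof -
    obtain k where k: "w = z (l ^ j) ^ k" by (rule mu_cases[OF lj_pos w])
    have "?c w 1"
    proof (cases "j = 0")
      case True
      then have "w = 1" using w by (simp add: mu_def)
      then show ?thesis using cr by simp
    next
      case False
      have "w - 1 = unif j * (- (\<Sum>i<k. z (l ^ j) ^ i))"
        unfolding k unif_def using False power_diff_1_eq[of "z (l ^ j)" k] by (simp add: algebra_simps)
      moreover have "- (\<Sum>i<k. z (l ^ j) ^ i) \<in> zring N"
        by (intro csubring_closed[OF A] zring_mono[OF dv(2) N0 z_zring])
      ultimately show ?thesis unfolding congm_def by blast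
    qed
    from congm_mult_left[OF A b this] show ?thesis by simp
  qed
  have zQ: "z (l ^ j) ^ x \<in> mu (l ^ j)" by (rule mu_closed(3)[OF z_mu[OF lj_pos]])
  have zN1: "?c (z N) e" unfolding zN using triv[OF eA zQ] by (simp add: e_def mult.commute)
  have QQ: "z (l ^ j) ^ x \<in> Qc" "e \<in> Qc" using Qc_mu[OF lj_pos zQ] Qc_mu[OF N(2) e] .
  have eqA: "e ^ ?q \<in> zring N" by (rule csubring_closed(3)[OF A eA])
  have "\<sigma> (z N) = e ^ ?q * \<sigma> (z (l ^ j) ^ x)"
    unfolding zN e_def[symmetric] using Aut_mult[OF s QQ] sw[OF e] by simp
  then have szN: "?c (\<sigma> (z N)) (e ^ ?q)"
    using triv[OF eqA Aut_in_mu[OF s lj_pos zQ]] by simp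
  obtain p where p: "a = poly (of_int_poly p) (z N)" using a by (auto simp: zring_def)
  let ?F = "poly (of_int_poly p)"
  have FA: "?F x \<in> zring N" if "x \<in> zring N" for x using csubring_ipoly[OF A that] .
  have sA: "\<sigma> (z N) \<in> zring N" by (rule mu_zring[OF N0 Aut_in_mu[OF s N0 z_mu[OF N0]]])
  have "\<sigma> a = ?F (\<sigma> (z N))" unfolding p
    by (rule Aut_poly[OF s _ Qc_mu[OF N0 z_mu[OF N0]]]) (simp add: coeff_map_poly)
  also have "?c \<dots> (?F (e ^ ?q))" by (rule congm_ipoly[OF A sA eqA szN])
  finally have 1: "?c (\<sigma> a) (?F (e ^ ?q))" .
  obtain c where c: "c \<in> zring N" "?F (e ^ ?q) = ?F e ^ ?q + of_nat l * c"
    using frobenius_ipoly_iterated[OF A l_prime eA] by blast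
  \<comment> \<open>The Frobenius congruence holds modulo l; it is weakened to one modulo
    \<open>unif j\<close>, which divides l.\<close>
  obtain d where d: "d \<in> zring (l ^ j)" "of_nat l = unif j * d" using unif_dvd_l by blast
  have "?F (e ^ ?q) - ?F e ^ ?q = unif j * (d * c)" using c(2) d(2) by simp
  then have 2: "?c (?F (e ^ ?q)) (?F e ^ ?q)"
    unfolding congm_def using csubringD(4)[OF A zring_mono[OF dv(2) N0 d(1)] c(1)] by blast
  have 3: "?c a (?F e)" unfolding p by (rule congm_ipoly[OF A z_zring eA zN1])
  have 4: "?c (a ^ ?q) (?F e ^ ?q)" by (rule congm_power[OF A a FA[OF eA] 3])
  show "?c (\<sigma> a) (a ^ ?q)" by (rule ct[OF ct[OF 1 2] cs[OF 4]])
  show "?c (a ^ ?q) a" if "[?q = 1] (mod n)"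
  proof -
    have "e ^ ?q = e" using mu_power_cong[OF N(2) e that] by simp
    then show ?thesis using ct[OF ct[OF 4 cs[OF 2]]] cs[OF 3] by simp
  qed
qed

lemma congm_P:
  assumes "N > 0" "congm (zring N) (unif j) a b" shows "a \<in> P \<longleftrightarrow> b \<in> P"
proof -
  obtain c where c: "c \<in> zring N" "a - b = unif j * c" using assms(2) by (auto simp: congm_def)
  have "a - b \<in> P" unfolding c(2) by (rule P_mult(1)[OF unif_P zring_algebraic_int[OF assms(1) c(1)]])
  then show ?thesis using P_add[of "a - b" b] P_diff[of a "a - b"] by auto
qed

text \<open>Modulo \<open>P\<close> the automorphism is a power map, and \<open>P\<close> is prime;
  hence it respects \<open>P\<close> on Z[zeta_N], as an element of the decomposition group
  does.\<close>

lemma zring_Aut_P: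
  assumes N: "N = l ^ j * n" "n > 0" "\<not> l dvd n" and s: "\<sigma> \<in> Aut"
    and sw: "\<And>w. w \<in> mu n \<Longrightarrow> \<sigma> w = w ^ (l ^ g)" and a: "a \<in> zring N"
  shows "\<sigma> a \<in> P \<longleftrightarrow> a \<in> P"
proof -
  have N0: "N > 0" using N lj_pos by simp
  have "\<sigma> a \<in> P \<longleftrightarrow> a ^ (l ^ g) \<in> P" by (rule congm_P[OF N0 zring_frobenius(1)[OF N s sw a]])
  also have "\<dots> \<longleftrightarrow> a \<in> P" using P_power_iff[OF zring_algebraic_int[OF N0 a]] l_pos by simp
  finally show ?thesis .
qed

section \<open>Factorisation by the uniformiser and the valuation\<close>

text \<open>Take the largest m such that t a = unif^m s for some t outside \<open>P\<close>. If s
  were in \<open>P\<close>, then s^q - s would be a multiple of the uniformiser while s^(q-1) - 1 is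
  outside \<open>P\<close>; multiplying t by the latter would raise m. So \<open>unif j\<close>
  generates the maximal ideal locally.\<close>

lemma zring_factor:
  assumes N: "N = l ^ j * n" "n > 0" "\<not> l dvd n" and a: "a \<in> zring N" "a \<noteq> 0"
  shows "\<exists>m t s. t \<in> zring N - P \<and> s \<in> zring N - P \<and> t * a = unif j ^ m * s"
proof -
  have N0: "N > 0" using N lj_pos by simp
  note A = zring_csubring[of N]
  note ai = zring_algebraic_int[OF N0]
  define g where "g = totient n"
  define q where "q = l ^ g"
  have "g > 0" unfolding g_def using N(2) by simp
  then have q: "q > 1" unfolding q_def using one_less_power[OF l_gt_1] by blast
  have "coprime l n" using l_prime N(3) by (rule prime_imp_coprime)
  then have q1: "[q = 1] (mod n)" unfolding q_def g_def by (rule euler_theorem)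
  obtain w where w: "algebraic_int w" "unif j ^ (l ^ j) = of_nat l * w" using unif_power by blast
  obtain a' k where k: "algebraic_int a'" "k \<noteq> 0" "a * a' = of_int k"
    using algebraic_int_divides_int[OF ai[OF a(1)] a(2)] by blast
  have "\<not> is_unit (int l)" using l_gt_1 by simp
  then obtain e k' where k': "k = int l ^ e * k'" "\<not> int l dvd k'"
    using multiplicity_decompose'[OF k(2)] by metis
  have kP: "of_int k' \<notin> P" using k'(2) P_int_iff by simp
  let ?M = "\<lambda>m. \<exists>t s. t \<in> zring N - P \<and> s \<in> zring N \<and> t * a = unif j ^ m * s"
  have "?M 0" using csubringD(1)[OF A] P_1 a(1) by (intro exI[of _ 1] exI[of _ a]) auto
  \<comment> \<open>\<open>a\<close> divides k = l^e k', and unif^(l^j) is a multiple of l. With one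
    factor of the uniformiser beyond l^j e to spare, t k' would lie in \<open>P\<close>, although
    neither t nor k' does.\<close>
  moreover have "m < Suc (l ^ j * e)" if M: "?M m" for m
  proof (rule ccontr)
    assume "\<not> m < Suc (l ^ j * e)"
    then have m: "m = l ^ j * e + Suc (m - Suc (l ^ j * e))" by simp
    obtain t s where ts: "t \<in> zring N - P" "s \<in> zring N" "t * a = unif j ^ m * s" using M by blast
    have "unif j ^ (l ^ j * e) * (t * of_int k') = (unif j ^ (l ^ j)) ^ e * t * of_int k'"
      by (simp add: power_mult)
    also have "\<dots> = t * (of_nat l ^ e * of_int k') * w ^ e" unfolding w(2) by (simp add: power_mult_distrib mult_ac)
    also have "of_nat l ^ e * of_int k' = (of_int k :: complex)" unfolding k'(1) by simp
    also have "t * of_int k * w ^ e = (t * a) * a' * w ^ e" unfolding k(3)[symmetric] by simp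
    also have "\<dots> = unif j ^ (l ^ j * e) * (unif j * (unif j ^ (m - Suc (l ^ j * e)) * s * a' * w ^ e))"
      unfolding ts(3) by (subst m) (simp add: power_add mult_ac)
    finally have "t * of_int k' = unif j * (unif j ^ (m - Suc (l ^ j * e)) * s * a' * w ^ e)"
      using unif_nonzero by simp
    also have "\<dots> \<in> P"
      by (intro P_mult(1) unif_P algebraic_int_mult algebraic_int_power unif_int ai ts k w)
    finally show False using P_prime[OF ai, of t "of_int k'"] ts(1) kP by auto
  qed
  ultimately obtain m where m: "?M m" "\<And>m'. ?M m' \<Longrightarrow> m' \<le> m"
    using ex_has_greatest_nat[of ?M 0 "\<lambda>m. m"] by blast
  obtain t s where ts: "t \<in> zring N - P" "s \<in> zring N" "t * a = unif j ^ m * s" using m(1) by blast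
  have "s \<notin> P"
  proof
    assume sP: "s \<in> P"
    have "congm (zring N) (unif j) (s ^ q) s"
    proof -
      have "coprime (l ^ g) n" using \<open>coprime l n\<close> by simp
      then obtain \<sigma> where "\<sigma> \<in> Aut" "\<And>w. w \<in> mu n \<Longrightarrow> \<sigma> w = w ^ (l ^ g)" using Aut_unit[OF N(2)] by blast
      then show ?thesis using zring_frobenius(2)[OF N _ _ ts(2)] q1 unfolding q_def by blast
    qed
    then obtain c where c: "c \<in> zring N" "s ^ q - s = unif j * c" by (auto simp: congm_def)
    have sq: "s ^ q = s ^ (q - 1) * s" using q by (simp add: power_eq_if)
    have "s ^ (q - 1) \<in> P" using P_power_iff[OF ai[OF ts(2)], of "q - 1"] q sP by simp
    then have nP: "s ^ (q - 1) - 1 \<notin> P" using P_diff[of "s ^ (q - 1)" "s ^ (q - 1) - 1"] P_1 by auto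
    have z1: "s ^ (q - 1) - 1 \<in> zring N" by (intro csubringD[OF A] csubring_closed[OF A] ts)
    have "?M (Suc m)"
    proof (intro exI conjI)
      show "t * (s ^ (q - 1) - 1) \<in> zring N - P"
        using ts(1) z1 nP P_prime[OF ai ai, of t "s ^ (q - 1) - 1"] csubringD(4)[OF A] by auto
      show "c \<in> zring N" by (rule c)
      have "t * (s ^ (q - 1) - 1) * a = unif j ^ m * (s ^ q - s)"
        using ts(3) unfolding sq by (simp add: algebra_simps)
      then show "t * (s ^ (q - 1) - 1) * a = unif j ^ Suc m * c" unfolding c(2) by simp
    qed
    then show False using m(2) by fastforce
  qed
  then show ?thesis using ts by blast
qed

lemma U_unif_powi: "unif j powi k \<in> U \<longleftrightarrow> k = 0"
proof
  have *: "unif j ^ n \<notin> U" if "n > 0" for n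
    using U_not_P[of "unif j ^ n"] P_power_iff[OF unif_int that] unif_P by blast
  show "k = 0" if "unif j powi k \<in> U"
  proof (rule ccontr)
    assume "k \<noteq> 0"
    show False
    proof (cases "k > 0")
      case True
      then show False using that *[of "nat k"] by (simp add: power_int_def)
    next
      case False
      then have "inverse (unif j powi k) = unif j ^ nat (- k)" using \<open>k \<noteq> 0\<close> by (simp add: power_int_def power_inverse)
      then show False using U_inverse[OF that] *[of "nat (- k)"] False \<open>k \<noteq> 0\<close> by simp
    qed
  qed
qed (simp add: U_1)

lemma cyc_field_factor:
  assumes N: "N = l ^ j * n" "n > 0" "\<not> l dvd n" and x: "x \<in> cyc_field N" "x \<noteq> 0"
  obtains m s t where "s \<in> zring N - P" "t \<in> zring N - P" "x = unif j powi m * (s / t)"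
proof -
  have N0: "N > 0" using N lj_pos by simp
  note A = zring_csubring[of N]
  obtain a k where ak: "a \<in> zring N" "k \<noteq> (0 :: int)" "x = a / of_int k" by (rule cyc_field_fraction[OF N0 x(1)])
  then have a0: "a \<noteq> 0" using x by auto
  have k: "of_int k \<in> zring N" "of_int k \<noteq> (0 :: complex)" using ak csubring_closed(5)[OF A] by auto
  obtain m t s where m: "t \<in> zring N - P" "s \<in> zring N - P" "t * a = unif j ^ m * s"
    using zring_factor[OF N ak(1) a0] by blast
  obtain m' t' s' where m': "t' \<in> zring N - P" "s' \<in> zring N - P" "t' * of_int k = unif j ^ m' * s'"
    using zring_factor[OF N k] by blast
  have nz: "t \<noteq> 0" "t' \<noteq> 0" "s' \<noteq> 0" "s \<noteq> 0" using m m' P_0 by auto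
  have cl: "u * v \<in> zring N - P" if "u \<in> zring N - P" "v \<in> zring N - P" for u v
    using that csubringD(4)[OF A] P_prime[OF zring_algebraic_int zring_algebraic_int, OF N0 _ N0] by auto
  have a: "a = unif j ^ m * s / t" "of_int k = unif j ^ m' * s' / t'" using m(3) m'(3) nz by (auto simp: field_simps)
  show ?thesis
  proof (rule that[OF cl[OF m(2) m'(1)] cl[OF m(1) m'(2)]])
    have "unif j powi (int m - int m') = unif j ^ m / unif j ^ m'" using unif_nonzero by (simp add: power_int_diff)
    then show "x = unif j powi (int m - int m') * (s * t' / (t * s'))"
      unfolding ak(3) a using nz unif_nonzero by (simp add: field_simps)
  qed
qed

text \<open>Normalised so that \<open>unif j\<close> has value 1. The description is meaningful only
  where a factorisation exists, which is why later rules carry membership in \<open>U\<close> as a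
  premise.\<close>

definition val :: "nat \<Rightarrow> complex \<Rightarrow> int"
  where "val j x = (THE m. x / unif j powi m \<in> U)"

lemma val_eqI:
  assumes "x / unif j powi m \<in> U" shows "val j x = m"
  unfolding val_def
proof (rule the_equality[where P = "\<lambda>m. x / unif j powi m \<in> U", OF assms])
  fix m' assume m': "x / unif j powi m' \<in> U"
  have x: "x \<noteq> 0" using U_nonzero[OF assms] by auto
  have "(x / unif j powi m) / (x / unif j powi m') = unif j powi (m' - m)"
    using x unif_nonzero by (simp add: power_int_diff)
  then show "m' = m" using U_divide[OF assms m'] U_unif_powi by simp
qed

lemma U_fraction: "N > 0 \<Longrightarrow> s \<in> zring N - P \<Longrightarrow> t \<in> zring N - P \<Longrightarrow> s / t \<in> U"
  by (intro U_I) (auto simp: zring_algebraic_int)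

lemma val_U:
  assumes N: "N = l ^ j * n" "n > 0" "\<not> l dvd n" and x: "x \<in> cyc_field N" "x \<noteq> 0"
  shows "x / unif j powi val j x \<in> U"
proof -
  have N0: "N > 0" using N lj_pos by simp
  obtain m s t where m: "s \<in> zring N - P" "t \<in> zring N - P" "x = unif j powi m * (s / t)"
    by (rule cyc_field_factor[OF N x])
  have "x / unif j powi m \<in> U" using U_fraction[OF N0 m(1,2)] m(3) unif_nonzero by simp
  then show ?thesis using val_eqI by metis
qed

lemma val_mult:
  assumes "x / unif j powi val j x \<in> U" "y / unif j powi val j y \<in> U"
  shows "val j (x * y) = val j x + val j y"
proof (rule val_eqI)
  have *: "x * y / unif j powi (val j x + val j y) = (x / unif j powi val j x) * (y / unif j powi val j y)"
    using unif_nonzero by (simp add: power_int_add)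
  show "x * y / unif j powi (val j x + val j y) \<in> U" unfolding * by (rule U_mult[OF assms])
qed

lemma val_prod:
  assumes "\<And>i. i \<in> I \<Longrightarrow> f i / unif j powi val j (f i) \<in> U"
  shows "(\<Prod>i\<in>I. f i) / unif j powi (\<Sum>i\<in>I. val j (f i)) \<in> U"
  using assms
proof (induction I rule: infinite_finite_induct)
  case (insert i I)
  have *: "(\<Prod>i\<in>insert i I. f i) / unif j powi (\<Sum>i\<in>insert i I. val j (f i)) =
    (f i / unif j powi val j (f i)) * ((\<Prod>i\<in>I. f i) / unif j powi (\<Sum>i\<in>I. val j (f i)))"
    using insert unif_nonzero by (simp add: power_int_add)
  show ?case unfolding * by (intro U_mult insert) auto
qed (simp_all add: U_1)

text \<open>The automorphism keeps elements of Z[zeta_N] outside \<open>P\<close> outside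
  \<open>P\<close> and changes the uniformiser by a unit only, so a factorisation of
  \<open>x\<close> is carried to one of its image with the same exponent.\<close>

lemma val_Aut:
  assumes N: "N = l ^ j * n" "n > 0" "\<not> l dvd n" and s: "\<sigma> \<in> Aut"
    and sw: "\<And>w. w \<in> mu n \<Longrightarrow> \<sigma> w = w ^ (l ^ g)" and sp: "\<sigma> (unif j) / unif j \<in> U"
    and x: "x \<in> cyc_field N" "x \<noteq> 0"
  shows "val j (\<sigma> x) = val j x"
proof -
  have N0: "N > 0" using N lj_pos by simp
  obtain m r t where m: "r \<in> zring N - P" "t \<in> zring N - P" "x = unif j powi m * (r / t)"
    by (rule cyc_field_factor[OF N x])
  have nz: "r \<noteq> 0" "t \<noteq> 0" using m P_0 by auto
  have Q: "r \<in> Qc" "t \<in> Qc" "unif j \<in> Qc"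
    using m zring_algebraic_int[OF N0] unif_int by (auto simp: Qc_def)
  have "\<sigma> a \<in> zring N - P" if a: "a \<in> zring N - P" for a
  proof -
    obtain p where p: "a = poly (of_int_poly p) (z N)" using a by (auto simp: zring_def)
    have "\<sigma> a = poly (of_int_poly p) (\<sigma> (z N))" unfolding p
      by (rule Aut_poly[OF s _ Qc_mu[OF N0 z_mu[OF N0]]]) (simp add: coeff_map_poly)
    also have "\<dots> \<in> zring N"
      by (rule csubring_ipoly[OF zring_csubring mu_zring[OF N0 Aut_in_mu[OF s N0 z_mu[OF N0]]]])
    finally show ?thesis using zring_Aut_P[OF N s sw, where a = a] a by blast
  qed
  then have U': "\<sigma> r / \<sigma> t \<in> U" using m U_fraction[OF N0] by blast
  have "\<sigma> x = \<sigma> (unif j) powi m * (\<sigma> r / \<sigma> t)"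
    unfolding m(3) divide_inverse using Q s
    by (simp add: Aut_mult Aut_powi Aut_inverse Qc_closed Qc_powi)
  then have "\<sigma> x / unif j powi m = (\<sigma> (unif j) / unif j) powi m * (\<sigma> r / \<sigma> t)"
    by (simp add: power_int_divide_distrib)
  then have "val j (\<sigma> x) = m" using U_mult[OF U_powi[OF sp] U'] by (intro val_eqI) simp
  moreover have "val j x = m" using U_fraction[OF N0 m(1,2)] m(3) unif_nonzero by (intro val_eqI) simp
  ultimately show ?thesis by simp
qed

end


section \<open>Torsion-valued distributions\<close>

context generators
begin

text \<open>Suppose the order of \<open>v\<close> is a proper divisor of p^k n, with n the order of
  \<open>w\<close>, and let q be a prime factor of the cofactor. Then q divides n, in the case q = p
  by hypothesis, and w^(n/q) would already be 1.\<close>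

lemma root_order_root:
  assumes w: "w \<in> mu_inf_star" and p: "prime p" "p dvd root_order w" and v: "v ^ (p ^ k) = w"
  shows "root_order v = p ^ k * root_order w"
proof -
  let ?n = "root_order w" and ?r = "root_order v"
  have n: "?n > 0" using mu_inf_star_order(1)[OF w] by simp
  have pk: "p ^ k > 0" using p(1) by (simp add: prime_gt_0_nat)
  have vi: "v \<in> mu_inf_star" by (rule roots_mu_inf[OF w v pk])
  have "v ^ (p ^ k * ?n) = 1" unfolding power_mult v using mu_inf_star_order(2)[OF w] by (simp add: mu_def)
  then have "?r dvd p ^ k * ?n" using mu_inf_star_order(3)[OF vi] by simp
  then obtain d where d: "p ^ k * ?n = ?r * d" by blast
  have "d = 1"
  proof (rule ccontr)
    assume "d \<noteq> 1"
    then obtain q where q: "prime q" "q dvd d" using prime_factor_nat by blast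
    have "q dvd p ^ k * ?n" using q(2) d by (simp add: dvd_mult)
    then have "q dvd ?n"
      using q(1) p by (metis prime_dvd_mult_iff prime_dvd_power primes_dvd_imp_eq)
    then obtain n' where n': "?n = q * n'" by blast
    obtain d' where d': "d = q * d'" using q(2) by blast
    have "q > 0" using q(1) by (simp add: prime_gt_0_nat)
    then have "p ^ k * n' = ?r * d'" using d n' d' by simp
    then have "v ^ (p ^ k * n') = 1" using mu_inf_star_order(3)[OF vi] by simp
    then have "w ^ n' = 1" unfolding power_mult v .
    then have "?n dvd n'" using mu_inf_star_order(3)[OF w] by simp
    moreover have "n' > 0" using n n' by (cases n') auto
    ultimately have "?n \<le> n'" by (rule dvd_imp_le)
    then show False using n' q(1) \<open>n' > 0\<close> prime_gt_1_nat[OF q(1)] by simp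
  qed
  then show ?thesis using d by simp
qed

end

context prime_over
begin

text \<open>The values of a distribution at order \<open>n\<close> are norms from arbitrarily high levels of the
  cyclotomic \<open>\<int>\<^sub>p\<close>-tower, in which the decomposition group of a prime above \<open>l \<noteq> p\<close> grows without bound;
  hence their valuations are divisible by arbitrarily large integers.\<close>

lemma Fd_unit:
  assumes f: "f \<in> Fd" and w: "w \<in> mu_inf_star" and p: "prime p" "p \<noteq> l" "p dvd root_order w"
  shows "f w \<in> U"
proof -
  let ?n = "root_order w"
  have n0: "?n > 0" using mu_inf_star_order(1)[OF w] by simp
  have fF: "f \<in> carrier FF" by (rule Fd_FF[OF f])
  obtain n where n: "?n = l ^ multiplicity l ?n * n" "\<not> l dvd n"
    using multiplicity_decompose'[of ?n l] n0 l_gt_1 by auto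
  define j where "j = multiplicity l ?n"
  have nj: "?n = l ^ j * n" using n(1) by (simp add: j_def)
  have npos: "n > 0" using n0 nj by (cases n) auto
  have pn: "p dvd n" using p nj l_prime by (metis prime_dvd_mult_iff prime_dvd_power primes_dvd_imp_eq)
  define g where "g = totient n"
  define q where "q = l ^ g"
  have "g > 0" unfolding g_def using npos by simp
  then have q: "q > 1" unfolding q_def using one_less_power[OF l_gt_1] by blast
  have cop: "coprime l n" using l_prime n(2) by (rule prime_imp_coprime)
  then have q1: "[q = 1] (mod n)" unfolding q_def g_def by (rule euler_theorem)
  have key: "\<exists>d > b. int d dvd val j (f w)" for b
  proof -
    \<comment> \<open>The height of the tower: p^k then exceeds q^b, so q has multiplicative order
      larger than b modulo p^k.\<close>
    define k where "k = q ^ b"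
    define n' where "n' = p ^ k * n"
    define N where "N = p ^ k * ?n"
    have pk: "p ^ k > 0" using p(1) by (simp add: prime_gt_0_nat)
    have n': "n' > 0" "\<not> l dvd n'"
      using npos pk n(2) p(1,2) l_prime unfolding n'_def
      by (auto simp: prime_dvd_mult_iff dest: prime_dvd_power primes_dvd_imp_eq)
    have N: "N = l ^ j * n'" unfolding N_def n'_def nj by (simp add: mult_ac)
    have N0: "N > 0" using N_def pk n0 by simp
    have copn': "coprime l n'" using l_prime n'(2) by (rule prime_imp_coprime)
    \<comment> \<open>The exponent of a Frobenius power in the decomposition group of
      \<open>P\<close>: trivial on roots of unity of l-power order, the q-power map on
      \<open>mu n'\<close>.\<close>
    then obtain u where u: "[u = 1] (mod (l ^ j))" "[u = q] (mod n')"
      using binary_chinese_remainder_nat[of "l ^ j" n' 1 q] by auto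
    have cu: "coprime u N"
    proof -
      have "coprime u (l ^ j)" using u(1) by (metis cong_imp_coprime cong_sym coprime_1_left)
      moreover have "coprime q n'" unfolding q_def using copn' by simp
      then have "coprime u n'" using u(2) by (metis cong_imp_coprime cong_sym)
      ultimately show ?thesis unfolding N by simp
    qed
    obtain \<sigma> where s: "\<sigma> \<in> Aut" "\<And>v. v \<in> mu N \<Longrightarrow> \<sigma> v = v ^ u" using Aut_unit[OF N0 cu] by blast
    have dv: "l ^ j dvd N" "n' dvd N" using N by auto
    have s1: "\<sigma> v = v" if "v \<in> mu (l ^ j)" for v
      using s(2)[OF mu_closed(5)[OF dv(1) that]] mu_power_cong[OF lj_pos that u(1)] by simp
    have s2: "\<sigma> v = v ^ (l ^ g)" if "v \<in> mu n'" for v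
      using s(2)[OF mu_closed(5)[OF dv(2) that]] mu_power_cong[OF n'(1) that u(2)] by (simp add: q_def)
    have s3: "\<sigma> (unif j) / unif j \<in> U"
    proof -
      have zj: "z (l ^ j) \<in> mu (l ^ j)" "z (l ^ j) \<in> Qc"
        using z_mu[OF lj_pos] Qc_mu[OF lj_pos z_mu[OF lj_pos]] by auto
      have "\<sigma> (unif j) = unif j"
        unfolding unif_def using s(1) s1[OF zj(1)] zj(2) by (simp add: Aut_rat Aut_diff Aut_1)
      then show ?thesis using unif_nonzero U_1 by simp
    qed
    define S where "S = {v. v ^ (p ^ k) = w}"
    have S: "v \<in> mu_inf_star" "root_order v = N" "v \<in> mu N" if "v \<in> S" for v
    proof -
      show vi: "v \<in> mu_inf_star" using roots_mu_inf[OF w _ pk] that by (auto simp: S_def)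
      show o: "root_order v = N" unfolding N_def by (rule root_order_root[OF w p(1,3)]) (use that in \<open>simp add: S_def\<close>)
      show "v \<in> mu N" using mu_inf_star_order(2)[OF vi] o by simp
    qed
    have fv: "f v \<in> cyc_field N" "f v \<noteq> 0" if "v \<in> S" for v
      using FF_cyc_field_order[OF fF S(1)[OF that]] S(2)[OF that] FF_nonzero[OF fF S(1)[OF that]] by auto
    \<comment> \<open>Since q = 1 modulo n, the automorphism fixes \<open>w\<close> and therefore
      permutes the p^k-th roots of \<open>w\<close>.\<close>
    have un1: "[u = 1] (mod ?n)"
    proof -
      have "n dvd n'" by (simp add: n'_def)
      then have "[u = q] (mod n)" by (rule cong_dvd_modulus_nat[OF u(2)])
      then have "[u = 1] (mod n)" using q1 by (rule cong_trans)
      then show ?thesis unfolding nj using u(1) cop by (intro coprime_cong_mult_nat) auto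
    qed
    \<comment> \<open>All roots in \<open>S\<close> have exact order N, so every orbit has length
      equal to the multiplicative order of u modulo N.\<close>
    define d where "d = ord N u"
    have d0: "d > 0" unfolding d_def using cu by (simp add: coprime_commute)
    have it: "((\<lambda>v. v ^ u) ^^ i) v = v ^ (u ^ i)" for i and v :: complex
      by (induction i) (simp_all add: power_mult[symmetric] mult.commute)
    have "int d dvd (\<Sum>v\<in>S. val j (f v))"
    proof (rule orbit_sum_dvd[where h = "\<lambda>v. v ^ u"])
      show "finite S" unfolding S_def by (rule roots_finite[OF pk])
      show "d > 0" by (rule d0)
    next
      fix v assume v: "v \<in> S"
      have "(v ^ u) ^ (p ^ k) = (v ^ (p ^ k)) ^ u" by (simp only: power_mult[symmetric] mult.commute)
      also have "v ^ (p ^ k) = w" using v by (simp add: S_def)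
      also have "w ^ u = w" using mu_power_cong[OF n0 mu_inf_star_order(2)[OF w] un1] by simp
      finally show "v ^ u \<in> S" by (simp add: S_def)
      have "f (v ^ u) = \<sigma> (f v)" using FF_Aut[OF fF S(1)[OF v] s(1)] s(2)[OF S(3)[OF v]] by simp
      then show "val j (f (v ^ u)) = val j (f v)"
        using val_Aut[OF N n' s(1) s2 s3 fv[OF v]] by simp
    next
      fix v i assume v: "v \<in> S"
      obtain x where x: "v = z N ^ x" by (rule mu_cases[OF N0 S(3)[OF v]])
      have cx: "coprime x N" using coprime_if_order[OF N0] S(2)[OF v] x by simp
      have "v ^ (u ^ i) = v \<longleftrightarrow> [x * u ^ i = x * 1] (mod N)"
        unfolding x power_mult[symmetric] using z_power_eq_iff[OF N0] by simp
      also have "\<dots> \<longleftrightarrow> [u ^ i = 1] (mod N)" using cx by (rule cong_mult_lcancel_nat)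
      also have "\<dots> \<longleftrightarrow> d dvd i" unfolding d_def by (rule ord_divides)
      finally show "((\<lambda>v. v ^ u) ^^ i) v = v \<longleftrightarrow> d dvd i" unfolding it .
    qed
    moreover have "val j (f w) = (\<Sum>v\<in>S. val j (f v))"
    proof (rule val_eqI)
      have "f w = (\<Prod>v\<in>S. f v)" using f w pk unfolding Fd_iff S_def by simp
      then show "f w / unif j powi (\<Sum>v\<in>S. val j (f v)) \<in> U"
        using val_prod[of S f j] val_U[OF N n' fv] by simp
    qed
    moreover have "d > b"
    proof (rule ccontr)
      assume "\<not> d > b"
      have "[u ^ d = 1] (mod N)" unfolding d_def by (rule ord)
      then have "[u ^ d = 1] (mod n')" using dv(2) by (rule cong_dvd_modulus_nat)
      then have "[q ^ d = 1] (mod n')" using cong_pow[OF u(2), of d] by (metis cong_sym cong_trans)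
      then have "[q ^ d = 1] (mod (p ^ k))" by (rule cong_dvd_modulus_nat) (simp add: n'_def)
      then have "p ^ k dvd q ^ d - 1" using q by (simp add: cong_altdef_nat)
      moreover have "q ^ d > 1" using one_less_power[OF q d0] .
      ultimately have "p ^ k \<le> q ^ d - 1" by (intro dvd_imp_le) auto
      also have "\<dots> < q ^ d" using \<open>q ^ d > 1\<close> by simp
      also have "\<dots> \<le> q ^ b" using \<open>\<not> d > b\<close> q by (intro power_increasing) auto
      also have "\<dots> = k" by (simp add: k_def)
      also have "\<dots> < 2 ^ k" by (rule less_exp)
      also have "\<dots> \<le> p ^ k" using prime_ge_2_nat[OF p(1)] by (rule power_mono) simp
      finally show False by simp
    qed
    ultimately show ?thesis by auto
  qed
  have "val j (f w) = 0"
  proof (rule ccontr)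
    assume nz: "val j (f w) \<noteq> 0"
    obtain d where d: "d > nat \<bar>val j (f w)\<bar>" "int d dvd val j (f w)" using key by blast
    then have "int d \<le> \<bar>val j (f w)\<bar>" using nz by (metis abs_of_nat dvd_imp_le_int)
    then show False using d(1) by linarith
  qed
  moreover have "f w / unif j powi val j (f w) \<in> U"
    by (rule val_U[OF nj npos n(2) FF_cyc_field_order[OF fF w] FF_nonzero[OF fF w]])
  ultimately show ?thesis by simp
qed

text \<open>An order with a prime factor other than l falls under \<open>Fd_unit\<close>. At order
  l^j conjugation preserves the valuation, and the equal valuations of \<open>f w\<close> and its
  conjugate add up to 0.\<close>

lemma kernel_unit:
  assumes f: "f \<in> Fd" and w: "w \<in> mu_inf_star" and k: "f w * cnj (f w) = 1"
  shows "f w \<in> U"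
proof -
  let ?n = "root_order w"
  have n0: "?n > 0" using mu_inf_star_order(1)[OF w] by simp
  have fF: "f \<in> carrier FF" by (rule Fd_FF[OF f])
  obtain n where n: "?n = l ^ multiplicity l ?n * n" "\<not> l dvd n"
    using multiplicity_decompose'[of ?n l] n0 l_gt_1 by auto
  define j where "j = multiplicity l ?n"
  have nj: "?n = l ^ j * n" using n(1) by (simp add: j_def)
  show ?thesis
  proof (cases "n = 1")
    case False
    then obtain p where p: "prime p" "p dvd n" using prime_factor_nat by blast
    then have "p \<noteq> l" "p dvd ?n" using n(2) nj by auto
    then show ?thesis using Fd_unit[OF f w p(1)] by blast
  next
    case True
    let ?c = "\<lambda>x\<in>Qc. cnj x"
    have N: "?n = l ^ j * 1" "(1 :: nat) > 0" "\<not> l dvd 1" using nj True l_gt_1 by auto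
    have zj: "z (l ^ j) \<in> mu (l ^ j)" "z (l ^ j) \<in> Qc"
      using z_mu[OF lj_pos] Qc_mu[OF lj_pos z_mu[OF lj_pos]] by auto
    have cU: "?c (unif j) / unif j \<in> U"
    proof (cases "j = 0")
      case True
      then show ?thesis using l_pos U_1 by (simp add: unif_def Qc_Rats)
    next
      case False
      let ?y = "z (l ^ j)"
      have y1: "?y ^ (l ^ j) = 1" using zj(1) by (simp add: mu_def)
      \<comment> \<open>On the unit circle conjugation multiplies 1 - y by the unit -1/y.\<close>
      have "cnj ?y * ?y = 1"
      proof -
        have "norm ?y = 1" using power_eq_1_iff[OF y1] lj_pos by auto
        then show ?thesis using complex_norm_square[of ?y] by (simp add: mult.commute)
      qed
      then have "(1 - cnj ?y) * ?y = - (1 - ?y)" by (simp add: algebra_simps)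
      then have "(1 - cnj ?y) = - 1 * inverse ?y * (1 - ?y)"
        using mu_nonzero[OF lj_pos zj(1)] by (simp add: field_simps)
      then have "?c (unif j) / unif j = - 1 * inverse ?y"
        using False unif_nonzero[of j] unif_int[of j] by (simp add: unif_def Qc_def algebraic_int_imp_algebraic)
      also have "\<dots> \<in> U" by (intro U_mult U_inverse U_root_of_unity[OF lj_pos y1] U_root_of_unity[of 2]) auto
      finally show ?thesis .
    qed
    have x: "f w \<in> cyc_field ?n" "f w \<noteq> 0" using FF_cyc_field_order[OF fF w] FF_nonzero[OF fF w] .
    have "val j (?c (f w)) = val j (f w)"
    proof (rule val_Aut[OF N Aut_cnj _ cU x])
      \<comment> \<open>The part of the level prime to l is 1, so the Frobenius condition on
        conjugation concerns only the root of unity 1, and any power of l may serve as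
        exponent.\<close>
      fix v assume "v \<in> mu 1"
      then show "?c v = v ^ (l ^ 1)" by (simp add: mu_def)
    qed
    moreover have "?c (f w) = cnj (f w)" using FF_Qc[OF fF w] by simp
    ultimately have c: "val j (cnj (f w)) = val j (f w)" by simp
    have xc: "cnj (f w) \<in> cyc_field ?n" "cnj (f w) \<noteq> 0"
      using Aut_cyc_field[OF Aut_cnj n0 x(1)] x(2) FF_Qc[OF fF w] by auto
    have "val j (f w * cnj (f w)) = val j (f w) + val j (cnj (f w))"
      by (rule val_mult[OF val_U[OF N x] val_U[OF N xc]])
    moreover have "val j (f w * cnj (f w)) = 0" unfolding k by (rule val_eqI) (simp add: U_1)
    ultimately have "val j (f w) = 0" using c by simp
    then show ?thesis using val_U[OF N x] by simp
  qed
qed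

end

section \<open>Integrality from local conditions\<close>

definition int_ideal :: "complex set \<Rightarrow> bool"
  where "int_ideal J \<longleftrightarrow> J \<subseteq> {x. algebraic_int x} \<and> 0 \<in> J \<and> (\<forall>x\<in>J. \<forall>y\<in>J. x + y \<in> J) \<and>
    (\<forall>x\<in>J. \<forall>a. algebraic_int a \<longrightarrow> a * x \<in> J)"

lemma int_idealD:
  assumes "int_ideal J"
  shows "x \<in> J \<Longrightarrow> algebraic_int x" "0 \<in> J" "x \<in> J \<Longrightarrow> y \<in> J \<Longrightarrow> x + y \<in> J"
    "x \<in> J \<Longrightarrow> algebraic_int a \<Longrightarrow> a * x \<in> J"
  using assms unfolding int_ideal_def by auto

text \<open>Zorn's lemma gives an ideal maximal among the proper ones containing \<open>I\<close>.
  It is prime: for a outside it, a relation 1 = m + c a multiplied by b expresses b through m and a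
  b.\<close>

lemma int_ideal_extend_prime:
  assumes I: "int_ideal I" "1 \<notin> I"
  obtains M where "primeideal M alg_integers" "I \<subseteq> M"
proof -
  let ?A = "{J. int_ideal J \<and> 1 \<notin> J \<and> I \<subseteq> J}"
  have "\<exists>M\<in>?A. \<forall>X\<in>?A. M \<subseteq> X \<longrightarrow> X = M"
  proof (rule subset_Zorn_nonempty)
    show "?A \<noteq> {}" using I by blast
    fix C assume C: "C \<noteq> {}" "subset.chain ?A C"
    have CA: "int_ideal J" "1 \<notin> J" "I \<subseteq> J" if "J \<in> C" for J
      using C(2) that by (auto simp: subset_chain_def)
    have "int_ideal (\<Union>C)"
      unfolding int_ideal_def
    proof (intro conjI ballI allI impI)
      show "\<Union>C \<subseteq> {x. algebraic_int x}" using int_idealD(1)[OF CA(1)] by blast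
      show "0 \<in> \<Union>C" using C(1) int_idealD(2)[OF CA(1)] by blast
    next
      fix x y assume "x \<in> \<Union>C" "y \<in> \<Union>C"
      then obtain J K where JK: "J \<in> C" "K \<in> C" "x \<in> J" "y \<in> K" by blast
      have "J \<subseteq> K \<or> K \<subseteq> J" using C(2) JK(1,2) unfolding subset_chain_def by simp
      then show "x + y \<in> \<Union>C"
      proof
        assume "J \<subseteq> K"
        then have "x + y \<in> K" using JK int_idealD(3)[OF CA(1)] by blast
        then show ?thesis using JK by blast
      next
        assume "K \<subseteq> J"
        then have "x + y \<in> J" using JK int_idealD(3)[OF CA(1)] by blast
        then show ?thesis using JK by blast
      qed
    next
      fix x a :: complex assume "x \<in> \<Union>C" "algebraic_int a"
      then show "a * x \<in> \<Union>C" using int_idealD(4)[OF CA(1)] by blast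
    qed
    then show "\<Union>C \<in> ?A" using CA C(1) by blast
  qed
  then obtain M where "M \<in> ?A" and max0: "\<forall>X\<in>?A. M \<subseteq> X \<longrightarrow> X = M" by (rule bexE)
  then have M: "int_ideal M" "1 \<notin> M" "I \<subseteq> M" by simp_all
  note D = int_idealD[OF M(1)]
  have prime: "b \<in> M" if ab: "algebraic_int a" "algebraic_int b" "a * b \<in> M" "a \<notin> M" for a b
  proof -
    define X where "X = {m + c * a | m c. m \<in> M \<and> algebraic_int c}"
    have "int_ideal X"
      unfolding int_ideal_def
    proof (intro conjI ballI allI impI subsetI)
      fix x assume "x \<in> X"
      then show "x \<in> {x. algebraic_int x}"
        using D(1) ab by (auto simp: X_def intro!: algebraic_int_add algebraic_int_mult)
    next
      show "0 \<in> X" unfolding X_def using D(2) by (intro CollectI exI[of _ 0]) auto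
    next
      fix x y assume "x \<in> X" "y \<in> X"
      then obtain m c m' c' where h: "m \<in> M" "m' \<in> M" "algebraic_int c" "algebraic_int c'"
        "x = m + c * a" "y = m' + c' * a" by (auto simp: X_def)
      have "x + y = (m + m') + (c + c') * a" using h by (simp add: algebra_simps)
      then show "x + y \<in> X" unfolding X_def using D(3)[OF h(1,2)] algebraic_int_add[OF h(3,4)] by blast
    next
      fix x e :: complex assume "x \<in> X" "algebraic_int e"
      then obtain m c where h: "m \<in> M" "algebraic_int c" "x = m + c * a" by (auto simp: X_def)
      have "e * x = e * m + (e * c) * a" using h by (simp add: algebra_simps)
      then show "e * x \<in> X"
        unfolding X_def using D(4)[OF h(1) \<open>algebraic_int e\<close>] algebraic_int_mult[OF \<open>algebraic_int e\<close> h(2)] by blast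
    qed
    moreover have "M \<subseteq> X"
    proof
      fix m assume "m \<in> M"
      then show "m \<in> X" unfolding X_def by (intro CollectI exI[of _ m] exI[of _ 0]) auto
    qed
    moreover have "a \<in> X" unfolding X_def using D(2) by (intro CollectI exI[of _ 0] exI[of _ 1]) auto
    ultimately have "1 \<in> X" using max0 ab(4) M(3) by auto
    then obtain m c where h: "m \<in> M" "algebraic_int c" "1 = m + c * a" by (auto simp: X_def)
    have "b = b * (m + c * a)" using h(3) by simp
    also have "\<dots> = b * m + c * (a * b)" by (simp add: algebra_simps)
    also have "\<dots> \<in> M" by (intro D(3) D(4) h ab)
    finally show ?thesis .
  qed
  interpret A: cring alg_integers by (rule alg_integers_cring)
  have "primeideal M alg_integers"
  proof (rule primeidealI)
    show "ideal M alg_integers"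
    proof (rule idealI)
      show "subgroup M (add_monoid alg_integers)"
      proof (rule A.add.subgroupI)
        show "M \<subseteq> carrier alg_integers" using D(1) by auto
        show "M \<noteq> {}" using D(2) by blast
        fix x assume "x \<in> M"
        then show "\<ominus>\<^bsub>alg_integers\<^esub> x \<in> M" using D(1) D(4)[of x "- 1"] by simp
      qed (use D(3) in simp)
    qed (use D(4) in \<open>auto simp: mult.commute A.ring_axioms\<close>)
    show "carrier alg_integers \<noteq> M" using M(2) by auto
    show "a \<in> M \<or> b \<in> M" if "a \<in> carrier alg_integers" "b \<in> carrier alg_integers" "a \<otimes>\<^bsub>alg_integers\<^esub> b \<in> M" for a b
      using prime[of a b] that by auto
  qed (rule alg_integers_cring)
  then show ?thesis using M(3) by (rule that)
qed

lemma primeideal_contains_prime: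
  assumes P: "primeideal M alg_integers" and k: "of_nat k \<in> M" "k > 0"
  shows "\<exists>l. prime l \<and> of_nat l \<in> M"
  using k
proof (induction k rule: less_induct)
  case (less k)
  have "k \<noteq> 1"
  proof
    assume "k = 1"
    then have "carrier alg_integers = M"
      using ideal.I_r_closed[OF primeideal.axioms(1)[OF P], of 1] ideal.Icarr[OF primeideal.axioms(1)[OF P]] less.prems by auto
    then show False using primeideal.I_notcarr[OF P] by simp
  qed
  then obtain p where p: "prime p" "p dvd k" using prime_factor_nat by blast
  then obtain m where m: "k = p * m" by blast
  have "(of_nat p :: complex) \<in> M \<or> of_nat m \<in> M"
    using primeideal.I_prime[OF P, of "of_nat p" "of_nat m"] less.prems(1) unfolding m by simp
  then show ?case
  proof
    assume mM: "(of_nat m :: complex) \<in> M"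
    have "m > 0" using m less.prems by (cases m) auto
    then have "m < k" using m prime_gt_1_nat[OF p(1)] by simp
    then show ?thesis using less.IH mM \<open>m > 0\<close> by blast
  qed (use p in blast)
qed

section \<open>Kronecker's theorem\<close>

text \<open>A linear factor with root in the unit disc at most doubles a bound valid for all
  coefficients.\<close>

lemma norm_coeff_prod_linear_le:
  fixes a :: "'i \<Rightarrow> complex"
  assumes "finite I" "\<And>i. i \<in> I \<Longrightarrow> norm (a i) \<le> 1"
  shows "norm (coeff (\<Prod>i\<in>I. [:- a i, 1:]) k) \<le> 2 ^ card I"
  using assms
proof (induction I arbitrary: k rule: finite_induct)
  case empty
  then show ?case by (simp add: coeff_1)
next
  case (insert i I)
  let ?q = "\<Prod>i\<in>I. [:- a i, 1:]"
  have e: "(\<Prod>i\<in>insert i I. [:- a i, 1:]) = pCons 0 ?q + [:- a i:] * ?q"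
    using insert by simp
  have "norm (coeff (\<Prod>i\<in>insert i I. [:- a i, 1:]) k) \<le> norm (coeff (pCons 0 ?q) k) + norm (- a i * coeff ?q k)"
    unfolding e by (simp add: norm_triangle_ineq4)
  also have "norm (coeff (pCons 0 ?q) k) \<le> 2 ^ card I"
    using insert by (cases k) auto
  also have "norm (- a i * coeff ?q k) \<le> 1 * 2 ^ card I"
    unfolding norm_mult using insert by (intro mult_mono) auto
  finally show ?case using insert by simp
qed

lemma finite_bounded_polys:
  assumes "finite C" shows "finite {p :: complex poly. degree p \<le> d \<and> (\<forall>i. coeff p i \<in> C)}"
proof (rule inj_on_finite)
  show "inj_on (\<lambda>p. restrict (coeff p) {..d}) {p :: complex poly. degree p \<le> d \<and> (\<forall>i. coeff p i \<in> C)}"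
  proof (rule inj_onI)
    fix p q :: "complex poly"
    assume pq: "p \<in> {p. degree p \<le> d \<and> (\<forall>i. coeff p i \<in> C)}" "q \<in> {p. degree p \<le> d \<and> (\<forall>i. coeff p i \<in> C)}"
      "restrict (coeff p) {..d} = restrict (coeff q) {..d}"
    show "p = q"
    proof (rule poly_eqI)
      fix i
      show "coeff p i = coeff q i"
        using fun_cong[OF pq(3), of i] pq(1,2) by (cases "i \<le> d") (auto simp: coeff_eq_0)
    qed
  qed
  show "(\<lambda>p. restrict (coeff p) {..d}) ` {p :: complex poly. degree p \<le> d \<and> (\<forall>i. coeff p i \<in> C)} \<subseteq> {..d} \<rightarrow>\<^sub>E C"
    by (rule image_subsetI) (simp add: PiE_iff)
  show "finite ({..d} \<rightarrow>\<^sub>E C)" using assms by (intro finite_PiE) auto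
qed

lemma polyrel_prod:
  assumes "emb_rel S" "\<And>i. i \<in> I \<Longrightarrow> polyrel S (p i) (q i)"
  shows "polyrel S (\<Prod>i\<in>I. p i) (\<Prod>i\<in>I. q i)"
  using assms(2)
proof (induction I rule: infinite_finite_induct)
  case (insert i I)
  then show ?case using polyrel_mult[OF assms(1)] by simp
qed (use polyrel_const[OF assms(1) emb_rel_0_1(2)[OF assms(1)]] in \<open>simp_all add: one_pCons\<close>)

lemma Aut_emb_rel:
  assumes "\<sigma> \<in> Aut" shows "emb_rel {(x, \<sigma> x) | x. x \<in> Qc}"
  unfolding emb_rel_def
  using assms by (auto simp: Qc_closed Aut_add Aut_mult Aut_rat Aut_0) (auto simp: Qc_def)

lemma Aut_fixed_Rats:
  assumes "x \<in> Qc" "\<And>\<sigma>. \<sigma> \<in> Aut \<Longrightarrow> \<sigma> x = x" shows "x \<in> \<rat>"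
  by (rule Aut_fixed) (use assms Qc_Rats in auto)

context generators
begin

text \<open>The a with a x integral form an ideal containing a nonzero integer. If it were proper,
  it would lie in a prime \<open>M\<close> above some l; but writing \<open>x\<close> as s / t with
  t outside \<open>M\<close> puts t into the ideal.\<close>

lemma algebraic_int_if_local_units:
  assumes x: "x \<in> Qc" and loc: "\<And>P l. prime_over z P l \<Longrightarrow> x \<in> prime_over.U P"
  shows "algebraic_int x"
proof -
  define I where "I = {a. algebraic_int a \<and> algebraic_int (a * x)}"
  have I: "int_ideal I"
    unfolding int_ideal_def I_def
    by (auto simp: distrib_right mult.assoc intro: algebraic_int_add algebraic_int_mult)
  have "1 \<in> I"
  proof (rule ccontr)
    assume "1 \<notin> I"
    then obtain M where M: "primeideal M alg_integers" "I \<subseteq> M" using int_ideal_extend_prime[OF I] by blast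
    obtain k where k: "k \<noteq> 0" "algebraic_int (of_int k * x)"
      using algebraic_imp_scaled_algebraic_int x by (auto simp: Qc_def)
    then have "of_int k \<in> I" by (simp add: I_def)
    then have "of_int \<bar>k\<bar> \<in> I" using int_idealD(4)[OF I, of "of_int k" "- 1"] by (auto simp: abs_if)
    then have "of_nat (nat \<bar>k\<bar>) \<in> I" by (simp add: of_nat_nat)
    then obtain l where l: "prime l" "of_nat l \<in> M"
      using primeideal_contains_prime[OF M(1), of "nat \<bar>k\<bar>"] M(2) k(1) by auto
    interpret prime_over z M l
      by (intro prime_over.intro prime_over_axioms.intro generators_axioms M(1) l)
    have "x \<in> U" by (rule loc) (rule prime_over_axioms)
    then obtain s t where st: "algebraic_int s" "algebraic_int t" "s \<notin> M" "t \<notin> M" "x = s / t"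
      unfolding U_def by blast
    have "t \<noteq> 0" using st P_0 by auto
    then have "t \<in> I" unfolding I_def using st by simp
    then show False using M(2) st by blast
  qed
  then show ?thesis by (simp add: I_def)
qed

text \<open>The polynomial whose roots are the f(v)^k, for v of the same order as \<open>w\<close>,
  has integral coefficients, rational by equivariance and bounded independently of k. Only finitely
  many such polynomials exist, so two powers of \<open>f w\<close> coincide.\<close>

lemma FF_Kronecker:
  assumes f: "f \<in> carrier FF" and w: "w \<in> mu_inf_star"
    and int: "\<And>v. v \<in> mu_inf_star \<Longrightarrow> algebraic_int (f v)" and one: "\<And>v. v \<in> mu_inf_star \<Longrightarrow> norm (f v) = 1"
  shows "\<exists>k>0. f w ^ k = 1"
proof -
  define W where "W = {v \<in> mu_inf_star. root_order v = root_order w}"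
  have n: "root_order w > 0" using mu_inf_star_order(1)[OF w] by simp
  have "W \<subseteq> mu (root_order w)" unfolding W_def using mu_inf_star_order(2) by fastforce
  then have fin: "finite W" using finite_mu[OF n] finite_subset by blast
  have wW: "w \<in> W" using w by (simp add: W_def)
  have Wm: "v \<in> mu_inf_star" if "v \<in> W" for v using that by (simp add: W_def)
  define Q where "Q k = (\<Prod>v\<in>W. [:- (f v ^ k), 1:])" for k :: nat
  have lead: "lead_coeff (Q k) = 1" for k unfolding Q_def by (simp add: lead_coeff_prod)
  have deg: "degree (Q k) \<le> card W" for k
    unfolding Q_def using degree_prod_sum_le[OF fin, of "\<lambda>v. [:- (f v ^ k), 1:]"] by simp
  have root: "poly (Q k) x = 0 \<longleftrightarrow> (\<exists>v\<in>W. x = f v ^ k)" for k x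
    unfolding Q_def using fin by (auto simp: poly_prod)
  have ai: "algebraic_int (coeff (Q k) i)" for k i
    by (rule algebraic_int_coeff_if_roots[OF lead]) (use root int Wm algebraic_int_power in auto)
  have fixed: "\<sigma> (coeff (Q k) i) = coeff (Q k) i" if s: "\<sigma> \<in> Aut" for \<sigma> k i
  proof -
    let ?S = "{(x, \<sigma> x) | x. x \<in> Qc}"
    note S = Aut_emb_rel[OF s]
    have Qf: "f v \<in> Qc" if "v \<in> W" for v using FF_Qc[OF f Wm[OF that]] .
    have "polyrel ?S [:- (f v ^ k), 1:] [:- (f (\<sigma> v) ^ k), 1:]" if v: "v \<in> W" for v
    proof -
      have "- (f (\<sigma> v) ^ k) = \<sigma> (- (f v ^ k))"
        using FF_Aut[OF f Wm[OF v] s] Qf[OF v] s by (simp add: Aut_uminus Aut_power Qc_power)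
      then show ?thesis
        unfolding polyrel_def using Qf[OF v] s
        by (auto simp: coeff_pCons Qc_uminus Qc_power Aut_0 Aut_1 split: nat.splits)
    qed
    then have "polyrel ?S (Q k) (\<Prod>v\<in>W. [:- (f (\<sigma> v) ^ k), 1:])"
      unfolding Q_def by (rule polyrel_prod[OF S])
    \<comment> \<open>The automorphism permutes the roots of unity of a given order, so it merely
      reorders the linear factors.\<close>
    moreover have "(\<Prod>v\<in>W. [:- (f (\<sigma> v) ^ k), 1:]) = Q k"
      unfolding Q_def
    proof (rule prod.reindex_bij_betw)
      have "inj_on \<sigma> W" by (rule inj_onI) (use Aut_inj[OF s] Wm Qc_mu_inf in blast)
      moreover have "\<sigma> ` W \<subseteq> W" using Aut_mu_inf[OF s] Aut_root_order[OF s] by (auto simp: W_def)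
      ultimately show "bij_betw \<sigma> W W" using endo_inj_surj[OF fin] by (auto simp: bij_betw_def)
    qed
    ultimately show ?thesis unfolding polyrel_def by auto
  qed
  define C where "C = (of_int :: int \<Rightarrow> complex) ` {- (2 ^ card W) .. 2 ^ card W}"
  have C: "coeff (Q k) i \<in> C" for k i
  proof -
    have "coeff (Q k) i \<in> \<rat>"
      by (rule Aut_fixed_Rats) (use ai fixed algebraic_int_imp_algebraic in \<open>auto simp: Qc_def\<close>)
    then have "coeff (Q k) i \<in> \<int>" using rational_algebraic_int_is_int[OF ai] by blast
    then obtain m where m: "coeff (Q k) i = of_int m" by (elim Ints_cases)
    have "norm (coeff (Q k) i) \<le> 2 ^ card W"
      unfolding Q_def by (rule norm_coeff_prod_linear_le[OF fin]) (use one Wm in \<open>simp add: norm_power\<close>)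
    then have "\<bar>real_of_int m\<bar> \<le> real_of_int (2 ^ card W)" unfolding m by simp
    then have "\<bar>m\<bar> \<le> 2 ^ card W" by linarith
    then show ?thesis unfolding C_def m by (intro imageI) (simp add: abs_le_iff)
  qed
  let ?L = "{p :: complex poly. degree p \<le> card W \<and> (\<forall>i. coeff p i \<in> C)}"
  have "finite ?L" by (rule finite_bounded_polys) (simp add: C_def)
  then have "finite (\<Union>p\<in>?L - {0}. {x. poly p x = 0})" using poly_roots_finite by blast
  moreover have "range (\<lambda>k. f w ^ k) \<subseteq> (\<Union>p\<in>?L - {0}. {x. poly p x = 0})"
  proof
    fix x assume "x \<in> range (\<lambda>k. f w ^ k)"
    then obtain k where "x = f w ^ k" by auto
    moreover have "Q k \<noteq> 0" using lead[of k] by auto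
    ultimately show "x \<in> (\<Union>p\<in>?L - {0}. {x. poly p x = 0})"
      using root[of k x] wW deg[of k] C by (intro UN_I[of "Q k"]) auto
  qed
  ultimately have "finite (range (\<lambda>k. f w ^ k))" by (rule finite_subset[rotated])
  then have "\<not> inj (\<lambda>k. f w ^ k)" using range_inj_infinite by blast
  then obtain i j where ij: "i < j" "f w ^ i = f w ^ j" unfolding inj_def by (metis linorder_neqE_nat)
  have nz: "f w \<noteq> 0" by (rule FF_nonzero[OF f w])
  have "f w ^ j = f w ^ i * f w ^ (j - i)" using ij(1) by (simp add: power_add[symmetric])
  then have "f w ^ i * f w ^ (j - i) = f w ^ i * 1" using ij(2) by simp
  then have "f w ^ (j - i) = 1" using nz by (simp only: mult_cancel_left) simp
  then show ?thesis using ij(1) by (intro exI[of _ "j - i"]) auto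
qed

section \<open>Characterisations of torsion-valued distributions\<close>

text \<open>The definition tests one root of unity per order; every other root of that order is
  Galois conjugate to it, so equivariance transports the condition. In this form the choice of
  \<open>z\<close> disappears.\<close>

lemma Ftv_iff:
  "f \<in> Ftv z \<longleftrightarrow> f \<in> Fd \<and> (\<forall>w\<in>mu_inf_star. \<exists>k>0. f w ^ k = 1)"
proof
  assume f: "f \<in> Ftv z"
  then have fd: "f \<in> Fd" by (simp add: Ftv_def)
  show "f \<in> Fd \<and> (\<forall>w\<in>mu_inf_star. \<exists>k>0. f w ^ k = 1)"
  proof (intro conjI ballI fd)
    fix w assume w: "w \<in> mu_inf_star"
    let ?n = "root_order w"
    have n: "?n > 1" by (rule mu_inf_star_order(1)[OF w])
    then obtain k where k: "k > 0" "f (z ?n) ^ k = 1" using f by (auto simp: Ftv_def)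
    obtain \<sigma> where s: "\<sigma> \<in> Aut" "\<sigma> (z ?n) = w"
      using Aut_transitive[OF z_mu_inf[OF n] w] root_order_z n by auto
    have "f w = \<sigma> (f (z ?n))" using FF_Aut[OF Fd_FF[OF fd] z_mu_inf[OF n] s(1)] s(2) by simp
    then have "f w ^ k = 1"
      using k(2) Aut_power[OF s(1) FF_Qc[OF Fd_FF[OF fd] z_mu_inf[OF n]], of k] Aut_1[OF s(1)] by simp
    then show "\<exists>k>0. f w ^ k = 1" using k(1) by blast
  qed
next
  assume "f \<in> Fd \<and> (\<forall>w\<in>mu_inf_star. \<exists>k>0. f w ^ k = 1)"
  then show "f \<in> Ftv z" using z_mu_inf by (auto simp: Ftv_def)
qed

lemma cnj_mult_self_eq_1: "x * cnj x = 1 \<longleftrightarrow> norm x = 1"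
proof -
  have "x * cnj x = of_real (norm x ^ 2)" using complex_norm_square[of x] by simp
  then have "x * cnj x = 1 \<longleftrightarrow> norm x ^ 2 = 1" by (simp only: of_real_eq_1_iff)
  then show ?thesis by (simp add: power2_eq_1_iff) (metis norm_ge_zero not_one_le_zero le_minus_one_simps(3) minus_equation_iff neg_0_le_iff_le)
qed

text \<open>For the converse direction, \<open>kernel_unit\<close> at every prime and
  \<open>algebraic_int_if_local_units\<close> make all values integral, as required by
  \<open>FF_Kronecker\<close>.\<close>

lemma Ftv_iff_norm_1:
  "f \<in> Ftv z \<longleftrightarrow> f \<in> Fd \<and> (\<forall>w\<in>mu_inf_star. norm (f w) = 1)"
proof
  assume "f \<in> Ftv z"
  then show "f \<in> Fd \<and> (\<forall>w\<in>mu_inf_star. norm (f w) = 1)"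
    unfolding Ftv_iff using power_eq_1_iff by blast
next
  assume f: "f \<in> Fd \<and> (\<forall>w\<in>mu_inf_star. norm (f w) = 1)"
  then have fF: "f \<in> carrier FF" by (simp add: Fd_FF)
  have "algebraic_int (f v)" if v: "v \<in> mu_inf_star" for v
  proof (rule algebraic_int_if_local_units[OF FF_Qc[OF fF v]])
    fix P l assume "prime_over z P l"
    then show "f v \<in> prime_over.U P"
      using prime_over.kernel_unit[of z P l f v] f v cnj_mult_self_eq_1 by blast
  qed
  then show "f \<in> Ftv z" using FF_Kronecker[OF fF] f unfolding Ftv_iff by blast
qed

lemma Ftv_iff_kernel:
  "f \<in> Ftv z \<longleftrightarrow> f \<in> Fd \<and> one_plus_tau \<odot>\<^bsub>FF\<^esub> f = \<zero>\<^bsub>FF\<^esub>"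
proof -
  have "one_plus_tau \<odot>\<^bsub>FF\<^esub> f = \<zero>\<^bsub>FF\<^esub> \<longleftrightarrow> (\<forall>w\<in>mu_inf_star. norm (f w) = 1)" if "f \<in> Fd"
    unfolding smult_one_plus_tau[OF Fd_FF[OF that]] FF_ops(1) restrict_def fun_eq_iff
    using cnj_mult_self_eq_1 by auto
  then show ?thesis unfolding Ftv_iff_norm_1 by blast
qed

end


section \<open>The cyclotomic distribution\<close>

text \<open>Both sides have degree a and leading coefficient 1, and they agree at the a distinct
  a-th roots of \<open>e\<close>.\<close>

lemma prod_nth_roots:
  fixes e :: complex
  assumes "e \<noteq> 0" "a > 0"
  shows "(\<Prod>w\<in>{w. w ^ a = e}. [:- w, 1:]) = monom 1 a - [:e:]"
proof (rule poly_eqI_degree_lead_coeff)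
  let ?A = "{w. w ^ a = e}"
  have fin: "finite ?A" using assms(2) by (rule finite_nth_roots)
  have card: "card ?A = a" using assms by (rule card_nth_roots)
  show "card ?A \<ge> a" using card by simp
  show "degree (\<Prod>w\<in>?A. [:- w, 1:]) \<le> a"
    using degree_prod_sum_le[OF fin, of "\<lambda>w. [:- w, 1:]"] card by simp
  show "degree (monom 1 a - [:e:]) \<le> a" by (intro degree_diff_le) (auto simp: degree_monom_le)
  have d: "degree (\<Prod>w\<in>?A. [:- w, 1:]) = a" 
    by (subst degree_prod_eq_sum_degree) (use card in auto)
  have "lead_coeff (\<Prod>w\<in>?A. [:- w, 1:]) = 1" by (simp add: lead_coeff_prod)
  then show "coeff (\<Prod>w\<in>?A. [:- w, 1:]) a = coeff (monom 1 a - [:e:]) a"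
    using assms(2) unfolding d by (simp add: coeff_pCons split: nat.splits)
  fix w assume "w \<in> ?A"
  then show "poly (\<Prod>w\<in>?A. [:- w, 1:]) w = poly (monom 1 a - [:e:]) w"
    using fin by (auto simp: poly_prod poly_monom intro!: prod_zero)
qed

lemma prod_one_minus_roots:
  assumes "e \<noteq> 0" "a > 0" shows "(\<Prod>w\<in>{w. w ^ a = e}. 1 - w) = (1 - e :: complex)"
  using arg_cong[OF prod_nth_roots[OF assms], of "\<lambda>p. poly p 1"] by (simp add: poly_prod poly_monom)

text \<open>The product of the roots is \<open>e\<close> up to the sign (-1)^(a+1); squaring removes
  the sign and makes the relation uniform in \<open>a\<close>.\<close>

lemma prod_roots_sq:
  assumes "e \<noteq> 0" "a > 0" shows "(\<Prod>w\<in>{w. w ^ a = e}. w) ^ 2 = (e :: complex) ^ 2"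
proof -
  have "(\<Prod>w\<in>{w. w ^ a = e}. - w) = - e"
    using arg_cong[OF prod_nth_roots[OF assms], of "\<lambda>p. poly p 0"] assms(2)
    by (simp add: poly_prod poly_monom zero_power)
  then have "(\<Prod>w\<in>{w. w ^ a = e}. - w) ^ 2 = e ^ 2" by simp
  moreover have "(\<Prod>w\<in>{w. w ^ a = e}. - w) ^ 2 = (\<Prod>w\<in>{w. w ^ a = e}. w) ^ 2"
    unfolding prod_power_distrib by simp
  ultimately show ?thesis by simp
qed

section \<open>Strictness as a multiplicative condition\<close>

context prime_over
begin

text \<open>The principal units at \<open>P\<close>, those congruent to 1 modulo the maximal ideal
  of the local ring.\<close>

definition V :: "complex set"
  where "V = {s / t | s t. algebraic_int s \<and> algebraic_int t \<and> s \<notin> P \<and> t \<notin> P \<and> s - t \<in> P}"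

lemma V_1: "1 \<in> V"
  unfolding V_def using P_1 P_0 by (intro CollectI exI[of _ 1]) auto

lemma V_mult:
  assumes "x \<in> V" "y \<in> V" shows "x * y \<in> V"
proof -
  obtain s t where st: "algebraic_int s" "algebraic_int t" "s \<notin> P" "t \<notin> P" "s - t \<in> P" "x = s / t"
    using assms(1) unfolding V_def by blast
  obtain s' t' where st': "algebraic_int s'" "algebraic_int t'" "s' \<notin> P" "t' \<notin> P" "s' - t' \<in> P" "y = s' / t'"
    using assms(2) unfolding V_def by blast
  have "s * s' - t * t' = s * (s' - t') + t' * (s - t)" by (simp add: algebra_simps)
  also have "\<dots> \<in> P" by (intro P_add P_mult st st')
  finally have "s * s' - t * t' \<in> P" .
  moreover have "x * y = (s * s') / (t * t')" using st st' by simp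
  ultimately show ?thesis
    unfolding V_def using P_prime[OF st(1) st'(1)] P_prime[OF st(2) st'(2)] st st' algebraic_int_mult by blast
qed

lemma V_inverse:
  assumes "x \<in> V" shows "inverse x \<in> V"
proof -
  obtain s t where st: "algebraic_int s" "algebraic_int t" "s \<notin> P" "t \<notin> P" "s - t \<in> P" "x = s / t"
    using assms(1) unfolding V_def by blast
  have "t - s \<in> P" using P_uminus[OF st(5)] by simp
  moreover have "inverse x = t / s" using st by simp
  ultimately show ?thesis unfolding V_def using st by blast
qed

lemma V_powi: "x \<in> V \<Longrightarrow> x powi k \<in> V"
proof -
  assume x: "x \<in> V"
  have p: "y ^ n \<in> V" if "y \<in> V" for y n by (induction n) (use that V_1 V_mult in auto)
  show ?thesis by (auto simp: power_int_def intro: p V_inverse x)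
qed

lemma V_prod: "(\<And>i. i \<in> I \<Longrightarrow> f i \<in> V) \<Longrightarrow> (\<Prod>i\<in>I. f i) \<in> V"
  by (induction I rule: infinite_finite_induct) (auto intro: V_1 V_mult)

text \<open>For a unit \<open>y\<close> the additive congruence says that x / y is a principal unit.
  The quotient form is compatible with products and powers, as the module structure on strict
  distributions requires.\<close>

lemma V_iff_cong:
  assumes y: "y \<in> U"
  shows "(\<exists>a\<in>P. \<exists>b\<in>carrier alg_integers - P. x - y = a / b) \<longleftrightarrow> x / y \<in> V"
proof -
  obtain u v where uv: "algebraic_int u" "algebraic_int v" "u \<notin> P" "v \<notin> P" "y = u / v"
    using y unfolding U_def by blast
  have nz: "u \<noteq> 0" "v \<noteq> 0" using uv P_0 by auto
  show ?thesis
  proof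
    assume "\<exists>a\<in>P. \<exists>b\<in>carrier alg_integers - P. x - y = a / b"
    then obtain a b where ab: "a \<in> P" "algebraic_int b" "b \<notin> P" "x - y = a / b" by auto
    have b: "b \<noteq> 0" using ab P_0 by auto
    have av: "a * v \<in> P" by (rule P_mult(1)[OF ab(1) uv(2)])
    have ub: "u * b \<notin> P" "algebraic_int (u * b)" using P_prime[OF uv(1) ab(2)] uv ab algebraic_int_mult by auto
    have "u * b + a * v \<notin> P" using P_diff[OF _ av, of "u * b + a * v"] ub by auto
    moreover have "algebraic_int (u * b + a * v)" using algebraic_int_add[OF ub(2) P_int[OF av]] .
    moreover have "(u * b + a * v) - u * b \<in> P" using av by simp
    moreover have "x / y = (u * b + a * v) / (u * b)"
    proof -
      have "x = a / b + u / v" using ab(4) uv(5) by (simp add: algebra_simps)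
      then show ?thesis unfolding uv(5) using nz b by (simp add: field_simps)
    qed
    ultimately show "x / y \<in> V" unfolding V_def using ub by blast
  next
    assume "x / y \<in> V"
    then obtain s t where st: "algebraic_int s" "algebraic_int t" "s \<notin> P" "t \<notin> P" "s - t \<in> P" "x / y = s / t"
      unfolding V_def by blast
    have t: "t \<noteq> 0" using st P_0 by auto
    have "y \<noteq> 0" using uv(5) nz by simp
    then have "x = s / t * y" using st(6) by (simp add: nonzero_divide_eq_eq)
    then have "x - y = u * (s - t) / (v * t)" unfolding uv(5) using nz t by (simp add: field_simps)
    moreover have "u * (s - t) \<in> P" by (rule P_mult(2)[OF st(5) uv(1)])
    moreover have "v * t \<in> carrier alg_integers - P" using P_prime[OF uv(2) st(2)] uv st algebraic_int_mult by auto
    ultimately show "\<exists>a\<in>P. \<exists>b\<in>carrier alg_integers - P. x - y = a / b" by blast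
  qed
qed

text \<open>Modulo l, (1 - e)^l is congruent to 1 - e^l = 0.\<close>

lemma one_minus_mu_l:
  assumes "e \<in> mu l" shows "1 - e \<in> P"
proof -
  have ei: "algebraic_int e" using assms by (intro algebraic_int_root_of_unity[OF l_pos]) (simp add: mu_def)
  have ev: "poly (of_int_poly [:1, - 1:]) x = 1 - x" for x :: complex
    by (simp add: of_int_hom.map_poly_pCons_hom)
  obtain c where c: "algebraic_int c" "1 - e ^ l = (1 - e) ^ l + of_nat l * c"
    using frobenius_ipoly[OF csubring_algebraic_int l_prime, of e "[:1, - 1:]"] ei unfolding ev by auto
  then have "(1 - e) ^ l = of_nat l * (- c)" using assms by (simp add: mu_def eq_neg_iff_add_eq_0)
  then have "(1 - e) ^ l \<in> P" using P_mult(1)[OF l_mem, of "- c"] c(1) by simp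
  then show ?thesis by (rule P_power[rotated]) (intro algebraic_int_diff ei, simp)
qed

end

context generators
begin

lemma prime_overI: "primeideal P alg_integers \<Longrightarrow> of_nat l \<in> P \<Longrightarrow> prime l \<Longrightarrow> prime_over z P l"
  by (intro prime_over.intro prime_over_axioms.intro generators_axioms)

text \<open>The congruence may be rewritten by \<open>V_iff_cong\<close> because \<open>f w\<close>
  is a unit above l: the order of \<open>w\<close> is prime to l and hence has a prime factor
  different from l, so \<open>Fd_unit\<close> applies.\<close>

lemma Fsd_iff:
  "f \<in> Fsd \<longleftrightarrow> f \<in> Fd \<and> (\<forall>n l e w P. n > 0 \<longrightarrow> \<not> l dvd n \<longrightarrow> e \<in> mu l \<longrightarrow> w \<in> mu n \<longrightarrow> w \<noteq> 1 \<longrightarrow>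
    prime_over z P l \<longrightarrow> f (e * w) / f w \<in> prime_over.V P)"
proof -
  have *: "cong_above l (f (e * w)) (f w) \<longleftrightarrow> (\<forall>P. prime_over z P l \<longrightarrow> f (e * w) / f w \<in> prime_over.V P)"
    if f: "f \<in> Fd" and n: "n > 0" "\<not> l dvd n" and l: "prime l" and e: "e \<in> mu l" and w: "w \<in> mu n" "w \<noteq> 1" for n l e w
  proof -
    have wi: "w \<in> mu_inf_star" using w n by (intro mu_inf_starI)
    obtain p where p: "prime p" "p dvd root_order w"
      using prime_factor_nat[of "root_order w"] mu_inf_star_order(1)[OF wi] by auto
    have "p \<noteq> l" using p(2) n(2) root_order_dvd[OF w(1) n(1)] dvd_trans by blast
    then have "f w \<in> prime_over.U P" if "prime_over z P l" for P
      using prime_over.Fd_unit[OF that f wi p(1) _ p(2)] by blast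
    then show ?thesis
      unfolding cong_above_def using prime_over.V_iff_cong prime_overI l
      by (metis prime_over.prime_ideal prime_over.l_mem)
  qed
  show ?thesis
  proof
    assume f: "f \<in> Fsd"
    then have fd: "f \<in> Fd" by (simp add: Fsd_def)
    show "f \<in> Fd \<and> (\<forall>n l e w P. n > 0 \<longrightarrow> \<not> l dvd n \<longrightarrow> e \<in> mu l \<longrightarrow> w \<in> mu n \<longrightarrow> w \<noteq> 1 \<longrightarrow>
      prime_over z P l \<longrightarrow> f (e * w) / f w \<in> prime_over.V P)"
    proof (intro conjI fd allI impI)
      fix n l e w P assume h: "n > 0" "\<not> l dvd n" "e \<in> mu l" "w \<in> mu n" "w \<noteq> 1" "prime_over z P l"
      have l: "prime l" by (rule prime_over.l_prime[OF h(6)])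
      have "cong_above l (f (e * w)) (f w)" using f h l by (auto simp: Fsd_def)
      then show "f (e * w) / f w \<in> prime_over.V P" using *[OF fd h(1,2) l h(3-5)] h(6) by blast
    qed
  next
    assume h: "f \<in> Fd \<and> (\<forall>n l e w P. n > 0 \<longrightarrow> \<not> l dvd n \<longrightarrow> e \<in> mu l \<longrightarrow> w \<in> mu n \<longrightarrow> w \<noteq> 1 \<longrightarrow>
      prime_over z P l \<longrightarrow> f (e * w) / f w \<in> prime_over.V P)"
    then show "f \<in> Fsd" using * unfolding Fsd_def by auto
  qed
qed

text \<open>If e w were 1, the order of \<open>w\<close> would divide both l and n, which are
  coprime.\<close>

lemma mult_mu_inf:
  assumes "prime l" "\<not> l dvd n" "n > 0" "e \<in> mu l" "w \<in> mu n" "w \<noteq> 1"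
  shows "e * w \<in> mu (l * n)" "e * w \<noteq> 1" "e * w \<in> mu_inf_star" "l * n > 0"
proof -
  have l: "l > 0" using assms(1) by (simp add: prime_gt_0_nat)
  show m: "e * w \<in> mu (l * n)" using mu_closed(5)[of l "l * n" e] mu_closed(5)[of n "l * n" w] assms(4,5) by (intro mu_closed(2)) auto
  show ne: "e * w \<noteq> 1"
  proof
    assume ew: "e * w = 1"
    have "(e * w) ^ l = w ^ l" using assms(4) by (simp add: mu_def power_mult_distrib)
    then have "w ^ l = 1" using ew by simp
    then have "root_order w dvd l" using mu_mem_iff_root_order(2)[OF assms(5,3)] by simp
    moreover have "root_order w dvd n" by (rule root_order_dvd[OF assms(5,3)])
    moreover have "coprime l n" using assms(1,2) by (rule prime_imp_coprime)
    ultimately have "root_order w = 1" using coprime_common_divisor_nat by blast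
    then show False using mu_mem_iff_root_order(2)[OF assms(5,3), of 1] assms(6) by simp
  qed
  show "l * n > 0" using l assms(3) by simp
  then show "e * w \<in> mu_inf_star" using m ne by (intro mu_inf_starI)
qed

text \<open>For the action of \<open>R\<close> the quotient is expanded over Galois elements.
  Equivariance turns each factor into the quotient for a conjugate pair of roots of unity, to which
  strictness applies again.\<close>

lemma Fsd_submodule: "submodule Fsd R FF"
proof (rule module.submoduleI[OF FF_module])
  have sub: "Fsd \<subseteq> Fd" by (auto simp: Fsd_def)
  then show "Fsd \<subseteq> carrier FF" using Fd_FF by blast
  note Fd_c = module.submoduleE[OF FF_module Fd_submodule]
  have l: "prime l" if "prime_over z P l" for P l by (rule prime_over.l_prime[OF that])
  show "\<zero>\<^bsub>FF\<^esub> \<in> Fsd"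
    unfolding Fsd_iff
  proof (intro conjI allI impI)
    show "\<zero>\<^bsub>FF\<^esub> \<in> Fd" using subgroup.one_closed[OF submodule.axioms(1)[OF Fd_submodule]] by simp
    fix n l e w P assume h: "n > 0" "\<not> l dvd n" "e \<in> mu l" "w \<in> mu n" "w \<noteq> 1" "prime_over z P l"
    show "\<zero>\<^bsub>FF\<^esub> (e * w) / \<zero>\<^bsub>FF\<^esub> w \<in> prime_over.V P"
      using mult_mu_inf(3)[OF l[OF h(6)] h(2,1,3-5)] mu_inf_starI[OF h(4,1,5)] prime_over.V_1[OF h(6)]
      by (simp add: FF_ops)
  qed
  fix f assume f: "f \<in> Fsd"
  then have fd: "f \<in> Fd" using sub by blast
  show "\<ominus>\<^bsub>FF\<^esub> f \<in> Fsd"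
    unfolding Fsd_iff
  proof (intro conjI allI impI)
    show "\<ominus>\<^bsub>FF\<^esub> f \<in> Fd" by (rule Fd_c(3)[OF fd])
    fix n l e w P assume h: "n > 0" "\<not> l dvd n" "e \<in> mu l" "w \<in> mu n" "w \<noteq> 1" "prime_over z P l"
    have "f (e * w) / f w \<in> prime_over.V P" using f h unfolding Fsd_iff by blast
    then have "inverse (f (e * w) / f w) \<in> prime_over.V P" by (rule prime_over.V_inverse[OF h(6)])
    then show "(\<ominus>\<^bsub>FF\<^esub> f) (e * w) / (\<ominus>\<^bsub>FF\<^esub> f) w \<in> prime_over.V P"
      using mult_mu_inf(3)[OF l[OF h(6)] h(2,1,3-5)] mu_inf_starI[OF h(4,1,5)]
      by (simp add: FF_a_inv[OF Fd_FF[OF fd]] field_simps)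
  qed
  show "f \<oplus>\<^bsub>FF\<^esub> g \<in> Fsd" if g: "g \<in> Fsd" for g
    unfolding Fsd_iff
  proof (intro conjI allI impI)
    have gd: "g \<in> Fd" using sub g by blast
    show "f \<oplus>\<^bsub>FF\<^esub> g \<in> Fd" by (rule Fd_c(5)[OF fd gd])
    fix n l e w P assume h: "n > 0" "\<not> l dvd n" "e \<in> mu l" "w \<in> mu n" "w \<noteq> 1" "prime_over z P l"
    have "f (e * w) / f w \<in> prime_over.V P" "g (e * w) / g w \<in> prime_over.V P" using f g h unfolding Fsd_iff by blast+
    then have "(f (e * w) / f w) * (g (e * w) / g w) \<in> prime_over.V P" by (rule prime_over.V_mult[OF h(6)])
    then show "(f \<oplus>\<^bsub>FF\<^esub> g) (e * w) / (f \<oplus>\<^bsub>FF\<^esub> g) w \<in> prime_over.V P"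
      using mult_mu_inf(3)[OF l[OF h(6)] h(2,1,3-5)] mu_inf_starI[OF h(4,1,5)] by (simp add: FF_ops)
  qed
  show "r \<odot>\<^bsub>FF\<^esub> f \<in> Fsd" if r: "r \<in> carrier R" for r
    unfolding Fsd_iff
  proof (intro conjI allI impI)
    have fF: "f \<in> carrier FF" by (rule Fd_FF[OF fd])
    show "r \<odot>\<^bsub>FF\<^esub> f \<in> Fd" by (rule Fd_c(4)[OF r fd])
    fix n l e w P assume h: "n > 0" "\<not> l dvd n" "e \<in> mu l" "w \<in> mu n" "w \<noteq> 1" "prime_over z P l"
    note ew = mult_mu_inf[OF l[OF h(6)] h(2,1,3-5)]
    let ?N = "l * n"
    have l0: "l > 0" using ew(4) by (cases l) auto
    have wN: "w \<in> mu ?N" using mu_closed(5)[of n ?N w] h(4) by simp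
    have c: "f (e * w) \<in> cyc_field ?N" "f w \<in> cyc_field ?N"
      using FF_cyc_field[OF fF ew(1,4,2)] FF_cyc_field[OF fF wN ew(4) h(5)] by auto
    have "(r \<odot>\<^bsub>FF\<^esub> f) (e * w) / (r \<odot>\<^bsub>FF\<^esub> f) w = act ?N (r ?N) (f (e * w)) / act ?N (r ?N) (f w)"
      using FF_smult_apply[OF r fF ew(1,4,2)] FF_smult_apply[OF r fF wN ew(4) h(5)] by simp
    also have "\<dots> = (\<Prod>g\<in>carrier (G ?N). (g (f (e * w)) / g (f w)) powi r ?N g)"
      unfolding act_def prod_dividef[symmetric] by (simp add: power_int_divide_distrib)
    also have "\<dots> \<in> prime_over.V P"
    proof (rule prime_over.V_prod[OF h(6)], rule prime_over.V_powi[OF h(6)])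
      fix g assume "g \<in> carrier (G ?N)"
      then obtain \<sigma> where s: "\<sigma> \<in> Aut" "g = restrict \<sigma> (cyc_field ?N)" using G_cases[OF ew(4)] by blast
      have "g (f (e * w)) = f (\<sigma> (e * w))" "g (f w) = f (\<sigma> w)"
        using s c FF_Aut[OF fF ew(3) s(1)] FF_Aut[OF fF mu_inf_starI[OF h(4,1,5)] s(1)] by auto
      moreover have "\<sigma> (e * w) = \<sigma> e * \<sigma> w"
        by (rule Aut_mult[OF s(1) Qc_mu[OF l0 h(3)] Qc_mu[OF h(1,4)]])
      moreover have "\<sigma> e \<in> mu l" "\<sigma> w \<in> mu n" using Aut_in_mu[OF s(1)] l0 h by auto
      moreover have "\<sigma> w \<noteq> 1" using Aut_mu_inf[OF s(1) mu_inf_starI[OF h(4,1,5)]] by (simp add: mu_inf_star_def)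
      ultimately show "g (f (e * w)) / g (f w) \<in> prime_over.V P"
        using f h(1,2,6) unfolding Fsd_iff by auto
    qed
    finally show "(r \<odot>\<^bsub>FF\<^esub> f) (e * w) / (r \<odot>\<^bsub>FF\<^esub> f) w \<in> prime_over.V P" .
  qed
qed

lemma Phi_FF: "Phi \<in> carrier FF"
proof -
  have "1 - w \<in> Qc - {0}" if "w \<in> mu_inf_star" for w
    using that Qc_add[OF Qc_1 Qc_uminus[OF Qc_mu_inf[OF that]]] by (auto simp: mu_inf_star_def)
  then show ?thesis
    unfolding FF_carrier Phi_def by (auto simp: Aut_mu_inf Aut_diff Aut_1 Qc_mu_inf)
qed

lemma Phi_Fd: "Phi \<in> Fd"
  unfolding Fd_iff
proof (intro conjI Phi_FF allI impI)
  fix a :: nat and e assume a: "a > 0" "e \<in> mu_inf_star"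
  obtain n where n: "n > 0" "e \<in> mu n" by (rule mu_inf_star_common[OF a(2)]) auto
  have "(\<Prod>w\<in>{w. w ^ a = e}. Phi w) = (\<Prod>w\<in>{w. w ^ a = e}. 1 - w)"
    using roots_mu_inf[OF a(2) _ a(1)] by (intro prod.cong refl) (auto simp: Phi_def)
  also have "\<dots> = 1 - e" by (rule prod_one_minus_roots[OF mu_nonzero[OF n] a(1)])
  finally show "(\<Prod>w\<in>{w. w ^ a = e}. Phi w) = Phi e" using a by (simp add: Phi_def)
qed

lemma Phi_Fsd: "Phi \<in> Fsd"
  unfolding Fsd_def
proof (intro CollectI conjI Phi_Fd allI impI ballI)
  fix n l :: nat and e w assume h: "n > 0" "prime l" "\<not> l dvd n" "e \<in> mu l" "w \<in> mu n - {1}"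
  have ew: "e * w \<in> mu_inf_star" using mult_mu_inf(3)[OF h(2,3,1,4)] h(5) by auto
  have w: "w \<in> mu_inf_star" "algebraic_int w"
    using h by (auto intro: mu_inf_starI algebraic_int_root_of_unity simp: mu_def)
  show "cong_above l (Phi (e * w)) (Phi w)"
    unfolding cong_above_def
  proof (intro allI impI)
    fix P assume "primeideal P alg_integers \<and> of_nat l \<in> P"
    then interpret prime_over z P l using prime_overI h(2) by blast
    have "Phi (e * w) - Phi w = (w * (1 - e)) / 1" using ew w by (simp add: Phi_def algebra_simps)
    moreover have "w * (1 - e) \<in> P" by (rule P_mult(2)[OF one_minus_mu_l[OF h(4)] w(2)])
    ultimately show "\<exists>a\<in>P. \<exists>b\<in>carrier alg_integers - P. Phi (e * w) - Phi w = a / b"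
      using P_1 by (intro bexI[of _ "w * (1 - e)"] bexI[of _ 1]) auto
  qed
qed

end


section \<open>The module of compatible systems of roots of unity\<close>

lemma common_prime_if_not_coprime:
  fixes a b :: nat
  assumes "\<not> coprime a b" obtains q where "prime q" "q dvd a" "q dvd b"
proof -
  have "gcd a b \<noteq> 1" using assms by (simp add: coprime_iff_gcd_eq_1)
  then obtain q where "prime q" "q dvd gcd a b" using prime_factor_nat by blast
  then show ?thesis using that by simp
qed

text \<open>By pigeonhole the powers of b modulo n are periodic from some exponent at most n on,
  with a period at most n, and this period divides both factorials. Hence b^(k!) becomes constant
  modulo n, so its limit is available at finite level.\<close>

lemma power_fact_cong:
  fixes b n m :: nat
  assumes "n > 0" "n \<le> m" shows "[b ^ fact m = b ^ fact n] (mod n)"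
proof -
  have "\<not> inj_on (\<lambda>i. b ^ i mod n) {..n}"
  proof
    assume "inj_on (\<lambda>i. b ^ i mod n) {..n}"
    then have "card {..n} \<le> card {..<n}"
      using assms(1) by (intro card_inj_on_le[of "\<lambda>i. b ^ i mod n"]) auto
    then show False by simp
  qed
  then obtain i j where ij: "i < j" "j \<le> n" "[b ^ i = b ^ j] (mod n)"
    unfolding inj_on_def cong_def by (metis atMost_iff linorder_neqE_nat)
  define t where "t = j - i"
  have t: "t > 0" "t \<le> n" "i \<le> n" using ij by (auto simp: t_def)
  have step: "[b ^ (s + t * c) = b ^ s] (mod n)" if "s \<ge> i" for s c
  proof (induction c)
    case (Suc c)
    have "[b ^ (s + t * c - i) * b ^ j = b ^ (s + t * c - i) * b ^ i] (mod n)"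
      using ij(3) by (intro cong_scalar_left) (rule cong_sym)
    moreover have "s + t * Suc c = (s + t * c - i) + j" "s + t * c = (s + t * c - i) + i" using that ij by (auto simp: t_def)
    ultimately have "[b ^ (s + t * Suc c) = b ^ (s + t * c)] (mod n)" by (metis power_add)
    then show ?case using Suc by (rule cong_trans)
  qed simp
  have "t dvd fact m" "t dvd fact n" using t assms by (auto intro: dvd_fact)
  then have "t dvd fact m - fact n" by (rule dvd_diff_nat)
  then obtain c where "fact m - fact n = t * c" by blast
  moreover have "fact n \<le> (fact m :: nat)" using assms(2) by (rule fact_mono)
  ultimately have "fact m = fact n + t * c" by simp
  moreover have "i \<le> fact n" using t(3) fact_ge_self[of n] by linarith
  ultimately show ?thesis using step[of "fact n" c] by simp
qed

context generators
begin

lemma zhat_mu: "m > 0 \<Longrightarrow> m' dvd m \<Longrightarrow> z m ^ (m div m') = z m'"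
  using z_mult_power[of "m div m'" m'] by (auto simp: dvd_div_eq_0_iff elim!: dvdE)

lemma z_2: "z 2 = - 1"
proof -
  have "z 2 ^ 2 = 1" using z_mu[of 2] by (simp add: mu_def)
  moreover have "z 2 \<noteq> 1" using z_power_eq_1[of 2 1] by simp
  ultimately show ?thesis by (simp add: power2_eq_1_iff)
qed

definition zhat :: "nat \<Rightarrow> complex"
  where "zhat = (\<lambda>m\<in>{0<..}. z m)"

lemma Zhat1_iff:
  "x \<in> carrier Zhat1 \<longleftrightarrow> x \<in> (\<Pi>\<^sub>E m\<in>{0<..}. mu m) \<and> (\<forall>m>0. \<forall>m'. m' dvd m \<longrightarrow> x m ^ (m div m') = x m')"
  by (simp add: Zhat1_def)

lemma Zhat1D:
  assumes "x \<in> carrier Zhat1"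
  shows "m > 0 \<Longrightarrow> x m \<in> mu m" "m > 0 \<Longrightarrow> m' dvd m \<Longrightarrow> x m ^ (m div m') = x m'" "x \<in> extensional {0<..}"
  using assms unfolding Zhat1_iff by (auto simp: PiE_iff)

lemma Zhat1_eqI:
  assumes "x \<in> carrier Zhat1" "y \<in> carrier Zhat1" "\<And>m. m > 0 \<Longrightarrow> x m = y m" shows "x = y"
  by (rule extensionalityI[OF Zhat1D(3)[OF assms(1)] Zhat1D(3)[OF assms(2)]]) (use assms(3) in auto)

lemma Zhat1_ops:
  "\<zero>\<^bsub>Zhat1\<^esub> = (\<lambda>m\<in>{0<..}. 1)" "x \<oplus>\<^bsub>Zhat1\<^esub> y = (\<lambda>m\<in>{0<..}. x m * y m)"
  "r \<odot>\<^bsub>Zhat1\<^esub> x = (\<lambda>m\<in>{0<..}. act m (r m) (x m))"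
  by (simp_all add: Zhat1_def)

lemma dvd_pos: "n > 0 \<Longrightarrow> m dvd n \<Longrightarrow> m > (0 :: nat)" by (auto intro: Nat.gr0I)

lemma zhat_closed: "zhat \<in> carrier Zhat1"
  unfolding Zhat1_iff zhat_def using z_mu zhat_mu dvd_pos by auto

lemma act_mu:
  assumes "n > 0" "w \<in> mu n" shows "act n a w \<in> mu n"
  using act_power_arg[OF assms(1) cyc_field_mu[OF assms(2)], of a n] assms act_1[OF assms(1)] by (simp add: mu_def)

lemma Zhat1_closed:
  shows Zhat1_zero_closed: "\<zero>\<^bsub>Zhat1\<^esub> \<in> carrier Zhat1"
    and Zhat1_add_closed: "x \<in> carrier Zhat1 \<Longrightarrow> y \<in> carrier Zhat1 \<Longrightarrow> x \<oplus>\<^bsub>Zhat1\<^esub> y \<in> carrier Zhat1"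
    and Zhat1_inverse_closed: "x \<in> carrier Zhat1 \<Longrightarrow> (\<lambda>m\<in>{0<..}. inverse (x m)) \<in> carrier Zhat1"
    and Zhat1_smult_closed: "r \<in> carrier R \<Longrightarrow> x \<in> carrier Zhat1 \<Longrightarrow> r \<odot>\<^bsub>Zhat1\<^esub> x \<in> carrier Zhat1"
proof -
  show "\<zero>\<^bsub>Zhat1\<^esub> \<in> carrier Zhat1"
    unfolding Zhat1_ops Zhat1_iff by (auto simp: mu_closed dvd_pos)
  show "x \<oplus>\<^bsub>Zhat1\<^esub> y \<in> carrier Zhat1" if "x \<in> carrier Zhat1" "y \<in> carrier Zhat1"
    unfolding Zhat1_ops Zhat1_iff using Zhat1D[OF that(1)] Zhat1D[OF that(2)]
    by (auto simp: mu_closed dvd_pos power_mult_distrib)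
  show "(\<lambda>m\<in>{0<..}. inverse (x m)) \<in> carrier Zhat1" if "x \<in> carrier Zhat1"
    unfolding Zhat1_iff using Zhat1D[OF that] by (auto simp: mu_closed dvd_pos power_inverse)
  show "r \<odot>\<^bsub>Zhat1\<^esub> x \<in> carrier Zhat1" if r: "r \<in> carrier R" and x: "x \<in> carrier Zhat1"
    unfolding Zhat1_ops Zhat1_iff
  proof (intro conjI allI impI)
    show "(\<lambda>m\<in>{0<..}. act m (r m) (x m)) \<in> (\<Pi>\<^sub>E m\<in>{0<..}. mu m)"
      using Zhat1D(1)[OF x] act_mu by auto
    fix m m' :: nat assume m: "m > 0" "m' dvd m"
    have m': "m' > 0" by (rule dvd_pos[OF m])
    have "act m (r m) (x m) ^ (m div m') = act m (r m) (x m ^ (m div m'))"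
      by (rule act_power_arg[OF m(1) cyc_field_mu[OF Zhat1D(1)[OF x m(1)]], symmetric])
    also have "\<dots> = act m (r m) (x m')" using Zhat1D(2)[OF x m] by simp
    also have "\<dots> = act m' (r m') (x m')"
      by (rule act_R_level[OF r m cyc_field_mu[OF Zhat1D(1)[OF x m']] mu_nonzero[OF m' Zhat1D(1)[OF x m']]])
    finally show "(\<lambda>m\<in>{0<..}. act m (r m) (x m)) m ^ (m div m') = (\<lambda>m\<in>{0<..}. act m (r m) (x m)) m'"
      using m m' by simp
  qed
qed

lemma Zhat1_module: "module R Zhat1"
proof (rule moduleI[OF R_cring])
  note ops = Zhat1_ops
  show "abelian_group Zhat1"
  proof (rule abelian_groupI)
    fix x assume x: "x \<in> carrier Zhat1"
    have "x m \<noteq> 0" if "m > 0" for m using mu_nonzero[OF that Zhat1D(1)[OF x that]] .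
    then show "\<exists>y\<in>carrier Zhat1. y \<oplus>\<^bsub>Zhat1\<^esub> x = \<zero>\<^bsub>Zhat1\<^esub>"
      by (intro bexI[OF _ Zhat1_inverse_closed[OF x]]) (auto simp: ops restrict_def)
    show "\<zero>\<^bsub>Zhat1\<^esub> \<oplus>\<^bsub>Zhat1\<^esub> x = x"
      by (rule Zhat1_eqI[OF Zhat1_add_closed[OF Zhat1_zero_closed x] x]) (simp add: ops)
  qed (simp_all add: Zhat1_add_closed Zhat1_zero_closed, auto simp: ops restrict_def mult_ac)
  fix r s x y assume r: "r \<in> carrier R" and s: "s \<in> carrier R" and x: "x \<in> carrier Zhat1" and y: "y \<in> carrier Zhat1"
  have c: "x m \<in> cyc_field m" "y m \<in> cyc_field m" "x m \<noteq> 0" if "m > 0" for m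
    using cyc_field_mu[OF Zhat1D(1)[OF x that]] cyc_field_mu[OF Zhat1D(1)[OF y that]] mu_nonzero[OF that Zhat1D(1)[OF x that]] by auto
  show "r \<odot>\<^bsub>Zhat1\<^esub> x \<in> carrier Zhat1" by (rule Zhat1_smult_closed[OF r x])
  show "(r \<oplus>\<^bsub>R\<^esub> s) \<odot>\<^bsub>Zhat1\<^esub> x = r \<odot>\<^bsub>Zhat1\<^esub> x \<oplus>\<^bsub>Zhat1\<^esub> s \<odot>\<^bsub>Zhat1\<^esub> x"
    using c by (auto simp: ops R_simps act_add restrict_def)
  show "r \<odot>\<^bsub>Zhat1\<^esub> (x \<oplus>\<^bsub>Zhat1\<^esub> y) = r \<odot>\<^bsub>Zhat1\<^esub> x \<oplus>\<^bsub>Zhat1\<^esub> r \<odot>\<^bsub>Zhat1\<^esub> y"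
    using c by (auto simp: ops act_mult_arg restrict_def)
  show "(r \<otimes>\<^bsub>R\<^esub> s) \<odot>\<^bsub>Zhat1\<^esub> x = r \<odot>\<^bsub>Zhat1\<^esub> (s \<odot>\<^bsub>Zhat1\<^esub> x)"
    using c R_component[OF r] R_component[OF s] by (auto simp: ops R_simps act_mult restrict_def)
next
  fix x assume x: "x \<in> carrier Zhat1"
  have "x m \<in> cyc_field m" if "m > 0" for m using cyc_field_mu[OF Zhat1D(1)[OF x that]] .
  then show "\<one>\<^bsub>R\<^esub> \<odot>\<^bsub>Zhat1\<^esub> x = x"
    by (intro Zhat1_eqI[OF Zhat1_smult_closed[OF R_one_closed x] x])
       (auto simp: Zhat1_ops R_simps act_one simp del: int_group_ring_simps)
qed

lemma Zhat1_a_inv: "x \<in> carrier Zhat1 \<Longrightarrow> \<ominus>\<^bsub>Zhat1\<^esub> x = (\<lambda>m\<in>{0<..}. inverse (x m))"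
  using mu_nonzero Zhat1D(1)[of x]
  by (intro abelian_group.minus_equality[of Zhat1] Zhat1_inverse_closed module.axioms(2)[OF Zhat1_module])
     (auto simp: Zhat1_ops restrict_def)

text \<open>A compatible system of unit exponents comes from a compatible system of automorphisms,
  that is, from a \<open>point\<close> of \<open>R\<close>; so every unit of the profinite integers
  is realised.\<close>

lemma unit_system_smult:
  assumes u: "\<And>m. m > 0 \<Longrightarrow> coprime (u m) m" "\<And>m m'. m > 0 \<Longrightarrow> m' dvd m \<Longrightarrow> [u m = u m'] (mod m')"
  shows "\<exists>r\<in>carrier R. r \<odot>\<^bsub>Zhat1\<^esub> zhat = (\<lambda>m\<in>{0<..}. z m ^ u m)"
proof -
  have "\<forall>m\<in>{0<..}. \<exists>\<sigma>. \<sigma> \<in> Aut \<and> (\<forall>w\<in>mu m. \<sigma> w = w ^ u m)" using Aut_unit u(1) by blast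
  then obtain \<sigma> where s: "\<And>m. m > 0 \<Longrightarrow> \<sigma> m \<in> Aut" "\<And>m w. m > 0 \<Longrightarrow> w \<in> mu m \<Longrightarrow> \<sigma> m w = w ^ u m"
    by (metis greaterThan_iff)
  define \<rho> where "\<rho> m = restrict (\<sigma> m) (cyc_field m)" for m
  have r: "\<rho> m \<in> carrier (G m)" if "m > 0" for m unfolding \<rho>_def using G_restrict[OF that s(1)[OF that]] .
  have zc: "z m \<in> cyc_field m" if "m > 0" for m using cyc_field_mu[OF z_mu[OF that]] .
  have pt: "point \<rho> \<in> carrier R"
  proof (rule point_closed[OF r])
    fix n m :: nat assume n: "n > 0" and d: "m dvd n"
    have m: "m > 0" by (rule dvd_pos[OF n d])
    show "restrict (\<rho> n) (cyc_field m) = \<rho> m"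
    proof (rule G_eqI[OF m G_restrict_level[OF n d r[OF n]] r[OF m]])
      have "restrict (\<rho> n) (cyc_field m) (z m) = \<sigma> n (z m)"
        using zc[OF m] cyc_field_mono[OF d zc[OF m]] by (simp add: \<rho>_def)
      also have "\<dots> = z m ^ u n" using s(2)[OF n mu_closed(5)[OF d z_mu[OF m]]] .
      also have "\<dots> = z m ^ u m" using z_power_eq_iff[OF m] u(2)[OF n d] by simp
      also have "\<dots> = \<rho> m (z m)" using s(2)[OF m z_mu[OF m]] zc[OF m] by (simp add: \<rho>_def)
      finally show "restrict (\<rho> n) (cyc_field m) (z m) = \<rho> m (z m)" .
    qed
  qed
  show ?thesis
  proof (intro bexI[OF _ pt])
    show "point \<rho> \<odot>\<^bsub>Zhat1\<^esub> zhat = (\<lambda>m\<in>{0<..}. z m ^ u m)"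
      unfolding Zhat1_ops
    proof (rule restrict_ext)
      fix m :: nat assume "m \<in> {0<..}"
      then have m: "m > 0" by simp
      show "act m (point \<rho> m) (zhat m) = z m ^ u m"
        using act_point[OF m r[OF m], of "z m"] m s(2)[OF m z_mu[OF m]] zc[OF m] by (simp add: point_def zhat_def \<rho>_def)
    qed
  qed
qed

text \<open>Every even element \<open>a\<close> of the profinite integers is \<open>u + w - 2\<close> with units \<open>u = a + 1 - e\<close> and
  \<open>w = 1 + e\<close>, where \<open>e\<close>, the limit of \<open>a\<^bsup>k!\<^esup>\<close>, is the idempotent supported at the primes not dividing \<open>a\<close>.\<close>

lemma Zhat1_generated:
  assumes x: "x \<in> carrier Zhat1"
  shows "\<exists>r\<in>carrier R. r \<odot>\<^bsub>Zhat1\<^esub> zhat = x"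
proof -
  note M = Zhat1_module
  note ag = module.axioms(2)[OF M]
  let ?T = "{x. \<exists>r\<in>carrier R. r \<odot>\<^bsub>Zhat1\<^esub> zhat = x}"
  have Tz: "zhat \<in> ?T" using module.smult_one[OF M zhat_closed] R_one_closed by blast
  have Tadd: "x \<oplus>\<^bsub>Zhat1\<^esub> y \<in> ?T" if xy: "x \<in> ?T" "y \<in> ?T" for x y
  proof -
    obtain r s where "r \<in> carrier R" "s \<in> carrier R" "r \<odot>\<^bsub>Zhat1\<^esub> zhat = x" "s \<odot>\<^bsub>Zhat1\<^esub> zhat = y" using xy by blast
    then show ?thesis using module.smult_l_distr[OF M _ _ zhat_closed, of r s] abelian_group.axioms(1)[OF R_abelian_group]
      by (auto intro!: bexI[of _ "r \<oplus>\<^bsub>R\<^esub> s"] abelian_monoid.a_closed)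
  qed
  have Tinv: "\<ominus>\<^bsub>Zhat1\<^esub> x \<in> ?T" if xT: "x \<in> ?T" for x
  proof -
    obtain r where "r \<in> carrier R" "r \<odot>\<^bsub>Zhat1\<^esub> zhat = x" using xT by blast
    then show ?thesis using module.smult_l_minus[OF M _ zhat_closed, of r] abelian_group.a_inv_closed[OF R_abelian_group]
      by (auto intro!: bexI[of _ "\<ominus>\<^bsub>R\<^esub> r"])
  qed
  have Tc: "x \<in> carrier Zhat1" if "x \<in> ?T" for x using that Zhat1_smult_closed zhat_closed by blast
  have even: "x \<in> ?T" if x: "x \<in> carrier Zhat1" and x2: "x 2 = 1" for x
  proof -
    have "\<forall>m\<in>{0<..}. \<exists>a :: nat. x m = z m ^ a" using Zhat1D(1)[OF x] mu_cases by (metis greaterThan_iff)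
    then obtain a :: "nat \<Rightarrow> nat" where a: "\<And>m. m > 0 \<Longrightarrow> x m = z m ^ a m" by (metis greaterThan_iff)
    have ac: "[a m = a m'] (mod m')" if m: "m > 0" "m' dvd m" for m m'
    proof -
      have m': "m' > 0" by (rule dvd_pos[OF m])
      have "z m' ^ a m = (z m ^ (m div m')) ^ a m" using zhat_mu[OF m] by simp
      also have "\<dots> = x m ^ (m div m')" using a[OF m(1)] by (simp add: power_mult[symmetric] mult.commute)
      also have "\<dots> = z m' ^ a m'" using Zhat1D(2)[OF x m] a[OF m'] by simp
      finally show ?thesis using z_power_eq_iff[OF m'] by simp
    qed
    have a2: "even (a m)" if m: "m > 0" "even m" for m
    proof -
      have "z 2 ^ a 2 = 1" using a[of 2] x2 by simp
      then have "even (a 2)" using z_power_eq_1[of 2] by simp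
      moreover have "[a m = a 2] (mod 2)" by (rule ac[OF m(1)]) (use m in simp)
      ultimately show ?thesis by (simp add: cong_def even_iff_mod_2_eq_zero)
    qed
    \<comment> \<open>At level m the exponent m! is large enough: modulo a prime q dividing m the
      number e is 0 if q divides a, and otherwise 1 by Fermat, as q - 1 divides m!.\<close>
    define e where "e m = a m ^ fact m" for m
    have ec: "[e m = e m'] (mod m')" if m: "m > 0" "m' dvd m" for m m'
    proof -
      have m': "m' > 0" by (rule dvd_pos[OF m])
      have "[a m ^ fact m = a m' ^ fact m] (mod m')" by (rule cong_pow[OF ac[OF m]])
      also have "[a m' ^ fact m = a m' ^ fact m'] (mod m')"
        by (rule power_fact_cong[OF m' dvd_imp_le[OF m(2,1)]])
      finally show ?thesis by (simp add: e_def)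
    qed
    have e0: "q dvd e m" if "q dvd a m" for q m
      unfolding e_def using that fact_gt_zero[of m] by (metis dvd_power dvd_trans)
    have e1: "[e m = 1] (mod q)" if q: "prime q" "q dvd m" "m > 0" "\<not> q dvd a m" for q m
    proof -
      have "q - 1 dvd fact m" using prime_gt_1_nat[OF q(1)] dvd_imp_le[OF q(2,3)] by (intro dvd_fact) auto
      then obtain c where c: "fact m = (q - 1) * c" by blast
      have "[(a m ^ (q - 1)) ^ c = 1 ^ c] (mod q)" by (rule cong_pow[OF fermat_theorem[OF q(1,4)]])
      then show ?thesis unfolding e_def c power_mult by simp
    qed
    \<comment> \<open>The summand (m - 1) e represents - e modulo m without subtraction of natural
      numbers.\<close>
    define u where "u m = a m + 1 + (m - 1) * e m" for m
    define w where "w m = 1 + e m" for m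
    have ue: "u m + e m = a m + 1 + m * e m" if "m > 0" for m
      using that by (cases m) (simp_all add: u_def)
    \<comment> \<open>Modulo a prime q dividing m, u is 1 if q divides a, and is a
      otherwise.\<close>
    have uc: "coprime (u m) m" if m: "m > 0" for m
    proof (rule ccontr)
      assume "\<not> coprime (u m) m"
      then obtain q where q: "prime q" "q dvd u m" "q dvd m" by (rule common_prime_if_not_coprime)
      have "[e m = u m + e m] (mod q)" using q(2) by (simp add: cong_def mod_add_eq[symmetric] mod_eq_0_iff_dvd[symmetric])
      moreover have "[u m + e m = a m + 1] (mod q)" unfolding ue[OF m] using q(3)
        by (metis cong_def add_0_right dvd_eq_mod_eq_0 dvd_mult2 mod_add_right_eq)
      ultimately have ea: "[e m = a m + 1] (mod q)" by (rule cong_trans)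
      show False
      proof (cases "q dvd a m")
        case True
        then have "q dvd a m + 1" using e0[OF True] ea by (simp add: cong_dvd_iff)
        then show False using True q(1) by (metis dvd_add_right_iff not_prime_unit)
      next
        case False
        have "[0 + 1 = a m + 1] (mod q)" using cong_trans[OF cong_sym[OF e1[OF q(1,3) m False]] ea] by simp
        then have "[0 = a m] (mod q)" by (simp only: cong_add_rcancel_nat)
        then show False using False by (simp add: cong_0_iff cong_sym_eq[of 0])
      qed
    qed
    \<comment> \<open>Modulo a prime q dividing m, w is 1 if q divides a, and 2 otherwise; in the
      latter case q = 2 is excluded because a is even at even levels.\<close>
    have wc: "coprime (w m) m" if m: "m > 0" for m
    proof (rule ccontr)
      assume "\<not> coprime (w m) m"
      then obtain q where q: "prime q" "q dvd w m" "q dvd m" by (rule common_prime_if_not_coprime)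
      show False
      proof (cases "q dvd a m")
        case True
        then have "q dvd 1" using e0[OF True] q(2) unfolding w_def by (metis dvd_add_left_iff)
        then show False using q(1) by simp
      next
        case False
        have "[1 + e m = 1 + 1] (mod q)" using e1[OF q(1,3) m False] by (intro cong_add) auto
        then have "q dvd 1 + 1" using q(2) unfolding w_def by (metis cong_0_iff cong_sym cong_trans)
        then have "q dvd 2" unfolding one_add_one .
        then have "q = 2" using q(1) by (simp add: primes_dvd_imp_eq)
        then show False using a2[OF m] q(3) False by simp
      qed
    qed
    have uu: "[u m = u m'] (mod m')" if m: "m > 0" "m' dvd m" for m m'
    proof -
      have m': "m' > 0" by (rule dvd_pos[OF m])
      have "[u m + e m = a m + 1] (mod m')" unfolding ue[OF m(1)] cong_def using m(2)
        by (metis add_0_right dvd_eq_mod_eq_0 dvd_mult2 mod_add_right_eq)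
      also have "[a m + 1 = a m' + 1] (mod m')" by (intro cong_add ac m) simp
      also have "[a m' + 1 = u m' + e m'] (mod m')" unfolding ue[OF m'] by (simp add: cong_def)
      also have "[u m' + e m' = u m' + e m] (mod m')" by (intro cong_add cong_sym[OF ec[OF m]]) simp
      finally show ?thesis by (simp only: cong_add_rcancel_nat)
    qed
    have ww: "[w m = w m'] (mod m')" if m: "m > 0" "m' dvd m" for m m'
      unfolding w_def by (intro cong_add ec m) simp
    let ?u = "\<lambda>m\<in>{0<..}. z m ^ u m" and ?w = "\<lambda>m\<in>{0<..}. z m ^ w m"
    have T1: "?u \<in> ?T" "?w \<in> ?T" using unit_system_smult[OF uc uu] unit_system_smult[OF wc ww] by blast+
    have nz: "z m \<noteq> 0" if "m > 0" for m using mu_nonzero[OF that z_mu[OF that]] .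
    define c where "c = \<ominus>\<^bsub>Zhat1\<^esub> (zhat \<oplus>\<^bsub>Zhat1\<^esub> zhat)"
    have cm: "c m = inverse (z m * z m)" if "m > 0" for m
      unfolding c_def Zhat1_a_inv[OF Zhat1_add_closed[OF zhat_closed zhat_closed]]
      using that by (simp add: Zhat1_ops zhat_def)
    have cT: "c \<in> ?T" unfolding c_def by (intro Tinv Tadd Tz)
    have "?u \<oplus>\<^bsub>Zhat1\<^esub> ?w \<oplus>\<^bsub>Zhat1\<^esub> c = x"
    proof (rule Zhat1_eqI)
      show "?u \<oplus>\<^bsub>Zhat1\<^esub> ?w \<oplus>\<^bsub>Zhat1\<^esub> c \<in> carrier Zhat1"
        by (intro Tc Tadd cT T1)
      fix m :: nat assume m: "m > 0"
      have "[u m + w m = a m + 2] (mod m)"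
      proof -
        have "u m + w m = a m + 2 + m * e m" using ue[OF m] by (simp add: w_def)
        then show ?thesis by (simp only: cong_def mod_mult_self2)
      qed
      then have "z m ^ (u m + w m) = z m ^ (a m + 2)" unfolding z_power_eq_iff[OF m] .
      then have "z m ^ u m * z m ^ w m = z m ^ a m * (z m * z m)"
        unfolding power_add power2_eq_square .
      then show "(?u \<oplus>\<^bsub>Zhat1\<^esub> ?w \<oplus>\<^bsub>Zhat1\<^esub> c) m = x m"
        using m nz[OF m] a[OF m] cm[OF m] by (simp add: Zhat1_ops field_simps)
    qed (rule x)
    then show ?thesis using Tadd[OF Tadd[OF T1] cT] by simp
  qed
  have "x 2 \<in> mu 2" using Zhat1D(1)[OF x] by simp
  then have "x 2 = 1 \<or> x 2 = - 1" by (simp add: mu_def power2_eq_1_iff)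
  then show ?thesis
  proof
    assume "x 2 = - 1"
    \<comment> \<open>An odd system becomes even after adding the generator, whose component at 2 is
      -1.\<close>
    have xz: "x \<oplus>\<^bsub>Zhat1\<^esub> zhat \<in> carrier Zhat1" by (rule Zhat1_add_closed[OF x zhat_closed])
    have "x \<oplus>\<^bsub>Zhat1\<^esub> zhat \<in> ?T" by (rule even[OF xz]) (simp add: Zhat1_ops zhat_def z_2 \<open>x 2 = - 1\<close>)
    then have "x \<oplus>\<^bsub>Zhat1\<^esub> zhat \<oplus>\<^bsub>Zhat1\<^esub> (\<ominus>\<^bsub>Zhat1\<^esub> zhat) \<in> ?T" using Tadd Tinv[OF Tz] by blast
    moreover have "x \<oplus>\<^bsub>Zhat1\<^esub> zhat \<oplus>\<^bsub>Zhat1\<^esub> (\<ominus>\<^bsub>Zhat1\<^esub> zhat) = x"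
    proof -
      interpret Z: abelian_group Zhat1 by (rule ag)
      show ?thesis using x zhat_closed by (simp add: Z.a_assoc Z.r_neg)
    qed
    ultimately show ?thesis by simp
  qed (use even[OF x] in simp)
qed

end


section \<open>Torsion-valued distributions and systems of roots of unity\<close>

context generators
begin

text \<open>Suppose the order k' of \<open>w\<close> does not divide N. With L = lcm(N, k'), a prime
  q dividing L / N and D = L / q, the exponent u = 1 + D c defines an automorphism that is trivial
  on Q(N) but moves \<open>w\<close>, as soon as u is prime to L and q does not divide c. Evenness
  of N guarantees such a c.\<close>

lemma root_of_unity_in_cyc_field:
  assumes N: "N > 0" "even N" and w: "w \<in> cyc_field N" "w ^ k = 1" "k > 0"
  shows "w \<in> mu N"
proof -
  have wk: "w \<in> mu k" using w by (simp add: mu_def)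
  define k' where "k' = root_order w"
  have k': "k' > 0" "\<And>i. w ^ i = 1 \<longleftrightarrow> k' dvd i"
    using mu_mem_iff_root_order[OF wk w(3)] by (simp_all add: k'_def)
  have wk': "w \<in> mu k'" using k'(2)[of k'] by (simp add: mu_def)
  define L where "L = lcm N k'"
  have L: "L > 0" "N dvd L" "k' dvd L" using N k' by (auto simp: L_def lcm_pos_nat)
  show ?thesis
  proof (rule ccontr)
    assume "w \<notin> mu N"
    then have "\<not> k' dvd N" using k'(2) by (simp add: mu_def)
    then have "L \<noteq> N" using L by auto
    then have "L div N \<noteq> 1" using L(2) by (metis dvd_div_mult_self mult_1)
    then obtain q where q: "prime q" "q dvd L div N" using prime_factor_nat by blast
    then obtain t where t: "L = N * (q * t)" using L(2) by (metis dvd_div_mult_self dvdE mult.commute)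
    define D where "D = N * t"
    have D: "L = D * q" "N dvd D" using t by (auto simp: D_def mult_ac)
    have D0: "D > 0" using L(1) D(1) by (cases D) auto
    have pd: "p dvd D" if "prime p" "p dvd L" "p \<noteq> q" for p
      using that q(1) unfolding D(1) by (metis prime_dvd_mult_iff primes_dvd_imp_eq)
    \<comment> \<open>If q divides D, take c = 1. Otherwise q is odd, as N is even and divides D,
      and one of 1 + D and 1 + 2 D is prime to q.\<close>
    obtain c where c: "\<not> q dvd c" "\<not> q dvd 1 + D * c"
    proof (cases "q dvd D")
      case True
      then show ?thesis using that[of 1] q(1) by (metis dvd_add_left_iff dvd_mult2 not_prime_unit)
    next
      case False
      then have "q \<noteq> 2" using N(2) D(2) dvd_trans by blast
      then have q2: "\<not> q dvd 2" using q(1) primes_dvd_imp_eq two_is_prime_nat by blast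
      show ?thesis
      proof (cases "q dvd 1 + D")
        case True
        have "1 + D * 2 = (1 + D) + D" by simp
        then have "\<not> q dvd 1 + D * 2" using True False by (metis dvd_add_right_iff)
        then show ?thesis using that[of 2] q2 by blast
      next
        case f: False
        then show ?thesis using that[of 1] prime_gt_1_nat[OF q(1)] by simp
      qed
    qed
    define u where "u = 1 + D * c"
    have "coprime u L"
    proof (rule ccontr)
      assume "\<not> coprime u L"
      then obtain p where p: "prime p" "p dvd u" "p dvd L" by (rule common_prime_if_not_coprime)
      show False
      proof (cases "p = q")
        case True
        then show False using p(2) c(2) by (simp add: u_def)
      next
        case False
        then have "p dvd D * c" using pd[OF p(1,3)] by simp
        then have "p dvd 1" using p(2) unfolding u_def by (metis dvd_add_left_iff)
        then show False using p(1) by simp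
      qed
    qed
    then obtain \<sigma> where s: "\<sigma> \<in> Aut" "\<And>v. v \<in> mu L \<Longrightarrow> \<sigma> v = v ^ u" using Aut_unit[OF L(1)] by blast
    have fixN: "\<sigma> v = (\<lambda>x\<in>Qc. x) v" if v: "v \<in> mu N" for v
    proof -
      obtain d where d: "D = N * d" using D(2) by blast
      have "[u = 1] (mod N)" unfolding u_def d cong_def mult.assoc by (simp only: mod_mult_self2)
      then show ?thesis
        using s(2)[OF mu_closed(5)[OF L(2) v]] mu_power_cong[OF N(1) v] Qc_mu[OF N(1) v] by simp
    qed
    have "\<sigma> w = w"
      using Aut_eq_on_cyc_field[OF s(1) Aut_id N(1) w(1) fixN] cyc_field_Qc[OF N(1) w(1)] by simp
    then have "w ^ u = w" using s(2)[OF mu_closed(5)[OF L(3) wk']] by simp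
    moreover have "w \<noteq> 0" using mu_nonzero[OF k'(1) wk'] .
    ultimately have "w ^ (D * c) = 1" by (simp add: u_def)
    then have "k' dvd D * c" using k'(2) by simp
    then have "L dvd D * c" unfolding L_def using D(2) by (intro lcm_least) auto
    then have "q dvd c" using D0 unfolding D(1) by simp
    then show False using c(1) by simp
  qed
qed

lemma Ftv_Fd: "f \<in> Ftv z \<Longrightarrow> f \<in> Fd" and Ftv_FF: "f \<in> Ftv z \<Longrightarrow> f \<in> carrier FF"
  using Fd_FF by (auto simp: Ftv_def)

lemma Ftv_mu:
  assumes f: "f \<in> Ftv z" and w: "w \<in> mu N" "w \<noteq> 1" and N: "N > 0" "even N"
  shows "f w \<in> mu N"
proof -
  have "w \<in> mu_inf_star" using w N by (intro mu_inf_starI)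
  then obtain k where "k > 0" "f w ^ k = 1" using f unfolding Ftv_iff by blast
  then show ?thesis
    using root_of_unity_in_cyc_field[OF N FF_cyc_field[OF Ftv_FF[OF f] w(1) N(1) w(2)]] by blast
qed

lemma even_gt_1: "N > 0 \<Longrightarrow> even N \<Longrightarrow> N > (1 :: nat)"
  by (cases "N = 1") auto

text \<open>Evenness of N makes the value at \<open>z N\<close> a power of \<open>z N\<close>, and
  conjugation carries the same exponent to all roots of order N.\<close>

lemma Ftv_exponent:
  assumes f: "f \<in> Ftv z" and N: "N > 0" "even N"
  shows "\<exists>b. \<forall>v\<in>mu_inf_star. root_order v = N \<longrightarrow> f v = v ^ b"
proof -
  have N1: "N > 1" by (rule even_gt_1[OF N])
  have zi: "z N \<in> mu_inf_star" by (rule z_mu_inf[OF N1])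
  have "z N \<noteq> 1" using zi by (simp add: mu_inf_star_def)
  then obtain b where b: "f (z N) = z N ^ b" using mu_cases[OF N(1) Ftv_mu[OF f z_mu[OF N(1)] _ N]] by blast
  show ?thesis
  proof (intro exI ballI impI)
    fix v assume v: "v \<in> mu_inf_star" "root_order v = N"
    obtain \<sigma> where s: "\<sigma> \<in> Aut" "\<sigma> (z N) = v"
      using Aut_transitive[OF zi v(1)] root_order_z[OF N(1)] v(2) by auto
    have "f v = \<sigma> (z N ^ b)" using FF_Aut[OF Ftv_FF[OF f] zi s(1)] s(2) b by simp
    then show "f v = v ^ b" using Aut_power[OF s(1) Qc_mu[OF N(1) z_mu[OF N(1)]]] s(2) by simp
  qed
qed

text \<open>All p-th roots of \<open>z N\<close> have order p N, so \<open>f\<close> is one fixed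
  power on them, and the distribution relation evaluates to that power of their product, which is
  \<open>z N\<close> up to sign.\<close>

lemma Ftv_compat_dvd:
  assumes f: "f \<in> Ftv z" and N: "N > 0" "even N" and p: "prime p" "p dvd N"
  shows "f (z (p * N)) ^ (2 * p) = f (z N) ^ 2"
proof -
  have p0: "p > 0" using p(1) by (simp add: prime_gt_0_nat)
  have pN: "p * N > 0" "even (p * N)" using p0 N by auto
  have zi: "z N \<in> mu_inf_star" "z (p * N) \<in> mu_inf_star"
    using z_mu_inf even_gt_1[OF N] even_gt_1[OF pN] by auto
  obtain b where b: "\<And>v. v \<in> mu_inf_star \<Longrightarrow> root_order v = p * N \<Longrightarrow> f v = v ^ b"
    using Ftv_exponent[OF f pN] by blast
  have "f (z N) = (\<Prod>v\<in>{v. v ^ p = z N}. f v)" using Ftv_Fd[OF f] p0 zi by (simp add: Fd_iff)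
  also have "\<dots> = (\<Prod>v\<in>{v. v ^ p = z N}. v ^ b)"
  proof (intro prod.cong refl b)
    fix v assume "v \<in> {v. v ^ p = z N}"
    then have v: "v ^ p ^ 1 = z N" by simp
    show "v \<in> mu_inf_star" using roots_mu_inf[OF zi(1) _ p0, of v] v by simp
    show "root_order v = p * N" using root_order_root[OF zi(1) p(1) _ v] p(2) root_order_z[OF N(1)] by simp
  qed
  also have "\<dots> = (\<Prod>v\<in>{v. v ^ p = z N}. v) ^ b" by (simp add: prod_power_distrib)
  finally have "f (z N) ^ 2 = ((\<Prod>v\<in>{v. v ^ p = z N}. v) ^ 2) ^ b" by (simp add: power_mult[symmetric] mult.commute)
  also have "\<dots> = (z N ^ 2) ^ b" using prod_roots_sq[OF mu_nonzero[OF N(1) z_mu[OF N(1)]] p0] by simp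
  also have "\<dots> = ((z (p * N) ^ p) ^ 2) ^ b" using z_mult_power[OF p0 N(1)] by simp
  also have "\<dots> = f (z (p * N)) ^ (2 * p)"
    using b[OF zi(2) root_order_z[OF pN(1)]] by (simp add: power_mult[symmetric] mult_ac)
  finally show ?thesis by simp
qed

text \<open>When \<open>p\<close> does not divide \<open>N\<close>, exactly one of the \<open>p\<close>-th roots of \<open>z N\<close> has order \<open>N\<close> instead of
  \<open>p N\<close>, which costs a factor \<open>p - 1\<close> in the exponent.\<close>

lemma Ftv_compat_coprime:
  assumes f: "f \<in> Ftv z" and N: "N > 0" "even N" and p: "prime p" "\<not> p dvd N"
  shows "(f (z N) ^ 2) ^ (p - 1) = (f (z (p * N)) ^ (2 * p)) ^ (p - 1)"
proof -
  have p0: "p > 0" using p(1) by (simp add: prime_gt_0_nat)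
  have pN: "p * N > 0" "even (p * N)" using p0 N by auto
  let ?y = "z N"
  have zi: "?y \<in> mu_inf_star" "z (p * N) \<in> mu_inf_star"
    using z_mu_inf even_gt_1[OF N] even_gt_1[OF pN] by auto
  have y0: "?y \<noteq> 0" using mu_nonzero[OF N(1) z_mu[OF N(1)]] .
  obtain b where b: "\<And>v. v \<in> mu_inf_star \<Longrightarrow> root_order v = N \<Longrightarrow> f v = v ^ b"
    using Ftv_exponent[OF f N] by blast
  obtain b' where b': "\<And>v. v \<in> mu_inf_star \<Longrightarrow> root_order v = p * N \<Longrightarrow> f v = v ^ b'"
    using Ftv_exponent[OF f pN] by blast
  have cop: "coprime p N" using p by (rule prime_imp_coprime)
  then obtain x where x: "[p * x = 1] (mod N)" using cong_solve_coprime_nat by auto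
  have xN: "coprime x N" using x by (metis cong_imp_coprime cong_sym coprime_1_left coprime_mult_left_iff)
  \<comment> \<open>The p-th root inside \<open>mu N\<close>, obtained by inverting p modulo
    N.\<close>
  define v0 where "v0 = ?y ^ x"
  have v0p: "v0 ^ p = ?y"
    unfolding v0_def power_mult[symmetric] using z_power_eq_iff[OF N(1), of "x * p" 1] x by (simp add: mult.commute)
  have v0i: "v0 \<in> mu_inf_star" by (rule roots_mu_inf[OF zi(1) v0p p0])
  obtain \<sigma> where s: "\<sigma> \<in> Aut" "\<And>w. w \<in> mu N \<Longrightarrow> \<sigma> w = w ^ x" using Aut_unit[OF N(1) xN] by blast
  have v0N: "root_order v0 = N"
    using Aut_root_order[OF s(1) zi(1)] s(2)[OF z_mu[OF N(1)]] root_order_z[OF N(1)] by (simp add: v0_def)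
  have v00: "v0 \<noteq> 0" using y0 by (simp add: v0_def)
  let ?S = "{v. v ^ p = ?y}"
  have fin: "finite ?S" by (rule roots_finite[OF p0])
  have ord: "v \<in> mu_inf_star \<and> root_order v = p * N" if v: "v \<in> ?S - {v0}" for v
  proof -
    have vp: "v ^ p = ?y" "v \<noteq> v0" using v by auto
    have vi: "v \<in> mu_inf_star" by (rule roots_mu_inf[OF zi(1) vp(1) p0])
    note o = mu_inf_star_order[OF vi]
    let ?r = "root_order v"
    have "v ^ (p * N) = 1" unfolding power_mult vp(1) using z_mu[OF N(1)] by (simp add: mu_def)
    then have rd: "?r dvd p * N" using o(3) by simp
    have "v ^ ?r = 1" using o(3) by simp
    moreover have "?y ^ ?r = (v ^ ?r) ^ p"
      unfolding vp(1)[symmetric] by (simp only: power_mult[symmetric] mult.commute)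
    ultimately have "?y ^ ?r = 1" by simp
    then have "N dvd ?r" using z_power_eq_1[OF N(1)] by simp
    then obtain c where c: "?r = N * c" by blast
    then have "c dvd p" using rd N(1) by (simp add: mult.commute)
    then have "c = 1 \<or> c = p" using p(1) by (simp add: prime_nat_iff)
    moreover have "c \<noteq> 1"
    proof
      assume "c = 1"
      then have vN: "v \<in> mu N" using c o(2) by simp
      have "v = v ^ (p * x)" using mu_power_cong[OF N(1) vN x] by simp
      also have "\<dots> = v0" unfolding power_mult vp(1) v0_def ..
      finally show False using vp(2) by simp
    qed
    ultimately show ?thesis using vi c by (simp add: mult.commute)
  qed
  define Y where "Y = (\<Prod>v\<in>?S. v)"
  have Y2: "Y ^ 2 = ?y ^ 2" unfolding Y_def by (rule prod_roots_sq[OF y0 p0])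
  have v0S: "v0 \<in> ?S" using v0p by simp
  have "Y = v0 * (\<Prod>v\<in>?S - {v0}. v)" unfolding Y_def using prod.remove[OF fin v0S] .
  then have Yv: "(\<Prod>v\<in>?S - {v0}. v) = Y / v0" using v00 by simp
  have "f ?y = (\<Prod>v\<in>?S. f v)" using Ftv_Fd[OF f] p0 zi by (simp add: Fd_iff)
  also have "\<dots> = f v0 * (\<Prod>v\<in>?S - {v0}. f v)" by (rule prod.remove[OF fin v0S])
  also have "(\<Prod>v\<in>?S - {v0}. f v) = (\<Prod>v\<in>?S - {v0}. v ^ b')"
    using ord b' by (intro prod.cong refl) blast
  also have "\<dots> = (Y / v0) ^ b'" unfolding prod_power_distrib[symmetric] Yv ..
  also have "f v0 = v0 ^ b" by (rule b[OF v0i v0N])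
  also have "f ?y = ?y ^ b" by (rule b[OF zi(1) root_order_z[OF N(1)]])
  finally have "?y ^ b * v0 ^ b' = v0 ^ b * Y ^ b'" using v00 by (simp add: power_divide)
  \<comment> \<open>Squaring allows the product of all roots to be replaced by \<open>z N\<close>,
    and the p-th power turns \<open>v0\<close> into \<open>z N\<close>; a relation between powers of
    \<open>z N\<close> alone remains.\<close>
  then have "((?y ^ b * v0 ^ b') ^ 2) ^ p = ((v0 ^ b * Y ^ b') ^ 2) ^ p" by simp
  then have "?y ^ (2 * b * p) * (v0 ^ p) ^ (2 * b') = (v0 ^ p) ^ (2 * b) * (Y ^ 2) ^ (b' * p)"
    by (simp add: power_mult_distrib power_mult[symmetric] mult_ac)
  then have "?y ^ (2 * b * p) * ?y ^ (2 * b') = ?y ^ (2 * b) * ?y ^ (2 * b' * p)"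
    unfolding v0p Y2 by (simp add: power_mult[symmetric] mult_ac)
  moreover have "2 * k * p = 2 * k * (p - 1) + 2 * k" for k using p0 by (cases p) simp_all
  ultimately have "?y ^ (2 * b * (p - 1)) * (?y ^ (2 * b) * ?y ^ (2 * b')) = ?y ^ (2 * b' * (p - 1)) * (?y ^ (2 * b) * ?y ^ (2 * b'))"
    by (simp add: power_add mult_ac)
  then have e: "?y ^ (2 * b * (p - 1)) = ?y ^ (2 * b' * (p - 1))" using y0 by simp
  have "f (z (p * N)) ^ (2 * p) = (z (p * N) ^ p) ^ (2 * b')"
    using b'[OF zi(2) root_order_z[OF pN(1)]] by (simp add: power_mult[symmetric] mult_ac)
  also have "\<dots> = ?y ^ (2 * b')" using z_mult_power[OF p0 N(1)] by simp
  finally have 2: "f (z (p * N)) ^ (2 * p) = ?y ^ (2 * b')" .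
  have "f ?y ^ 2 = ?y ^ (2 * b)"
    using b[OF zi(1) root_order_z[OF N(1)]] by (simp add: power_mult[symmetric] mult_ac)
  then show ?thesis unfolding 2 using e by (simp add: power_mult)
qed

text \<open>Composite q is treated factor by factor. For a prime q not dividing N the relation is
  known only up to (q - 1)-st powers. Using it at level (q - 1) N and descending by the induction
  hypothesis for q - 1, both at N and at q N, absorbs this exponent.\<close>

lemma Ftv_compat:
  assumes f: "f \<in> Ftv z"
  shows "q > 0 \<Longrightarrow> N > 0 \<Longrightarrow> even N \<Longrightarrow> f (z (q * N)) ^ (2 * q) = f (z N) ^ 2"
proof (induction q arbitrary: N rule: less_induct)
  case (less q)
  have mult: "f (z (a * c * M)) ^ (2 * (a * c)) = f (z M) ^ 2"
    if h: "f (z (a * (c * M))) ^ (2 * a) = f (z (c * M)) ^ 2" "f (z (c * M)) ^ (2 * c) = f (z M) ^ 2" for a c M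
  proof -
    have "f (z (a * c * M)) ^ (2 * (a * c)) = (f (z (a * (c * M))) ^ (2 * a)) ^ c"
      by (simp add: power_mult[symmetric] mult_ac)
    also have "\<dots> = f (z (c * M)) ^ (2 * c)" unfolding h(1) by (simp add: power_mult[symmetric])
    finally show ?thesis using h(2) by simp
  qed
  consider "q = 1" | "prime q" | a c where "q = a * c" "a < q" "c < q" "a > 0" "c > 0"
  proof (cases "q = 1 \<or> prime q")
    case False
    then obtain p where p: "prime p" "p dvd q" using prime_factor_nat by blast
    then obtain c where c: "q = p * c" by blast
    have "c > 0" using c less.prems(1) by (cases c) auto
    moreover have "c < q" unfolding c using \<open>c > 0\<close> prime_gt_1_nat[OF p(1)] by simp
    moreover have "c \<noteq> 1" using False c p(1) by auto
    then have "p < q" unfolding c using \<open>c > 0\<close> prime_gt_0_nat[OF p(1)] by simp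
    ultimately show ?thesis using that(3)[OF c] prime_gt_0_nat[OF p(1)] by blast
  qed (use that in blast)
  then show ?case
  proof cases
    case 1
    then show ?thesis by simp
  next
    case (3 a c)
    show ?thesis unfolding 3(1)
      by (rule mult) (use less.IH[OF 3(2), of "c * N"] less.IH[OF 3(3), of N] 3 less.prems in auto)
  next
    case 2
    show ?thesis
    proof (cases "q dvd N")
      case True
      then show ?thesis by (rule Ftv_compat_dvd[OF f less.prems(2,3) 2])
    next
      case False
      then have "q \<noteq> 2" using less.prems(3) by auto
      define a where "a = q - 1"
      have a: "a > 0" "a < q" using prime_gt_1_nat[OF 2] by (auto simp: a_def)
      let ?N = "a * N"
      have aN: "?N > 0" "even ?N" using a less.prems by auto
      have "\<not> q dvd ?N" using False a 2 by (auto simp: prime_dvd_mult_iff dest: dvd_imp_le)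
      then have "(f (z ?N) ^ 2) ^ a = (f (z (q * ?N)) ^ (2 * q)) ^ a"
        using Ftv_compat_coprime[OF f aN 2] by (simp add: a_def)
      moreover have "(f (z ?N) ^ 2) ^ a = f (z N) ^ 2"
        using less.IH[OF a(2,1) less.prems(2,3)] by (simp add: power_mult[symmetric])
      moreover have "(f (z (q * ?N)) ^ (2 * q)) ^ a = (f (z (a * (q * N))) ^ (2 * a)) ^ q"
        by (simp add: power_mult[symmetric] mult_ac)
      moreover have "f (z (a * (q * N))) ^ (2 * a) = f (z (q * N)) ^ 2"
        using less.IH[OF a(2,1), of "q * N"] less.prems by simp
      ultimately show ?thesis by (simp add: power_mult)
    qed
  qed
qed

section \<open>The map to the compatible systems of roots of unity\<close>

text \<open>At the even level 2 m the value lies in \<open>mu (2 * m)\<close>, so its square lies in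
  \<open>mu m\<close>, as \<open>Zhat1\<close> demands.\<close>

definition tv_map :: "(complex \<Rightarrow> complex) \<Rightarrow> nat \<Rightarrow> complex"
  where "tv_map f = (\<lambda>m\<in>{0<..}. f (z (2 * m)) ^ 2)"

lemma z_even:
  assumes "m > 0"
  shows "z (2 * m) \<in> mu (2 * m)" "2 * m > 0" "z (2 * m) \<noteq> 1" "even (2 * m)" "z (2 * m) \<in> mu_inf_star"
  using z_mu[of "2 * m"] z_mu_inf[of "2 * m"] assms by (auto simp: mu_inf_star_def)

lemma tv_map_closed:
  assumes f: "f \<in> Ftv z" shows "tv_map f \<in> carrier Zhat1"
  unfolding Zhat1_iff
proof (intro conjI allI impI)
  show "tv_map f \<in> (\<Pi>\<^sub>E m\<in>{0<..}. mu m)"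
  proof -
    have "f (z (2 * m)) ^ 2 \<in> mu m" if "m > 0" for m
      using Ftv_mu[OF f z_even(1,3,2,4)[OF that]] by (simp add: mu_def power_mult)
    then show ?thesis by (auto simp: tv_map_def)
  qed
  fix m m' :: nat assume m: "m > 0" "m' dvd m"
  then obtain q where q: "m = q * m'" by (metis dvdE mult.commute)
  then have q0: "q > 0" "m' > 0" using m by auto
  have "f (z (2 * m)) ^ (2 * q) = f (z (2 * m')) ^ 2"
    using Ftv_compat[OF f q0(1) z_even(2,4)[OF q0(2)]] by (simp add: q mult_ac)
  moreover have "m div m' = q" using q q0 by simp
  ultimately show "tv_map f m ^ (m div m') = tv_map f m'"
    using m(1) q0(2) by (simp add: tv_map_def power_mult)
qed

lemma tv_map_add: "tv_map (f \<oplus>\<^bsub>FF\<^esub> g) = tv_map f \<oplus>\<^bsub>Zhat1\<^esub> tv_map g"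
  unfolding tv_map_def Zhat1_ops
  by (rule restrict_ext) (use z_even(5) in \<open>simp add: FF_ops power_mult_distrib\<close>)

lemma tv_map_smult:
  assumes r: "r \<in> carrier R" and f: "f \<in> Ftv z"
  shows "tv_map (r \<odot>\<^bsub>FF\<^esub> f) = r \<odot>\<^bsub>Zhat1\<^esub> tv_map f"
  unfolding tv_map_def[of "r \<odot>\<^bsub>FF\<^esub> f"] Zhat1_ops
proof (rule restrict_ext)
  fix m :: nat assume "m \<in> {0<..}"
  then have m: "m > 0" by simp
  note ze = z_even[OF m]
  have c: "f (z (2 * m)) \<in> cyc_field (2 * m)" by (rule FF_cyc_field[OF Ftv_FF[OF f] ze(1-3)])
  have t: "tv_map f m = f (z (2 * m)) ^ 2" "tv_map f m \<in> mu m"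
    using m Zhat1D(1)[OF tv_map_closed[OF f] m] by (simp_all add: tv_map_def)
  have "(r \<odot>\<^bsub>FF\<^esub> f) (z (2 * m)) ^ 2 = act (2 * m) (r (2 * m)) (tv_map f m)"
    unfolding FF_smult_apply[OF r Ftv_FF[OF f] ze(1-3)] t(1) act_power_arg[OF ze(2) c] ..
  also have "\<dots> = act m (r m) (tv_map f m)"
    by (rule act_R_level[OF r ze(2) _ cyc_field_mu[OF t(2)] mu_nonzero[OF m t(2)]]) simp
  finally show "(r \<odot>\<^bsub>FF\<^esub> f) (z (2 * m)) ^ 2 = act m (r m) (tv_map f m)" .
qed

lemma neg_root_order:
  assumes "w \<in> mu n" "odd n" "n > 0"
  shows "- w \<in> mu_inf_star" "even (root_order (- w))"
proof -
  have "(- w) ^ (2 * n) = ((- w) ^ 2) ^ n" by (rule power_mult)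
  also have "\<dots> = (w ^ 2) ^ n" by simp
  also have "\<dots> = (w ^ n) ^ 2" by (simp only: power_mult[symmetric] mult.commute)
  finally have "(- w) ^ (2 * n) = 1" using assms(1) by (simp add: mu_def)
  then have m: "- w \<in> mu (2 * n)" by (simp add: mu_def)
  have "- w \<noteq> 1"
  proof
    assume "- w = 1"
    then have "w = - 1" by (metis add.inverse_inverse)
    then show False using assms by (simp add: mu_def)
  qed
  then show mi: "- w \<in> mu_inf_star" using m assms(3) by (intro mu_inf_starI[of _ "2 * n"]) auto
  show "even (root_order (- w))"
  proof (rule ccontr)
    let ?r = "root_order (- w)"
    assume o: "odd ?r"
    have "(- w) ^ ?r = 1" using mu_inf_star_order(3)[OF mi] by simp
    then have "w ^ ?r = - 1" using o by (simp add: minus_equation_iff)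
    then have "(w ^ n) ^ ?r = (- 1) ^ n" by (metis mult.commute power_mult)
    then show False using assms by (simp add: mu_def)
  qed
qed

text \<open>At even orders the hypothesis is transported by conjugacy. At an odd order let v be the
  square root of \<open>w\<close> in the group generated by \<open>w\<close>. From f(w) = f(v)
  f(-v), with -v of even order, f(w)^2 = f(v)^2; the automorphism squaring roots of unity gives
  f(w)^2 = f(v)^4. Hence f(v)^2 = 1.\<close>

lemma tv_map_kernel:
  assumes f: "f \<in> Ftv z" and k: "tv_map f = \<zero>\<^bsub>Zhat1\<^esub>" and w: "w \<in> mu_inf_star"
  shows "f w ^ 2 = 1"
proof -
  have fF: "f \<in> carrier FF" by (rule Ftv_FF[OF f])
  have ev: "f v ^ 2 = 1" if v: "v \<in> mu_inf_star" "even (root_order v)" for v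
  proof -
    obtain m where m: "root_order v = 2 * m" using v(2) by auto
    have m0: "m > 0" using mu_inf_star_order(1)[OF v(1)] m by simp
    note ze = z_even[OF m0]
    obtain \<sigma> where s: "\<sigma> \<in> Aut" "\<sigma> (z (2 * m)) = v"
      using Aut_transitive[OF ze(5) v(1)] root_order_z[OF ze(2)] m by auto
    have "f (z (2 * m)) ^ 2 = 1" using fun_cong[OF k, of m] m0 by (simp add: tv_map_def Zhat1_ops)
    then have "\<sigma> (f (z (2 * m)) ^ 2) = 1" using Aut_1[OF s(1)] by simp
    then show ?thesis using FF_Aut[OF fF ze(5) s(1)] s(2) Aut_power[OF s(1) FF_Qc[OF fF ze(5)]] by simp
  qed
  show ?thesis
  proof (cases "even (root_order w)")
    case False
    let ?n = "root_order w"
    have n: "?n > 0" using mu_inf_star_order(1)[OF w] by simp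
    have wn: "w \<in> mu ?n" by (rule mu_inf_star_order(2)[OF w])
    define v where "v = w ^ ((?n + 1) div 2)"
    obtain k where "?n = 2 * k + 1" using False by (auto elim: oddE)
    then have "(?n + 1) div 2 * 2 = ?n + 1" by simp
    then have v2: "v ^ 2 = w" unfolding v_def power_mult[symmetric] using wn by (simp add: mu_def)
    have vn: "v \<in> mu ?n" unfolding v_def by (rule mu_closed(3)[OF wn])
    have vi: "v \<in> mu_inf_star" by (rule roots_mu_inf[OF w v2]) simp
    have v0: "v \<noteq> 0" using mu_nonzero[OF n vn] .
    have set: "{x. x ^ 2 = w} = {v, - v}" unfolding v2[symmetric] by (auto simp: power2_eq_iff)
    have vv: "v \<noteq> - v" using v0 by simp
    have "f w = (\<Prod>x\<in>{x. x ^ 2 = w}. f x)" using Ftv_Fd[OF f] w by (simp add: Fd_iff)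
    also have "\<dots> = f v * f (- v)" unfolding set using vv by simp
    finally have "f w ^ 2 = f v ^ 2 * f (- v) ^ 2" by (simp add: power_mult_distrib)
    then have fw: "f w ^ 2 = f v ^ 2" using ev[OF neg_root_order[OF vn False n]] by simp
    have v1: "v \<noteq> 1" using vi by (simp add: mu_inf_star_def)
    have v2n: "v \<in> mu (2 * ?n)" by (rule mu_closed(5)[OF _ vn]) simp
    have "f v \<in> mu (2 * ?n)" using Ftv_mu[OF f v2n v1] n by simp
    then have y: "f v ^ 2 \<in> mu ?n" by (simp add: mu_def power_mult)
    have "coprime 2 ?n" using False by simp
    then obtain \<sigma> where s: "\<sigma> \<in> Aut" "\<And>x. x \<in> mu ?n \<Longrightarrow> \<sigma> x = x ^ 2" using Aut_unit[OF n] by blast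
    have "f w = \<sigma> (f v)" using FF_Aut[OF fF vi s(1)] s(2)[OF vn] v2 by simp
    then have "f w ^ 2 = \<sigma> (f v ^ 2)" using Aut_power[OF s(1) FF_Qc[OF fF vi]] by simp
    also have "\<dots> = (f v ^ 2) ^ 2" by (rule s(2)[OF y])
    finally have "(f v ^ 2) * (f v ^ 2) = f v ^ 2 * 1" using fw by (simp add: power2_eq_square)
    moreover have "f v ^ 2 \<noteq> 0" using mu_nonzero[OF n y] .
    ultimately have "f v ^ 2 = 1" by (simp only: mult_cancel_left) simp
    then show ?thesis using fw by simp
  qed (rule ev[OF w])
qed

text \<open>Its value at a root of unity w is simply -w, so it generates the whole unbounded part of
  the torsion-valued distributions.\<close>

definition Omega :: "complex \<Rightarrow> complex"
  where "Omega = one_minus_tau \<odot>\<^bsub>FF\<^esub> Phi"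

lemma Omega_FF: "Omega \<in> carrier FF" and Omega_Fd: "Omega \<in> Fd"
  and Omega_apply: "w \<in> mu_inf_star \<Longrightarrow> Omega w = - w"
proof -
  show "Omega \<in> Fd" unfolding Omega_def
    by (rule module.submoduleE(4)[OF FF_module Fd_submodule one_tau_closed(2) Phi_Fd])
  then show "Omega \<in> carrier FF" by (rule Fd_FF)
  show "Omega w = - w" if w: "w \<in> mu_inf_star"
  proof -
    obtain n where n: "n > 0" "w \<in> mu n" "w \<noteq> 1" using mu_inf_star_common[OF w] by metis
    have w0: "w \<noteq> 0" by (rule mu_nonzero[OF n(1,2)])
    have "norm w = 1" using power_eq_1_iff[of w n] n by (auto simp: mu_def)
    then have "w * cnj w = 1" by (simp add: cnj_mult_self_eq_1)
    then have c: "cnj w = inverse w" by (metis inverse_unique)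
    have "Omega w = (1 - w) / cnj (1 - w)"
      unfolding Omega_def smult_one_minus_tau[OF Phi_FF] using w by (simp add: Phi_def)
    also have "cnj (1 - w) = 1 - inverse w" using c by simp
    also have "(1 - w) / (1 - inverse w) = - w" using w0 n(3) by (simp add: field_simps)
    finally show ?thesis .
  qed
qed

lemma Omega_Ftv: "Omega \<in> Ftv z"
  unfolding Ftv_iff_norm_1
proof (intro conjI Omega_Fd ballI)
  fix w assume w: "w \<in> mu_inf_star"
  obtain n where "n > 0" "w \<in> mu n" using mu_inf_star_common[OF w] by metis
  then show "norm (Omega w) = 1" using Omega_apply[OF w] power_eq_1_iff[of w n] by (auto simp: mu_def)
qed

lemma tv_map_Omega: "tv_map Omega = zhat"
  unfolding tv_map_def zhat_def
proof (rule restrict_ext)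
  fix m :: nat assume "m \<in> {0<..}"
  then have m: "m > 0" by simp
  show "Omega (z (2 * m)) ^ 2 = z m" using Omega_apply[OF z_even(5)[OF m]] z_mult_power[of 2 m] m by simp
qed

text \<open>By hypothesis \<open>r\<close> acts trivially on every \<open>z m\<close>, in particular
  on -1 = z 2, and hence also on -w, the value of \<open>Omega\<close> at w.\<close>

lemma tv_map_Omega_inj:
  assumes r: "r \<in> carrier R" and k: "tv_map (r \<odot>\<^bsub>FF\<^esub> Omega) = \<zero>\<^bsub>Zhat1\<^esub>"
  shows "r \<odot>\<^bsub>FF\<^esub> Omega = \<zero>\<^bsub>FF\<^esub>"
proof (rule FF_eqI[OF FF_smult_closed[OF r Omega_FF] FF_zero_closed])
  fix w assume w: "w \<in> mu_inf_star"
  obtain n where n: "n > 0" "w \<in> mu n" "w \<noteq> 1" "root_order w = n" by (rule mu_inf_star_common[OF w])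
  have rz: "act m (r m) (z m) = 1" if "m > 0" for m
    using fun_cong[OF k[unfolded tv_map_smult[OF r Omega_Ftv] tv_map_Omega], of m] that by (simp add: Zhat1_ops zhat_def)
  have c: "w \<in> cyc_field n" "z n \<in> cyc_field n" "- 1 \<in> cyc_field 2" "- 1 \<in> cyc_field n"
    using cyc_field_mu[OF n(2)] cyc_field_mu[OF z_mu[OF n(1)]] by (auto intro: cyc_field_Rats)
  have zi: "z n \<in> mu_inf_star" "root_order (z n) = n"
    using z_mu_inf root_order_z n mu_inf_star_order(1)[OF w] by auto
  obtain \<sigma> where s: "\<sigma> \<in> Aut" "\<sigma> (z n) = w" using Aut_transitive[OF zi(1) w] zi(2) n(4) by auto
  have 1: "act n (r n) w = 1"
    using Aut_act[OF s(1) n(1) c(2), of "r n"] s(2) rz[OF n(1)] Aut_1[OF s(1)] by simp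
  have "act n (r n) (- 1) = act (2 * n) (r (2 * n)) (- 1)"
    by (rule act_R_level[OF r _ _ c(4), symmetric]) (use n in auto)
  also have "\<dots> = act 2 (r 2) (- 1)"
    by (rule act_R_level[OF r _ _ c(3)]) (use n in auto)
  also have "\<dots> = 1" using rz[of 2] by (simp add: z_2)
  finally have 2: "act n (r n) (- 1) = 1" .
  have "(r \<odot>\<^bsub>FF\<^esub> Omega) w = act n (r n) (- 1 * w)"
    using FF_smult_apply[OF r Omega_FF n(2,1,3)] Omega_apply[OF w] by simp
  also have "\<dots> = 1" using act_mult_arg[OF n(1) c(4,1), of "r n"] 1 2 by simp
  finally show "(r \<odot>\<^bsub>FF\<^esub> Omega) w = \<zero>\<^bsub>FF\<^esub> w" using w by (simp add: FF_ops)
qed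

end


section \<open>Submodules and quotients\<close>

context module
begin

lemma submodule_facts:
  assumes N: "submodule N R M"
  shows "N \<subseteq> carrier M" "\<zero>\<^bsub>M\<^esub> \<in> N" "x \<in> N \<Longrightarrow> y \<in> N \<Longrightarrow> x \<oplus>\<^bsub>M\<^esub> y \<in> N"
    "x \<in> N \<Longrightarrow> \<ominus>\<^bsub>M\<^esub> x \<in> N" "r \<in> carrier R \<Longrightarrow> x \<in> N \<Longrightarrow> r \<odot>\<^bsub>M\<^esub> x \<in> N"
    "abelian_subgroup N M"
proof -
  have s: "subgroup N (add_monoid M)" by (rule submodule.axioms(1)[OF N])
  show "\<zero>\<^bsub>M\<^esub> \<in> N" using subgroup.one_closed[OF s] by simp
  show "abelian_subgroup N M"
    by (intro abelian_subgroupI3 additive_subgroup.intro s abelian_group_axioms)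
qed (use submoduleE[OF N] in auto)

lemma minus_eq_zero_iff:
  assumes "x \<in> carrier M" "y \<in> carrier M" shows "x \<ominus>\<^bsub>M\<^esub> y = \<zero>\<^bsub>M\<^esub> \<longleftrightarrow> x = y"
proof
  assume "x \<ominus>\<^bsub>M\<^esub> y = \<zero>\<^bsub>M\<^esub>"
  moreover have "x = (x \<ominus>\<^bsub>M\<^esub> y) \<oplus>\<^bsub>M\<^esub> y" using assms by (simp add: minus_eq a_assoc l_neg)
  ultimately show "x = y" using assms by simp
qed (use assms in \<open>simp add: minus_eq r_neg\<close>)

lemma coset_eq_iff:
  assumes N: "submodule N R M" and x: "x \<in> carrier M" and y: "y \<in> carrier M"
  shows "N +>\<^bsub>M\<^esub> x = N +>\<^bsub>M\<^esub> y \<longleftrightarrow> x \<ominus>\<^bsub>M\<^esub> y \<in> N"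
proof -
  note F = submodule_facts[OF N]
  have Nc: "n \<in> carrier M" if "n \<in> N" for n using F(1) that by blast
  show ?thesis
  proof
    assume "N +>\<^bsub>M\<^esub> x = N +>\<^bsub>M\<^esub> y"
    moreover have "x \<in> N +>\<^bsub>M\<^esub> x" using F(2) x by (auto simp: a_r_coset_def' intro!: bexI[of _ "\<zero>\<^bsub>M\<^esub>"])
    ultimately obtain n where "n \<in> N" "x = n \<oplus>\<^bsub>M\<^esub> y" by (auto simp: a_r_coset_def')
    then show "x \<ominus>\<^bsub>M\<^esub> y \<in> N" using Nc y by (simp add: minus_eq a_assoc r_neg)
  next
    assume d: "x \<ominus>\<^bsub>M\<^esub> y \<in> N"
    define n where "n = x \<ominus>\<^bsub>M\<^esub> y"
    have n: "n \<in> N" "n \<in> carrier M" using d Nc by (auto simp: n_def)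
    have xn: "x = n \<oplus>\<^bsub>M\<^esub> y" using x y by (simp add: n_def minus_eq a_assoc l_neg)
    have yn: "y = \<ominus>\<^bsub>M\<^esub> n \<oplus>\<^bsub>M\<^esub> x" using n y unfolding xn by (simp add: a_assoc[symmetric] l_neg)
    show "N +>\<^bsub>M\<^esub> x = N +>\<^bsub>M\<^esub> y"
    proof (intro equalityI subsetI)
      fix w assume "w \<in> N +>\<^bsub>M\<^esub> x"
      then obtain k where k: "k \<in> N" "w = k \<oplus>\<^bsub>M\<^esub> x" by (auto simp: a_r_coset_def')
      then have "w = (k \<oplus>\<^bsub>M\<^esub> n) \<oplus>\<^bsub>M\<^esub> y" unfolding xn using n Nc y by (simp add: a_assoc)
      then show "w \<in> N +>\<^bsub>M\<^esub> y" using F(3)[OF k(1) n(1)] by (auto simp: a_r_coset_def')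
    next
      fix w assume "w \<in> N +>\<^bsub>M\<^esub> y"
      then obtain k where k: "k \<in> N" "w = k \<oplus>\<^bsub>M\<^esub> y" by (auto simp: a_r_coset_def')
      then have "w = (k \<oplus>\<^bsub>M\<^esub> \<ominus>\<^bsub>M\<^esub> n) \<oplus>\<^bsub>M\<^esub> x" using n Nc x by (subst (asm) yn) (simp add: a_assoc)
      then show "w \<in> N +>\<^bsub>M\<^esub> x" using F(3)[OF k(1) F(4)[OF n(1)]] by (auto simp: a_r_coset_def')
    qed
  qed
qed

lemma coset_zero:
  assumes N: "submodule N R M" shows "N +>\<^bsub>M\<^esub> \<zero>\<^bsub>M\<^esub> = N"
  using submodule_facts(1)[OF N] by (auto simp: a_r_coset_def' subset_iff)

text \<open>The scalar action on a coset is defined as a union over representatives; it is a single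
  coset because scalars preserve \<open>N\<close>.\<close>

lemma quot_ops:
  assumes N: "submodule N R M"
  shows "carrier (quot_module M N) = (\<lambda>x. N +>\<^bsub>M\<^esub> x) ` carrier M"
    and "\<zero>\<^bsub>quot_module M N\<^esub> = N +>\<^bsub>M\<^esub> \<zero>\<^bsub>M\<^esub>"
    and "x \<in> carrier M \<Longrightarrow> y \<in> carrier M \<Longrightarrow>
      (N +>\<^bsub>M\<^esub> x) \<oplus>\<^bsub>quot_module M N\<^esub> (N +>\<^bsub>M\<^esub> y) = N +>\<^bsub>M\<^esub> (x \<oplus>\<^bsub>M\<^esub> y)"
    and "r \<in> carrier R \<Longrightarrow> x \<in> carrier M \<Longrightarrow>
      r \<odot>\<^bsub>quot_module M N\<^esub> (N +>\<^bsub>M\<^esub> x) = N +>\<^bsub>M\<^esub> (r \<odot>\<^bsub>M\<^esub> x)"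
proof -
  note F = submodule_facts[OF N]
  show "carrier (quot_module M N) = (\<lambda>x. N +>\<^bsub>M\<^esub> x) ` carrier M"
    by (auto simp: quot_module_def A_RCOSETS_def')
  show "\<zero>\<^bsub>quot_module M N\<^esub> = N +>\<^bsub>M\<^esub> \<zero>\<^bsub>M\<^esub>"
    unfolding coset_zero[OF N] by (simp add: quot_module_def)
  show "(N +>\<^bsub>M\<^esub> x) \<oplus>\<^bsub>quot_module M N\<^esub> (N +>\<^bsub>M\<^esub> y) = N +>\<^bsub>M\<^esub> (x \<oplus>\<^bsub>M\<^esub> y)"
    if "x \<in> carrier M" "y \<in> carrier M"
    using abelian_subgroup.a_rcos_sum[OF F(6) that] by (simp add: quot_module_def)
  assume r: "r \<in> carrier R" and x: "x \<in> carrier M"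
  have "N +>\<^bsub>M\<^esub> (r \<odot>\<^bsub>M\<^esub> y) = N +>\<^bsub>M\<^esub> (r \<odot>\<^bsub>M\<^esub> x)" if y: "y \<in> N +>\<^bsub>M\<^esub> x" for y
  proof -
    obtain n where n: "n \<in> N" "y = n \<oplus>\<^bsub>M\<^esub> x" using y by (auto simp: a_r_coset_def')
    have nc: "n \<in> carrier M" using n F(1) by blast
    have "r \<odot>\<^bsub>M\<^esub> y \<ominus>\<^bsub>M\<^esub> r \<odot>\<^bsub>M\<^esub> x = r \<odot>\<^bsub>M\<^esub> n"
      using r x nc unfolding n(2) by (simp add: smult_r_distr minus_eq a_assoc r_neg)
    then show ?thesis using F(5)[OF r n(1)] coset_eq_iff[OF N] r x nc n(2) by simp
  qed
  moreover have "x \<in> N +>\<^bsub>M\<^esub> x" using F(2) x by (auto simp: a_r_coset_def' intro!: bexI[of _ "\<zero>\<^bsub>M\<^esub>"])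
  ultimately show "r \<odot>\<^bsub>quot_module M N\<^esub> (N +>\<^bsub>M\<^esub> x) = N +>\<^bsub>M\<^esub> (r \<odot>\<^bsub>M\<^esub> x)"
  proof -
    assume eq: "\<And>y. y \<in> N +>\<^bsub>M\<^esub> x \<Longrightarrow> N +>\<^bsub>M\<^esub> (r \<odot>\<^bsub>M\<^esub> y) = N +>\<^bsub>M\<^esub> (r \<odot>\<^bsub>M\<^esub> x)"
      and ne: "x \<in> N +>\<^bsub>M\<^esub> x"
    have "(\<Union>y\<in>N +>\<^bsub>M\<^esub> x. N +>\<^bsub>M\<^esub> (r \<odot>\<^bsub>M\<^esub> y)) = (\<Union>y\<in>N +>\<^bsub>M\<^esub> x. N +>\<^bsub>M\<^esub> (r \<odot>\<^bsub>M\<^esub> x))"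
      by (intro SUP_cong refl eq)
    also have "\<dots> = N +>\<^bsub>M\<^esub> (r \<odot>\<^bsub>M\<^esub> x)" using ne by blast
    finally show ?thesis by (simp add: quot_module_def)
  qed
qed

lemma quot_module_module:
  assumes N: "submodule N R M" shows "module R (quot_module M N)"
proof -
  note Q = quot_ops[OF N]
  have zc: "N +>\<^bsub>M\<^esub> \<zero>\<^bsub>M\<^esub> \<in> carrier (quot_module M N)" unfolding Q(1) by simp
  show ?thesis
  proof (rule moduleI)
    show "cring R" by (rule is_cring)
    show "abelian_group (quot_module M N)"
    proof (rule abelian_groupI)
      fix X assume "X \<in> carrier (quot_module M N)"
      then obtain x where x: "x \<in> carrier M" "X = N +>\<^bsub>M\<^esub> x" unfolding Q(1) by blast
      show "\<zero>\<^bsub>quot_module M N\<^esub> \<oplus>\<^bsub>quot_module M N\<^esub> X = X" unfolding x(2) Q(2) using x Q(3) by simp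
      show "\<exists>Y\<in>carrier (quot_module M N). Y \<oplus>\<^bsub>quot_module M N\<^esub> X = \<zero>\<^bsub>quot_module M N\<^esub>"
        unfolding x(2) Q(1,2) using x Q(3) by (intro bexI[of _ "N +>\<^bsub>M\<^esub> (\<ominus>\<^bsub>M\<^esub> x)"]) (auto simp: l_neg)
    qed (auto simp: Q a_ac)
  qed (auto simp: Q smult_l_distr smult_r_distr smult_assoc1)
qed

lemma quot_proj_hom:
  assumes N: "submodule N R M" shows "(\<lambda>x. N +>\<^bsub>M\<^esub> x) \<in> Rmodule_hom R M (quot_module M N)"
  unfolding Rmodule_hom_def by (auto simp: quot_ops[OF N])

end

section \<open>Homomorphisms and the first isomorphism theorem\<close>

lemma Rmodule_homD:
  assumes "h \<in> Rmodule_hom R M N"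
  shows "x \<in> carrier M \<Longrightarrow> h x \<in> carrier N"
    "x \<in> carrier M \<Longrightarrow> y \<in> carrier M \<Longrightarrow> h (x \<oplus>\<^bsub>M\<^esub> y) = h x \<oplus>\<^bsub>N\<^esub> h y"
    "r \<in> carrier R \<Longrightarrow> x \<in> carrier M \<Longrightarrow> h (r \<odot>\<^bsub>M\<^esub> x) = r \<odot>\<^bsub>N\<^esub> h x"
  using assms unfolding Rmodule_hom_def by auto

lemma Rmodule_hom_zero_minus:
  assumes M: "module R M" and N: "module R N" and h: "h \<in> Rmodule_hom R M N"
  shows "h \<zero>\<^bsub>M\<^esub> = \<zero>\<^bsub>N\<^esub>"
    and "x \<in> carrier M \<Longrightarrow> h (\<ominus>\<^bsub>M\<^esub> x) = \<ominus>\<^bsub>N\<^esub> h x"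
    and "x \<in> carrier M \<Longrightarrow> y \<in> carrier M \<Longrightarrow> h (x \<ominus>\<^bsub>M\<^esub> y) = h x \<ominus>\<^bsub>N\<^esub> h y"
proof -
  interpret M: abelian_group M by (rule module.axioms(2)[OF M])
  interpret N: abelian_group N by (rule module.axioms(2)[OF N])
  note D = Rmodule_homD[OF h]
  have "h \<zero>\<^bsub>M\<^esub> \<oplus>\<^bsub>N\<^esub> h \<zero>\<^bsub>M\<^esub> = h \<zero>\<^bsub>M\<^esub>" using D(2)[of "\<zero>\<^bsub>M\<^esub>" "\<zero>\<^bsub>M\<^esub>"] by simp
  then show z: "h \<zero>\<^bsub>M\<^esub> = \<zero>\<^bsub>N\<^esub>" using D(1)[OF M.zero_closed] N.add.r_cancel_one' by metis
  show m: "h (\<ominus>\<^bsub>M\<^esub> x) = \<ominus>\<^bsub>N\<^esub> h x" if x: "x \<in> carrier M" for x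
  proof -
    have "h (\<ominus>\<^bsub>M\<^esub> x) \<oplus>\<^bsub>N\<^esub> h x = \<zero>\<^bsub>N\<^esub>" using D(2)[of "\<ominus>\<^bsub>M\<^esub> x" x] x z by (simp add: M.l_neg)
    then show ?thesis using N.minus_equality D(1) x by (metis M.a_inv_closed)
  qed
  show "h (x \<ominus>\<^bsub>M\<^esub> y) = h x \<ominus>\<^bsub>N\<^esub> h y" if "x \<in> carrier M" "y \<in> carrier M"
    using that D(2)[of x "\<ominus>\<^bsub>M\<^esub> y"] m[OF that(2)] by (simp add: a_minus_def)
qed

lemma Rmodule_hom_image_submodule:
  assumes M: "module R M" and N: "module R N" and h: "h \<in> Rmodule_hom R M N" and S: "submodule S R M"
  shows "submodule (h ` S) R N"
proof -
  note D = Rmodule_homD[OF h] and Z = Rmodule_hom_zero_minus[OF M N h] and F = module.submodule_facts[OF M S]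
  have Sc: "x \<in> carrier M" if "x \<in> S" for x using F(1) that by blast
  show ?thesis
  proof (rule module.submoduleI[OF N])
    show "h ` S \<subseteq> carrier N" using D(1) Sc by blast
    show "\<zero>\<^bsub>N\<^esub> \<in> h ` S" using Z(1) F(2) by (metis imageI)
  next
    fix a assume "a \<in> h ` S"
    then obtain x where "x \<in> S" "a = h x" by blast
    then show "\<ominus>\<^bsub>N\<^esub> a \<in> h ` S" using Z(2)[OF Sc] F(4) by (metis imageI)
  next
    fix a b assume "a \<in> h ` S" "b \<in> h ` S"
    then obtain x y where "x \<in> S" "a = h x" "y \<in> S" "b = h y" by blast
    then show "a \<oplus>\<^bsub>N\<^esub> b \<in> h ` S" using D(2)[OF Sc Sc] F(3) by (metis imageI)
  next
    fix r a assume "r \<in> carrier R" "a \<in> h ` S"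
    then obtain x where "x \<in> S" "a = h x" by blast
    then show "r \<odot>\<^bsub>N\<^esub> a \<in> h ` S" using D(3)[OF \<open>r \<in> carrier R\<close> Sc] F(5)[OF \<open>r \<in> carrier R\<close>] by (metis imageI)
  qed
qed

lemma Rmodule_hom_kernel_submodule:
  assumes M: "module R M" and N: "module R N" and h: "h \<in> Rmodule_hom R M N"
  shows "submodule {x \<in> carrier M. h x = \<zero>\<^bsub>N\<^esub>} R M"
proof -
  interpret M: module R M by (rule M)
  interpret N: module R N by (rule N)
  note D = Rmodule_homD[OF h] and Z = Rmodule_hom_zero_minus[OF M N h]
  show ?thesis by (rule M.submoduleI) (auto simp: D Z)
qed

lemma Rmodule_hom_compose:
  assumes "g \<in> Rmodule_hom R M N" "h \<in> Rmodule_hom R N L"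
  shows "(\<lambda>x. h (g x)) \<in> Rmodule_hom R M L"
  unfolding Rmodule_hom_def using Rmodule_homD[OF assms(1)] Rmodule_homD[OF assms(2)] by auto

lemma Rmodule_iso_inverse:
  assumes "h \<in> Rmodule_iso R M N"
  shows "inv_into (carrier M) h \<in> Rmodule_iso R N M"
proof -
  have h: "h \<in> Rmodule_hom R M N" "module R M" "module R N" "bij_betw h (carrier M) (carrier N)"
    using assms by (auto simp: Rmodule_iso_def)
  interpret M: module R M by (rule h(2))
  let ?g = "inv_into (carrier M) h"
  note D = Rmodule_homD[OF h(1)]
  have g: "bij_betw ?g (carrier N) (carrier M)" by (rule bij_betw_inv_into[OF h(4)])
  have gc: "?g y \<in> carrier M" "h (?g y) = y" if "y \<in> carrier N" for y
    using h(4) that by (auto simp: bij_betw_def inv_into_into f_inv_into_f)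
  have gh: "?g (h x) = x" if "x \<in> carrier M" for x
    using h(4) that by (auto simp: bij_betw_def inv_into_f_f)
  have "?g \<in> Rmodule_hom R N M"
    unfolding Rmodule_hom_def
  proof (intro CollectI conjI ballI)
    show "?g \<in> carrier N \<rightarrow> carrier M" using gc by blast
    fix x y assume xy: "x \<in> carrier N" "y \<in> carrier N"
    show "?g (x \<oplus>\<^bsub>N\<^esub> y) = ?g x \<oplus>\<^bsub>M\<^esub> ?g y"
      using D(2)[OF gc(1)[OF xy(1)] gc(1)[OF xy(2)]] gc[OF xy(1)] gc[OF xy(2)] gh[of "?g x \<oplus>\<^bsub>M\<^esub> ?g y"] by simp
  next
    fix r x assume rx: "r \<in> carrier R" "x \<in> carrier N"
    show "?g (r \<odot>\<^bsub>N\<^esub> x) = r \<odot>\<^bsub>M\<^esub> ?g x"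
      using D(3)[OF rx(1) gc(1)[OF rx(2)]] gc[OF rx(2)] gh[of "r \<odot>\<^bsub>M\<^esub> ?g x"] rx(1) by simp
  qed
  then show ?thesis using h g by (simp add: Rmodule_iso_def)
qed

text \<open>The first isomorphism theorem, in a form that records the values on cosets; the claims
  that an isomorphism is induced by a given map rest on this.\<close>

lemma quot_module_iso:
  assumes M: "module R M" and L: "module R L" and N: "submodule N R M"
    and p: "p \<in> Rmodule_hom R M L" and surj: "carrier L \<subseteq> p ` carrier M"
    and ker: "\<And>x. x \<in> carrier M \<Longrightarrow> p x = \<zero>\<^bsub>L\<^esub> \<longleftrightarrow> x \<in> N"
  shows "\<exists>h\<in>Rmodule_iso R (quot_module M N) L. \<forall>x\<in>carrier M. h (N +>\<^bsub>M\<^esub> x) = p x"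
proof -
  interpret M: module R M by (rule M)
  interpret L: module R L by (rule L)
  note D = Rmodule_homD[OF p] and Q = M.quot_ops[OF N]
  have eq: "p x = p y \<longleftrightarrow> N +>\<^bsub>M\<^esub> x = N +>\<^bsub>M\<^esub> y" if xy: "x \<in> carrier M" "y \<in> carrier M" for x y
  proof -
    have "p x = p y \<longleftrightarrow> p x \<ominus>\<^bsub>L\<^esub> p y = \<zero>\<^bsub>L\<^esub>" using D(1) xy by (simp add: L.minus_eq_zero_iff)
    also have "\<dots> \<longleftrightarrow> x \<ominus>\<^bsub>M\<^esub> y \<in> N"
      using ker[of "x \<ominus>\<^bsub>M\<^esub> y"] Rmodule_hom_zero_minus(3)[OF M L p xy] xy by simp
    also have "\<dots> \<longleftrightarrow> N +>\<^bsub>M\<^esub> x = N +>\<^bsub>M\<^esub> y" using M.coset_eq_iff[OF N xy] by simp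
    finally show ?thesis .
  qed
  define h where "h X = p (SOME x. x \<in> carrier M \<and> X = N +>\<^bsub>M\<^esub> x)" for X
  have h: "h (N +>\<^bsub>M\<^esub> x) = p x" if x: "x \<in> carrier M" for x
  proof -
    define y where "y = (SOME y. y \<in> carrier M \<and> N +>\<^bsub>M\<^esub> x = N +>\<^bsub>M\<^esub> y)"
    have "\<exists>y. y \<in> carrier M \<and> N +>\<^bsub>M\<^esub> x = N +>\<^bsub>M\<^esub> y" using x by blast
    then have y: "y \<in> carrier M \<and> N +>\<^bsub>M\<^esub> x = N +>\<^bsub>M\<^esub> y" unfolding y_def by (rule someI_ex)
    have "h (N +>\<^bsub>M\<^esub> x) = p y" unfolding h_def y_def ..
    also have "\<dots> = p x" using eq[of x y] x y by simp
    finally show ?thesis .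
  qed
  have "h \<in> Rmodule_hom R (quot_module M N) L"
    unfolding Rmodule_hom_def using D by (auto simp: Q h)
  moreover have "bij_betw h (carrier (quot_module M N)) (carrier L)"
    unfolding bij_betw_def
  proof
    show "inj_on h (carrier (quot_module M N))" unfolding Q(1) inj_on_def using eq h by auto
    show "h ` carrier (quot_module M N) = carrier L"
      unfolding Q(1) image_image using surj D(1) h by (auto simp: image_def)
  qed
  ultimately have "h \<in> Rmodule_iso R (quot_module M N) L"
    using M.quot_module_module[OF N] L by (simp add: Rmodule_iso_def)
  then show ?thesis using h by blast
qed

section \<open>Submodules of the equivariant functions\<close>

context generators
begin

lemma sub_module: "submodule A R FF \<Longrightarrow> module R (sub A)"
  by (rule submodule.submodule_is_module[OF _ FF_module])

lemma sub_submodule: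
  assumes "submodule A R FF" "submodule B R FF" "B \<subseteq> A" shows "submodule B R (sub A)"
  using module.module_incl_imp_submodule[OF sub_module[OF assms(1)], of B] sub_module[OF assms(2)] assms(3) by simp

lemma sub_submodule_FF:
  assumes "submodule A R FF" "submodule B R (sub A)" shows "submodule B R FF"
proof -
  have m: "module R (sub B)"
    using submodule.submodule_is_module[OF assms(2) sub_module[OF assms(1)]] by simp
  have "B \<subseteq> A" using module.submodule_facts(1)[OF sub_module[OF assms(1)] assms(2)] by simp
  then have "B \<subseteq> carrier FF" using module.submodule_facts(1)[OF FF_module assms(1)] by blast
  then show ?thesis using module.module_incl_imp_submodule[OF FF_module _ m] by blast
qed

lemma smult_hom:
  assumes r: "r \<in> carrier R" and A: "submodule A R FF"
  shows "(\<lambda>f. r \<odot>\<^bsub>FF\<^esub> f) \<in> Rmodule_hom R (sub A) (sub A)"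
proof -
  interpret module R FF by (rule FF_module)
  note F = submodule_facts[OF A]
  have c: "f \<in> carrier FF" if "f \<in> A" for f using F(1) that by blast
  show ?thesis
    unfolding Rmodule_hom_def
    using r F(5) c by (auto simp: smult_r_distr smult_assoc1[symmetric] R.m_comm)
qed

lemma mult_by_submodule:
  assumes r: "r \<in> carrier R" and A: "submodule A R FF"
  shows "submodule (mult_by r A) R FF"
  using Rmodule_hom_image_submodule[OF sub_module[OF A] sub_module[OF A] smult_hom[OF r A], of A]
    module.carrier_is_submodule[OF sub_module[OF A]] sub_submodule_FF[OF A] by simp

lemma nat_add_pow_FF: "f \<in> carrier FF \<Longrightarrow> [k] \<cdot>\<^bsub>sub A\<^esub> f = (\<lambda>w\<in>mu_inf_star. f w ^ k)"
proof -
  have "[k] \<cdot>\<^bsub>sub A\<^esub> f = (\<lambda>w\<in>mu_inf_star. f w ^ k)" for k :: nat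
  proof (induction k)
    case 0
    show ?case by (simp add: add_pow_def nat_pow_def FF_ops)
  next
    case (Suc k)
    have "[Suc k] \<cdot>\<^bsub>sub A\<^esub> f = [k] \<cdot>\<^bsub>sub A\<^esub> f \<oplus>\<^bsub>FF\<^esub> f" by (simp add: add_pow_def nat_pow_def)
    then show ?case unfolding Suc FF_ops by (auto simp: restrict_def mult.commute)
  qed
  then show ?thesis .
qed

lemma torsion_iff:
  assumes "A \<subseteq> carrier FF"
  shows "f \<in> torsion (sub A) \<longleftrightarrow> f \<in> A \<and> (\<exists>k>0. \<forall>w\<in>mu_inf_star. f w ^ k = 1)"
proof -
  have "[k] \<cdot>\<^bsub>sub A\<^esub> f = \<zero>\<^bsub>sub A\<^esub> \<longleftrightarrow> (\<forall>w\<in>mu_inf_star. f w ^ k = 1)" if "f \<in> A" for k :: nat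
  proof -
    have "f \<in> carrier FF" using that assms by blast
    then show ?thesis unfolding nat_add_pow_FF[OF \<open>f \<in> carrier FF\<close>] by (auto simp: FF_ops restrict_def fun_eq_iff)
  qed
  then show ?thesis by (auto simp: torsion_def)
qed

lemma torsion_submodule:
  assumes A: "submodule A R FF" shows "submodule (torsion (sub A)) R FF"
proof -
  interpret module R FF by (rule FF_module)
  note F = submodule_facts[OF A]
  note T = torsion_iff[OF F(1)]
  have c: "f \<in> carrier FF" if "f \<in> A" for f using F(1) that by blast
  show ?thesis
  proof (rule submoduleI)
    show "torsion (sub A) \<subseteq> carrier FF" using T c by blast
    show "\<zero>\<^bsub>FF\<^esub> \<in> torsion (sub A)" unfolding T using F(2) by (auto simp: FF_ops)
  next
    fix f assume f: "f \<in> torsion (sub A)"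
    then have fc: "f \<in> carrier FF" using T c by blast
    obtain k where "k > 0" "\<forall>w\<in>mu_inf_star. f w ^ k = 1" using f T by blast
    then have "\<forall>w\<in>mu_inf_star. (\<ominus>\<^bsub>FF\<^esub> f) w ^ k = 1" "k > 0"
      by (simp_all add: FF_a_inv[OF fc] power_inverse)
    moreover have "\<ominus>\<^bsub>FF\<^esub> f \<in> A" using f F(4) T by blast
    ultimately show "\<ominus>\<^bsub>FF\<^esub> f \<in> torsion (sub A)" unfolding T by blast
  next
    fix f g assume fg: "f \<in> torsion (sub A)" "g \<in> torsion (sub A)"
    obtain k l where "k > 0" "\<forall>w\<in>mu_inf_star. f w ^ k = 1" "l > 0" "\<forall>w\<in>mu_inf_star. g w ^ l = 1"
      using fg T by blast
    then have "\<forall>w\<in>mu_inf_star. (f \<oplus>\<^bsub>FF\<^esub> g) w ^ (k * l) = 1" "k * l > 0"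
      by (auto simp: FF_ops power_mult_distrib power_mult) (metis mult.commute power_mult power_one)
    then show "f \<oplus>\<^bsub>FF\<^esub> g \<in> torsion (sub A)" using fg F(3) unfolding T by blast
  next
    fix r f assume r: "r \<in> carrier R" and f: "f \<in> torsion (sub A)"
    then have fc: "f \<in> carrier FF" using T c by blast
    obtain k where k: "k > 0" "\<forall>w\<in>mu_inf_star. f w ^ k = 1" using f T by blast
    have "(r \<odot>\<^bsub>FF\<^esub> f) w ^ k = 1" if w: "w \<in> mu_inf_star" for w
    proof -
      have n: "root_order w > 0" using mu_inf_star_order(1)[OF w] by simp
      have "(r \<odot>\<^bsub>FF\<^esub> f) w ^ k = act (root_order w) (r (root_order w)) (f w ^ k)"
        using w act_power_arg[OF n FF_cyc_field_order[OF fc w]] by (simp add: FF_ops)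
      also have "f w ^ k = 1" using k(2) w by blast
      finally show ?thesis using act_1[OF n] by simp
    qed
    then show "r \<odot>\<^bsub>FF\<^esub> f \<in> torsion (sub A)" using f k(1) F(5)[OF r] unfolding T by blast
  qed
qed

text \<open>The multiples of \<open>Phi\<close> already form a submodule, so the intersection
  defining \<open>Fc\<close> is cyclic.\<close>

lemma Fc_eq: "Fc = (\<lambda>r. r \<odot>\<^bsub>FF\<^esub> Phi) ` carrier R"
proof
  interpret module R FF by (rule FF_module)
  show "Fc \<subseteq> (\<lambda>r. r \<odot>\<^bsub>FF\<^esub> Phi) ` carrier R"
  proof -
    have "submodule ((\<lambda>r. r \<odot>\<^bsub>FF\<^esub> Phi) ` carrier R) R FF"
    proof (rule submoduleI)
      show "\<zero>\<^bsub>FF\<^esub> \<in> (\<lambda>r. r \<odot>\<^bsub>FF\<^esub> Phi) ` carrier R"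
        using smult_l_null[OF Phi_FF] by (intro image_eqI[of _ _ "\<zero>\<^bsub>R\<^esub>"]) auto
    next
      fix a assume "a \<in> (\<lambda>r. r \<odot>\<^bsub>FF\<^esub> Phi) ` carrier R"
      then obtain r where "r \<in> carrier R" "a = r \<odot>\<^bsub>FF\<^esub> Phi" by blast
      then show "\<ominus>\<^bsub>FF\<^esub> a \<in> (\<lambda>r. r \<odot>\<^bsub>FF\<^esub> Phi) ` carrier R"
        using smult_l_minus[OF _ Phi_FF, of r] by (intro image_eqI[of _ _ "\<ominus>\<^bsub>R\<^esub> r"]) auto
    next
      fix a b assume "a \<in> (\<lambda>r. r \<odot>\<^bsub>FF\<^esub> Phi) ` carrier R" "b \<in> (\<lambda>r. r \<odot>\<^bsub>FF\<^esub> Phi) ` carrier R"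
      then obtain r s where "r \<in> carrier R" "a = r \<odot>\<^bsub>FF\<^esub> Phi" "s \<in> carrier R" "b = s \<odot>\<^bsub>FF\<^esub> Phi" by blast
      then show "a \<oplus>\<^bsub>FF\<^esub> b \<in> (\<lambda>r. r \<odot>\<^bsub>FF\<^esub> Phi) ` carrier R"
        using smult_l_distr[OF _ _ Phi_FF, of r s] by (intro image_eqI[of _ _ "r \<oplus>\<^bsub>R\<^esub> s"]) auto
    next
      fix s a assume "s \<in> carrier R" "a \<in> (\<lambda>r. r \<odot>\<^bsub>FF\<^esub> Phi) ` carrier R"
      then obtain r where "r \<in> carrier R" "a = r \<odot>\<^bsub>FF\<^esub> Phi" by blast
      then show "s \<odot>\<^bsub>FF\<^esub> a \<in> (\<lambda>r. r \<odot>\<^bsub>FF\<^esub> Phi) ` carrier R"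
        using smult_assoc1[OF \<open>s \<in> carrier R\<close> _ Phi_FF, of r] \<open>s \<in> carrier R\<close> by (intro image_eqI[of _ _ "s \<otimes>\<^bsub>R\<^esub> r"]) auto
    qed (use Phi_FF in auto)
    moreover have "Phi \<in> (\<lambda>r. r \<odot>\<^bsub>FF\<^esub> Phi) ` carrier R"
      using smult_one[OF Phi_FF] by (intro image_eqI[of _ _ "\<one>\<^bsub>R\<^esub>"]) auto
    ultimately show ?thesis unfolding Fc_def generated_submodule_def by blast
  qed
  show "(\<lambda>r. r \<odot>\<^bsub>FF\<^esub> Phi) ` carrier R \<subseteq> Fc"
    unfolding Fc_def generated_submodule_def using submodule_facts(5) by blast
qed

lemma Fc_submodule: "submodule Fc R FF"
proof -
  interpret module R FF by (rule FF_module)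
  have "submodule (carrier FF) R FF" by (rule carrier_is_submodule)
  then have mem: "x \<in> N" if "x \<in> Fc" "submodule N R FF" "Phi \<in> N" for x N
    using that unfolding Fc_def generated_submodule_def by blast
  have I: "x \<in> Fc" if "\<And>N. submodule N R FF \<Longrightarrow> Phi \<in> N \<Longrightarrow> x \<in> N" for x
    using that unfolding Fc_def generated_submodule_def by blast
  show ?thesis
  proof (rule submoduleI)
    show "Fc \<subseteq> carrier FF" using mem[OF _ carrier_is_submodule Phi_FF] by blast
  qed (auto intro!: I dest: mem intro: submodule_facts)
qed

lemma Fc_subset: "submodule A R FF \<Longrightarrow> Phi \<in> A \<Longrightarrow> Fc \<subseteq> A"
  unfolding Fc_def generated_submodule_def by blast

text \<open>Commutativity of \<open>R\<close> moves \<open>r\<close> past 1 - tau, so this module is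
  again cyclic, generated by \<open>Omega\<close>.\<close>

lemma one_minus_tau_Fc: "mult_by one_minus_tau Fc = (\<lambda>r. r \<odot>\<^bsub>FF\<^esub> Omega) ` carrier R"
proof -
  interpret module R FF by (rule FF_module)
  have "one_minus_tau \<odot>\<^bsub>FF\<^esub> (r \<odot>\<^bsub>FF\<^esub> Phi) = r \<odot>\<^bsub>FF\<^esub> Omega" if r: "r \<in> carrier R" for r
    unfolding Omega_def
    using smult_assoc1[OF one_tau_closed(2) r Phi_FF] smult_assoc1[OF r one_tau_closed(2) Phi_FF]
      R.m_comm[OF r one_tau_closed(2)] by simp
  then show ?thesis unfolding Fc_eq image_image by (intro image_cong) auto
qed

end


section \<open>The structure of torsion-valued distributions\<close>

context generators
begin

text \<open>A basic neighbourhood of \<open>x\<close> constrains finitely many coordinates only. At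
  the product n of their indices \<open>x\<close> is a power of \<open>z n\<close>, and the same
  exponent is correct at every divisor of n.\<close>

lemma zhat_topological_generator: "topological_generator zhat"
  unfolding topological_generator_def
proof (intro conjI zhat_closed)
  let ?P = "product_topology (\<lambda>m. discrete_topology (mu m)) {0<..}"
  let ?S = "range (\<lambda>k :: int. [k] \<cdot>\<^bsub>Zhat1\<^esub> zhat)"
  have "carrier Zhat1 \<subseteq> topspace ?P" by (auto simp: Zhat1_iff)
  then have top: "topspace Zhat1_topology = carrier Zhat1"
    by (auto simp: Zhat1_topology_def)
  have pow: "[int k] \<cdot>\<^bsub>Zhat1\<^esub> zhat = (\<lambda>m\<in>{0<..}. z m ^ k)" for k :: nat
  proof -
    have "[k] \<cdot>\<^bsub>Zhat1\<^esub> zhat = (\<lambda>m\<in>{0<..}. z m ^ k)"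
    proof (induction k)
      case 0
      show ?case by (simp add: add_pow_def nat_pow_def Zhat1_ops)
    next
      case (Suc k)
      have "[Suc k] \<cdot>\<^bsub>Zhat1\<^esub> zhat = [k] \<cdot>\<^bsub>Zhat1\<^esub> zhat \<oplus>\<^bsub>Zhat1\<^esub> zhat" by (simp add: add_pow_def nat_pow_def)
      then show ?case unfolding Suc Zhat1_ops by (auto simp: restrict_def zhat_def mult.commute)
    qed
    then show ?thesis by (simp add: add_pow_def int_pow_int)
  qed
  show "Zhat1_topology closure_of ?S = carrier Zhat1"
  proof
    show "Zhat1_topology closure_of ?S \<subseteq> carrier Zhat1" using closure_of_subset_topspace[of Zhat1_topology ?S] top by simp
    show "carrier Zhat1 \<subseteq> Zhat1_topology closure_of ?S"
    proof
      fix x assume x: "x \<in> carrier Zhat1"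
      show "x \<in> Zhat1_topology closure_of ?S"
        unfolding in_closure_of top
      proof (intro conjI x allI impI)
        fix T assume T: "x \<in> T \<and> openin Zhat1_topology T"
        then obtain W where W: "openin ?P W" "T = W \<inter> carrier Zhat1"
          unfolding Zhat1_topology_def openin_subtopology by blast
        then have xW: "x \<in> W" using T by blast
        obtain B where B: "finite {m \<in> {0<..}. B m \<noteq> topspace (discrete_topology (mu m))}"
          "x \<in> Pi\<^sub>E {0<..} B" "Pi\<^sub>E {0<..} B \<subseteq> W"
          using W(1)[unfolded openin_product_topology_alt, rule_format, OF xW] by blast
        define J where "J = {m \<in> {0<..}. B m \<noteq> mu m}"
        have J: "finite J" "\<And>m. m \<in> J \<Longrightarrow> m > 0" using B(1) by (auto simp: J_def)
        define n where "n = \<Prod>J"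
        have n: "n > 0" unfolding n_def using J by (intro prod_pos) auto
        obtain k where k: "x n = z n ^ k" by (rule mu_cases[OF n Zhat1D(1)[OF x n]])
        let ?y = "[int k] \<cdot>\<^bsub>Zhat1\<^esub> zhat"
        have "z m ^ k \<in> B m" if m: "m > 0" for m
        proof (cases "m \<in> J")
          case True
          then have d: "m dvd n" unfolding n_def using dvd_prod_eqI[OF J(1) _ refl, of m "\<lambda>i. i"] by blast
          have "x m = x n ^ (n div m)" using Zhat1D(2)[OF x n d] by simp
          also have "\<dots> = (z n ^ (n div m)) ^ k" unfolding k by (simp only: power_mult[symmetric] mult.commute)
          also have "\<dots> = z m ^ k" using zhat_mu[OF n d] by simp
          finally have "x m = z m ^ k" .
          moreover have "x m \<in> B m" using B(2) m by (simp add: PiE_iff)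
          ultimately show ?thesis by simp
        next
          case False
          then show ?thesis using m mu_closed(3)[OF z_mu[OF m]] by (simp add: J_def)
        qed
        then have "(\<lambda>m\<in>{0<..}. z m ^ k) \<in> Pi\<^sub>E {0<..} B" by (simp add: PiE_iff)
        then have "?y \<in> W" unfolding pow using B(3) by blast
        moreover have "?y \<in> carrier Zhat1"
        proof -
          have "(\<lambda>m\<in>{0<..}. z m ^ k) \<in> carrier Zhat1"
            unfolding Zhat1_iff
          proof (intro conjI allI impI)
            fix m m' :: nat assume m: "m > 0" "m' dvd m"
            have "(z m ^ k) ^ (m div m') = (z m ^ (m div m')) ^ k" by (metis power_mult mult.commute)
            then show "(\<lambda>m\<in>{0<..}. z m ^ k) m ^ (m div m') = (\<lambda>m\<in>{0<..}. z m ^ k) m'"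
              using m dvd_pos[OF m] zhat_mu[OF m] by simp
          qed (use mu_closed(3)[OF z_mu] in auto)
          then show ?thesis unfolding pow .
        qed
        ultimately show "\<exists>y. y \<in> ?S \<and> y \<in> T" using W(2) by blast
      qed
    qed
  qed
qed

lemma Fsd_sub_Fd: "Fsd \<subseteq> Fd" by (auto simp: Fsd_def)

lemma Ftv_submodule: "submodule (Ftv z) R FF"
proof -
  have "Ftv z = {f \<in> carrier (sub Fd). one_plus_tau \<odot>\<^bsub>FF\<^esub> f = \<zero>\<^bsub>sub Fd\<^esub>}"
    using Ftv_iff_kernel by auto
  then have "submodule (Ftv z) R (sub Fd)"
    using Rmodule_hom_kernel_submodule[OF sub_module[OF Fd_submodule] sub_module[OF Fd_submodule]
      smult_hom[OF one_tau_closed(1) Fd_submodule]] by simp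
  then show ?thesis by (rule sub_submodule_FF[OF Fd_submodule])
qed

lemma torsion_subset_Ftv: "torsion (sub Fd) \<subseteq> Ftv z"
  using torsion_iff[of Fd] Fd_FF Ftv_iff by blast

lemma Omega_submodule: "submodule (mult_by one_minus_tau Fc) R FF"
  by (rule mult_by_submodule[OF one_tau_closed(2) Fc_submodule])

lemma Omega_multiples_Ftv: "mult_by one_minus_tau Fc \<subseteq> Ftv z"
  unfolding one_minus_tau_Fc using module.submodule_facts(5)[OF FF_module Ftv_submodule _ Omega_Ftv] by blast

lemma tv_map_hom:
  assumes "submodule A R FF" "A \<subseteq> Ftv z" shows "tv_map \<in> Rmodule_hom R (sub A) Zhat1"
  unfolding Rmodule_hom_def
  using assms(2) tv_map_closed tv_map_smult by (auto simp: tv_map_add)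

text \<open>Injectivity is \<open>tv_map_Omega_inj\<close> applied to a difference; surjectivity
  holds because \<open>zhat\<close>, the image of \<open>Omega\<close>, generates
  \<open>Zhat1\<close> over \<open>R\<close>.\<close>

lemma tv_map_iso: "tv_map \<in> Rmodule_iso R (sub (mult_by one_minus_tau Fc)) Zhat1"
proof -
  let ?A = "mult_by one_minus_tau Fc"
  note m = sub_module[OF Omega_submodule]
  note h = tv_map_hom[OF Omega_submodule Omega_multiples_Ftv]
  interpret A: module R "sub ?A" by (rule m)
  have "inj_on tv_map ?A"
  proof (rule inj_onI)
    fix f g assume fg: "f \<in> ?A" "g \<in> ?A" "tv_map f = tv_map g"
    have d: "f \<ominus>\<^bsub>sub ?A\<^esub> g \<in> ?A" using A.minus_closed[of f g] fg by simp
    have "tv_map (f \<ominus>\<^bsub>sub ?A\<^esub> g) = tv_map f \<ominus>\<^bsub>Zhat1\<^esub> tv_map g"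
      using Rmodule_hom_zero_minus(3)[OF m Zhat1_module h, of f g] fg by simp
    also have "\<dots> = \<zero>\<^bsub>Zhat1\<^esub>"
      unfolding fg(3) using module.minus_eq_zero_iff[OF Zhat1_module, of "tv_map g" "tv_map g"]
        tv_map_closed Omega_multiples_Ftv fg(2) by blast
    finally have t: "tv_map (f \<ominus>\<^bsub>sub ?A\<^esub> g) = \<zero>\<^bsub>Zhat1\<^esub>" .
    from d obtain r where r: "r \<in> carrier R" "f \<ominus>\<^bsub>sub ?A\<^esub> g = r \<odot>\<^bsub>FF\<^esub> Omega" unfolding one_minus_tau_Fc by blast
    have "f \<ominus>\<^bsub>sub ?A\<^esub> g = \<zero>\<^bsub>sub ?A\<^esub>"
      using tv_map_Omega_inj[OF r(1)] t unfolding r(2) by simp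
    then show "f = g" using A.minus_eq_zero_iff fg by simp
  qed
  moreover have "tv_map ` ?A = carrier Zhat1"
  proof
    show "tv_map ` ?A \<subseteq> carrier Zhat1" using tv_map_closed Omega_multiples_Ftv by blast
    show "carrier Zhat1 \<subseteq> tv_map ` ?A"
    proof
      fix x assume "x \<in> carrier Zhat1"
      then obtain r where r: "r \<in> carrier R" "r \<odot>\<^bsub>Zhat1\<^esub> zhat = x" using Zhat1_generated by blast
      then have "x = tv_map (r \<odot>\<^bsub>FF\<^esub> Omega)" using tv_map_smult[OF r(1) Omega_Ftv] tv_map_Omega by simp
      then show "x \<in> tv_map ` ?A" unfolding one_minus_tau_Fc using r(1) by blast
    qed
  qed
  ultimately show ?thesis
    unfolding Rmodule_iso_def bij_betw_def using h m Zhat1_module by simp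
qed

text \<open>Elements of the kernel have order dividing 2. Conversely Zhat(1) is torsion-free: the
  component at m is the k-th power of the component at k m.\<close>

lemma torsion_iff_tv_map:
  assumes f: "f \<in> Ftv z" shows "tv_map f = \<zero>\<^bsub>Zhat1\<^esub> \<longleftrightarrow> f \<in> torsion (sub Fd)"
proof
  assume "tv_map f = \<zero>\<^bsub>Zhat1\<^esub>"
  then have "\<forall>w\<in>mu_inf_star. f w ^ 2 = 1" using tv_map_kernel[OF f] by blast
  then show "f \<in> torsion (sub Fd)"
    using torsion_iff[of Fd] Fd_FF Ftv_Fd[OF f] by (metis subsetI zero_less_numeral)
next
  assume "f \<in> torsion (sub Fd)"
  then obtain k where k: "k > 0" "\<And>w. w \<in> mu_inf_star \<Longrightarrow> f w ^ k = 1"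
    using torsion_iff[of Fd] Fd_FF by blast
  note t = tv_map_closed[OF f]
  show "tv_map f = \<zero>\<^bsub>Zhat1\<^esub>"
  proof (rule Zhat1_eqI[OF t Zhat1_zero_closed])
    fix m :: nat assume m: "m > 0"
    have km: "k * m > 0" using m k by simp
    have "tv_map f m = tv_map f (k * m) ^ k" using Zhat1D(2)[OF t km, of m] m by simp
    also have "\<dots> = (f (z (2 * (k * m))) ^ k) ^ 2"
      using km by (simp add: tv_map_def power_mult[symmetric] mult.commute)
    also have "\<dots> = 1" using k(2)[OF z_even(5)[OF km]] by simp
    finally show "tv_map f m = \<zero>\<^bsub>Zhat1\<^esub> m" using m by (simp add: Zhat1_ops)
  qed
qed

text \<open>The image in Zhat(1) is lifted to a multiple of \<open>Omega\<close>; the difference has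
  trivial image and is therefore torsion.\<close>

lemma Ftv_decompose:
  assumes f: "f \<in> Ftv z"
  obtains t g where "t \<in> torsion (sub Fd)" "g \<in> mult_by one_minus_tau Fc" "f = t \<oplus>\<^bsub>FF\<^esub> g"
proof -
  interpret F: module R FF by (rule FF_module)
  note T = F.submodule_facts[OF Ftv_submodule]
  obtain r where r: "r \<in> carrier R" "r \<odot>\<^bsub>Zhat1\<^esub> zhat = tv_map f" using Zhat1_generated[OF tv_map_closed[OF f]] by blast
  define g where "g = r \<odot>\<^bsub>FF\<^esub> Omega"
  have g: "g \<in> mult_by one_minus_tau Fc" "g \<in> Ftv z"
    using r(1) Omega_multiples_Ftv unfolding g_def one_minus_tau_Fc by auto
  have tg: "tv_map g = tv_map f" unfolding g_def tv_map_smult[OF r(1) Omega_Ftv] tv_map_Omega r(2) ..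
  define t where "t = f \<oplus>\<^bsub>FF\<^esub> \<ominus>\<^bsub>FF\<^esub> g"
  have tF: "t \<in> Ftv z" unfolding t_def using T(3)[OF f T(4)[OF g(2)]] .
  have fg: "f \<in> carrier FF" "g \<in> carrier FF" using Ftv_FF f g by auto
  have ft: "f = t \<oplus>\<^bsub>FF\<^esub> g" unfolding t_def using fg by (simp add: F.a_assoc F.l_neg)
  have "tv_map t \<oplus>\<^bsub>Zhat1\<^esub> tv_map g = \<zero>\<^bsub>Zhat1\<^esub> \<oplus>\<^bsub>Zhat1\<^esub> tv_map g"
  proof -
    interpret Z: module R Zhat1 by (rule Zhat1_module)
    show ?thesis using ft tv_map_add[of t g] tg tv_map_closed[OF f] by simp
  qed
  then have "tv_map t = \<zero>\<^bsub>Zhat1\<^esub>"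
  proof -
    interpret Z: module R Zhat1 by (rule Zhat1_module)
    assume e: "tv_map t \<oplus>\<^bsub>Zhat1\<^esub> tv_map g = \<zero>\<^bsub>Zhat1\<^esub> \<oplus>\<^bsub>Zhat1\<^esub> tv_map g"
    show ?thesis by (rule Z.add.right_cancel[THEN iffD1, OF _ _ _ e]) (use tv_map_closed tF g(2) in auto)
  qed
  then have "t \<in> torsion (sub Fd)" using torsion_iff_tv_map[OF tF] by blast
  then show ?thesis using that g(1) ft by blast
qed

lemma Ftv_eq_torsion_plus:
  "Ftv z = torsion (sub Fd) <+>\<^bsub>sub Fd\<^esub> mult_by one_minus_tau Fc \<and>
   (\<lambda>f. one_plus_tau \<odot>\<^bsub>FF\<^esub> f) \<in> Rmodule_hom R (sub Fd) (sub Fd) \<and>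
   Ftv z = a_kernel (sub Fd) (sub Fd) (\<lambda>f. one_plus_tau \<odot>\<^bsub>FF\<^esub> f)"
proof (intro conjI)
  have "f \<oplus>\<^bsub>FF\<^esub> g \<in> Ftv z" if "f \<in> torsion (sub Fd)" "g \<in> mult_by one_minus_tau Fc" for f g
    using module.submodule_facts(3)[OF FF_module Ftv_submodule] that torsion_subset_Ftv Omega_multiples_Ftv by blast
  then show "Ftv z = torsion (sub Fd) <+>\<^bsub>sub Fd\<^esub> mult_by one_minus_tau Fc"
    unfolding set_add_def' by (auto elim!: Ftv_decompose)
  show "(\<lambda>f. one_plus_tau \<odot>\<^bsub>FF\<^esub> f) \<in> Rmodule_hom R (sub Fd) (sub Fd)"
    by (rule smult_hom[OF one_tau_closed(1) Fd_submodule])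
  show "Ftv z = a_kernel (sub Fd) (sub Fd) (\<lambda>f. one_plus_tau \<odot>\<^bsub>FF\<^esub> f)"
    using Ftv_iff_kernel by (auto simp: a_kernel_def')
qed

text \<open>The isomorphism is induced by \<open>tv_map\<close> followed by the inverse of its
  restriction to the multiples of \<open>Omega\<close>. On these multiples the composite is the
  identity, so it inverts the map induced by inclusion.\<close>

lemma Ftv_quotient_iso:
  "\<exists>h \<in> Rmodule_iso R (quot_module (sub (Ftv z)) (torsion (sub Fd))) (sub (mult_by one_minus_tau Fc)).
     \<forall>g \<in> mult_by one_minus_tau Fc. g \<in> Ftv z \<and> h (torsion (sub Fd) +>\<^bsub>sub (Ftv z)\<^esub> g) = g"
proof -
  let ?A = "mult_by one_minus_tau Fc"
  let ?i = "inv_into (carrier (sub ?A)) tv_map"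
  have i: "?i \<in> Rmodule_iso R Zhat1 (sub ?A)" by (rule Rmodule_iso_inverse[OF tv_map_iso])
  have bij: "bij_betw tv_map ?A (carrier Zhat1)" using tv_map_iso by (simp add: Rmodule_iso_def)
  have ig: "?i (tv_map g) = g" if "g \<in> ?A" for g using bij that by (simp add: bij_betw_def inv_into_f_f)
  have ih: "?i \<in> Rmodule_hom R Zhat1 (sub ?A)" using i by (simp add: Rmodule_iso_def)
  note A = sub_module[OF Omega_submodule] and V = sub_module[OF Ftv_submodule]
  have zA: "\<zero>\<^bsub>FF\<^esub> \<in> ?A" by (rule module.submodule_facts(2)[OF FF_module Omega_submodule])
  have tz: "tv_map \<zero>\<^bsub>FF\<^esub> = \<zero>\<^bsub>Zhat1\<^esub>"
    using Rmodule_hom_zero_minus(1)[OF V Zhat1_module tv_map_hom[OF Ftv_submodule order.refl]] by simp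
  have "\<exists>h\<in>Rmodule_iso R (quot_module (sub (Ftv z)) (torsion (sub Fd))) (sub ?A).
    \<forall>f\<in>carrier (sub (Ftv z)). h (torsion (sub Fd) +>\<^bsub>sub (Ftv z)\<^esub> f) = ?i (tv_map f)"
  proof (rule quot_module_iso[OF V A])
    show "submodule (torsion (sub Fd)) R (sub (Ftv z))"
      by (rule sub_submodule[OF Ftv_submodule torsion_submodule[OF Fd_submodule] torsion_subset_Ftv])
    show "(\<lambda>f. ?i (tv_map f)) \<in> Rmodule_hom R (sub (Ftv z)) (sub ?A)"
      by (rule Rmodule_hom_compose[OF tv_map_hom[OF Ftv_submodule order.refl] ih])
    show "carrier (sub ?A) \<subseteq> (\<lambda>f. ?i (tv_map f)) ` carrier (sub (Ftv z))"
    proof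
      fix g assume "g \<in> carrier (sub ?A)"
      then show "g \<in> (\<lambda>f. ?i (tv_map f)) ` carrier (sub (Ftv z))"
        using ig[of g] Omega_multiples_Ftv by (intro image_eqI[of _ _ g]) auto
    qed
    fix f assume "f \<in> carrier (sub (Ftv z))"
    then have f: "f \<in> Ftv z" by simp
    have "?i (tv_map f) = \<zero>\<^bsub>FF\<^esub> \<longleftrightarrow> tv_map f = \<zero>\<^bsub>Zhat1\<^esub>"
    proof
      assume "?i (tv_map f) = \<zero>\<^bsub>FF\<^esub>"
      then have "tv_map (?i (tv_map f)) = \<zero>\<^bsub>Zhat1\<^esub>" using tz by simp
      then show "tv_map f = \<zero>\<^bsub>Zhat1\<^esub>"
        using bij tv_map_closed[OF f] by (simp add: bij_betw_def f_inv_into_f)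
    next
      assume "tv_map f = \<zero>\<^bsub>Zhat1\<^esub>"
      then show "?i (tv_map f) = \<zero>\<^bsub>FF\<^esub>" using ig[OF zA] tz by simp
    qed
    then show "?i (tv_map f) = \<zero>\<^bsub>sub ?A\<^esub> \<longleftrightarrow> f \<in> torsion (sub Fd)" using torsion_iff_tv_map[OF f] by simp
  qed
  then obtain h where h: "h \<in> Rmodule_iso R (quot_module (sub (Ftv z)) (torsion (sub Fd))) (sub ?A)"
    "\<And>f. f \<in> Ftv z \<Longrightarrow> h (torsion (sub Fd) +>\<^bsub>sub (Ftv z)\<^esub> f) = ?i (tv_map f)" by auto
  show ?thesis
  proof (intro bexI[of _ h] h(1) ballI conjI)
    fix g assume g: "g \<in> ?A"
    then show "g \<in> Ftv z" using Omega_multiples_Ftv by blast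
    then show "h (torsion (sub Fd) +>\<^bsub>sub (Ftv z)\<^esub> g) = g" using h(2) ig[OF g] by simp
  qed
qed

text \<open>Formulated for a variable submodule F so that \<open>Fd\<close> and \<open>Fsd\<close>
  are covered at once. The target is reached from F itself by a surjection whose kernel is the
  torsion of F plus \<open>Fc\<close>; the isomorphism results from dividing out these two summands
  one after the other.\<close>

lemma torsion_free_quotient_iso:
  assumes F: "submodule F R FF" "F \<subseteq> Fd" "Phi \<in> F"
  defines "Ftf \<equiv> quot_module (sub F) (torsion (sub F))"
    and "Fc' \<equiv> (\<lambda>f. torsion (sub F) +>\<^bsub>sub F\<^esub> f) ` Fc"
  shows "Fc \<subseteq> F \<and>
    (\<exists>h \<in> Rmodule_iso R (quot_module Ftf Fc')
          (quot_module (sub (mult_by one_plus_tau F)) (mult_by one_plus_tau Fc)).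
       \<forall>f\<in>F. h (Fc' +>\<^bsub>Ftf\<^esub> (torsion (sub F) +>\<^bsub>sub F\<^esub> f)) =
         mult_by one_plus_tau Fc +>\<^bsub>sub (mult_by one_plus_tau F)\<^esub> (one_plus_tau \<odot>\<^bsub>FF\<^esub> f))"
proof (intro conjI)
  show FcF: "Fc \<subseteq> F" by (rule Fc_subset[OF F(1,3)])
  let ?T = "torsion (sub F)" and ?W = "sub (mult_by one_plus_tau F)" and ?Q = "mult_by one_plus_tau Fc"
  let ?s = "\<lambda>f. one_plus_tau \<odot>\<^bsub>FF\<^esub> f"
  interpret FF: module R FF by (rule FF_module)
  note FM = sub_module[OF F(1)]
  have Fcar: "F \<subseteq> carrier FF" using FF.submodule_facts(1)[OF F(1)] .
  have TF: "submodule ?T R FF" by (rule torsion_submodule[OF F(1)])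
  have Tsub: "?T \<subseteq> F" using torsion_iff[OF Fcar] by blast
  have TS: "submodule ?T R (sub F)" by (rule sub_submodule[OF F(1) TF Tsub])
  have FcS: "submodule Fc R (sub F)" by (rule sub_submodule[OF F(1) Fc_submodule FcF])
  have LF: "submodule (mult_by one_plus_tau F) R FF" by (rule mult_by_submodule[OF one_tau_closed(1) F(1)])
  have QF: "submodule ?Q R FF" by (rule mult_by_submodule[OF one_tau_closed(1) Fc_submodule])
  have QS: "submodule ?Q R ?W" by (rule sub_submodule[OF LF QF]) (use FcF in blast)
  note L0M = sub_module[OF LF]
  have sh: "?s \<in> Rmodule_hom R (sub F) ?W"
    using smult_hom[OF one_tau_closed(1) F(1)] unfolding Rmodule_hom_def by auto
  have TfM: "module R Ftf" unfolding Ftf_def by (rule module.quot_module_module[OF FM TS])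
  have proj: "(\<lambda>f. ?T +>\<^bsub>sub F\<^esub> f) \<in> Rmodule_hom R (sub F) Ftf"
    unfolding Ftf_def by (rule module.quot_proj_hom[OF FM TS])
  have Fc'S: "submodule Fc' R Ftf" unfolding Fc'_def by (rule Rmodule_hom_image_submodule[OF FM TfM proj FcS])
  let ?L = "quot_module ?W ?Q"
  have LM: "module R ?L" by (rule module.quot_module_module[OF L0M QS])
  have qproj: "(\<lambda>f. ?Q +>\<^bsub>?W\<^esub> f) \<in> Rmodule_hom R ?W ?L" by (rule module.quot_proj_hom[OF L0M QS])
  let ?p = "\<lambda>f. ?Q +>\<^bsub>?W\<^esub> (?s f)"
  have ph: "?p \<in> Rmodule_hom R (sub F) ?L" by (rule Rmodule_hom_compose[OF sh qproj])
  have Lc: "carrier ?L = ?p ` F"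
    using module.quot_ops(1)[OF L0M QS] by (simp add: image_image)
  have p0: "?p f = \<zero>\<^bsub>?L\<^esub> \<longleftrightarrow> (\<exists>t\<in>?T. \<exists>c\<in>Fc. f = t \<oplus>\<^bsub>FF\<^esub> c)" if f: "f \<in> F" for f
  proof -
    have fc: "f \<in> carrier FF" using f Fcar by blast
    have zL: "\<zero>\<^bsub>FF\<^esub> \<in> mult_by one_plus_tau F" by (rule FF.submodule_facts(2)[OF LF])
    interpret L0: module R ?W by (rule L0M)
    have sf: "?s f \<in> carrier ?W" using f by simp
    have e1: "?p f = \<zero>\<^bsub>?L\<^esub> \<longleftrightarrow> ?Q +>\<^bsub>?W\<^esub> (?s f) = ?Q +>\<^bsub>?W\<^esub> \<zero>\<^bsub>?W\<^esub>"
      using module.quot_ops(2)[OF L0M QS] by simp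
    note e2 = L0.coset_eq_iff[OF QS sf L0.zero_closed]
    have e3: "?s f \<ominus>\<^bsub>?W\<^esub> \<zero>\<^bsub>?W\<^esub> = ?s f"
      unfolding a_minus_def L0.minus_equality[OF L0.l_zero[OF L0.zero_closed] L0.zero_closed L0.zero_closed]
      by (rule L0.r_zero[OF sf])
    have e: "?p f = \<zero>\<^bsub>?L\<^esub> \<longleftrightarrow> ?s f \<in> ?Q" by (rule trans[OF e1 e2[unfolded e3]])
    show ?thesis
      unfolding e
    proof
      assume "?s f \<in> ?Q"
      then obtain c where c: "c \<in> Fc" "?s f = ?s c" by blast
      have cF: "c \<in> F" "c \<in> carrier FF" using c(1) FcF Fcar by auto
      define d where "d = f \<oplus>\<^bsub>FF\<^esub> \<ominus>\<^bsub>FF\<^esub> c"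
      have dF: "d \<in> F" unfolding d_def using FF.submodule_facts(3,4)[OF F(1)] f cF(1) by blast
      have "?s d = ?s f \<oplus>\<^bsub>FF\<^esub> \<ominus>\<^bsub>FF\<^esub> (?s c)"
        unfolding d_def using fc cF(2) one_tau_closed(1) by (simp add: FF.smult_r_distr FF.smult_r_minus)
      also have "\<dots> = \<zero>\<^bsub>FF\<^esub>" unfolding c(2) using cF(2) one_tau_closed(1) by (simp add: FF.r_neg)
      finally have "d \<in> Ftv z" using dF F(2) Ftv_iff_kernel by blast
      then obtain t g where tg: "t \<in> torsion (sub Fd)" "g \<in> mult_by one_minus_tau Fc" "d = t \<oplus>\<^bsub>FF\<^esub> g"
        by (rule Ftv_decompose)
      have gFc: "g \<in> Fc" using tg(2) FF.submodule_facts(5)[OF Fc_submodule one_tau_closed(2)] by blast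
      have gF: "g \<in> F" "g \<in> carrier FF" using gFc FcF Fcar by auto
      have tFF: "t \<in> carrier FF" using tg(1) torsion_subset_Ftv Ftv_FF by blast
      \<comment> \<open>The decomposition is made in \<open>Fd\<close>; its torsion part returns to
        F because g lies in \<open>Fc\<close>, which is contained in F.\<close>
      have "t = d \<oplus>\<^bsub>FF\<^esub> \<ominus>\<^bsub>FF\<^esub> g" unfolding tg(3) using tFF gF by (simp add: FF.a_assoc FF.r_neg)
      then have "t \<in> F" using FF.submodule_facts(3,4)[OF F(1)] dF gF(1) by blast
      then have tT: "t \<in> ?T" using tg(1) torsion_iff[OF Fcar] torsion_iff[of Fd] Fd_FF by blast
      have "f = d \<oplus>\<^bsub>FF\<^esub> c" unfolding d_def using fc cF(2) by (simp add: FF.a_assoc FF.l_neg)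
      also have "\<dots> = t \<oplus>\<^bsub>FF\<^esub> (g \<oplus>\<^bsub>FF\<^esub> c)" unfolding tg(3) using tFF gF cF by (simp add: FF.a_assoc)
      finally show "\<exists>t\<in>?T. \<exists>c\<in>Fc. f = t \<oplus>\<^bsub>FF\<^esub> c"
        using tT FF.submodule_facts(3)[OF Fc_submodule gFc c(1)] by blast
    next
      assume "\<exists>t\<in>?T. \<exists>c\<in>Fc. f = t \<oplus>\<^bsub>FF\<^esub> c"
      then obtain t c where tc: "t \<in> ?T" "c \<in> Fc" "f = t \<oplus>\<^bsub>FF\<^esub> c" by blast
      have "t \<in> torsion (sub Fd)" using tc(1) F(2) torsion_iff[OF Fcar] torsion_iff[of Fd] Fd_FF by blast
      then have "?s t = \<zero>\<^bsub>FF\<^esub>" using torsion_subset_Ftv Ftv_iff_kernel by blast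
      moreover have "t \<in> carrier FF" "c \<in> carrier FF" using tc Tsub FcF Fcar by auto
      ultimately have "?s f = ?s c" unfolding tc(3) using one_tau_closed(1) by (simp add: FF.smult_r_distr)
      then show "?s f \<in> ?Q" using tc(2) by blast
    qed
  qed
  have pT: "?p f = \<zero>\<^bsub>?L\<^esub>" if "f \<in> ?T" for f
  proof -
    have "f \<in> F" "f \<in> carrier FF" using that Tsub Fcar by auto
    then show ?thesis
      using p0[of f] that FF.submodule_facts(2)[OF Fc_submodule] by (metis FF.r_zero)
  qed
  \<comment> \<open>The map on the torsion-free quotient picks a representative; since torsion
    elements are sent to zero, the choice does not matter.\<close>
  define q where "q X = ?p (SOME f. f \<in> F \<and> X = ?T +>\<^bsub>sub F\<^esub> f)" for X
  interpret FM: module R "sub F" by (rule FM)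
  interpret LL: module R ?L by (rule LM)
  have q: "q (?T +>\<^bsub>sub F\<^esub> f) = ?p f" if f: "f \<in> F" for f
  proof -
    define g where "g = (SOME g. g \<in> F \<and> ?T +>\<^bsub>sub F\<^esub> f = ?T +>\<^bsub>sub F\<^esub> g)"
    have "\<exists>g. g \<in> F \<and> ?T +>\<^bsub>sub F\<^esub> f = ?T +>\<^bsub>sub F\<^esub> g" using f by blast
    then have g: "g \<in> F \<and> ?T +>\<^bsub>sub F\<^esub> f = ?T +>\<^bsub>sub F\<^esub> g" unfolding g_def by (rule someI_ex)
    then have "f \<ominus>\<^bsub>sub F\<^esub> g \<in> ?T" using FM.coset_eq_iff[OF TS, of f g] f by simp
    then have "?p (f \<ominus>\<^bsub>sub F\<^esub> g) = \<zero>\<^bsub>?L\<^esub>" by (rule pT)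
    then have "?p f \<ominus>\<^bsub>?L\<^esub> ?p g = \<zero>\<^bsub>?L\<^esub>" using Rmodule_hom_zero_minus(3)[OF FM LM ph, of f g] f g by simp
    then have "?p f = ?p g" using LL.minus_eq_zero_iff[of "?p f" "?p g"] Rmodule_homD(1)[OF ph] f g by simp
    then show ?thesis unfolding q_def g_def by simp
  qed
  have Tfc: "carrier Ftf = (\<lambda>f. ?T +>\<^bsub>sub F\<^esub> f) ` F" unfolding Ftf_def using FM.quot_ops(1)[OF TS] by simp
  have qh: "q \<in> Rmodule_hom R Ftf ?L"
    unfolding Rmodule_hom_def Tfc
  proof (intro CollectI conjI ballI Pi_I)
    fix X assume "X \<in> (\<lambda>f. ?T +>\<^bsub>sub F\<^esub> f) ` F"
    then obtain f where f: "f \<in> F" "X = ?T +>\<^bsub>sub F\<^esub> f" by blast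
    show "q X \<in> carrier ?L" unfolding f(2) q[OF f(1)] using Rmodule_homD(1)[OF ph, of f] f(1) by simp
    fix Y assume "Y \<in> (\<lambda>f. ?T +>\<^bsub>sub F\<^esub> f) ` F"
    then obtain g where g: "g \<in> F" "Y = ?T +>\<^bsub>sub F\<^esub> g" by blast
    have "X \<oplus>\<^bsub>Ftf\<^esub> Y = ?T +>\<^bsub>sub F\<^esub> (f \<oplus>\<^bsub>sub F\<^esub> g)"
      unfolding f g Ftf_def using FM.quot_ops(3)[OF TS] f g by simp
    moreover have "f \<oplus>\<^bsub>sub F\<^esub> g \<in> F" using FM.a_closed[of f g] f g by simp
    ultimately show "q (X \<oplus>\<^bsub>Ftf\<^esub> Y) = q X \<oplus>\<^bsub>?L\<^esub> q Y"
      using q Rmodule_homD(2)[OF ph, of f g] f g by simp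
  next
    fix r X assume r: "r \<in> carrier R" and "X \<in> (\<lambda>f. ?T +>\<^bsub>sub F\<^esub> f) ` F"
    then obtain f where f: "f \<in> F" "X = ?T +>\<^bsub>sub F\<^esub> f" by blast
    have "r \<odot>\<^bsub>Ftf\<^esub> X = ?T +>\<^bsub>sub F\<^esub> (r \<odot>\<^bsub>sub F\<^esub> f)"
      unfolding f Ftf_def using FM.quot_ops(4)[OF TS r] f by simp
    moreover have "r \<odot>\<^bsub>sub F\<^esub> f \<in> F" using FM.smult_closed[OF r, of f] f by simp
    ultimately show "q (r \<odot>\<^bsub>Ftf\<^esub> X) = r \<odot>\<^bsub>?L\<^esub> q X"
      using q Rmodule_homD(3)[OF ph r, of f] f by simp
  qed
  have "\<exists>h\<in>Rmodule_iso R (quot_module Ftf Fc') ?L. \<forall>X\<in>carrier Ftf. h (Fc' +>\<^bsub>Ftf\<^esub> X) = q X"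
  proof (rule quot_module_iso[OF TfM LM Fc'S qh])
    show "carrier ?L \<subseteq> q ` carrier Ftf" unfolding Lc Tfc image_image using q by auto
    fix X assume "X \<in> carrier Ftf"
    then obtain f where f: "f \<in> F" "X = ?T +>\<^bsub>sub F\<^esub> f" unfolding Tfc by blast
    have fc: "f \<in> carrier FF" using f Fcar by blast
    have "q X = \<zero>\<^bsub>?L\<^esub> \<longleftrightarrow> (\<exists>c\<in>Fc. \<exists>t\<in>?T. f = t \<oplus>\<^bsub>FF\<^esub> c)" unfolding f(2) q[OF f(1)] p0[OF f(1)] by blast
    also have "\<dots> \<longleftrightarrow> (\<exists>c\<in>Fc. ?T +>\<^bsub>sub F\<^esub> f = ?T +>\<^bsub>sub F\<^esub> c)"
    proof (intro bex_cong refl)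
      fix c assume c: "c \<in> Fc"
      have cF: "c \<in> F" "c \<in> carrier FF" using c FcF Fcar by auto
      show "(\<exists>t\<in>?T. f = t \<oplus>\<^bsub>FF\<^esub> c) \<longleftrightarrow> ?T +>\<^bsub>sub F\<^esub> f = ?T +>\<^bsub>sub F\<^esub> c"
      proof
        assume "\<exists>t\<in>?T. f = t \<oplus>\<^bsub>FF\<^esub> c"
        then obtain t where t: "t \<in> ?T" "f = t \<oplus>\<^bsub>sub F\<^esub> c" by auto
        have m: "t \<in> carrier (sub F)" "c \<in> carrier (sub F)" using t(1) Tsub cF by auto
        have "f \<ominus>\<^bsub>sub F\<^esub> c = t"
          unfolding t(2) a_minus_def FM.a_assoc[OF m FM.a_inv_closed[OF m(2)]] FM.r_neg[OF m(2)] FM.r_zero[OF m(1)] ..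
        then show "?T +>\<^bsub>sub F\<^esub> f = ?T +>\<^bsub>sub F\<^esub> c" using FM.coset_eq_iff[OF TS, of f c] f cF t by simp
      next
        assume "?T +>\<^bsub>sub F\<^esub> f = ?T +>\<^bsub>sub F\<^esub> c"
        then have "f \<ominus>\<^bsub>sub F\<^esub> c \<in> ?T" using FM.coset_eq_iff[OF TS, of f c] f cF by simp
        moreover have "f = (f \<ominus>\<^bsub>sub F\<^esub> c) \<oplus>\<^bsub>sub F\<^esub> c"
        proof -
          have m: "f \<in> carrier (sub F)" "c \<in> carrier (sub F)" using f cF by auto
          show ?thesis unfolding a_minus_def FM.a_assoc[OF m(1) FM.a_inv_closed[OF m(2)] m(2)] FM.l_neg[OF m(2)] FM.r_zero[OF m(1)] ..
        qed
        ultimately show "\<exists>t\<in>?T. f = t \<oplus>\<^bsub>FF\<^esub> c" by auto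
      qed
    qed
    also have "\<dots> \<longleftrightarrow> X \<in> Fc'" unfolding f(2) Fc'_def by blast
    finally show "q X = \<zero>\<^bsub>?L\<^esub> \<longleftrightarrow> X \<in> Fc'" .
  qed
  then show "\<exists>h \<in> Rmodule_iso R (quot_module Ftf Fc') ?L.
    \<forall>f\<in>F. h (Fc' +>\<^bsub>Ftf\<^esub> (?T +>\<^bsub>sub F\<^esub> f)) = ?p f"
    using q unfolding Tfc by auto
qed

end

theorem theorem4p1:
  fixes zeta :: "nat \<Rightarrow> complex"
  assumes "compatible_generators zeta"
  shows
    "(Ftv zeta = torsion (sub Fd) <+>\<^bsub>sub Fd\<^esub> mult_by one_minus_tau Fc \<and>
      (\<lambda>f. one_plus_tau \<odot>\<^bsub>FF\<^esub> f) \<in> Rmodule_hom R (sub Fd) (sub Fd) \<and>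
      Ftv zeta = a_kernel (sub Fd) (sub Fd) (\<lambda>f. one_plus_tau \<odot>\<^bsub>FF\<^esub> f))
     \<and>
     ((\<exists>h \<in> Rmodule_iso R (quot_module (sub (Ftv zeta)) (torsion (sub Fd)))
                         (sub (mult_by one_minus_tau Fc)).
         \<forall>g \<in> mult_by one_minus_tau Fc.
           g \<in> Ftv zeta \<and> h (torsion (sub Fd) +>\<^bsub>sub (Ftv zeta)\<^esub> g) = g) \<and>
      (\<exists>h \<in> Rmodule_iso R (sub (mult_by one_minus_tau Fc)) Zhat1.
         h (one_minus_tau \<odot>\<^bsub>FF\<^esub> Phi) = (\<lambda>m\<in>{0<..}. zeta m)) \<and>
      topological_generator (\<lambda>m\<in>{0<..}. zeta m))
     \<and>
     (\<forall>F \<in> {Fd, Fsd}.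
       let Ftf = quot_module (sub F) (torsion (sub F));
           Fc' = (\<lambda>f. torsion (sub F) +>\<^bsub>sub F\<^esub> f) ` Fc
       in Fc \<subseteq> F \<and>
          (\<exists>h \<in> Rmodule_iso R (quot_module Ftf Fc')
                (quot_module (sub (mult_by one_plus_tau F)) (mult_by one_plus_tau Fc)).
             \<forall>f\<in>F. h (Fc' +>\<^bsub>Ftf\<^esub> (torsion (sub F) +>\<^bsub>sub F\<^esub> f)) =
               mult_by one_plus_tau Fc +>\<^bsub>sub (mult_by one_plus_tau F)\<^esub> (one_plus_tau \<odot>\<^bsub>FF\<^esub> f)))"
proof -
  interpret generators zeta by unfold_locales (rule assms)
  have "tv_map (one_minus_tau \<odot>\<^bsub>FF\<^esub> Phi) = (\<lambda>m\<in>{0<..}. zeta m)"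
    using tv_map_Omega unfolding Omega_def zhat_def .
  moreover have "topological_generator (\<lambda>m\<in>{0<..}. zeta m)"
    using zhat_topological_generator unfolding zhat_def .
  moreover note Ftv_eq_torsion_plus Ftv_quotient_iso tv_map_iso
  moreover note torsion_free_quotient_iso[OF Fd_submodule order.refl Phi_Fd]
    torsion_free_quotient_iso[OF Fsd_submodule Fsd_sub_Fd Phi_Fsd]
  ultimately show ?thesis unfolding Let_def by blast
qed

end
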